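(* Let $\mathbb{T}=\mathbb{C}^n/\Lambda$ be any complex torus, equipped with the Hermitian form $\omega$ induced by the standard Euclidean form $\frac{i}{2}\sum_{j=1}^n dz_j\wedge d\overline z_j$ on $\mathbb{C}^n$. There exists an entire curve (holomorphic map) $\mathbf F:\mathbb{C}\to\mathbb{T}$ such that the concentric holomorphic discs $\{\mathbf F|_{\overline{\mathbb D}_R}\}_{R>0}$ generate all Nevanlinna/Ahlfors currents on $\mathbb{T}$ up to cohomological equivalence. That is: for every Nevanlinna current (respectively Ahlfors current) $\mathcal T$ on $\mathbb{T}$, there is an increasing sequence of radii $R_j\to\infty$ such that the sequence of discs $\{\mathbf F|_{\overline{\mathbb D}_{R_j}}\}_{j\ge 1}$ generates a Nevanlinna current (respectively an Ahlfors current) whose class in $H^{n-1,n-1}(\mathbb{T},\mathbb{R})$ equals the class $[\mathcal T]$.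
   Context: $\mathbb{D}(z,r)\subset\mathbb{C}$ is the open disc with center $z$ and radius $r$, and $\mathbb{D}_r=\mathbb{D}(0,r)$. Let $X$ be a compact complex manifold with a Hermitian form $\omega$. Areas and lengths of images of holomorphic discs are counted with multiplicity: $\mathrm{Area}_\omega(F(D))=\int_D F^*\omega$, and $\mathrm{Length}_\omega(F(\partial D))$ is the length of the parametrized curve $F|_{\partial D}$. Nevanlinna currents. Let $F_j:\overline{\mathbb D}(z_j,R_j)\to X$ be nonconstant holomorphic discs, smooth up to the boundary. Put $\langle\widehat{\mathcal N}_{F_j},\phi\rangle=\int_0^{R_j}\frac{dt}{t}\int_{\mathbb D(z_j,t)}F_j^*\phi$ for smooth $(1,1)$-forms $\phi$ on $X$, $\mathfrak A_{F_j}=\langle\widehat{\mathcal N}_{F_j},\omega\rangle$ and $\mathfrak L_{F_j}=\int_0^{R_j}\mathrm{Length}_\omega(F_j(\partial\mathbb D(z_j,t)))\frac{dt}{t}$. If $\mathfrak L_{F_j}/\mathfrak A_{F_j}\to0$, any weak limit of a subsequence of the normalized currents $\widehat{\mathcal N}_{F_j}/\mathfrak A_{F_j}$ (a positive closed current of bidimension $(1,1)$ and mass $1$) is called a Nevanlinna current on $X$, generated by $\{F_j\}$. Ahlfors currents. Let $F_j:D_j\to X$ be nonconstant holomorphic discs, smooth up to the boundary ($D_j\subset\mathbb C$ closed discs). If $\mathrm{Length}_\omega(F_j(\partial D_j))/\mathrm{Area}_\omega(F_j(D_j))\to0$, any weak limit of a subsequence of the normalized currents $(F_j)_*[D_j]/\mathrm{Area}_\omega(F_j(D_j))$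 is called an Ahlfors current on $X$, generated by $\{F_j\}$. When $\dim_{\mathbb C}X=n$, closed currents of bidimension $(1,1)$ define classes in $H^{n-1,n-1}(X,\mathbb C)$, and $H^{n-1,n-1}(X,\mathbb{R})=H^{n-1,n-1}(X,\mathbb{C})\cap H^{2n-2}(X,\mathbb{R})$. *)

theory Defs
  imports "HOL-Complex_Analysis.Complex_Analysis"
begin

section \<open>Smooth functions\<close>

primrec dir_derivs ::
    "'a::real_normed_vector list \<Rightarrow> ('a \<Rightarrow> 'b::real_normed_vector) \<Rightarrow> 'a \<Rightarrow> 'b" where
  "dir_derivs [] f = f"
| "dir_derivs (u # us) f = dir_derivs us (\<lambda>x. frechet_derivative f (at x) u)"

text \<open>For open \<open>V\<close> in a finite-dimensional space this is real $C^\infty$ regularity on \<open>V\<close>.\<close>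

definition smooth_on :: "'a::real_normed_vector set \<Rightarrow> ('a \<Rightarrow> 'b::real_normed_vector) \<Rightarrow> bool" where
  "smooth_on V f \<longleftrightarrow> (\<forall>us. \<forall>x\<in>V. dir_derivs us f differentiable (at x))"


section \<open>Complex tori\<close>

definition lattice :: "(complex^'n) set \<Rightarrow> bool" where
  "lattice \<Lambda> \<longleftrightarrow> (\<exists>B. independent B \<and> span B = UNIV \<and>
     \<Lambda> = {\<Sum>b\<in>B. of_int (c b) *\<^sub>R b | c :: complex^'n \<Rightarrow> int. True})"

text \<open>Points of the torus are the cosets of \<open>\<Lambda>\<close>.\<close>

definition proj :: "(complex^'n) set \<Rightarrow> complex^'n \<Rightarrow> (complex^'n) set" where
  "proj \<Lambda> x = {y. y - x \<in> \<Lambda>}"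

definition torus :: "(complex^'n) set \<Rightarrow> (complex^'n) set set" where
  "torus \<Lambda> = range (proj \<Lambda>)"


section \<open>Holomorphic discs and entire curves in a torus\<close>

text \<open>Since \<open>proj \<Lambda>\<close> is a local biholomorphism, maps into the torus are holomorphic or smooth
  iff they have holomorphic or smooth local lifts. Smoothness at a boundary point of a closed disc
  means that a local lift extends smoothly across the boundary.\<close>

definition holomorphic_disc ::
    "(complex^'n) set \<Rightarrow> (complex \<Rightarrow> (complex^'n) set) \<Rightarrow> complex \<Rightarrow> real \<Rightarrow> bool" where
  "holomorphic_disc \<Lambda> F z R \<longleftrightarrow> 0 < R \<and>
     (\<forall>w\<in>cball z R. \<exists>V f. open V \<and> w \<in> V \<and> smooth_on V f \<and>
        (\<forall>j. (\<lambda>u. f u $ j) holomorphic_on (V \<inter> ball z R)) \<and>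
        (\<forall>u\<in>V \<inter> cball z R. F u = proj \<Lambda> (f u)))"

definition entire_curve :: "(complex^'n) set \<Rightarrow> (complex \<Rightarrow> (complex^'n) set) \<Rightarrow> bool" where
  "entire_curve \<Lambda> F \<longleftrightarrow>
     (\<forall>w. \<exists>V f. open V \<and> w \<in> V \<and> (\<forall>j. (\<lambda>u. f u $ j) holomorphic_on V) \<and>
        (\<forall>u\<in>V. F u = proj \<Lambda> (f u)))"

text \<open>The tangent spaces of the torus are identified with \<open>complex^'n\<close>. The two derivatives below
  are those of an arbitrary local lift; two such lifts differ by a locally constant element of the
  lattice.\<close>

definition torus_deriv ::
    "(complex^'n) set \<Rightarrow> (complex \<Rightarrow> (complex^'n) set) \<Rightarrow> complex \<Rightarrow> complex^'n" where
  "torus_deriv \<Lambda> F z = (THE v. \<exists>f e. 0 < e \<and> (\<forall>w\<in>ball z e. F w = proj \<Lambda> (f w)) \<and>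
     (\<forall>j. ((\<lambda>w. f w $ j) has_field_derivative v $ j) (at z)))"

definition velocity ::
    "(complex^'n) set \<Rightarrow> (real \<Rightarrow> (complex^'n) set) \<Rightarrow> real \<Rightarrow> complex^'n" where
  "velocity \<Lambda> \<gamma> t = (THE v. \<exists>g e. 0 < e \<and> (\<forall>s\<in>ball t e. \<gamma> s = proj \<Lambda> (g s)) \<and>
     (g has_vector_derivative v) (at t))"


section \<open>Smooth differential forms on a torus\<close>

text \<open>A complex-valued form of degree \<open>k\<close> assigns to a point \<open>p\<close> and a list of \<open>k\<close> tangent
  vectors a complex number, real-multilinear and alternating in the vectors. Values at lists of
  other lengths, or at sets that are not points of the torus, are irrelevant.\<close>

type_synonym 'n form = "(complex^'n) set \<Rightarrow> (complex^'n) list \<Rightarrow> complex"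

definition alternating :: "nat \<Rightarrow> ((complex^'n) list \<Rightarrow> complex) \<Rightarrow> bool" where
  "alternating k a \<longleftrightarrow> (\<forall>vs. length vs = k \<longrightarrow>
     (\<forall>i<k. linear (\<lambda>v. a (vs[i := v]))) \<and>
     (\<forall>i<k. \<forall>j<k. i \<noteq> j \<and> vs ! i = vs ! j \<longrightarrow> a vs = 0))"

definition smooth_form :: "(complex^'n) set \<Rightarrow> nat \<Rightarrow> 'n form \<Rightarrow> bool" where
  "smooth_form \<Lambda> k \<phi> \<longleftrightarrow> (\<forall>p\<in>torus \<Lambda>. alternating k (\<phi> p)) \<and>
     (\<forall>vs. length vs = k \<longrightarrow> smooth_on UNIV (\<lambda>x. \<phi> (proj \<Lambda> x) vs))"

text \<open>The exterior derivative in the flat coordinates of the universal cover: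
  $(d\phi)(v_0,\dots,v_k) = \sum_i (-1)^i\, \partial_{v_i} \phi(v_0,\dots,\widehat{v_i},\dots,v_k)$.
  By periodicity the choice of the representative of \<open>p\<close> does not matter.\<close>

definition ext_deriv :: "(complex^'n) set \<Rightarrow> 'n form \<Rightarrow> 'n form" where
  "ext_deriv \<Lambda> \<phi> p vs = (\<Sum>i<length vs. (-1) ^ i *
     frechet_derivative (\<lambda>x. \<phi> (proj \<Lambda> x) (take i vs @ drop (Suc i) vs))
       (at (SOME x. x \<in> p)) (vs ! i))"

text \<open>Bidegrees of 2-forms: pointwise combinations of
  $dz_j \wedge d\overline z_k$, $dz_j \wedge dz_k$ and
  $d\overline z_j \wedge d\overline z_k$ respectively.\<close>

definition form11 :: "(complex^'n) set \<Rightarrow> 'n form \<Rightarrow> bool" where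
  "form11 \<Lambda> \<phi> \<longleftrightarrow> smooth_form \<Lambda> 2 \<phi> \<and>
     (\<forall>p\<in>torus \<Lambda>. \<exists>c :: 'n \<Rightarrow> 'n \<Rightarrow> complex. \<forall>u v.
        \<phi> p [u, v] = (\<Sum>j\<in>UNIV. \<Sum>k\<in>UNIV. c j k * (u $ j * cnj (v $ k) - v $ j * cnj (u $ k))))"

definition form20 :: "(complex^'n) set \<Rightarrow> 'n form \<Rightarrow> bool" where
  "form20 \<Lambda> \<phi> \<longleftrightarrow> smooth_form \<Lambda> 2 \<phi> \<and>
     (\<forall>p\<in>torus \<Lambda>. \<exists>c :: 'n \<Rightarrow> 'n \<Rightarrow> complex. \<forall>u v.
        \<phi> p [u, v] = (\<Sum>j\<in>UNIV. \<Sum>k\<in>UNIV. c j k * (u $ j * v $ k - v $ j * u $ k)))"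

definition form02 :: "(complex^'n) set \<Rightarrow> 'n form \<Rightarrow> bool" where
  "form02 \<Lambda> \<phi> \<longleftrightarrow> smooth_form \<Lambda> 2 \<phi> \<and>
     (\<forall>p\<in>torus \<Lambda>. \<exists>c :: 'n \<Rightarrow> 'n \<Rightarrow> complex. \<forall>u v.
        \<phi> p [u, v] = (\<Sum>j\<in>UNIV. \<Sum>k\<in>UNIV.
          c j k * (cnj (u $ j) * cnj (v $ k) - cnj (v $ j) * cnj (u $ k))))"

text \<open>The form $\frac i2 \sum_j dz_j \wedge d\overline z_j$; the associated Riemannian metric is the
  Euclidean one, so lengths are measured with \<open>norm\<close>.\<close>

definition omega :: "'n::finite form" where
  "omega p vs = \<i> / 2 *
     (\<Sum>j\<in>UNIV. (vs ! 0) $ j * cnj ((vs ! 1) $ j) - (vs ! 1) $ j * cnj ((vs ! 0) $ j))"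


section \<open>Currents and their classes\<close>

text \<open>Convergence in the Frechet space of smooth \<open>k\<close>-forms, i.e. uniform convergence of all
  derivatives of all coefficients. This space is metrizable, so currents, its continuous linear
  functionals, are the sequentially continuous ones.\<close>

definition forms_converge ::
    "(complex^'n) set \<Rightarrow> nat \<Rightarrow> (nat \<Rightarrow> 'n form) \<Rightarrow> 'n form \<Rightarrow> bool" where
  "forms_converge \<Lambda> k \<phi> \<psi> \<longleftrightarrow> (\<forall>vs us. length vs = k \<longrightarrow>
     uniform_limit UNIV (\<lambda>m. dir_derivs us (\<lambda>x. \<phi> m (proj \<Lambda> x) vs))
       (dir_derivs us (\<lambda>x. \<psi> (proj \<Lambda> x) vs)) sequentially)"

definition current :: "(complex^'n) set \<Rightarrow> nat \<Rightarrow> ('n form \<Rightarrow> complex) \<Rightarrow> bool" where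
  "current \<Lambda> k T \<longleftrightarrow>
     (\<forall>\<phi> \<psi>. smooth_form \<Lambda> k \<phi> \<and> smooth_form \<Lambda> k \<psi> \<longrightarrow>
        T (\<lambda>p vs. \<phi> p vs + \<psi> p vs) = T \<phi> + T \<psi>) \<and>
     (\<forall>c \<phi>. smooth_form \<Lambda> k \<phi> \<longrightarrow> T (\<lambda>p vs. c * \<phi> p vs) = c * T \<phi>) \<and>
     (\<forall>\<phi> \<psi>. (\<forall>m. smooth_form \<Lambda> k (\<phi> m)) \<and> smooth_form \<Lambda> k \<psi> \<and> forms_converge \<Lambda> k \<phi> \<psi> \<longrightarrow>
        (\<lambda>m. T (\<phi> m)) \<longlonglongrightarrow> T \<psi>)"

definition current11 :: "(complex^'n) set \<Rightarrow> ('n form \<Rightarrow> complex) \<Rightarrow> bool" where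
  "current11 \<Lambda> T \<longleftrightarrow> current \<Lambda> 2 T \<and> (\<forall>\<phi>. form20 \<Lambda> \<phi> \<or> form02 \<Lambda> \<phi> \<longrightarrow> T \<phi> = 0)"

text \<open>The class of a closed current of dimension 2 in $H^{2n-2}$, computed by the de Rham complex of
  currents: the coset of \<open>T\<close> modulo the boundaries \<open>\<phi> \<mapsto> U (d\<phi>)\<close> of currents \<open>U\<close> of dimension 3.
  Boundaries are closed, so for closed \<open>T\<close> all members are closed.\<close>

definition current_class ::
    "(complex^'n) set \<Rightarrow> ('n form \<Rightarrow> complex) \<Rightarrow> ('n form \<Rightarrow> complex) set" where
  "current_class \<Lambda> T = {S. current \<Lambda> 2 S \<and>
     (\<exists>U. current \<Lambda> 3 U \<and> (\<forall>\<phi>. smooth_form \<Lambda> 2 \<phi> \<longrightarrow> S \<phi> - T \<phi> = U (ext_deriv \<Lambda> \<phi>)))}"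


section \<open>Nevanlinna and Ahlfors currents\<close>

text \<open>The integral of $F^*\phi$ over the disc of radius \<open>t\<close>, where
  $F^*\phi = \phi(F', iF')\, dx \wedge dy$.\<close>

definition disc_int ::
    "(complex^'n) set \<Rightarrow> (complex \<Rightarrow> (complex^'n) set) \<Rightarrow> complex \<Rightarrow> real \<Rightarrow> 'n form \<Rightarrow> complex" where
  "disc_int \<Lambda> F z t \<phi> =
     (LINT w:ball z t|lborel. \<phi> (F w) [torus_deriv \<Lambda> F w, \<i> *s torus_deriv \<Lambda> F w])"

text \<open>\<open>Re\<close> below is only a coercion: the pairings with \<open>omega\<close> are real.\<close>

definition disc_area ::
    "(complex^'n) set \<Rightarrow> (complex \<Rightarrow> (complex^'n) set) \<Rightarrow> complex \<Rightarrow> real \<Rightarrow> real" where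
  "disc_area \<Lambda> F z t = Re (disc_int \<Lambda> F z t omega)"

definition bdry_length ::
    "(complex^'n) set \<Rightarrow> (complex \<Rightarrow> (complex^'n) set) \<Rightarrow> complex \<Rightarrow> real \<Rightarrow> real" where
  "bdry_length \<Lambda> F z t = (LINT s:{0..1}|lborel. norm (velocity \<Lambda> (F \<circ> circlepath z t) s))"

definition nev_int ::
    "(complex^'n) set \<Rightarrow> (complex \<Rightarrow> (complex^'n) set) \<Rightarrow> complex \<Rightarrow> real \<Rightarrow> 'n form \<Rightarrow> complex" where
  "nev_int \<Lambda> F z R \<phi> = (LINT t:{0<..<R}|lborel. disc_int \<Lambda> F z t \<phi> / of_real t)"

definition nev_area ::
    "(complex^'n) set \<Rightarrow> (complex \<Rightarrow> (complex^'n) set) \<Rightarrow> complex \<Rightarrow> real \<Rightarrow> real" where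
  "nev_area \<Lambda> F z R = Re (nev_int \<Lambda> F z R omega)"

definition nev_length ::
    "(complex^'n) set \<Rightarrow> (complex \<Rightarrow> (complex^'n) set) \<Rightarrow> complex \<Rightarrow> real \<Rightarrow> real" where
  "nev_length \<Lambda> F z R = (LINT t:{0<..<R}|lborel. bdry_length \<Lambda> F z t / t)"

definition generates_nevanlinna ::
    "(complex^'n) set \<Rightarrow> (nat \<Rightarrow> complex \<Rightarrow> (complex^'n) set) \<Rightarrow> (nat \<Rightarrow> complex) \<Rightarrow> (nat \<Rightarrow> real)
      \<Rightarrow> ('n form \<Rightarrow> complex) \<Rightarrow> bool" where
  "generates_nevanlinna \<Lambda> F z R T \<longleftrightarrow>
     (\<forall>j. holomorphic_disc \<Lambda> (F j) (z j) (R j) \<and> \<not> F j constant_on cball (z j) (R j)) \<and>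
     (\<lambda>j. nev_length \<Lambda> (F j) (z j) (R j) / nev_area \<Lambda> (F j) (z j) (R j)) \<longlonglongrightarrow> 0 \<and>
     current11 \<Lambda> T \<and>
     (\<exists>r. strict_mono r \<and> (\<forall>\<phi>. form11 \<Lambda> \<phi> \<longrightarrow>
        ((\<lambda>j. nev_int \<Lambda> (F j) (z j) (R j) \<phi> / of_real (nev_area \<Lambda> (F j) (z j) (R j))) \<circ> r)
          \<longlonglongrightarrow> T \<phi>))"

definition generates_ahlfors ::
    "(complex^'n) set \<Rightarrow> (nat \<Rightarrow> complex \<Rightarrow> (complex^'n) set) \<Rightarrow> (nat \<Rightarrow> complex) \<Rightarrow> (nat \<Rightarrow> real)
      \<Rightarrow> ('n form \<Rightarrow> complex) \<Rightarrow> bool" where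
  "generates_ahlfors \<Lambda> F z R T \<longleftrightarrow>
     (\<forall>j. holomorphic_disc \<Lambda> (F j) (z j) (R j) \<and> \<not> F j constant_on cball (z j) (R j)) \<and>
     (\<lambda>j. bdry_length \<Lambda> (F j) (z j) (R j) / disc_area \<Lambda> (F j) (z j) (R j)) \<longlonglongrightarrow> 0 \<and>
     current11 \<Lambda> T \<and>
     (\<exists>r. strict_mono r \<and> (\<forall>\<phi>. form11 \<Lambda> \<phi> \<longrightarrow>
        ((\<lambda>j. disc_int \<Lambda> (F j) (z j) (R j) \<phi> / of_real (disc_area \<Lambda> (F j) (z j) (R j))) \<circ> r)
          \<longlonglongrightarrow> T \<phi>))"

definition nevanlinna_current :: "(complex^'n) set \<Rightarrow> ('n form \<Rightarrow> complex) \<Rightarrow> bool" where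
  "nevanlinna_current \<Lambda> T \<longleftrightarrow> (\<exists>F z R. generates_nevanlinna \<Lambda> F z R T)"

definition ahlfors_current :: "(complex^'n) set \<Rightarrow> ('n form \<Rightarrow> complex) \<Rightarrow> bool" where
  "ahlfors_current \<Lambda> T \<longleftrightarrow> (\<exists>F z R. generates_ahlfors \<Lambda> F z R T)"

end

theory Submission imports Defs begin

text \<open>On a torus every closed 2-current takes the same value on a form and on its average over all
  translations, so the class of a closed current of bidegree type (1,1) is determined by its values on
  the constant forms, that is, by a matrix. For a disc with derivative \<open>f'\<close> this matrix is a
  normalised integral of \<open>f' f'\<^sup>*\<close>, so the matrix of a Nevanlinna or Ahlfors current lies in
  the compact convex hull of the matrices \<open>v v\<^sup>*\<close> with \<open>v\<close> a unit vector.
  Conversely, let \<open>H\<^sub>k\<close> run through a sequence in this hull that has every point of the hull as a limit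
  point, and write \<open>H\<^sub>k\<close> as a finite sum of matrices \<open>u u\<^sup>*\<close>. A block of monomials
  \<open>w\<^sup>m\<^sup>+\<^sup>l u\<^sub>l\<close> of large degree, suitably scaled, is negligible on radius
  \<open>4\<^sup>k\<^sup>-\<^sup>1\<close> but dominates everything built before on radius \<open>4\<^sup>k\<close>, where
  it has matrix close to \<open>H\<^sub>k\<close> by orthogonality of monomials, and length much smaller than area
  since its degree is large. Integrating the sum of such blocks, each chosen after the previous ones,
  gives the entire curve.\<close>

section \<open>Classes of closed currents on a torus by averaging over translations\<close>

section \<open>Smooth functions\<close>

text \<open>A class is a coset modulo boundaries, so averaging must come with a homotopy that is
  itself a current. It is therefore done along one lattice vector at a time by integrals over
  segments; each step has an explicit homotopy with weight \<open>1 - r\<close>, whose transpose is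
  continuous on forms.

  The competing discs are arbitrary and known at the boundary only through local smooth extensions.
  The lift and Stokes' estimate are therefore made inside and carried to the boundary by continuity.

  Both kinds of currents are treated together: either pairing is integration against a finite
  measure, and matrices, compactness and blocks use little else. So one curve and one set of radii
  serve both.

  The constants of a block balance three demands. With the factor \<open>2 ^ m\<close>, its size at
  radius \<open>q R\<close> is of order \<open>m (2 q) ^ m\<close>: tiny for \<open>q = 1/4\<close>,
  whereas for \<open>q = 1\<close> the area grows at least like \<open>4 ^ m\<close> and both length
  and cross terms with other blocks only like \<open>m 2 ^ m\<close>. Later blocks together add at
  most 1 on an earlier disc, which this growth absorbs.\<close>

abbreviation dirder :: "'a::real_normed_vector \<Rightarrow> ('a \<Rightarrow> 'b::real_normed_vector) \<Rightarrow> 'a \<Rightarrow> 'b" where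
  "dirder u f \<equiv> \<lambda>x. frechet_derivative f (at x) u"

lemma smooth_imp_differentiable: "smooth_on UNIV f \<Longrightarrow> f differentiable (at x)"
  unfolding smooth_on_def by (metis UNIV_I dir_derivs.simps(1))

lemma smooth_dirder: "smooth_on UNIV f \<Longrightarrow> smooth_on UNIV (dirder u f)"
  unfolding smooth_on_def by (metis dir_derivs.simps(2))

lemma smooth_has_derivative:
  "smooth_on UNIV f \<Longrightarrow> (f has_derivative (\<lambda>u. dirder u f x)) (at x)"
  using smooth_imp_differentiable frechet_derivative_works by fast

lemma smooth_dir_derivs: "smooth_on UNIV f \<Longrightarrow> smooth_on UNIV (dir_derivs us f)"
  by (induction us arbitrary: f) (auto intro: smooth_dirder)

lemma smooth_continuous: "smooth_on UNIV f \<Longrightarrow> continuous_on S f"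
  by (meson UNIV_I continuous_on_subset differentiable_at_imp_differentiable_on
      differentiable_imp_continuous_on smooth_imp_differentiable subsetI)

text \<open>An invariant that implies differentiability and survives one directional derivative
  survives any list of them. Sums, linear images, averages and entire maps are then handled by
  writing down the invariant.\<close>

lemma smooth_coinduct:
  assumes "P f" and "\<And>f x. P f \<Longrightarrow> f differentiable (at x)" and "\<And>f u. P f \<Longrightarrow> P (dirder u f)"
  shows "smooth_on UNIV f"
proof -
  have "P (dir_derivs us f)" for us
    using assms(1,3) by (induction us arbitrary: f) auto
  then show ?thesis
    unfolding smooth_on_def using assms(2) by blast
qed

lemma dirder_add:
  assumes "smooth_on UNIV f" "smooth_on UNIV g"
  shows "dirder u (\<lambda>x. f x + g x) = (\<lambda>x. dirder u f x + dirder u g x)"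
proof
  fix x
  have "((\<lambda>x. f x + g x) has_derivative (\<lambda>u. dirder u f x + dirder u g x)) (at x)"
    by (intro derivative_intros smooth_has_derivative assms)
  then show "dirder u (\<lambda>x. f x + g x) x = dirder u f x + dirder u g x"
    by (metis frechet_derivative_at)
qed

lemma dirder_bounded_linear:
  assumes "bounded_linear L" "smooth_on UNIV f"
  shows "dirder u (\<lambda>x. L (f x)) = (\<lambda>x. L (dirder u f x))"
proof
  fix x
  have "((\<lambda>x. L (f x)) has_derivative (\<lambda>u. L (dirder u f x))) (at x)"
    by (intro bounded_linear.has_derivative[OF assms(1)] smooth_has_derivative assms)
  then show "dirder u (\<lambda>x. L (f x)) x = L (dirder u f x)"
    by (metis frechet_derivative_at)
qed

lemma smooth_add:
  assumes "smooth_on UNIV f" "smooth_on UNIV g"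
  shows "smooth_on UNIV (\<lambda>x. f x + g x)"
proof (rule smooth_coinduct[where P="\<lambda>h. \<exists>f g. smooth_on UNIV f \<and> smooth_on UNIV g \<and> h = (\<lambda>x. f x + g x)"])
  show "\<exists>f' g'. smooth_on UNIV f' \<and> smooth_on UNIV g' \<and> (\<lambda>x. f x + g x) = (\<lambda>x. f' x + g' x)"
    using assms by blast
next
  fix h :: "'a \<Rightarrow> 'b" and x
  assume "\<exists>f g. smooth_on UNIV f \<and> smooth_on UNIV g \<and> h = (\<lambda>x. f x + g x)"
  then show "h differentiable (at x)"
    using differentiable_add smooth_imp_differentiable by blast
next
  fix h :: "'a \<Rightarrow> 'b" and u
  assume "\<exists>f g. smooth_on UNIV f \<and> smooth_on UNIV g \<and> h = (\<lambda>x. f x + g x)"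
  then obtain f g where "smooth_on UNIV f" "smooth_on UNIV g" "h = (\<lambda>x. f x + g x)" by blast
  then show "\<exists>f g. smooth_on UNIV f \<and> smooth_on UNIV g \<and> dirder u h = (\<lambda>x. f x + g x)"
    using dirder_add smooth_dirder by blast
qed

lemma smooth_bounded_linear:
  fixes L :: "'b::real_normed_vector \<Rightarrow> 'c::real_normed_vector"
  assumes "bounded_linear L" "smooth_on UNIV f"
  shows "smooth_on UNIV (\<lambda>x. L (f x))"
proof (rule smooth_coinduct[where P="\<lambda>h. \<exists>f. smooth_on UNIV f \<and> h = (\<lambda>x. L (f x))"])
  show "\<exists>f'. smooth_on UNIV f' \<and> (\<lambda>x. L (f x)) = (\<lambda>x. L (f' x))"
    using assms by blast
next
  fix h :: "'a \<Rightarrow> 'c" and x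
  assume "\<exists>f. smooth_on UNIV f \<and> h = (\<lambda>x. L (f x))"
  then obtain f where "smooth_on UNIV f" "h = (\<lambda>x. L (f x))" by blast
  then show "h differentiable (at x)"
    using bounded_linear.has_derivative[OF assms(1) smooth_has_derivative] differentiableI by blast
next
  fix h :: "'a \<Rightarrow> 'c" and u
  assume "\<exists>f. smooth_on UNIV f \<and> h = (\<lambda>x. L (f x))"
  then obtain f where "smooth_on UNIV f" "h = (\<lambda>x. L (f x))" by blast
  then show "\<exists>f. smooth_on UNIV f \<and> dirder u h = (\<lambda>x. L (f x))"
    using dirder_bounded_linear[OF assms(1)] smooth_dirder by blast
qed

lemma smooth_const: "smooth_on UNIV (\<lambda>x. c)"
  by (rule smooth_coinduct[where P="\<lambda>h. \<exists>c. h = (\<lambda>x. c)"])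
    (auto simp: frechet_derivative_const)

lemma smooth_cmult:
  fixes c :: "'b::real_normed_algebra"
  shows "smooth_on UNIV f \<Longrightarrow> smooth_on UNIV (\<lambda>x. c * f x)"
  by (rule smooth_bounded_linear[OF bounded_linear_mult_right])

lemma smooth_uminus: "smooth_on UNIV f \<Longrightarrow> smooth_on UNIV (\<lambda>x. - f x)"
  by (rule smooth_bounded_linear[OF bounded_linear_minus[OF bounded_linear_ident]])

lemma smooth_diff:
  "smooth_on UNIV f \<Longrightarrow> smooth_on UNIV g \<Longrightarrow> smooth_on UNIV (\<lambda>x. f x - g x)"
  using smooth_add[OF _ smooth_uminus, of f g] by simp

lemma dirder_linear: "smooth_on UNIV f \<Longrightarrow> linear (\<lambda>u. dirder u f x)"
  using smooth_has_derivative has_derivative_linear by blast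

section \<open>Weighted averages along a segment\<close>

text \<open>Two weights occur: 1 gives the mean over the segment from \<open>x\<close> to
  \<open>x + b\<close>, and \<open>1 - r\<close> gives the homotopy between this mean and the
  identity.\<close>

definition segavg ::
    "(real \<Rightarrow> real) \<Rightarrow> 'a::real_normed_vector \<Rightarrow> ('a \<Rightarrow> 'b::euclidean_space) \<Rightarrow> 'a \<Rightarrow> 'b" where
  "segavg w b f x = integral {0..1} (\<lambda>r. w r *\<^sub>R f (x + r *\<^sub>R b))"

lemma segavg_integrable:
  fixes f :: "'a::real_normed_vector \<Rightarrow> 'b::euclidean_space"
  assumes "continuous_on {0..1} w" "continuous_on UNIV f"
  shows "(\<lambda>r. w r *\<^sub>R f (x + r *\<^sub>R b)) integrable_on {0..1}"
  by (intro integrable_continuous_real continuous_intros assms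
      continuous_on_compose2[OF assms(2)]) auto

lemma segavg_has_derivative:
  fixes f :: "'a::euclidean_space \<Rightarrow> 'b::euclidean_space"
  assumes w: "continuous_on {0..1} w" and f: "smooth_on UNIV f"
  shows "(segavg w b f has_derivative (\<lambda>u. segavg w b (dirder u f) x)) (at x)"
proof -
  \<comment> \<open>The Leibniz rule asks for a derivative that is continuous as a bounded linear
    map; in finite dimension this follows from continuity in each fixed direction.\<close>
  define D where "D = (\<lambda>x. Blinfun (\<lambda>u. dirder u f x))"
  have D: "blinfun_apply (D x) u = dirder u f x" for x u
    unfolding D_def using bounded_linear_Blinfun_apply[OF has_derivative_bounded_linear[OF smooth_has_derivative[OF f]]]
    by metis
  have contD: "continuous_on UNIV D"
    by (rule continuous_on_blinfun_componentwise) (simp add: D smooth_continuous smooth_dirder f)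
  have cont: "continuous_on (UNIV \<times> cbox 0 1) (\<lambda>(x, r). w r *\<^sub>R D (x + r *\<^sub>R b))"
    unfolding split_beta
    by (intro continuous_intros continuous_on_compose2[OF w] continuous_on_compose2[OF contD]) auto
  have int: "(\<lambda>r. w r *\<^sub>R D (x + r *\<^sub>R b)) integrable_on cbox 0 1"
    by (intro integrable_continuous continuous_intros continuous_on_compose2[OF contD])
      (use w in auto)
  have "((\<lambda>x. integral (cbox 0 1) (\<lambda>r. w r *\<^sub>R f (x + r *\<^sub>R b))) has_derivative
      integral (cbox 0 1) (\<lambda>r. w r *\<^sub>R D (x + r *\<^sub>R b))) (at x within UNIV)"
  proof (rule leibniz_rule)
    show "((\<lambda>x. w r *\<^sub>R f (x + r *\<^sub>R b)) has_derivative
        blinfun_apply (w r *\<^sub>R D (x + r *\<^sub>R b))) (at x within UNIV)" for x r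
    proof -
      have "((\<lambda>x. f (x + r *\<^sub>R b)) has_derivative (\<lambda>u. dirder u f (x + r *\<^sub>R b))) (at x)"
        by (rule has_derivative_compose[OF _ smooth_has_derivative[OF f], where f="\<lambda>x. x + r *\<^sub>R b" and f'="\<lambda>u. u", simplified])
          (auto intro!: derivative_eq_intros)
      then have "((\<lambda>x. w r *\<^sub>R f (x + r *\<^sub>R b)) has_derivative (\<lambda>u. w r *\<^sub>R dirder u f (x + r *\<^sub>R b))) (at x)"
        by (rule has_derivative_scaleR_right)
      moreover have "blinfun_apply (w r *\<^sub>R D (x + r *\<^sub>R b)) = (\<lambda>u. w r *\<^sub>R dirder u f (x + r *\<^sub>R b))"
        by (auto simp: D scaleR_blinfun.rep_eq)
      ultimately show ?thesis by simp
    qed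
    show "(\<lambda>r. w r *\<^sub>R f (x + r *\<^sub>R b)) integrable_on cbox 0 1" for x
      using segavg_integrable[OF w smooth_continuous[OF f]] by simp
  qed (use cont in auto)
  moreover have app: "blinfun_apply (integral (cbox 0 1) (\<lambda>r. w r *\<^sub>R D (x + r *\<^sub>R b))) u = segavg w b (dirder u f) x" for u
  proof -
    have "blinfun_apply (integral (cbox 0 1) (\<lambda>r. w r *\<^sub>R D (x + r *\<^sub>R b))) u
      = integral (cbox 0 1) (\<lambda>r. blinfun_apply (w r *\<^sub>R D (x + r *\<^sub>R b)) u)"
      by (rule blinfun_apply_integral[OF int])
    then show ?thesis by (simp add: segavg_def D scaleR_blinfun.rep_eq)
  qed
  moreover have "segavg w b f = (\<lambda>x. integral (cbox 0 1) (\<lambda>r. w r *\<^sub>R f (x + r *\<^sub>R b)))"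
    by (auto simp: segavg_def)
  moreover have "blinfun_apply (integral (cbox 0 1) (\<lambda>r. w r *\<^sub>R D (x + r *\<^sub>R b)))
      = (\<lambda>u. segavg w b (dirder u f) x)"
    by (rule ext) (rule app)
  ultimately show ?thesis by simp
qed

lemma dirder_segavg:
  fixes f :: "'a::euclidean_space \<Rightarrow> 'b::euclidean_space"
  assumes "continuous_on {0..1} w" "smooth_on UNIV f"
  shows "dirder u (segavg w b f) = segavg w b (dirder u f)"
proof
  fix x show "dirder u (segavg w b f) x = segavg w b (dirder u f) x"
    using fun_cong[OF frechet_derivative_at[OF segavg_has_derivative[OF assms, where b=b and x=x]], of u] by simp
qed

lemma smooth_segavg:
  fixes f :: "'a::euclidean_space \<Rightarrow> 'b::euclidean_space"
  assumes w: "continuous_on {0..1} w" and "smooth_on UNIV f"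
  shows "smooth_on UNIV (segavg w b f)"
proof (rule smooth_coinduct[where P="\<lambda>h. \<exists>f. smooth_on UNIV f \<and> h = segavg w b f"])
  show "\<exists>f'. smooth_on UNIV f' \<and> segavg w b f = segavg w b f'"
    using assms by blast
next
  fix h :: "'a \<Rightarrow> 'b" and x
  assume "\<exists>f. smooth_on UNIV f \<and> h = segavg w b f"
  then show "h differentiable (at x)"
    using segavg_has_derivative[OF w] differentiableI by blast
next
  fix h :: "'a \<Rightarrow> 'b" and u
  assume "\<exists>f. smooth_on UNIV f \<and> h = segavg w b f"
  then show "\<exists>f. smooth_on UNIV f \<and> dirder u h = segavg w b f"
    using dirder_segavg[OF w] smooth_dirder by blast
qed

lemma dir_derivs_segavg:
  fixes f :: "'a::euclidean_space \<Rightarrow> 'b::euclidean_space"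
  assumes "continuous_on {0..1} w" "smooth_on UNIV f"
  shows "dir_derivs us (segavg w b f) = segavg w b (dir_derivs us f)"
  using assms by (induction us arbitrary: f) (auto simp: dirder_segavg smooth_dirder)

lemma segavg_add:
  fixes f g :: "'a::real_normed_vector \<Rightarrow> 'b::euclidean_space"
  assumes "continuous_on {0..1} w" "continuous_on UNIV f" "continuous_on UNIV g"
  shows "segavg w b (\<lambda>x. f x + g x) x = segavg w b f x + segavg w b g x"
  unfolding segavg_def
  by (simp add: scaleR_add_right integral_add segavg_integrable assms)

lemma segavg_cmult:
  fixes f :: "'a::real_normed_vector \<Rightarrow> complex"
  shows "segavg w b (\<lambda>x. c * f x) x = c * segavg w b f x"
  unfolding segavg_def by (simp add: mult_scaleR_right[symmetric] del: mult_scaleR_right)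

text \<open>Weights bounded by 1 over a parameter interval of length 1 do not increase sup
  distances; this makes averaging continuous in the topology of smooth forms.\<close>

lemma segavg_dist_le:
  fixes f g :: "'a::real_normed_vector \<Rightarrow> 'b::euclidean_space"
  assumes w: "continuous_on {0..1} w" "\<And>r. r \<in> {0..1} \<Longrightarrow> \<bar>w r\<bar> \<le> 1"
    and "continuous_on UNIV f" "continuous_on UNIV g" and e: "\<And>x. dist (f x) (g x) \<le> e"
  shows "dist (segavg w b f x) (segavg w b g x) \<le> e"
proof -
  have "e \<ge> 0" using e[of 0] by (meson dual_order.trans zero_le_dist)
  have "norm (integral {0..1} (\<lambda>r. w r *\<^sub>R (f (x + r *\<^sub>R b) - g (x + r *\<^sub>R b)))) \<le> e * (1 - 0)"
  proof (rule integral_bound)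
    show "continuous_on {0..1} (\<lambda>r. w r *\<^sub>R (f (x + r *\<^sub>R b) - g (x + r *\<^sub>R b)))"
      by (intro continuous_intros continuous_on_compose2[OF assms(3)] continuous_on_compose2[OF assms(4)] w) auto
    show "norm (w r *\<^sub>R (f (x + r *\<^sub>R b) - g (x + r *\<^sub>R b))) \<le> e" if "r \<in> {0..1}" for r
      using mult_mono[OF w(2)[OF that] e[of "x + r *\<^sub>R b"]] by (simp add: dist_norm)
  qed auto
  then show ?thesis
    unfolding segavg_def dist_norm
    by (simp add: scaleR_diff_right integral_diff segavg_integrable assms)
qed

text \<open>Integration by parts along the segment: \<open>1 - r\<close> has derivative -1, which
  produces the mean, and it vanishes at \<open>r = 1\<close>, so only the boundary term at
  \<open>x\<close> remains. This is the homotopy formula for functions.\<close>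

lemma segavg_dirder:
  fixes f :: "'a::euclidean_space \<Rightarrow> 'b::euclidean_space"
  assumes f: "smooth_on UNIV f"
  shows "segavg (\<lambda>r. 1 - r) b (dirder b f) x = segavg (\<lambda>r. 1) b f x - f x"
proof -
  have d: "((\<lambda>r. f (x + r *\<^sub>R b)) has_vector_derivative dirder b f (x + r *\<^sub>R b)) (at r within {0..1})" for r
  proof -
    have "((\<lambda>r. f (x + r *\<^sub>R b)) has_derivative (\<lambda>s. dirder (s *\<^sub>R b) f (x + r *\<^sub>R b))) (at r within {0..1})"
      by (rule has_derivative_compose[OF _ smooth_has_derivative[OF f], where f="\<lambda>r. x + r *\<^sub>R b"])
        (auto intro!: derivative_eq_intros)
    then show ?thesis
      by (simp add: has_vector_derivative_def linear_cmul[OF dirder_linear[OF f]])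
  qed
  have "((\<lambda>r. (1 - r) *\<^sub>R dirder b f (x + r *\<^sub>R b) - f (x + r *\<^sub>R b)) has_integral
     ((1 - 1) *\<^sub>R f (x + 1 *\<^sub>R b) - (1 - 0) *\<^sub>R f (x + 0 *\<^sub>R b))) {0..1}"
    by (rule fundamental_theorem_of_calculus)
      (auto intro!: derivative_eq_intros d)
  then have 1: "integral {0..1} (\<lambda>r. (1 - r) *\<^sub>R dirder b f (x + r *\<^sub>R b) - f (x + r *\<^sub>R b)) = - f x"
    by (simp add: integral_unique)
  have 2: "(\<lambda>r. (1 - r) *\<^sub>R dirder b f (x + r *\<^sub>R b)) integrable_on {0..1}"
    by (rule segavg_integrable) (auto intro!: continuous_intros smooth_continuous[OF smooth_dirder[OF f]])
  have 3: "(\<lambda>r. f (x + r *\<^sub>R b)) integrable_on {0..1}"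
    using segavg_integrable[of "\<lambda>r. 1" f x b] by (simp add: smooth_continuous f)
  show ?thesis
    using 1 integral_diff[OF 2 3] by (simp add: segavg_def algebra_simps)
qed

text \<open>The mean over a full period does not see its starting point: moving the window changes
  the integral at the rate of the difference of the two end values, which is 0 by
  periodicity.\<close>

lemma segavg_periodic:
  fixes f :: "'a::real_normed_vector \<Rightarrow> 'b::euclidean_space"
  assumes f: "continuous_on UNIV f" and per: "\<And>x. f (x + b) = f x"
  shows "segavg (\<lambda>r. 1) b f (x + s *\<^sub>R b) = segavg (\<lambda>r. 1) b f x"
proof -
  let ?g = "\<lambda>r. f (x + r *\<^sub>R b)"
  have g: "continuous_on A ?g" for A
    by (intro continuous_on_compose2[OF f] continuous_intros) auto
  have pg: "?g (r + 1) = ?g r" for r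
    using per[of "x + r *\<^sub>R b"] by (simp add: algebra_simps)
  define h where "h = (\<lambda>s. integral {0..1} (\<lambda>r. ?g (r + s)))"
  have gint: "?g integrable_on {a..b'}" for a b' using g integrable_continuous_real by blast
  have sh: "h s = integral {s..1+s} ?g" for s
    unfolding h_def using integral_shift[of 0 s 1 ?g] g by (simp add: o_def)
  have const: "h s = h 0" for s
  proof -
    \<comment> \<open>An interval containing 0 and \<open>s\<close>; its left end is the common base
      point of the integrals, so that the fundamental theorem applies.\<close>
    obtain k where k: "k \<ge> 0" "s \<ge> - k" "s \<le> k" by (metis abs_ge_self abs_ge_zero abs_le_iff minus_le_iff)
    have hd: "(h has_vector_derivative 0) (at t within {-k..k})" if t: "t \<in> {-k..k}" for t
    proof -
      have eq: "h u = integral {-k..1+u} ?g - integral {-k..u} ?g" if "u \<in> {-k..k}" for u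
        using Henstock_Kurzweil_Integration.integral_combine[of "-k" u "1+u" ?g] gint that sh[of u] by (simp add: algebra_simps)
      have A: "((\<lambda>u. integral {-k..u} ?g) has_vector_derivative ?g t) (at t within {-k..k})"
        by (rule integral_has_vector_derivative[OF g t])
      have "((\<lambda>u. integral {-k..u} ?g) has_vector_derivative ?g (1 + t)) (at (1 + t) within {-k..k+1})"
        by (rule integral_has_vector_derivative[OF g]) (use t in auto)
      then have "((\<lambda>u. integral {-k..u} ?g) has_vector_derivative ?g (1 + t)) (at (1 + t) within (\<lambda>u. 1 + u) ` {-k..k})"
        by (rule has_vector_derivative_within_subset) auto
      then have B: "((\<lambda>u. integral {-k..1+u} ?g) has_vector_derivative ?g (1 + t)) (at t within {-k..k})"
        using vector_diff_chain_within[of "\<lambda>u. 1 + u" 1 t "{-k..k}" "\<lambda>u. integral {-k..u} ?g" "?g (1+t)"]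
          has_vector_derivative_add[OF has_vector_derivative_const[of "1::real"] has_vector_derivative_id[of "at t within {-k..k}"]]
        by (simp add: o_def)
      have "((\<lambda>u. integral {-k..1+u} ?g - integral {-k..u} ?g) has_vector_derivative ?g (1 + t) - ?g t) (at t within {-k..k})"
        by (intro derivative_intros A B)
      moreover have "?g (1 + t) = ?g t" using pg[of t] by (simp add: add.commute)
      ultimately have "((\<lambda>u. integral {-k..1+u} ?g - integral {-k..u} ?g) has_vector_derivative 0) (at t within {-k..k})"
        by simp
      then show ?thesis
        by (rule has_vector_derivative_transform[OF t, rotated]) (use eq in auto)
    qed
    have "\<exists>c. \<forall>t\<in>{-k..k}. h t = c"
      using has_vector_derivative_zero_constant[OF convex_real_interval(5) hd] by metis
    then show ?thesis using k by (metis atLeastAtMost_iff neg_le_0_iff_le)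
  qed
  have "segavg (\<lambda>r. 1) b f (x + s *\<^sub>R b) = h s" unfolding segavg_def h_def by (simp add: algebra_simps)
  moreover have "segavg (\<lambda>r. 1) b f x = h 0" unfolding segavg_def h_def by simp
  ultimately show ?thesis using const by simp
qed

section \<open>Lattices\<close>

lemma lattice_zero: assumes "lattice \<Lambda>" shows "0 \<in> \<Lambda>"
proof -
  obtain B where "\<Lambda> = {\<Sum>b\<in>B. of_int (c b) *\<^sub>R b | c :: complex^'a \<Rightarrow> int. True}"
    using assms unfolding lattice_def by blast
  then show ?thesis by (auto intro!: exI[of _ "\<lambda>_. 0"])
qed

lemma lattice_diff: assumes "lattice \<Lambda>" "x \<in> \<Lambda>" "y \<in> \<Lambda>" shows "x - y \<in> \<Lambda>"
proof -
  obtain B where B: "\<Lambda> = {\<Sum>b\<in>B. of_int (c b) *\<^sub>R b | c :: complex^'a \<Rightarrow> int. True}"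
    using assms unfolding lattice_def by blast
  then obtain c d where "x = (\<Sum>b\<in>B. of_int (c b) *\<^sub>R b)" "y = (\<Sum>b\<in>B. of_int (d b) *\<^sub>R b)"
    using assms(2,3) by blast
  then have "x - y = (\<Sum>b\<in>B. of_int (c b - d b) *\<^sub>R b)"
    by (simp add: sum_subtractf scaleR_diff_left)
  then show ?thesis unfolding B by (auto intro!: exI[of _ "\<lambda>b. c b - d b"])
qed

lemma lattice_minus: "lattice \<Lambda> \<Longrightarrow> x \<in> \<Lambda> \<Longrightarrow> - x \<in> \<Lambda>"
  using lattice_diff[of \<Lambda> 0 x] lattice_zero by force

lemma lattice_add: "lattice \<Lambda> \<Longrightarrow> x \<in> \<Lambda> \<Longrightarrow> y \<in> \<Lambda> \<Longrightarrow> x + y \<in> \<Lambda>"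
  using lattice_diff[of \<Lambda> x "-y"] lattice_minus by force

lemma proj_eq_iff: assumes "lattice \<Lambda>" shows "proj \<Lambda> x = proj \<Lambda> y \<longleftrightarrow> x - y \<in> \<Lambda>"
proof
  assume "proj \<Lambda> x = proj \<Lambda> y"
  moreover have "x \<in> proj \<Lambda> x" using lattice_zero[OF assms] by (simp add: proj_def)
  ultimately show "x - y \<in> \<Lambda>" by (simp add: proj_def)
next
  assume a: "x - y \<in> \<Lambda>"
  have "z - x \<in> \<Lambda> \<longleftrightarrow> z - y \<in> \<Lambda>" for z
    using lattice_add[OF assms a, of "z - x"] lattice_diff[OF assms _ a, of "z - y"] by auto
  then show "proj \<Lambda> x = proj \<Lambda> y" by (simp add: proj_def)
qed

lemma proj_add: "lattice \<Lambda> \<Longrightarrow> l \<in> \<Lambda> \<Longrightarrow> proj \<Lambda> (x + l) = proj \<Lambda> x"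
  by (simp add: proj_eq_iff)

lemma proj_shift: "lattice \<Lambda> \<Longrightarrow> proj \<Lambda> x = proj \<Lambda> y \<Longrightarrow> proj \<Lambda> (x + v) = proj \<Lambda> (y + v)"
  by (simp add: proj_eq_iff)

lemma proj_some: assumes "lattice \<Lambda>" shows "proj \<Lambda> (SOME y. y \<in> proj \<Lambda> x) = proj \<Lambda> x"
proof -
  have "x \<in> proj \<Lambda> x" using lattice_zero[OF assms] by (simp add: proj_def)
  then have "(SOME y. y \<in> proj \<Lambda> x) \<in> proj \<Lambda> x" by (rule someI)
  then show ?thesis by (simp add: proj_eq_iff[OF assms]) (simp add: proj_def)
qed

lemma proj_in_torus [simp]: "proj \<Lambda> x \<in> torus \<Lambda>"
  by (simp add: torus_def)

definition lattice_basis :: "(complex^'n) set \<Rightarrow> (complex^'n) set \<Rightarrow> bool" where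
  "lattice_basis \<Lambda> B \<longleftrightarrow> finite B \<and> independent B \<and> span B = UNIV \<and> B \<subseteq> \<Lambda> \<and>
    \<Lambda> = {\<Sum>b\<in>B. of_int (c b) *\<^sub>R b | c :: complex^'n \<Rightarrow> int. True}"

lemma lattice_basisD:
  assumes "lattice_basis \<Lambda> B"
  shows "finite B" "independent B" "span B = UNIV" "B \<subseteq> \<Lambda>"
    "\<Lambda> = {\<Sum>b\<in>B. of_int (c b) *\<^sub>R b | c :: complex^'n \<Rightarrow> int. True}"
  using assms unfolding lattice_basis_def by blast+

lemma lattice_basis_exists:
  fixes \<Lambda> :: "(complex^'n) set"
  assumes "lattice \<Lambda>"
  shows "\<exists>B. lattice_basis \<Lambda> B"
proof -
  obtain B where B: "independent B" "span B = (UNIV :: (complex^'n) set)"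
    "\<Lambda> = {\<Sum>b\<in>B. of_int (c b) *\<^sub>R b | c :: complex^'n \<Rightarrow> int. True}"
    using assms unfolding lattice_def by blast
  have fin: "finite B" using B(1) independent_imp_finite by blast
  have "b \<in> \<Lambda>" if "b \<in> B" for b
  proof -
    have "(\<Sum>b'\<in>B. of_int (if b' = b then 1 else 0) *\<^sub>R b') = (\<Sum>b'\<in>B. if b' = b then b' else 0)"
      by (rule sum.cong) auto
    also have "\<dots> = b" using fin that by (simp add: sum.delta)
    finally show ?thesis
      unfolding B(3) mem_Collect_eq by (intro exI[of _ "\<lambda>b'. if b' = b then 1 else 0"]) simp
  qed
  then have "lattice_basis \<Lambda> B" unfolding lattice_basis_def using fin B by blast
  then show ?thesis ..
qed

text \<open>The coordinates with respect to the basis are bounded linear functionals and take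
  integer values on the lattice; on a short vector they are below 1 in absolute value, hence
  0.\<close>

lemma lattice_discrete:
  fixes \<Lambda> :: "(complex^'n) set"
  assumes "lattice \<Lambda>"
  obtains e where "e > 0" "\<And>l. l \<in> \<Lambda> \<Longrightarrow> norm l < e \<Longrightarrow> l = 0"
proof -
  obtain B where "lattice_basis \<Lambda> B" using lattice_basis_exists[OF assms] by blast
  note B = lattice_basisD(1,2,5)[OF this]
  have "\<exists>g::complex^'n \<Rightarrow> real. linear g \<and> (\<forall>b'\<in>B. g b' = (if b' = b then 1 else 0))" for b
    using linear_independent_extend[OF B(2), of "\<lambda>b'. if b' = b then 1 else 0"] by blast
  then obtain g :: "complex^'n \<Rightarrow> complex^'n \<Rightarrow> real" where
    g: "\<And>b. linear (g b)" "\<And>b b'. b' \<in> B \<Longrightarrow> g b b' = (if b' = b then 1 else 0)" by metis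
  have "\<exists>K>0. \<forall>x. \<bar>g b x\<bar> \<le> K * norm x" for b
  proof -
    obtain K where "K > 0" "\<And>x. norm (g b x) \<le> K * norm x"
      using linear_bounded_pos[OF g(1)[of b]] by blast
    then show ?thesis by auto
  qed
  then obtain K where K: "\<And>b. K b > 0" "\<And>b x. \<bar>g b x\<bar> \<le> K b * norm x" by metis
  define e where "e = 1 / (1 + (\<Sum>b\<in>B. K b))"
  have pos: "1 + (\<Sum>b\<in>B. K b) > 0" using K(1) by (simp add: add_pos_nonneg less_imp_le sum_nonneg)
  show ?thesis
  proof
    show "e > 0" using pos by (simp add: e_def)
    fix l assume l: "l \<in> \<Lambda>" "norm l < e"
    then obtain c where c: "l = (\<Sum>b\<in>B. of_int (c b) *\<^sub>R b)" using B(3) by blast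
    have "c b = 0" if b: "b \<in> B" for b
    proof -
      have "g b l = (\<Sum>b'\<in>B. of_int (c b') * (if b' = b then 1 else 0))"
        unfolding c by (simp add: linear_sum[OF g(1)] linear_cmul[OF g(1)] g(2))
      also have "\<dots> = (\<Sum>b'\<in>B. if b' = b then of_int (c b') else 0)"
        by (rule sum.cong) auto
      also have "\<dots> = of_int (c b)"
        using b B(1) by (simp add: sum.delta)
      finally have "\<bar>of_int (c b)\<bar> \<le> K b * norm l" using K(2)[of b l] by simp
      also have "\<dots> \<le> (1 + (\<Sum>b\<in>B. K b)) * norm l"
        using member_le_sum[of b B K] b B(1) K(1) by (intro mult_right_mono) (auto simp: less_imp_le add_increasing)
      also have "\<dots> < 1" using l(2) pos by (simp add: e_def field_simps)
      finally show ?thesis by linarith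
    qed
    then show "l = 0" by (simp add: c)
  qed
qed

text \<open>Rounding the coordinates down leaves a remainder with coordinates between 0 and 1, so
  the sum of the norms of the basis vectors is a valid \<open>\<rho>\<close>.\<close>

lemma lattice_cocompact:
  fixes \<Lambda> :: "(complex^'n) set"
  assumes "lattice \<Lambda>"
  obtains \<rho> where "\<And>x. \<exists>l\<in>\<Lambda>. norm (x - l) \<le> \<rho>"
proof -
  obtain B where "lattice_basis \<Lambda> B" using lattice_basis_exists[OF assms] by blast
  note B = lattice_basisD(1,3,5)[OF this]
  have "\<exists>l\<in>\<Lambda>. norm (x - l) \<le> (\<Sum>b\<in>B. norm b)" for x
  proof -
    have "x \<in> span B" using B(2) by simp
    then obtain t where t: "x = (\<Sum>b\<in>B. t b *\<^sub>R b)" unfolding span_finite[OF B(1)] by auto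
    let ?l = "\<Sum>b\<in>B. of_int \<lfloor>t b\<rfloor> *\<^sub>R b"
    have "?l \<in> \<Lambda>" unfolding B(3) mem_Collect_eq by (intro exI[of _ "\<lambda>b. \<lfloor>t b\<rfloor>"]) simp
    moreover have "norm (x - ?l) \<le> (\<Sum>b\<in>B. norm b)"
    proof -
      have "x - ?l = (\<Sum>b\<in>B. (t b - of_int \<lfloor>t b\<rfloor>) *\<^sub>R b)"
        unfolding t by (simp add: sum_subtractf scaleR_diff_left)
      also have "norm \<dots> \<le> (\<Sum>b\<in>B. norm ((t b - of_int \<lfloor>t b\<rfloor>) *\<^sub>R b))" by (rule norm_sum)
      also have "\<dots> \<le> (\<Sum>b\<in>B. norm b)"
      proof (rule sum_mono)
        fix b
        have "\<bar>t b - of_int \<lfloor>t b\<rfloor>\<bar> \<le> 1" by linarith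
        then show "norm ((t b - of_int \<lfloor>t b\<rfloor>) *\<^sub>R b) \<le> norm b"
          by (simp add: mult_left_le_one_le)
      qed
      finally show ?thesis .
    qed
    ultimately show ?thesis by blast
  qed
  then show ?thesis using that by blast
qed

text \<open>Invariance is required under real multiples of the basis vectors, and these carry 0 to
  every point, one basis vector after another.\<close>

lemma translation_invariant_const:
  fixes g :: "complex^'n \<Rightarrow> 'b"
  assumes "finite B" "span B = UNIV" and inv: "\<And>b x s. b \<in> B \<Longrightarrow> g (x + s *\<^sub>R b) = g x"
  shows "g x = g 0"
proof -
  have "x \<in> span B" using assms(2) by simp
  then obtain t where t: "x = (\<Sum>b\<in>B. t b *\<^sub>R b)" unfolding span_finite[OF assms(1)] by auto
  have "g (\<Sum>b\<in>C. t b *\<^sub>R b) = g 0" if "C \<subseteq> B" for C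
    using finite_subset[OF that assms(1)] that
    by (induction C rule: finite_induct) (simp_all add: add.commute[of "_ *\<^sub>R _"] inv)
  then show ?thesis using t by blast
qed

text \<open>A fixed ball contains a representative of every point, and a continuous function is
  bounded there.\<close>

lemma periodic_bounded:
  fixes c :: "complex^'n \<Rightarrow> 'b::real_normed_vector"
  assumes "lattice \<Lambda>" "continuous_on UNIV c" and per: "\<And>x l. l \<in> \<Lambda> \<Longrightarrow> c (x + l) = c x"
  obtains K where "K > 0" "\<And>x. norm (c x) \<le> K"
proof -
  obtain \<rho> where \<rho>: "\<And>x. \<exists>l\<in>\<Lambda>. norm (x - l) \<le> \<rho>" using lattice_cocompact[OF assms(1)] by blast
  have "compact (c ` cball 0 \<rho>)"
    by (intro compact_continuous_image continuous_on_subset[OF assms(2)]) auto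
  then obtain K where K: "K > 0" "\<And>y. y \<in> c ` cball 0 \<rho> \<Longrightarrow> norm y \<le> K"
    using compact_imp_bounded[of "c ` cball 0 \<rho>"] unfolding bounded_pos by blast
  have "norm (c x) \<le> K" for x
  proof -
    obtain l where "l \<in> \<Lambda>" "norm (x - l) \<le> \<rho>" using \<rho> by blast
    then show ?thesis using per[of l "x - l"] K(2)[of "c (x - l)"] by simp
  qed
  then show ?thesis using that K by blast
qed

lemma periodic_uniformly_continuous:
  fixes c :: "complex^'n \<Rightarrow> 'b::metric_space"
  assumes "lattice \<Lambda>" "continuous_on UNIV c" and per: "\<And>x l. l \<in> \<Lambda> \<Longrightarrow> c (x + l) = c x"
  shows "uniformly_continuous_on UNIV c"
proof -
  obtain \<rho> where \<rho>: "\<And>x. \<exists>l\<in>\<Lambda>. norm (x - l) \<le> \<rho>" using lattice_cocompact[OF assms(1)] by blast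
  \<comment> \<open>The margin 1 lets a single lattice vector move two points at distance below 1
    into the same compact ball.\<close>
  have uc: "uniformly_continuous_on (cball 0 (\<rho> + 1)) c"
    by (intro compact_uniformly_continuous continuous_on_subset[OF assms(2)]) auto
  show ?thesis
    unfolding uniformly_continuous_on_def
  proof (intro allI impI)
    fix e :: real assume "e > 0"
    then obtain d where d: "d > 0" "\<And>x x'. x \<in> cball 0 (\<rho> + 1) \<Longrightarrow> x' \<in> cball 0 (\<rho> + 1) \<Longrightarrow>
        dist x' x < d \<Longrightarrow> dist (c x') (c x) < e"
      using uc unfolding uniformly_continuous_on_def by blast
    have "dist (c y) (c x) < e" if xy: "dist y x < min d 1" for x y
    proof -
      obtain l where l: "l \<in> \<Lambda>" "norm (x - l) \<le> \<rho>" using \<rho> by blast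
      have "norm (y - l) \<le> norm (x - l) + norm (y - x)"
        using norm_triangle_ineq[of "x - l" "y - x"] by simp
      then have "norm (y - l) \<le> \<rho> + 1" using xy l by (simp add: dist_norm)
      then have "dist (c (y - l)) (c (x - l)) < e"
        using d(2)[of "x - l" "y - l"] l xy by (simp add: dist_norm norm_minus_commute[of l])
      then show ?thesis using per[OF l(1), of "y - l"] per[OF l(1), of "x - l"] by simp
    qed
    then show "\<exists>d>0. \<forall>x\<in>UNIV. \<forall>x'\<in>UNIV. dist x' x < d \<longrightarrow> dist (c x') (c x) < e"
      using d(1) by (intro exI[of _ "min d 1"]) auto
  qed
qed

text \<open>Discreteness of the lattice turns continuity into local constancy. It is applied to the
  difference of two local lifts, whose derivatives therefore agree.\<close>

lemma lattice_valued_locally_const: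
  fixes h :: "'a::metric_space \<Rightarrow> complex^'n"
  assumes "lattice \<Lambda>" "0 < e" "\<And>w. w \<in> ball z e \<Longrightarrow> h w \<in> \<Lambda>" "isCont h z"
  obtains d where "0 < d" "\<And>w. w \<in> ball z d \<Longrightarrow> h w = h z"
proof -
  obtain r where r: "r > 0" "\<And>l. l \<in> \<Lambda> \<Longrightarrow> norm l < r \<Longrightarrow> l = 0"
    using lattice_discrete[OF assms(1)] by blast
  obtain d where d: "d > 0" "\<And>w. dist w z < d \<Longrightarrow> dist (h w) (h z) < r"
    using assms(4) r(1) unfolding continuous_at_eps_delta by blast
  show ?thesis
  proof
    show "0 < min d e" using d assms by simp
    fix w assume w: "w \<in> ball z (min d e)"
    then have "h w - h z \<in> \<Lambda>" using assms by (intro lattice_diff) auto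
    moreover have "norm (h w - h z) < r" using d(2)[of w] w by (simp add: dist_norm dist_commute)
    ultimately show "h w = h z" using r(2) by force
  qed
qed

section \<open>Forms and currents\<close>

lemma dirder_segavg_at:
  fixes f :: "'a::euclidean_space \<Rightarrow> 'b::euclidean_space"
  assumes "continuous_on {0..1} w" "smooth_on UNIV f"
  shows "dirder u (segavg w b f) x = segavg w b (dirder u f) x"
  using fun_cong[OF dirder_segavg[OF assms], of b x u] .

text \<open>Forms are total functions with arbitrary values at other sets and lists, so equality of
  functions is too strong; this is the equality that matters.\<close>

definition forms_agree :: "(complex^'n) set \<Rightarrow> nat \<Rightarrow> 'n form \<Rightarrow> 'n form \<Rightarrow> bool" where
  "forms_agree \<Lambda> k \<phi> \<psi> \<longleftrightarrow> (\<forall>x vs. length vs = k \<longrightarrow> \<phi> (proj \<Lambda> x) vs = \<psi> (proj \<Lambda> x) vs)"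

lemma smooth_form_cong:
  assumes "forms_agree \<Lambda> k \<phi> \<psi>" "smooth_form \<Lambda> k \<phi>" shows "smooth_form \<Lambda> k \<psi>"
proof -
  have eq: "\<phi> p vs = \<psi> p vs" if "p \<in> torus \<Lambda>" "length vs = k" for p vs
    using assms(1) that unfolding forms_agree_def torus_def by auto
  have "alternating k (\<psi> p)" if p: "p \<in> torus \<Lambda>" for p
  proof -
    have a: "alternating k (\<phi> p)" using assms(2) p unfolding smooth_form_def by blast
    have "(\<lambda>v. \<phi> p (vs[i := v])) = (\<lambda>v. \<psi> p (vs[i := v]))" if "length vs = k" for vs i
      using eq[OF p] that by auto
    then show ?thesis using a eq[OF p] unfolding alternating_def by (metis (mono_tags, lifting))
  qed
  moreover have "smooth_on UNIV (\<lambda>x. \<psi> (proj \<Lambda> x) vs)" if "length vs = k" for vs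
    using assms(2) eq that unfolding smooth_form_def by simp
  ultimately show ?thesis unfolding smooth_form_def by blast
qed

lemma current_add:
  "current \<Lambda> k T \<Longrightarrow> smooth_form \<Lambda> k \<phi> \<Longrightarrow> smooth_form \<Lambda> k \<psi> \<Longrightarrow>
    T (\<lambda>p vs. \<phi> p vs + \<psi> p vs) = T \<phi> + T \<psi>"
  unfolding current_def by blast

lemma current_cmult:
  "current \<Lambda> k T \<Longrightarrow> smooth_form \<Lambda> k \<phi> \<Longrightarrow> T (\<lambda>p vs. c * \<phi> p vs) = c * T \<phi>"
  unfolding current_def by blast

lemma current_limit:
  "current \<Lambda> k T \<Longrightarrow> (\<And>m. smooth_form \<Lambda> k (\<phi> m)) \<Longrightarrow> smooth_form \<Lambda> k \<psi> \<Longrightarrow>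
    forms_converge \<Lambda> k \<phi> \<psi> \<Longrightarrow> (\<lambda>m. T (\<phi> m)) \<longlonglongrightarrow> T \<psi>"
  unfolding current_def by blast

text \<open>Continuity alone gives this: the constant sequence \<open>\<phi>\<close> converges to
  \<open>\<psi>\<close>, because only the relevant values enter
  \<open>forms_converge\<close>.\<close>

lemma current_cong:
  assumes T: "current \<Lambda> k T" and agree: "forms_agree \<Lambda> k \<phi> \<psi>" and "smooth_form \<Lambda> k \<phi>"
  shows "T \<phi> = T \<psi>"
proof -
  have "forms_converge \<Lambda> k (\<lambda>_. \<phi>) \<psi>"
    unfolding forms_converge_def
  proof (intro allI impI)
    fix vs :: "(complex^'a) list" and us :: "(complex^'a) list" assume "length vs = k"
    then have "(\<lambda>x. \<phi> (proj \<Lambda> x) vs) = (\<lambda>x. \<psi> (proj \<Lambda> x) vs)"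
      using agree unfolding forms_agree_def by auto
    then show "uniform_limit UNIV (\<lambda>m. dir_derivs us (\<lambda>x. \<phi> (proj \<Lambda> x) vs))
        (dir_derivs us (\<lambda>x. \<psi> (proj \<Lambda> x) vs)) sequentially"
      by (simp add: uniform_limit_const)
  qed
  then have "(\<lambda>m::nat. T \<phi>) \<longlonglongrightarrow> T \<psi>"
    using current_limit[OF T, of "\<lambda>_. \<phi>" \<psi>] assms(3) smooth_form_cong[OF agree] by blast
  then show ?thesis by (simp add: LIMSEQ_const_iff)
qed

lemma alternating_add:
  "alternating k a \<Longrightarrow> alternating k b \<Longrightarrow> alternating k (\<lambda>vs. a vs + b vs)"
  unfolding alternating_def by (simp add: linear_compose_add)

lemma linear_cmult_complex:
  fixes f :: "'a::real_vector \<Rightarrow> complex" shows "linear f \<Longrightarrow> linear (\<lambda>v. c * f v)"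
  by (auto intro!: linearI simp: linear_add linear_cmul algebra_simps)

lemma alternating_cmult: "alternating k a \<Longrightarrow> alternating k (\<lambda>vs. c * a vs)"
  unfolding alternating_def by (simp add: linear_cmult_complex)

lemma smooth_form_add:
  "smooth_form \<Lambda> k \<phi> \<Longrightarrow> smooth_form \<Lambda> k \<psi> \<Longrightarrow> smooth_form \<Lambda> k (\<lambda>p vs. \<phi> p vs + \<psi> p vs)"
  unfolding smooth_form_def by (simp add: alternating_add smooth_add)

lemma smooth_form_cmult:
  "smooth_form \<Lambda> k \<phi> \<Longrightarrow> smooth_form \<Lambda> k (\<lambda>p vs. c * \<phi> p vs)"
  unfolding smooth_form_def by (simp add: alternating_cmult smooth_cmult)

lemma smooth_form_diff:
  "smooth_form \<Lambda> k \<phi> \<Longrightarrow> smooth_form \<Lambda> k \<psi> \<Longrightarrow> smooth_form \<Lambda> k (\<lambda>p vs. \<phi> p vs - \<psi> p vs)"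
  using smooth_form_add[OF _ smooth_form_cmult[of \<Lambda> k \<psi> "-1"], of \<phi>] by simp

lemma smooth_form_zero: "smooth_form \<Lambda> k (\<lambda>p vs. 0)"
  unfolding smooth_form_def alternating_def by (simp add: smooth_const linear_iff)

lemma smooth_form_sum:
  "(\<And>i. i \<in> I \<Longrightarrow> smooth_form \<Lambda> k (\<phi> i)) \<Longrightarrow> smooth_form \<Lambda> k (\<lambda>p vs. \<Sum>i\<in>I. \<phi> i p vs)"
  by (induction I rule: infinite_finite_induct) (simp_all add: smooth_form_zero smooth_form_add)

lemma smooth_form_smooth:
  "smooth_form \<Lambda> k \<phi> \<Longrightarrow> length vs = k \<Longrightarrow> smooth_on UNIV (\<lambda>x. \<phi> (proj \<Lambda> x) vs)"
  unfolding smooth_form_def by blast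

lemma smooth_form_alternating:
  "smooth_form \<Lambda> k \<phi> \<Longrightarrow> alternating k (\<phi> (proj \<Lambda> x))"
  unfolding smooth_form_def by simp

lemma current_diff:
  assumes "current \<Lambda> k T" "smooth_form \<Lambda> k \<phi>" "smooth_form \<Lambda> k \<psi>"
  shows "T (\<lambda>p vs. \<phi> p vs - \<psi> p vs) = T \<phi> - T \<psi>"
  using current_add[OF assms(1,2) smooth_form_cmult[OF assms(3), of "-1"]]
    current_cmult[OF assms(1,3), of "-1"] by simp

lemma current_sum:
  assumes "current \<Lambda> k T" "finite I" "\<And>i. i \<in> I \<Longrightarrow> smooth_form \<Lambda> k (\<phi> i)"
  shows "T (\<lambda>p vs. \<Sum>i\<in>I. \<phi> i p vs) = (\<Sum>i\<in>I. T (\<phi> i))"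
  using assms(2,3)
proof (induction I rule: finite_induct)
  case empty
  then show ?case using current_cmult[OF assms(1) smooth_form_zero, of 0] by simp
next
  case (insert i I)
  have "T (\<lambda>p vs. \<phi> i p vs + (\<Sum>i\<in>I. \<phi> i p vs)) = T (\<phi> i) + T (\<lambda>p vs. \<Sum>i\<in>I. \<phi> i p vs)"
    by (rule current_add[OF assms(1)]) (use insert in \<open>auto intro: smooth_form_sum\<close>)
  then show ?case using insert by simp
qed

lemma current_plus:
  assumes "current \<Lambda> k T" "current \<Lambda> k U" shows "current \<Lambda> k (\<lambda>\<phi>. T \<phi> + c * U \<phi>)"
  unfolding current_def
proof (intro conjI allI impI)
  fix \<phi> \<psi> :: "'a form" assume "smooth_form \<Lambda> k \<phi> \<and> smooth_form \<Lambda> k \<psi>"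
  then show "T (\<lambda>p vs. \<phi> p vs + \<psi> p vs) + c * U (\<lambda>p vs. \<phi> p vs + \<psi> p vs) = T \<phi> + c * U \<phi> + (T \<psi> + c * U \<psi>)"
    using current_add[OF assms(1)] current_add[OF assms(2)] by (simp add: algebra_simps)
next
  fix \<phi> :: "'a form" and d assume "smooth_form \<Lambda> k \<phi>"
  then show "T (\<lambda>p vs. d * \<phi> p vs) + c * U (\<lambda>p vs. d * \<phi> p vs) = d * (T \<phi> + c * U \<phi>)"
    using current_cmult[OF assms(1)] current_cmult[OF assms(2)] by (simp add: algebra_simps)
next
  fix \<phi> :: "nat \<Rightarrow> 'a form" and \<psi>
  assume "(\<forall>m. smooth_form \<Lambda> k (\<phi> m)) \<and> smooth_form \<Lambda> k \<psi> \<and> forms_converge \<Lambda> k \<phi> \<psi>"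
  then show "(\<lambda>m. T (\<phi> m) + c * U (\<phi> m)) \<longlonglongrightarrow> T \<psi> + c * U \<psi>"
    by (intro tendsto_intros current_limit[OF assms(1)] current_limit[OF assms(2)]) auto
qed

lemma alternating1_iff: "alternating 1 a \<longleftrightarrow> linear (\<lambda>v. a [v])"
proof
  assume "alternating 1 a"
  then have "linear (\<lambda>v. a ([0][0 := v]))"
    unfolding alternating_def by (elim allE[of _ "[0]"]) simp
  then show "linear (\<lambda>v. a [v])" by simp
next
  assume "linear (\<lambda>v. a [v])"
  then show "alternating 1 a"
    unfolding alternating_def by (auto simp: length_Suc_conv)
qed

lemma alternating2_iff:
  "alternating 2 a \<longleftrightarrow> (\<forall>v. linear (\<lambda>u. a [u, v])) \<and> (\<forall>u. linear (\<lambda>v. a [u, v])) \<and> (\<forall>u. a [u, u] = 0)"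
proof
  assume a: "alternating 2 a"
  have "linear (\<lambda>w. a ([u, v][0 := w]))" "linear (\<lambda>w. a ([u, v][1 := w]))"
    "u = v \<Longrightarrow> a [u, v] = 0" for u v
    using a[unfolded alternating_def, rule_format, of "[u, v]"] by (auto simp: All_less_Suc numeral_2_eq_2)
  then show "(\<forall>v. linear (\<lambda>u. a [u, v])) \<and> (\<forall>u. linear (\<lambda>v. a [u, v])) \<and> (\<forall>u. a [u, u] = 0)" by simp
next
  assume a: "(\<forall>v. linear (\<lambda>u. a [u, v])) \<and> (\<forall>u. linear (\<lambda>v. a [u, v])) \<and> (\<forall>u. a [u, u] = 0)"
  show "alternating 2 a"
    unfolding alternating_def
  proof (intro allI impI)
    fix vs :: "(complex^'a) list" assume "length vs = 2"
    then obtain u v where "vs = [u, v]" by (auto simp: length_Suc_conv numeral_2_eq_2)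
    then show "(\<forall>i<2. linear (\<lambda>v. a (vs[i := v]))) \<and>
        (\<forall>i<2. \<forall>j<2. i \<noteq> j \<and> vs ! i = vs ! j \<longrightarrow> a vs = 0)"
      using a by (auto simp: All_less_Suc numeral_2_eq_2)
  qed
qed

lemma alternating2_swap: assumes "alternating 2 a" shows "a [u, v] = - a [v, u]"
proof -
  have l: "\<And>v. linear (\<lambda>u. a [u, v])" "\<And>u. linear (\<lambda>v. a [u, v])" "\<And>u. a [u, u] = 0"
    using assms unfolding alternating2_iff by auto
  have "a [u + v, u + v] = a [u, u] + a [v, u] + a [u, v] + a [v, v]"
    using linear_add[OF l(1)] linear_add[OF l(2)] by simp
  then show ?thesis using l(3) by (simp add: eq_neg_iff_add_eq_0 add.commute)
qed

lemma alternating_contract: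
  assumes "alternating (Suc k) a" shows "alternating k (\<lambda>vs. a (b # vs))"
  unfolding alternating_def
proof (intro allI impI)
  fix vs :: "(complex^'a) list" assume "length vs = k"
  then have "length (b # vs) = Suc k" by simp
  then have *: "\<forall>i<Suc k. linear (\<lambda>v. a ((b # vs)[i := v]))"
    "\<forall>i<Suc k. \<forall>j<Suc k. i \<noteq> j \<and> (b # vs) ! i = (b # vs) ! j \<longrightarrow> a (b # vs) = 0"
    using assms unfolding alternating_def by blast+
  have "linear (\<lambda>v. a (b # vs[i := v]))" if "i < k" for i
    using *(1)[rule_format, of "Suc i"] that by simp
  moreover have "a (b # vs) = 0" if "i < k" "j < k" "i \<noteq> j" "vs ! i = vs ! j" for i j
    using *(2)[rule_format, of "Suc i" "Suc j"] that by simp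
  ultimately show "(\<forall>i<k. linear (\<lambda>v. a (b # vs[i := v]))) \<and>
      (\<forall>i<k. \<forall>j<k. i \<noteq> j \<and> vs ! i = vs ! j \<longrightarrow> a (b # vs) = 0)" by blast
qed

section \<open>Averaging forms along a lattice vector\<close>

text \<open>The interior product with the constant vector field \<open>b\<close>.\<close>

definition contract :: "complex^'n \<Rightarrow> 'n form \<Rightarrow> 'n form" where
  "contract b \<phi> p vs = \<phi> p (b # vs)"

definition form_avg ::
    "(complex^'n) set \<Rightarrow> (real \<Rightarrow> real) \<Rightarrow> complex^'n \<Rightarrow> 'n form \<Rightarrow> 'n form" where
  "form_avg \<Lambda> w b \<phi> p vs = segavg w b (\<lambda>x. \<phi> (proj \<Lambda> x) vs) (SOME x. x \<in> p)"

text \<open>The integrand depends on the chosen representative only through its coset, so the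
  average can be computed at any point above \<open>p\<close>.\<close>

lemma form_avg_proj:
  assumes "lattice \<Lambda>"
  shows "form_avg \<Lambda> w b \<phi> (proj \<Lambda> x) vs = segavg w b (\<lambda>x. \<phi> (proj \<Lambda> x) vs) x"
  unfolding form_avg_def segavg_def using proj_shift[OF assms proj_some[OF assms]] by metis

lemma smooth_form_contract: "smooth_form \<Lambda> (Suc k) \<phi> \<Longrightarrow> smooth_form \<Lambda> k (contract b \<phi>)"
  unfolding smooth_form_def contract_def by (simp add: alternating_contract)

lemma forms_converge_contract:
  "forms_converge \<Lambda> (Suc k) \<phi> \<psi> \<Longrightarrow> forms_converge \<Lambda> k (\<lambda>m. contract b (\<phi> m)) (contract b \<psi>)"
  unfolding forms_converge_def contract_def by simp

lemma smooth_form_avg: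
  assumes L: "lattice \<Lambda>" and w: "continuous_on {0..1} w" and \<phi>: "smooth_form \<Lambda> k \<phi>"
  shows "smooth_form \<Lambda> k (form_avg \<Lambda> w b \<phi>)"
  unfolding smooth_form_def
proof (intro conjI ballI allI impI)
  fix p assume "p \<in> torus \<Lambda>"
  then obtain x where p: "p = proj \<Lambda> x" unfolding torus_def by blast
  have a: "alternating k (\<phi> (proj \<Lambda> y))" for y using smooth_form_alternating[OF \<phi>] .
  show "alternating k (form_avg \<Lambda> w b \<phi> p)"
    unfolding alternating_def p form_avg_proj[OF L]
  proof (intro allI impI conjI)
    fix vs :: "(complex^'a) list" and i assume vs: "length vs = k" and i: "i < k"
    have lin: "linear (\<lambda>v. \<phi> (proj \<Lambda> y) (vs[i := v]))" for y
      using a[of y] vs i unfolding alternating_def by blast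
    have c: "continuous_on UNIV (\<lambda>x. \<phi> (proj \<Lambda> x) (vs[i := v]))" for v
      by (rule smooth_continuous[OF smooth_form_smooth[OF \<phi>]]) (use vs in simp)
    show "linear (\<lambda>v. segavg w b (\<lambda>x. \<phi> (proj \<Lambda> x) (vs[i := v])) x)"
    proof (rule linearI)
      fix u v r
      show "segavg w b (\<lambda>x. \<phi> (proj \<Lambda> x) (vs[i := u + v])) x =
          segavg w b (\<lambda>x. \<phi> (proj \<Lambda> x) (vs[i := u])) x + segavg w b (\<lambda>x. \<phi> (proj \<Lambda> x) (vs[i := v])) x"
        by (simp add: linear_add[OF lin] segavg_add w c)
      show "segavg w b (\<lambda>x. \<phi> (proj \<Lambda> x) (vs[i := r *\<^sub>R v])) x =
          r *\<^sub>R segavg w b (\<lambda>x. \<phi> (proj \<Lambda> x) (vs[i := v])) x"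
        unfolding linear_cmul[OF lin] by (simp add: scaleR_conv_of_real segavg_cmult)
    qed
  next
    fix vs :: "(complex^'a) list" and i j
    assume vs: "length vs = k" and ij: "i < k" "j < k" "i \<noteq> j \<and> vs ! i = vs ! j"
    have "\<phi> (proj \<Lambda> y) vs = 0" for y
      using a[of y] vs ij unfolding alternating_def by blast
    then show "segavg w b (\<lambda>x. \<phi> (proj \<Lambda> x) vs) x = 0" by (simp add: segavg_def)
  qed
next
  fix vs :: "(complex^'a) list" assume "length vs = k"
  then show "smooth_on UNIV (\<lambda>x. form_avg \<Lambda> w b \<phi> (proj \<Lambda> x) vs)"
    unfolding form_avg_proj[OF L] by (rule smooth_segavg[OF w smooth_form_smooth[OF \<phi>]])
qed

text \<open>Averaging commutes with directional derivatives, so uniform convergence of each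
  derivative passes through it by the sup estimate.\<close>

lemma forms_converge_avg:
  assumes L: "lattice \<Lambda>" and w: "continuous_on {0..1} w" "\<And>r. r \<in> {0..1} \<Longrightarrow> \<bar>w r\<bar> \<le> 1"
    and \<phi>: "\<And>m. smooth_form \<Lambda> k (\<phi> m)" "smooth_form \<Lambda> k \<psi>" and conv: "forms_converge \<Lambda> k \<phi> \<psi>"
  shows "forms_converge \<Lambda> k (\<lambda>m. form_avg \<Lambda> w b (\<phi> m)) (form_avg \<Lambda> w b \<psi>)"
  unfolding forms_converge_def form_avg_proj[OF L]
proof (intro allI impI)
  fix vs us :: "(complex^'a) list" assume vs: "length vs = k"
  have sm: "smooth_on UNIV (\<lambda>x. \<phi> m (proj \<Lambda> x) vs)" "smooth_on UNIV (\<lambda>x. \<psi> (proj \<Lambda> x) vs)" for m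
    using smooth_form_smooth \<phi> vs by blast+
  have ul: "uniform_limit UNIV (\<lambda>m. dir_derivs us (\<lambda>x. \<phi> m (proj \<Lambda> x) vs))
       (dir_derivs us (\<lambda>x. \<psi> (proj \<Lambda> x) vs)) sequentially"
    using conv vs unfolding forms_converge_def by blast
  show "uniform_limit UNIV (\<lambda>m. dir_derivs us (segavg w b (\<lambda>x. \<phi> m (proj \<Lambda> x) vs)))
       (dir_derivs us (segavg w b (\<lambda>x. \<psi> (proj \<Lambda> x) vs))) sequentially"
    unfolding uniform_limit_iff
  proof (intro allI impI)
    fix e :: real assume "e > 0"
    then have "\<forall>\<^sub>F m in sequentially. \<forall>x. dist (dir_derivs us (\<lambda>x. \<phi> m (proj \<Lambda> x) vs) x)
        (dir_derivs us (\<lambda>x. \<psi> (proj \<Lambda> x) vs) x) < e / 2"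
      using uniform_limitD[OF ul, of "e / 2"] by simp
    then show "\<forall>\<^sub>F m in sequentially. \<forall>x\<in>UNIV. dist (dir_derivs us (segavg w b (\<lambda>x. \<phi> m (proj \<Lambda> x) vs)) x)
        (dir_derivs us (segavg w b (\<lambda>x. \<psi> (proj \<Lambda> x) vs)) x) < e"
    proof eventually_elim
      case (elim m)
      show ?case
      proof
        fix x
        have "dist (segavg w b (dir_derivs us (\<lambda>x. \<phi> m (proj \<Lambda> x) vs)) x)
            (segavg w b (dir_derivs us (\<lambda>x. \<psi> (proj \<Lambda> x) vs)) x) \<le> e / 2"
          by (rule segavg_dist_le[OF w]) (use elim in \<open>auto intro!: smooth_continuous smooth_dir_derivs sm simp: less_imp_le\<close>)
        then show "dist (dir_derivs us (segavg w b (\<lambda>x. \<phi> m (proj \<Lambda> x) vs)) x)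
            (dir_derivs us (segavg w b (\<lambda>x. \<psi> (proj \<Lambda> x) vs)) x) < e"
          using \<open>e > 0\<close> by (simp add: dir_derivs_segavg[OF w(1)] sm)
      qed
    qed
  qed
qed

lemma current_avg:
  assumes L: "lattice \<Lambda>" and w: "continuous_on {0..1} w" "\<And>r. r \<in> {0..1} \<Longrightarrow> \<bar>w r\<bar> \<le> 1"
    and T: "current \<Lambda> k T"
  shows "current \<Lambda> k (\<lambda>\<phi>. T (form_avg \<Lambda> w b \<phi>))"
  unfolding current_def
proof (intro conjI allI impI)
  fix \<phi> \<psi> :: "'a form" assume a: "smooth_form \<Lambda> k \<phi> \<and> smooth_form \<Lambda> k \<psi>"
  have "forms_agree \<Lambda> k (\<lambda>p vs. form_avg \<Lambda> w b \<phi> p vs + form_avg \<Lambda> w b \<psi> p vs) (form_avg \<Lambda> w b (\<lambda>p vs. \<phi> p vs + \<psi> p vs))"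
    unfolding forms_agree_def form_avg_proj[OF L]
    using a by (auto intro!: segavg_add[symmetric] w smooth_continuous smooth_form_smooth)
  from current_cong[OF T this] show "T (form_avg \<Lambda> w b (\<lambda>p vs. \<phi> p vs + \<psi> p vs)) = T (form_avg \<Lambda> w b \<phi>) + T (form_avg \<Lambda> w b \<psi>)"
    using a by (simp add: current_add[OF T] smooth_form_avg[OF L w(1)] smooth_form_add)
next
  fix \<phi> :: "'a form" and c assume a: "smooth_form \<Lambda> k \<phi>"
  have "forms_agree \<Lambda> k (\<lambda>p vs. c * form_avg \<Lambda> w b \<phi> p vs) (form_avg \<Lambda> w b (\<lambda>p vs. c * \<phi> p vs))"
    unfolding forms_agree_def form_avg_proj[OF L] by (simp add: segavg_cmult)
  from current_cong[OF T this] show "T (form_avg \<Lambda> w b (\<lambda>p vs. c * \<phi> p vs)) = c * T (form_avg \<Lambda> w b \<phi>)"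
    using a by (simp add: current_cmult[OF T] smooth_form_avg[OF L w(1)] smooth_form_cmult)
next
  fix \<phi> :: "nat \<Rightarrow> 'a form" and \<psi>
  assume "(\<forall>m. smooth_form \<Lambda> k (\<phi> m)) \<and> smooth_form \<Lambda> k \<psi> \<and> forms_converge \<Lambda> k \<phi> \<psi>"
  then show "(\<lambda>m. T (form_avg \<Lambda> w b (\<phi> m))) \<longlonglongrightarrow> T (form_avg \<Lambda> w b \<psi>)"
    by (intro current_limit[OF T] forms_converge_avg[OF L w] smooth_form_avg[OF L w(1)]) auto
qed

lemma current_contract:
  assumes T: "current \<Lambda> k T" shows "current \<Lambda> (Suc k) (\<lambda>\<phi>. T (contract b \<phi>))"
  unfolding current_def
proof (intro conjI allI impI)
  fix \<phi> \<psi> :: "'a form" assume a: "smooth_form \<Lambda> (Suc k) \<phi> \<and> smooth_form \<Lambda> (Suc k) \<psi>"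
  have "contract b (\<lambda>p vs. \<phi> p vs + \<psi> p vs) = (\<lambda>p vs. contract b \<phi> p vs + contract b \<psi> p vs)"
    by (intro ext) (simp add: contract_def)
  then show "T (contract b (\<lambda>p vs. \<phi> p vs + \<psi> p vs)) = T (contract b \<phi>) + T (contract b \<psi>)"
    using a by (simp add: current_add[OF T] smooth_form_contract)
next
  fix \<phi> :: "'a form" and c assume a: "smooth_form \<Lambda> (Suc k) \<phi>"
  have "contract b (\<lambda>p vs. c * \<phi> p vs) = (\<lambda>p vs. c * contract b \<phi> p vs)"
    by (intro ext) (simp add: contract_def)
  then show "T (contract b (\<lambda>p vs. c * \<phi> p vs)) = c * T (contract b \<phi>)"
    using a by (simp add: current_cmult[OF T] smooth_form_contract)
next
  fix \<phi> :: "nat \<Rightarrow> 'a form" and \<psi>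
  assume "(\<forall>m. smooth_form \<Lambda> (Suc k) (\<phi> m)) \<and> smooth_form \<Lambda> (Suc k) \<psi> \<and> forms_converge \<Lambda> (Suc k) \<phi> \<psi>"
  then show "(\<lambda>m. T (contract b (\<phi> m))) \<longlonglongrightarrow> T (contract b \<psi>)"
    by (intro current_limit[OF T] forms_converge_contract smooth_form_contract) auto
qed

section \<open>The exterior derivative and the homotopy formula\<close>

lemma dirder_periodic:
  assumes "smooth_on UNIV f" "\<And>x. f (x + l) = f x"
  shows "dirder u f (x + l) = dirder u f x"
proof -
  have "((\<lambda>x. f (x + l)) has_derivative (\<lambda>u. dirder u f (x + l))) (at x)"
    by (rule has_derivative_compose[OF _ smooth_has_derivative[OF assms(1)], where f="\<lambda>x. x + l" and f'="\<lambda>u. u"])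
      (auto intro!: derivative_eq_intros)
  then have "(f has_derivative (\<lambda>u. dirder u f (x + l))) (at x)" by (simp add: assms(2))
  then show ?thesis using frechet_derivative_at by metis
qed

lemma ext_deriv_proj:
  assumes L: "lattice \<Lambda>" and \<phi>: "smooth_form \<Lambda> k \<phi>" and vs: "length vs = Suc k"
  shows "ext_deriv \<Lambda> \<phi> (proj \<Lambda> x) vs =
    (\<Sum>i<Suc k. (-1) ^ i * dirder (vs ! i) (\<lambda>x. \<phi> (proj \<Lambda> x) (take i vs @ drop (Suc i) vs)) x)"
  unfolding ext_deriv_def vs
proof (rule sum.cong[OF refl])
  fix i assume i: "i \<in> {..<Suc k}"
  let ?y = "SOME y. y \<in> proj \<Lambda> x" and ?f = "\<lambda>x. \<phi> (proj \<Lambda> x) (take i vs @ drop (Suc i) vs)"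
  have "?y - x \<in> \<Lambda>" using proj_some[OF L, of x] by (simp add: proj_eq_iff[OF L])
  then have "?f (z + (?y - x)) = ?f z" for z by (simp add: proj_add[OF L])
  then have "dirder (vs ! i) ?f (x + (?y - x)) = dirder (vs ! i) ?f x"
    using vs i by (intro dirder_periodic smooth_form_smooth[OF \<phi>]) auto
  then show "(-1) ^ i * dirder (vs ! i) ?f ?y = (-1) ^ i * dirder (vs ! i) ?f x" by simp
qed

lemma ext_deriv_1form:
  assumes "lattice \<Lambda>" "smooth_form \<Lambda> 1 \<eta>"
  shows "ext_deriv \<Lambda> \<eta> (proj \<Lambda> x) [u, v] =
    dirder u (\<lambda>x. \<eta> (proj \<Lambda> x) [v]) x - dirder v (\<lambda>x. \<eta> (proj \<Lambda> x) [u]) x"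
  by (subst ext_deriv_proj[OF assms]) simp_all

lemma ext_deriv_2form:
  assumes "lattice \<Lambda>" "smooth_form \<Lambda> 2 \<phi>"
  shows "ext_deriv \<Lambda> \<phi> (proj \<Lambda> x) [u, v, w] = dirder u (\<lambda>x. \<phi> (proj \<Lambda> x) [v, w]) x
    - dirder v (\<lambda>x. \<phi> (proj \<Lambda> x) [u, w]) x + dirder w (\<lambda>x. \<phi> (proj \<Lambda> x) [u, v]) x"
  by (subst ext_deriv_proj[OF assms]) (simp_all add: numeral_2_eq_2)

lemma smooth_form_ext_deriv:
  assumes L: "lattice \<Lambda>" and \<eta>: "smooth_form \<Lambda> 1 \<eta>"
  shows "smooth_form \<Lambda> 2 (ext_deriv \<Lambda> \<eta>)"
  unfolding smooth_form_def
proof (intro conjI ballI allI impI)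
  have sm: "smooth_on UNIV (\<lambda>x. \<eta> (proj \<Lambda> x) [v])" for v by (rule smooth_form_smooth[OF \<eta>]) simp
  fix p assume "p \<in> torus \<Lambda>"
  then obtain x where p: "p = proj \<Lambda> x" unfolding torus_def by blast
  have lin: "linear (\<lambda>v. \<eta> (proj \<Lambda> y) [v])" for y
    using smooth_form_alternating[OF \<eta>, of y] unfolding alternating1_iff .
  have l1: "linear (\<lambda>u. dirder u (\<lambda>x. \<eta> (proj \<Lambda> x) [v]) x)" for v
    by (rule dirder_linear[OF sm])
  have l2: "linear (\<lambda>v. dirder u (\<lambda>x. \<eta> (proj \<Lambda> x) [v]) x)" for u
  proof (rule linearI)
    fix v w r
    show "dirder u (\<lambda>x. \<eta> (proj \<Lambda> x) [v + w]) x =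
        dirder u (\<lambda>x. \<eta> (proj \<Lambda> x) [v]) x + dirder u (\<lambda>x. \<eta> (proj \<Lambda> x) [w]) x"
      using fun_cong[OF dirder_add[OF sm[of v] sm[of w], of u], of x] by (simp add: linear_add[OF lin])
    show "dirder u (\<lambda>x. \<eta> (proj \<Lambda> x) [r *\<^sub>R v]) x = r *\<^sub>R dirder u (\<lambda>x. \<eta> (proj \<Lambda> x) [v]) x"
      using fun_cong[OF dirder_bounded_linear[OF bounded_linear_scaleR_right[of r] sm[of v], where u=u], of x]
      by (simp add: linear_cmul[OF lin])
  qed
  show "alternating 2 (ext_deriv \<Lambda> \<eta> p)"
    unfolding alternating2_iff p ext_deriv_1form[OF L \<eta>]
    using l1 l2 by (simp add: linear_compose_sub)
next
  have sm: "smooth_on UNIV (\<lambda>x. \<eta> (proj \<Lambda> x) [v])" for v by (rule smooth_form_smooth[OF \<eta>]) simp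
  fix vs :: "(complex^'a) list" assume "length vs = 2"
  then obtain u v where "vs = [u, v]" by (auto simp: length_Suc_conv numeral_2_eq_2)
  then show "smooth_on UNIV (\<lambda>x. ext_deriv \<Lambda> \<eta> (proj \<Lambda> x) vs)"
    by (simp add: ext_deriv_1form[OF L \<eta>] smooth_diff smooth_dirder sm)
qed

definition closed_current :: "(complex^'n) set \<Rightarrow> ('n form \<Rightarrow> complex) \<Rightarrow> bool" where
  "closed_current \<Lambda> T \<longleftrightarrow> current \<Lambda> 2 T \<and> (\<forall>\<eta>. smooth_form \<Lambda> 1 \<eta> \<longrightarrow> T (ext_deriv \<Lambda> \<eta>) = 0)"

lemma list2_iff: "length vs = 2 \<longleftrightarrow> (\<exists>u v. vs = [u, v])"
  by (auto simp: length_Suc_conv numeral_2_eq_2)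

text \<open>Cartan's formula for the flow \<open>x \<mapsto> x + r b\<close>, integrated over \<open>r\<close>, in its dual form on
  closed currents.\<close>

lemma closed_current_homotopy:
  assumes L: "lattice \<Lambda>" and T: "closed_current \<Lambda> T" and \<phi>: "smooth_form \<Lambda> 2 \<phi>"
  shows "T (form_avg \<Lambda> (\<lambda>_. 1) b \<phi>) - T \<phi> =
    T (form_avg \<Lambda> (\<lambda>r. 1 - r) b (contract b (ext_deriv \<Lambda> \<phi>)))"
proof -
  let ?w = "\<lambda>r::real. 1 - r"
  have w: "continuous_on {0..1} ?w" "continuous_on {0..1} (\<lambda>_::real. 1::real)" by (intro continuous_intros)+
  have sm: "smooth_on UNIV (\<lambda>x. \<phi> (proj \<Lambda> x) [u, v])" for u v by (rule smooth_form_smooth[OF \<phi>]) simp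
  let ?M = "form_avg \<Lambda> (\<lambda>_. 1) b \<phi>"
  \<comment> \<open>The homotopy operator applied to \<open>\<phi>\<close>: contract with the
    direction of the flow, then integrate with weight \<open>1 - r\<close>.\<close>
  define \<kappa> where "\<kappa> = form_avg \<Lambda> ?w b (contract b \<phi>)"
  let ?X = "form_avg \<Lambda> ?w b (contract b (ext_deriv \<Lambda> \<phi>))"
  let ?R = "\<lambda>p vs. ?M p vs - \<phi> p vs - ext_deriv \<Lambda> \<kappa> p vs"
  have s\<kappa>: "smooth_form \<Lambda> 1 \<kappa>"
    unfolding \<kappa>_def by (intro smooth_form_avg[OF L w(1)] smooth_form_contract) (use \<phi> in \<open>simp add: numeral_2_eq_2\<close>)
  have sM: "smooth_form \<Lambda> 2 ?M" by (rule smooth_form_avg[OF L w(2) \<phi>])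
  have agree: "forms_agree \<Lambda> 2 ?R ?X"
    unfolding forms_agree_def list2_iff
  proof (intro allI impI)
    fix x and vs :: "(complex^'a) list" assume "\<exists>u v. vs = [u, v]"
    then obtain v u where vs: "vs = [v, u]" by blast
    let ?f = "\<lambda>v u x. \<phi> (proj \<Lambda> x) [v, u]"
    have c: "continuous_on UNIV (dirder a (?f v u))" for a v u
      by (rule smooth_continuous[OF smooth_dirder[OF sm]])
    \<comment> \<open>In the three-term formula for the exterior derivative on
      \<open>b, v, u\<close>, the derivative along \<open>b\<close> integrates by parts to average
      minus \<open>\<phi>\<close>; the two other terms form minus the exterior derivative of
      \<open>\<kappa>\<close>.\<close>
    have "?X (proj \<Lambda> x) vs = segavg ?w b (\<lambda>x. (dirder b (?f v u) x + (-1) * dirder v (?f b u) x) + dirder u (?f b v) x) x"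
      by (simp add: vs form_avg_proj[OF L] contract_def ext_deriv_2form[OF L \<phi>])
    also have "\<dots> = segavg ?w b (dirder b (?f v u)) x - segavg ?w b (dirder v (?f b u)) x + segavg ?w b (dirder u (?f b v)) x"
      by (subst segavg_add[OF w(1)] | intro continuous_intros c | subst segavg_cmult)+ simp
    also have "segavg ?w b (dirder b (?f v u)) x = ?M (proj \<Lambda> x) vs - \<phi> (proj \<Lambda> x) vs"
      by (simp add: segavg_dirder[OF sm] form_avg_proj[OF L] vs)
    also have "segavg ?w b (dirder v (?f b u)) x = dirder v (\<lambda>x. \<kappa> (proj \<Lambda> x) [u]) x"
      unfolding \<kappa>_def form_avg_proj[OF L] contract_def by (rule dirder_segavg_at[OF w(1) sm, symmetric])
    also have "segavg ?w b (dirder u (?f b v)) x = dirder u (\<lambda>x. \<kappa> (proj \<Lambda> x) [v]) x"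
      unfolding \<kappa>_def form_avg_proj[OF L] contract_def by (rule dirder_segavg_at[OF w(1) sm, symmetric])
    finally show "?R (proj \<Lambda> x) vs = ?X (proj \<Lambda> x) vs"
      by (simp add: vs ext_deriv_1form[OF L s\<kappa>])
  qed
  have cT: "current \<Lambda> 2 T" and T0: "T (ext_deriv \<Lambda> \<kappa>) = 0"
    using T s\<kappa> unfolding closed_current_def by auto
  have sR: "smooth_form \<Lambda> 2 (\<lambda>p vs. ?M p vs - \<phi> p vs)" by (rule smooth_form_diff[OF sM \<phi>])
  note sd = smooth_form_ext_deriv[OF L s\<kappa>]
  have "T ?X = T ?R" by (rule current_cong[OF cT agree, symmetric]) (rule smooth_form_diff[OF sR sd])
  also have "\<dots> = T ?M - T \<phi>"
    using current_diff[OF cT sR sd] current_diff[OF cT sM \<phi>] T0 by simp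
  finally show ?thesis by simp
qed

text \<open>Translations commute with the exterior derivative, hence so does averaging; this lets
  the homotopy formula be applied to one lattice vector after another.\<close>

lemma closed_current_avg:
  assumes L: "lattice \<Lambda>" and T: "closed_current \<Lambda> T"
  shows "closed_current \<Lambda> (\<lambda>\<phi>. T (form_avg \<Lambda> (\<lambda>_. 1) b \<phi>))"
  unfolding closed_current_def
proof (intro conjI allI impI)
  have cT: "current \<Lambda> 2 T" using T unfolding closed_current_def by blast
  then show "current \<Lambda> 2 (\<lambda>\<phi>. T (form_avg \<Lambda> (\<lambda>_. 1) b \<phi>))" by (intro current_avg[OF L]) auto
  fix \<eta> assume \<eta>: "smooth_form \<Lambda> 1 \<eta>"
  have w: "continuous_on {0..1} (\<lambda>_::real. 1::real)" by simp
  have sm: "smooth_on UNIV (\<lambda>x. \<eta> (proj \<Lambda> x) [v])" for v by (rule smooth_form_smooth[OF \<eta>]) simp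
  have s\<eta>: "smooth_form \<Lambda> 1 (form_avg \<Lambda> (\<lambda>_. 1) b \<eta>)" by (rule smooth_form_avg[OF L w \<eta>])
  have "forms_agree \<Lambda> 2 (ext_deriv \<Lambda> (form_avg \<Lambda> (\<lambda>_. 1) b \<eta>)) (form_avg \<Lambda> (\<lambda>_. 1) b (ext_deriv \<Lambda> \<eta>))"
    unfolding forms_agree_def list2_iff
  proof (intro allI impI)
    fix x and vs :: "(complex^'a) list" assume "\<exists>u v. vs = [u, v]"
    then obtain u v where vs: "vs = [u, v]" by blast
    let ?f = "\<lambda>v x. \<eta> (proj \<Lambda> x) [v]"
    have c: "continuous_on UNIV (dirder a (?f v))" for a v
      by (rule smooth_continuous[OF smooth_dirder[OF sm]])
    have "form_avg \<Lambda> (\<lambda>_. 1) b (ext_deriv \<Lambda> \<eta>) (proj \<Lambda> x) vs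
        = segavg (\<lambda>_. 1) b (\<lambda>x. dirder u (?f v) x + (-1) * dirder v (?f u) x) x"
      by (simp add: vs form_avg_proj[OF L] ext_deriv_1form[OF L \<eta>])
    also have "\<dots> = segavg (\<lambda>_. 1) b (dirder u (?f v)) x - segavg (\<lambda>_. 1) b (dirder v (?f u)) x"
      by (subst segavg_add[OF w] | intro continuous_intros c | subst segavg_cmult)+ simp
    also have "\<dots> = ext_deriv \<Lambda> (form_avg \<Lambda> (\<lambda>_. 1) b \<eta>) (proj \<Lambda> x) vs"
      by (simp add: vs ext_deriv_1form[OF L s\<eta>] form_avg_proj[OF L] dirder_segavg_at[OF w sm])
    finally show "ext_deriv \<Lambda> (form_avg \<Lambda> (\<lambda>_. 1) b \<eta>) (proj \<Lambda> x) vs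
      = form_avg \<Lambda> (\<lambda>_. 1) b (ext_deriv \<Lambda> \<eta>) (proj \<Lambda> x) vs" by simp
  qed
  from current_cong[OF cT this smooth_form_ext_deriv[OF L s\<eta>]]
  show "T (form_avg \<Lambda> (\<lambda>_. 1) b (ext_deriv \<Lambda> \<eta>)) = 0"
    using T s\<eta> unfolding closed_current_def by simp
qed

definition form_avgs :: "(complex^'n) set \<Rightarrow> (complex^'n) list \<Rightarrow> 'n form \<Rightarrow> 'n form" where
  "form_avgs \<Lambda> bs \<phi> = foldr (form_avg \<Lambda> (\<lambda>_. 1)) bs \<phi>"

lemma smooth_form_avgs:
  "lattice \<Lambda> \<Longrightarrow> smooth_form \<Lambda> k \<phi> \<Longrightarrow> smooth_form \<Lambda> k (form_avgs \<Lambda> bs \<phi>)"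
  unfolding form_avgs_def by (induction bs) (auto intro!: smooth_form_avg)

text \<open>The homotopies of the single averages add up. The induction runs over all closed
  currents, because once the first vector is peeled off, the hypothesis is applied to the averaged
  current.\<close>

lemma closed_current_avgs:
  assumes L: "lattice \<Lambda>" and T: "closed_current \<Lambda> T"
  shows "\<exists>U. current \<Lambda> 3 U \<and> (\<forall>\<phi>. smooth_form \<Lambda> 2 \<phi> \<longrightarrow> T (form_avgs \<Lambda> bs \<phi>) - T \<phi> = U (ext_deriv \<Lambda> \<phi>))"
  using T
proof (induction bs arbitrary: T)
  case Nil
  have "current \<Lambda> 3 (\<lambda>_. 0)" unfolding current_def by simp
  then show ?case unfolding form_avgs_def by (intro exI[of _ "\<lambda>_. 0"]) simp
next
  case (Cons b bs)
  let ?T = "\<lambda>\<phi>. T (form_avg \<Lambda> (\<lambda>_. 1) b \<phi>)"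
  obtain U where U: "current \<Lambda> 3 U" "\<And>\<phi>. smooth_form \<Lambda> 2 \<phi> \<Longrightarrow> ?T (form_avgs \<Lambda> bs \<phi>) - ?T \<phi> = U (ext_deriv \<Lambda> \<phi>)"
    using Cons.IH[OF closed_current_avg[OF L Cons.prems]] by blast
  let ?V = "\<lambda>\<phi>. T (form_avg \<Lambda> (\<lambda>r. 1 - r) b (contract b \<phi>))"
  have "current \<Lambda> 2 (\<lambda>\<phi>. T (form_avg \<Lambda> (\<lambda>r. 1 - r) b \<phi>))"
    using Cons.prems unfolding closed_current_def by (intro current_avg[OF L]) (auto intro!: continuous_intros)
  from current_contract[OF this] have "current \<Lambda> 3 ?V" by (simp add: numeral_3_eq_3)
  from current_plus[OF U(1) this, of 1] have "current \<Lambda> 3 (\<lambda>\<phi>. U \<phi> + ?V \<phi>)" by simp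
  moreover have "T (form_avgs \<Lambda> (b # bs) \<phi>) - T \<phi> = U (ext_deriv \<Lambda> \<phi>) + ?V (ext_deriv \<Lambda> \<phi>)"
    if "smooth_form \<Lambda> 2 \<phi>" for \<phi>
    using U(2)[OF that] closed_current_homotopy[OF L Cons.prems that, of b]
    by (simp add: form_avgs_def algebra_simps)
  ultimately show ?case by blast
qed

text \<open>Each average creates invariance along its own vector, by periodicity, and preserves the
  invariance along the others, since translations commute.\<close>

lemma form_avgs_invariant:
  assumes L: "lattice \<Lambda>" and \<phi>: "smooth_form \<Lambda> k \<phi>" and "set bs \<subseteq> \<Lambda>" "b \<in> set bs" "length vs = k"
  shows "form_avgs \<Lambda> bs \<phi> (proj \<Lambda> (x + s *\<^sub>R b)) vs = form_avgs \<Lambda> bs \<phi> (proj \<Lambda> x) vs"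
  using assms(3,4)
proof (induction bs arbitrary: x)
  case (Cons a bs)
  let ?f = "\<lambda>x. form_avgs \<Lambda> bs \<phi> (proj \<Lambda> x) vs"
  have eq: "form_avgs \<Lambda> (a # bs) \<phi> (proj \<Lambda> y) vs = segavg (\<lambda>_. 1) a ?f y" for y
    by (simp add: form_avgs_def form_avg_proj[OF L])
  show ?case
  proof (cases "b = a")
    case True
    have "continuous_on UNIV ?f"
      by (rule smooth_continuous[OF smooth_form_smooth[OF smooth_form_avgs[OF L \<phi>] assms(5)]])
    then show ?thesis
      unfolding eq True using Cons.prems by (intro segavg_periodic) (auto simp: proj_add[OF L])
  next
    case False
    then have "?f (y + s *\<^sub>R b) = ?f y" for y using Cons by auto
    from this[of "x + r *\<^sub>R a" for r] have "?f (x + s *\<^sub>R b + r *\<^sub>R a) = ?f (x + r *\<^sub>R a)" for r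
      by (simp add: algebra_simps)
    then show ?thesis unfolding eq segavg_def by simp
  qed
qed simp

text \<open>The difference of the two currents is closed and kills every fully averaged form,
  because such a form has constant coefficients; the homotopy formula then exhibits the difference
  as a boundary.\<close>

lemma current_class_eqI:
  fixes \<Lambda> :: "(complex^'n) set"
  assumes L: "lattice \<Lambda>" and T1: "closed_current \<Lambda> T1" and T2: "closed_current \<Lambda> T2"
    and eq: "\<And>\<beta>. smooth_form \<Lambda> 2 \<beta> \<Longrightarrow>
      (\<And>x vs. length vs = 2 \<Longrightarrow> \<beta> (proj \<Lambda> x) vs = \<beta> (proj \<Lambda> 0) vs) \<Longrightarrow> T1 \<beta> = T2 \<beta>"
  shows "current_class \<Lambda> T1 = current_class \<Lambda> T2"
proof -
  obtain B where B: "lattice_basis \<Lambda> B" using lattice_basis_exists[OF L] by blast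
  obtain bs where bs: "set bs = B" using finite_list lattice_basisD(1)[OF B] by blast
  let ?T = "\<lambda>\<phi>. T1 \<phi> + (-1) * T2 \<phi>"
  have "closed_current \<Lambda> ?T"
    using T1 T2 current_plus[of \<Lambda> 2 T1 T2 "-1"] unfolding closed_current_def by simp
  from closed_current_avgs[OF L this, of bs] obtain U where U: "current \<Lambda> 3 U"
    "\<And>\<phi>. smooth_form \<Lambda> 2 \<phi> \<Longrightarrow> ?T (form_avgs \<Lambda> bs \<phi>) - ?T \<phi> = U (ext_deriv \<Lambda> \<phi>)" by blast
  have zero: "?T (form_avgs \<Lambda> bs \<phi>) = 0" if \<phi>: "smooth_form \<Lambda> 2 \<phi>" for \<phi>
  proof -
    have "form_avgs \<Lambda> bs \<phi> (proj \<Lambda> x) vs = form_avgs \<Lambda> bs \<phi> (proj \<Lambda> 0) vs" if "length vs = 2" for x vs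
      using translation_invariant_const[OF lattice_basisD(1,3)[OF B], of "\<lambda>x. form_avgs \<Lambda> bs \<phi> (proj \<Lambda> x) vs"]
        form_avgs_invariant[OF L \<phi> _ _ that, of bs] bs lattice_basisD(4)[OF B] by blast
    then have "T1 (form_avgs \<Lambda> bs \<phi>) = T2 (form_avgs \<Lambda> bs \<phi>)"
      by (intro eq smooth_form_avgs[OF L \<phi>])
    then show ?thesis by simp
  qed
  have diff: "T2 \<phi> - T1 \<phi> = U (ext_deriv \<Lambda> \<phi>)" if "smooth_form \<Lambda> 2 \<phi>" for \<phi>
    using U(2)[OF that] zero[OF that] by (simp add: algebra_simps)
  \<comment> \<open>One inclusion of cosets when the currents differ by \<open>c\<close> times a
    boundary; \<open>c = 1\<close> and \<open>c = -1\<close> give the two inclusions.\<close>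
  have step: "S \<in> current_class \<Lambda> T'"
    if S: "S \<in> current_class \<Lambda> T" and d: "\<And>\<phi>. smooth_form \<Lambda> 2 \<phi> \<Longrightarrow> T' \<phi> - T \<phi> = c * U (ext_deriv \<Lambda> \<phi>)" for S T T' c
  proof -
    obtain V where S2: "current \<Lambda> 2 S" and V: "current \<Lambda> 3 V"
      "\<And>\<phi>. smooth_form \<Lambda> 2 \<phi> \<Longrightarrow> S \<phi> - T \<phi> = V (ext_deriv \<Lambda> \<phi>)"
      using S unfolding current_class_def by blast
    have "S \<phi> - T' \<phi> = V (ext_deriv \<Lambda> \<phi>) + (-c) * U (ext_deriv \<Lambda> \<phi>)" if "smooth_form \<Lambda> 2 \<phi>" for \<phi>
      using V(2)[OF that] d[OF that] by (simp add: algebra_simps)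
    then show ?thesis
      unfolding current_class_def using S2 current_plus[OF V(1) U(1), of "-c"] by blast
  qed
  show ?thesis
    using step[of _ T1 T2 1] step[of _ T2 T1 "-1"] diff by (auto simp: algebra_simps)
qed

no_notation fps_nth (infixl \<open>$\<close> 75)

section \<open>Bidegrees: the class of a (1,1)-current as a matrix\<close>

section \<open>Bidegrees of 2-forms\<close>

lemma linear_imul: "linear (\<lambda>v::complex^'n. \<i> *s v)"
  by (rule linearI) (simp_all add: vec_eq_iff algebra_simps)

lemma linear_comp_imul: "linear f \<Longrightarrow> linear (\<lambda>u::complex^'n. f (\<i> *s u))"
  using linear_compose[OF linear_imul] by (simp add: o_def)

lemma linear_comp_uminus: "linear f \<Longrightarrow> linear (\<lambda>u. f (- u))"
  using linear_compose[OF linear_uminus] by (simp add: o_def)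

lemmas linear_intros = linear_compose_add linear_compose_sub linear_cmult_complex
  linear_comp_imul linear_comp_uminus

text \<open>The parameter \<open>s\<close> covers complex linear maps (\<open>s = \<i>\<close>) and
  antilinear ones (\<open>s = - \<i>\<close>) at once: the bracket is then the coordinate or its
  conjugate.\<close>

lemma complex_linear_expand:
  fixes f :: "complex^'n \<Rightarrow> complex"
  assumes f: "linear f" "\<And>u. f (\<i> *s u) = s * f u"
  shows "f u = (\<Sum>j\<in>UNIV. (of_real (Re (u $ j)) + s * of_real (Im (u $ j))) * f (axis j 1))"
proof -
  have scal: "f (c *s x) = (of_real (Re c) + s * of_real (Im c)) * f x" for c x
  proof -
    have "c *s x = Re c *\<^sub>R x + Im c *\<^sub>R (\<i> *s x)"
      by (simp add: vec_eq_iff complex_eq_iff algebra_simps)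
    then have "f (c *s x) = Re c *\<^sub>R f x + Im c *\<^sub>R (s * f x)"
      by (simp only: linear_add[OF f(1)] linear_cmul[OF f(1)] f(2))
    then show ?thesis by (simp add: scaleR_conv_of_real algebra_simps)
  qed
  have "f u = f (\<Sum>j\<in>UNIV. u $ j *s axis j 1)" by (simp add: basis_expansion)
  also have "\<dots> = (\<Sum>j\<in>UNIV. (of_real (Re (u $ j)) + s * of_real (Im (u $ j))) * f (axis j 1))"
    by (simp add: linear_sum[OF f(1)] scal)
  finally show ?thesis .
qed

lemma complex_bilinear_expand:
  fixes h :: "complex^'n \<Rightarrow> complex^'n \<Rightarrow> complex"
  assumes l: "\<And>v. linear (\<lambda>u. h u v)" "\<And>u. linear (\<lambda>v. h u v)"
    and s: "\<And>u v. h (\<i> *s u) v = s * h u v" and t: "\<And>u v. h u (\<i> *s v) = t * h u v"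
  shows "h u v = (\<Sum>j\<in>UNIV. \<Sum>k\<in>UNIV. h (axis j 1) (axis k 1) *
    ((of_real (Re (u $ j)) + s * of_real (Im (u $ j))) * (of_real (Re (v $ k)) + t * of_real (Im (v $ k)))))"
proof -
  have "h u v = (\<Sum>j\<in>UNIV. (of_real (Re (u $ j)) + s * of_real (Im (u $ j))) * h (axis j 1) v)"
    by (rule complex_linear_expand[OF l(1)[of v] s])
  also have "\<dots> = (\<Sum>j\<in>UNIV. (of_real (Re (u $ j)) + s * of_real (Im (u $ j))) *
      (\<Sum>k\<in>UNIV. (of_real (Re (v $ k)) + t * of_real (Im (v $ k))) * h (axis j 1) (axis k 1)))"
    by (subst complex_linear_expand[OF l(2) t, of _ v]) simp
  finally show ?thesis by (simp add: sum_distrib_left mult_ac)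
qed

lemma Re_plus_Im_i: "of_real (Re z) + \<i> * of_real (Im z) = z"
  "of_real (Re z) + - \<i> * of_real (Im z) = cnj z"
  by (simp_all add: complex_eq_iff)

lemma bilinear_11_expand:
  fixes a :: "complex^'n \<Rightarrow> complex^'n \<Rightarrow> complex"
  assumes l: "\<And>v. linear (\<lambda>u. a u v)" "\<And>u. linear (\<lambda>v. a u v)" and alt: "\<And>u v. a v u = - a u v"
    and J: "\<And>u v. a (\<i> *s u) (\<i> *s v) = a u v"
  shows "\<exists>c. \<forall>u v. a u v = (\<Sum>j\<in>UNIV. \<Sum>k\<in>UNIV. c j k * (u $ j * cnj (v $ k) - v $ j * cnj (u $ k)))"
proof -
  \<comment> \<open>The part of \<open>a\<close> that is complex linear in \<open>u\<close> and
    antilinear in \<open>v\<close>; invariance under multiplication by \<open>\<i>\<close> makes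
    \<open>a\<close> its antisymmetrization.\<close>
  define h where "h = (\<lambda>u v. 1 / 2 * (a u v + \<i> * a u (\<i> *s v)))"
  have i1: "a (\<i> *s u) v = - a u (\<i> *s v)" for u v
    using J[of "\<i> *s u" v] by (simp add: linear_neg[OF l(1)])
  have lh: "linear (\<lambda>u. h u v)" "linear (\<lambda>v. h u v)" for u v
    unfolding h_def by (intro linear_intros l)+
  have s: "h (\<i> *s u) v = \<i> * h u v" and t: "h u (\<i> *s v) = - \<i> * h u v" for u v
    unfolding h_def by (simp_all add: i1 linear_neg[OF l(2)] field_simps)
  have e: "h u v = (\<Sum>j\<in>UNIV. \<Sum>k\<in>UNIV. h (axis j 1) (axis k 1) * (u $ j * cnj (v $ k)))" for u v
    using complex_bilinear_expand[where h=h, OF lh s t, of u v] unfolding Re_plus_Im_i .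
  have d: "a u v = h u v - h v u" for u v
    using alt[of u v] alt[of u "\<i> *s v"] i1[of v u] unfolding h_def by (simp add: alt[of v "\<i> *s u"] field_simps)
  have "a u v = (\<Sum>j\<in>UNIV. \<Sum>k\<in>UNIV. h (axis j 1) (axis k 1) * (u $ j * cnj (v $ k) - v $ j * cnj (u $ k)))" for u v
    by (subst d, subst e[of u v], subst e[of v u]) (simp add: sum_subtractf right_diff_distrib)
  then show ?thesis by (intro exI[of _ "\<lambda>j k. h (axis j 1) (axis k 1)"] allI)
qed

text \<open>Antisymmetry forces the same factor \<open>s\<close> in both arguments, so only products
  of two coordinates, or of two conjugate coordinates, occur. The proof halves the coefficients
  because it writes the expansion antisymmetrically.\<close>

lemma bilinear_20_expand:
  fixes a :: "complex^'n \<Rightarrow> complex^'n \<Rightarrow> complex"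
  assumes l: "\<And>v. linear (\<lambda>u. a u v)" "\<And>u. linear (\<lambda>v. a u v)" and alt: "\<And>u v. a v u = - a u v"
    and s: "\<And>u v. a (\<i> *s u) v = s * a u v"
  shows "\<exists>c. \<forall>u v. a u v = (\<Sum>j\<in>UNIV. \<Sum>k\<in>UNIV. c j k *
    ((of_real (Re (u $ j)) + s * of_real (Im (u $ j))) * (of_real (Re (v $ k)) + s * of_real (Im (v $ k)))
   - (of_real (Re (v $ j)) + s * of_real (Im (v $ j))) * (of_real (Re (u $ k)) + s * of_real (Im (u $ k)))))"
proof -
  have t: "a u (\<i> *s v) = s * a u v" for u v
    using s[of v u] alt[of u "\<i> *s v"] alt[of u v] by simp
  note e = complex_bilinear_expand[where h=a, OF l s t]
  have d: "a u v = (a u v - a v u) / 2" for u v using alt[of u v] by simp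
  let ?z = "\<lambda>u j. of_real (Re (u $ j)) + s * of_real (Im (u $ j))"
  have "a u v = (\<Sum>j\<in>UNIV. \<Sum>k\<in>UNIV. a (axis j 1) (axis k 1) / 2 * (?z u j * ?z v k - ?z v j * ?z u k))" for u v
    by (subst d, subst e[of u v], subst e[of v u])
      (simp add: sum_subtractf right_diff_distrib diff_divide_distrib sum_divide_distrib)
  then show ?thesis by (intro exI[of _ "\<lambda>j k. a (axis j 1) (axis k 1) / 2"] allI)
qed

definition part11 :: "'n::finite form \<Rightarrow> 'n form" where
  "part11 \<phi> p vs = 1 / 2 * (\<phi> p vs + \<phi> p [\<i> *s (vs ! 0), \<i> *s (vs ! 1)])"

text \<open>The (2,0) part for \<open>s = \<i>\<close> and the (0,2) part for
  \<open>s = - \<i>\<close>: the component on which multiplication of one argument by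
  \<open>\<i>\<close> acts as the factor \<open>s\<close>.\<close>

definition part_anti :: "complex \<Rightarrow> 'n::finite form \<Rightarrow> 'n form" where
  "part_anti s \<phi> p vs = 1 / 4 * ((\<phi> p vs - \<phi> p [\<i> *s (vs ! 0), \<i> *s (vs ! 1)])
     - s * (\<phi> p [\<i> *s (vs ! 0), vs ! 1] + \<phi> p [vs ! 0, \<i> *s (vs ! 1)]))"

lemma alternating2_bilinear:
  assumes "alternating 2 a"
  shows "linear (\<lambda>u. a [u, v])" "linear (\<lambda>v. a [u, v])" "a [u, u] = 0"
  using assms unfolding alternating2_iff by auto

lemma smooth_form2I:
  assumes "\<And>x v. linear (\<lambda>u. \<phi> (proj \<Lambda> x) [u, v])" "\<And>x u. linear (\<lambda>v. \<phi> (proj \<Lambda> x) [u, v])"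
    "\<And>x u. \<phi> (proj \<Lambda> x) [u, u] = 0" "\<And>u v. smooth_on UNIV (\<lambda>x. \<phi> (proj \<Lambda> x) [u, v])"
  shows "smooth_form \<Lambda> 2 \<phi>"
  unfolding smooth_form_def alternating2_iff list2_iff torus_def using assms by auto

lemma smooth_form2_bilinear:
  assumes "smooth_form \<Lambda> 2 \<phi>"
  shows "linear (\<lambda>u. \<phi> (proj \<Lambda> x) [u, v])" "linear (\<lambda>v. \<phi> (proj \<Lambda> x) [u, v])"
    "\<phi> (proj \<Lambda> x) [u, u] = 0" "smooth_on UNIV (\<lambda>x. \<phi> (proj \<Lambda> x) [u, v])"
    "\<phi> (proj \<Lambda> x) [u, v] = - \<phi> (proj \<Lambda> x) [v, u]"
proof -
  note a = smooth_form_alternating[OF assms, of x]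
  show "linear (\<lambda>u. \<phi> (proj \<Lambda> x) [u, v])" "linear (\<lambda>v. \<phi> (proj \<Lambda> x) [u, v])"
    "\<phi> (proj \<Lambda> x) [u, u] = 0" "\<phi> (proj \<Lambda> x) [u, v] = - \<phi> (proj \<Lambda> x) [v, u]"
    by (rule alternating2_bilinear[OF a] alternating2_swap[OF a])+
  show "smooth_on UNIV (\<lambda>x. \<phi> (proj \<Lambda> x) [u, v])" by (rule smooth_form_smooth[OF assms]) simp
qed

lemma form11_part11:
  assumes \<phi>: "smooth_form \<Lambda> 2 \<phi>" shows "form11 \<Lambda> (part11 \<phi>)"
proof -
  note b = smooth_form2_bilinear[OF \<phi>]
  have L: "linear (\<lambda>u. part11 \<phi> (proj \<Lambda> x) [u, v])" "linear (\<lambda>v. part11 \<phi> (proj \<Lambda> x) [u, v])" for x u v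
    unfolding part11_def nth_Cons_0 nth_Cons_Suc One_nat_def by (intro linear_intros b)+
  have sm: "smooth_form \<Lambda> 2 (part11 \<phi>)"
  proof (rule smooth_form2I[where \<phi>="part11 \<phi>", OF L])
    show "part11 \<phi> (proj \<Lambda> x) [u, u] = 0" for x u unfolding part11_def by (simp add: b(3))
    show "smooth_on UNIV (\<lambda>x. part11 \<phi> (proj \<Lambda> x) [u, v])" for u v
      unfolding part11_def nth_Cons_0 nth_Cons_Suc One_nat_def by (intro smooth_cmult smooth_add b)
  qed
  have "\<exists>c. \<forall>u v. part11 \<phi> (proj \<Lambda> x) [u, v] =
      (\<Sum>j\<in>UNIV. \<Sum>k\<in>UNIV. c j k * (u $ j * cnj (v $ k) - v $ j * cnj (u $ k)))" for x
  proof (rule bilinear_11_expand[OF L])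
    show "part11 \<phi> (proj \<Lambda> x) [v, u] = - part11 \<phi> (proj \<Lambda> x) [u, v]" for u v
      by (rule smooth_form2_bilinear(5)[OF sm])
    show "part11 \<phi> (proj \<Lambda> x) [\<i> *s u, \<i> *s v] = part11 \<phi> (proj \<Lambda> x) [u, v]" for u v
      unfolding part11_def by (simp add: linear_neg[OF b(1)] linear_neg[OF b(2)])
  qed
  then show ?thesis using sm unfolding form11_def torus_def by auto
qed

lemma part_anti_props:
  assumes \<phi>: "smooth_form \<Lambda> 2 \<phi>" and s: "s * s = -1"
  shows "smooth_form \<Lambda> 2 (part_anti s \<phi>)"
    and "\<exists>c. \<forall>u v. part_anti s \<phi> (proj \<Lambda> x) [u, v] = (\<Sum>j\<in>UNIV. \<Sum>k\<in>UNIV. c j k *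
    ((of_real (Re (u $ j)) + s * of_real (Im (u $ j))) * (of_real (Re (v $ k)) + s * of_real (Im (v $ k)))
   - (of_real (Re (v $ j)) + s * of_real (Im (v $ j))) * (of_real (Re (u $ k)) + s * of_real (Im (u $ k)))))"
proof -
  note b = smooth_form2_bilinear[OF \<phi>]
  have L: "linear (\<lambda>u. part_anti s \<phi> (proj \<Lambda> x) [u, v])" "linear (\<lambda>v. part_anti s \<phi> (proj \<Lambda> x) [u, v])" for x u v
    unfolding part_anti_def nth_Cons_0 nth_Cons_Suc One_nat_def by (intro linear_intros b)+
  show sm: "smooth_form \<Lambda> 2 (part_anti s \<phi>)"
  proof (rule smooth_form2I[where \<phi>="part_anti s \<phi>", OF L])
    show "part_anti s \<phi> (proj \<Lambda> x) [u, u] = 0" for x u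
      using b(5)[of x u "\<i> *s u"] unfolding part_anti_def by (simp add: b(3))
    show "smooth_on UNIV (\<lambda>x. part_anti s \<phi> (proj \<Lambda> x) [u, v])" for u v
      unfolding part_anti_def nth_Cons_0 nth_Cons_Suc One_nat_def by (intro smooth_cmult smooth_add smooth_diff b)
  qed
  show "\<exists>c. \<forall>u v. part_anti s \<phi> (proj \<Lambda> x) [u, v] = (\<Sum>j\<in>UNIV. \<Sum>k\<in>UNIV. c j k *
    ((of_real (Re (u $ j)) + s * of_real (Im (u $ j))) * (of_real (Re (v $ k)) + s * of_real (Im (v $ k)))
   - (of_real (Re (v $ j)) + s * of_real (Im (v $ j))) * (of_real (Re (u $ k)) + s * of_real (Im (u $ k)))))"
  proof (rule bilinear_20_expand[OF L])
    show "part_anti s \<phi> (proj \<Lambda> x) [v, u] = - part_anti s \<phi> (proj \<Lambda> x) [u, v]" for u v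
      by (rule smooth_form2_bilinear(5)[OF sm])
    have ss: "s * (s * z) = - z" for z using s by (simp add: mult.assoc[symmetric])
    show "part_anti s \<phi> (proj \<Lambda> x) [\<i> *s u, v] = s * part_anti s \<phi> (proj \<Lambda> x) [u, v]" for u v
      unfolding part_anti_def
      by (simp add: linear_neg[OF b(1)] linear_neg[OF b(2)] distrib_left right_diff_distrib ss)
  qed
qed

text \<open>The form is the sum of its three bidegree parts, and the current kills two of
  them.\<close>

lemma current11_part11:
  assumes T: "current11 \<Lambda> T" and \<phi>: "smooth_form \<Lambda> 2 \<phi>"
  shows "T \<phi> = T (part11 \<phi>)"
proof -
  let ?a = "part_anti \<i> \<phi>" and ?b = "part_anti (- \<i>) \<phi>"
  have a: "smooth_form \<Lambda> 2 ?a" "form20 \<Lambda> ?a"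
    using part_anti_props[OF \<phi>, of "\<i>"] unfolding form20_def torus_def Re_plus_Im_i by auto
  have b: "smooth_form \<Lambda> 2 ?b" "form02 \<Lambda> ?b"
    using part_anti_props[OF \<phi>, of "- \<i>"] unfolding form02_def torus_def Re_plus_Im_i by auto
  have c: "smooth_form \<Lambda> 2 (part11 \<phi>)" using form11_part11[OF \<phi>] unfolding form11_def by blast
  have cT: "current \<Lambda> 2 T" and "T ?a = 0" "T ?b = 0"
    using T a b unfolding current11_def by auto
  moreover have "T \<phi> = T (\<lambda>p vs. part11 \<phi> p vs + (?a p vs + ?b p vs))"
    by (rule current_cong[OF cT _ \<phi>]) (simp add: forms_agree_def part11_def part_anti_def field_simps)
  ultimately show ?thesis
    using current_add[OF cT c smooth_form_add[OF a(1) b(1)]] current_add[OF cT a(1) b(1)] by simp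
qed

text \<open>The constant form \<open>i/2\<close> times the wedge of \<open>dz_j\<close> with the
  conjugate of \<open>dz_k\<close>. The factor is chosen so that the value at \<open>v\<close> and
  \<open>\<i> *s v\<close> is exactly an entry of the rank one matrix of \<open>v\<close>.\<close>

definition unit_form11 :: "'n::finite \<Rightarrow> 'n \<Rightarrow> 'n form" where
  "unit_form11 j k p vs = \<i> / 2 * ((vs ! 0) $ j * cnj ((vs ! 1) $ k) - (vs ! 1) $ j * cnj ((vs ! 0) $ k))"

lemma form11_unit_form11: "form11 \<Lambda> (unit_form11 j k)"
proof -
  have l: "linear (\<lambda>u::complex^'a. u $ j * c)" "linear (\<lambda>u::complex^'a. c * cnj (u $ k))"
    "linear (\<lambda>u::complex^'a. c * u $ j)" "linear (\<lambda>u::complex^'a. cnj (u $ k) * c)" for c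
    by (rule linearI; simp add: algebra_simps)+
  have "linear (\<lambda>u. unit_form11 j k (proj \<Lambda> x) [u, v])" "linear (\<lambda>v. unit_form11 j k (proj \<Lambda> x) [u, v])" for x u v
    unfolding unit_form11_def nth_Cons_0 nth_Cons_Suc One_nat_def
    by (rule linear_cmult_complex, rule linear_compose_sub; rule l)+
  then have sm: "smooth_form \<Lambda> 2 (unit_form11 j k)"
    by (rule smooth_form2I) (simp_all add: unit_form11_def smooth_const)
  have e: "unit_form11 j k p [u, v] = (\<Sum>a\<in>UNIV. \<Sum>b\<in>UNIV.
      (if a = j then if b = k then \<i> / 2 else 0 else 0) * (u $ a * cnj (v $ b) - v $ a * cnj (u $ b)))" for p u v
  proof -
    have "(\<Sum>b\<in>UNIV. (if a = j then if b = k then \<i> / 2 else 0 else 0) * f b) = (if a = j then \<i> / 2 * f k else 0)"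
      for f :: "'a \<Rightarrow> complex" and a
      by (cases "a = j") (simp_all add: if_distrib[of "\<lambda>x. x * _"] cong: if_cong)
    then show ?thesis by (simp add: unit_form11_def)
  qed
  show ?thesis
    unfolding form11_def
  proof (intro conjI ballI)
    show "smooth_form \<Lambda> 2 (unit_form11 j k)" by (rule sm)
    fix p
    show "\<exists>c. \<forall>u v. unit_form11 j k p [u, v] =
        (\<Sum>a\<in>UNIV. \<Sum>b\<in>UNIV. c a b * (u $ a * cnj (v $ b) - v $ a * cnj (u $ b)))"
      by (rule exI[of _ "\<lambda>a b. if a = j then if b = k then \<i> / 2 else 0 else 0"]) (intro allI, rule e)
  qed
qed

lemma unit_form11_disc [simp]: "unit_form11 j k p [v, \<i> *s v] = v $ j * cnj (v $ k)"
  by (simp add: unit_form11_def)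

text \<open>Averaging leaves constant forms, the bidegree leaves their (1,1) parts, and these are
  spanned by the \<open>unit_form11 j k\<close>.\<close>

lemma current_class_eqI11:
  fixes \<Lambda> :: "(complex^'n) set"
  assumes L: "lattice \<Lambda>" and T: "closed_current \<Lambda> T" "current11 \<Lambda> T"
    and S: "closed_current \<Lambda> S" "current11 \<Lambda> S"
    and eq: "\<And>j k. T (unit_form11 j k) = S (unit_form11 j k)"
  shows "current_class \<Lambda> T = current_class \<Lambda> S"
proof (rule current_class_eqI[OF L T(1) S(1)])
  fix \<beta> assume \<beta>: "smooth_form \<Lambda> 2 \<beta>"
    and const: "\<And>x vs. length vs = 2 \<Longrightarrow> \<beta> (proj \<Lambda> x) vs = \<beta> (proj \<Lambda> 0) vs"
  obtain c where c: "\<And>u v. part11 \<beta> (proj \<Lambda> 0) [u, v] =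
      (\<Sum>j\<in>UNIV. \<Sum>k\<in>UNIV. c j k * (u $ j * cnj (v $ k) - v $ j * cnj (u $ k)))"
    using form11_part11[OF \<beta>] proj_in_torus[of \<Lambda> 0] unfolding form11_def by blast
  have sm: "smooth_form \<Lambda> 2 (unit_form11 j k)" for j k
    using form11_unit_form11 unfolding form11_def by blast
  have sP: "smooth_form \<Lambda> 2 (part11 \<beta>)" using form11_part11[OF \<beta>] unfolding form11_def by blast
  \<comment> \<open>The factor \<open>- 2 * \<i>\<close> cancels the \<open>\<i> / 2\<close> in
    \<open>unit_form11\<close>.\<close>
  define P where "P = (\<lambda>p vs. \<Sum>j\<in>UNIV. \<Sum>k\<in>UNIV. (- 2 * \<i> * c j k) * unit_form11 j k p vs)"
  have agree: "forms_agree \<Lambda> 2 (part11 \<beta>) P"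
    unfolding forms_agree_def list2_iff
  proof (intro allI impI)
    fix x and vs :: "(complex^'n) list" assume "\<exists>u v. vs = [u, v]"
    then obtain u v where vs: "vs = [u, v]" by blast
    have "part11 \<beta> (proj \<Lambda> x) [u, v] = part11 \<beta> (proj \<Lambda> 0) [u, v]"
      unfolding part11_def by (simp add: const[of _ x])
    also have "\<dots> = P (proj \<Lambda> x) vs"
    proof -
      have *: "d * z = (- 2 * \<i> * d) * (\<i> / 2 * z)" for d z :: complex
        by (simp add: complex_eq_iff algebra_simps)
      show ?thesis
        unfolding c P_def unit_form11_def vs nth_Cons_0 nth_Cons_Suc One_nat_def
        by (intro sum.cong refl *)
    qed
    finally show "part11 \<beta> (proj \<Lambda> x) vs = P (proj \<Lambda> x) vs" by (simp add: vs)
  qed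
  have val: "R \<beta> = (\<Sum>j\<in>UNIV. \<Sum>k\<in>UNIV. (- 2 * \<i> * c j k) * R (unit_form11 j k))" if R: "current11 \<Lambda> R" for R
  proof -
    have cR: "current \<Lambda> 2 R" using R unfolding current11_def by blast
    have "R \<beta> = R (part11 \<beta>)" by (rule current11_part11[OF R \<beta>])
    also have "\<dots> = R P" by (rule current_cong[OF cR agree sP])
    also have "\<dots> = (\<Sum>j\<in>UNIV. R (\<lambda>p vs. \<Sum>k\<in>UNIV. (- 2 * \<i> * c j k) * unit_form11 j k p vs))"
      unfolding P_def by (rule current_sum[OF cR]) (intro finite smooth_form_sum smooth_form_cmult sm)+
    also have "\<dots> = (\<Sum>j\<in>UNIV. \<Sum>k\<in>UNIV. R (\<lambda>p vs. (- 2 * \<i> * c j k) * unit_form11 j k p vs))"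
      by (intro sum.cong refl current_sum[OF cR]) (intro finite smooth_form_cmult sm)+
    also have "\<dots> = (\<Sum>j\<in>UNIV. \<Sum>k\<in>UNIV. (- 2 * \<i> * c j k) * R (unit_form11 j k))"
      by (intro sum.cong refl current_cmult[OF cR] sm)
    finally show ?thesis .
  qed
  show "T \<beta> = S \<beta>" unfolding val[OF T(2)] val[OF S(2)] eq ..
qed

section \<open>Analysis on a single disc: Green's formula, lifts, pairings, Stokes' estimate\<close>

section \<open>Green's theorem on discs\<close>

lemma borel_measurable_lborel_pairI:
  fixes f :: "'a::euclidean_space \<times> 'b::euclidean_space \<Rightarrow> 'c::topological_space"
  shows "continuous_on UNIV f \<Longrightarrow> f \<in> borel_measurable (lborel \<Otimes>\<^sub>M lborel)"
  unfolding lborel_prod using borel_measurable_continuous_onI[of f] by simp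

text \<open>Both measures give a box the product of its side lengths, and this determines Lebesgue
  measure.\<close>

lemma lborel_eq_distr_Complex:
  "(lborel :: complex measure) = distr (lborel \<Otimes>\<^sub>M lborel) borel (\<lambda>(x, y). Complex x y)"
proof (rule lborel_eqI[symmetric, symmetric])
  have m: "(\<lambda>(x, y). Complex x y) \<in> borel_measurable (lborel \<Otimes>\<^sub>M lborel)"
    unfolding split_beta Complex_eq by (intro borel_measurable_lborel_pairI continuous_intros)
  show "emeasure (distr (lborel \<Otimes>\<^sub>M lborel) borel (\<lambda>(x, y). Complex x y)) (box l u) = (\<Prod>b\<in>Basis. (u - l) \<bullet> b)"
    if le: "\<And>b. b \<in> Basis \<Longrightarrow> l \<bullet> b \<le> u \<bullet> b" for l u
  proof -
    have le': "Re l \<le> Re u" "Im l \<le> Im u" using le[of 1] le[of \<i>] by (auto simp: Basis_complex_def)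
    have "(\<lambda>(x, y). Complex x y) -` box l u \<inter> space (lborel \<Otimes>\<^sub>M lborel) = {Re l<..<Re u} \<times> {Im l<..<Im u}"
      by (auto simp: box_def Basis_complex_def space_pair_measure)
    then show ?thesis
      using le' by (simp add: emeasure_distr[OF m] lborel.emeasure_pair_measure_Times Basis_complex_def ennreal_mult)
  qed
qed simp

text \<open>With the coordinates exchanged, the same slicing argument integrates along vertical
  chords.\<close>

lemma lborel_eq_distr_Complex_swap:
  "(lborel :: complex measure) = distr (lborel \<Otimes>\<^sub>M lborel) borel (\<lambda>(y, x). Complex x y)"
proof -
  have m: "(\<lambda>(x, y). Complex x y) \<in> borel_measurable (lborel \<Otimes>\<^sub>M lborel)"
    unfolding split_beta Complex_eq by (intro borel_measurable_lborel_pairI continuous_intros)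
  have "distr (lborel \<Otimes>\<^sub>M lborel) borel (\<lambda>(x, y). Complex x y) =
      distr (distr (lborel \<Otimes>\<^sub>M lborel) (lborel \<Otimes>\<^sub>M lborel) (\<lambda>(x, y). (y, x))) borel (\<lambda>(x, y). Complex x y)"
    by (subst lborel_pair.distr_pair_swap) simp
  also have "\<dots> = distr (lborel \<Otimes>\<^sub>M lborel) borel (\<lambda>(y, x). Complex x y)"
    by (subst distr_distr[OF m]) (auto simp: o_def case_prod_unfold)
  finally show ?thesis using lborel_eq_distr_Complex by simp
qed

text \<open>Fubini, and the fundamental theorem on every chord. The parametrization \<open>L\<close>
  stands for \<open>Complex\<close> with its arguments in either order, so that one proof covers
  both partial derivatives.\<close>

lemma disc_integral_slices:
  fixes Q g :: "complex \<Rightarrow> complex" and L :: "real \<Rightarrow> real \<Rightarrow> complex"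
  assumes L: "lborel = distr (lborel \<Otimes>\<^sub>M lborel) borel (\<lambda>(x, y). L x y)"
    and Lc: "continuous_on UNIV (\<lambda>(x, y). L x y)"
    and Ld: "\<And>x y. dist z (L x y) = sqrt ((x - x0)\<^sup>2 + (y - y0)\<^sup>2)" and t: "0 < t"
    and Q: "continuous_on (cball z t) Q" and g: "continuous_on (cball z t) g"
    and d: "\<And>x y. L x y \<in> cball z t \<Longrightarrow> ((\<lambda>x. Q (L x y)) has_vector_derivative g (L x y)) (at x)"
  shows "(LINT w:ball z t|lborel. g w) =
    integral {y0 - t..y0 + t} (\<lambda>y. Q (L (x0 + sqrt (t\<^sup>2 - (y - y0)\<^sup>2)) y)) -
    integral {y0 - t..y0 + t} (\<lambda>y. Q (L (x0 - sqrt (t\<^sup>2 - (y - y0)\<^sup>2)) y))"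
proof -
  let ?s = "\<lambda>y. sqrt (t\<^sup>2 - (y - y0)\<^sup>2)"
  let ?I = "{y0 - t<..<y0 + t}"
  define f where "f = (\<lambda>w. indicator (ball z t) w *\<^sub>R g w)"
  have "set_integrable lborel (cball z t) g"
    unfolding set_integrable_def by (rule borel_integrable_compact[OF compact_cball g])
  then have "set_integrable lborel (ball z t) g"
    by (rule set_integrable_subset) auto
  then have f: "integrable lborel f" unfolding f_def set_integrable_def .
  have m: "(\<lambda>(x, y). L x y) \<in> borel_measurable (lborel \<Otimes>\<^sub>M lborel)"
    using Lc by (rule borel_measurable_lborel_pairI)
  have fb: "f \<in> borel_measurable borel" using f by simp
  have fL: "integrable (lborel \<Otimes>\<^sub>M lborel) (\<lambda>(x, y). f (L x y))"
    using f unfolding L using integrable_distr_eq[OF m fb] by (simp add: case_prod_unfold)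
  have "(LINT w:ball z t|lborel. g w) = integral\<^sup>L (lborel \<Otimes>\<^sub>M lborel) (\<lambda>(x, y). f (L x y))"
    unfolding set_lebesgue_integral_def f_def[symmetric]
    by (subst L, subst integral_distr[OF m fb]) (simp add: case_prod_unfold)
  also have "\<dots> = (\<integral>y. (\<integral>x. f (L x y) \<partial>lborel) \<partial>lborel)"
    using lborel_pair.integral_snd[OF fL] by simp
  also have "\<dots> = (LINT y:?I|lborel. Q (L (x0 + ?s y) y) - Q (L (x0 - ?s y) y))"
    unfolding set_lebesgue_integral_def
  proof (rule Bochner_Integration.integral_cong[OF refl])
    fix y
    show "(\<integral>x. f (L x y) \<partial>lborel) = indicator ?I y *\<^sub>R (Q (L (x0 + ?s y) y) - Q (L (x0 - ?s y) y))"
    proof (cases "y \<in> ?I")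
      case True
      then have "\<bar>y - y0\<bar> < t" by auto
      then have pos: "(y - y0)\<^sup>2 < t\<^sup>2" using power_strict_mono[of "\<bar>y - y0\<bar>" t 2] by simp
      have mem: "L x y \<in> cball z t \<longleftrightarrow> x \<in> {x0 - ?s y..x0 + ?s y}"
        "L x y \<in> ball z t \<longleftrightarrow> x \<in> {x0 - ?s y<..<x0 + ?s y}" for x
      proof -
        have sq: "sqrt X \<le> t \<longleftrightarrow> X \<le> t\<^sup>2" "sqrt X < t \<longleftrightarrow> X < t\<^sup>2" for X
          using real_sqrt_le_iff[of X "t\<^sup>2"] real_sqrt_less_iff[of X "t\<^sup>2"] t by simp_all
        have "L x y \<in> cball z t \<longleftrightarrow> (x - x0)\<^sup>2 \<le> t\<^sup>2 - (y - y0)\<^sup>2"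
          unfolding mem_cball Ld sq by auto
        also have "\<dots> \<longleftrightarrow> \<bar>x - x0\<bar> \<le> ?s y"
          using real_sqrt_le_iff[of "(x - x0)\<^sup>2" "t\<^sup>2 - (y - y0)\<^sup>2"] by simp
        finally show "L x y \<in> cball z t \<longleftrightarrow> x \<in> {x0 - ?s y..x0 + ?s y}" by auto
        have "L x y \<in> ball z t \<longleftrightarrow> (x - x0)\<^sup>2 < t\<^sup>2 - (y - y0)\<^sup>2"
          unfolding mem_ball Ld sq by auto
        also have "\<dots> \<longleftrightarrow> \<bar>x - x0\<bar> < ?s y"
          using real_sqrt_less_iff[of "(x - x0)\<^sup>2" "t\<^sup>2 - (y - y0)\<^sup>2"] by simp
        finally show "L x y \<in> ball z t \<longleftrightarrow> x \<in> {x0 - ?s y<..<x0 + ?s y}" by auto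
      qed
      have le: "x0 - ?s y \<le> x0 + ?s y" using pos by simp
      have "(\<integral>x. f (L x y) \<partial>lborel) = (LINT x:{x0 - ?s y<..<x0 + ?s y}|lborel. g (L x y))"
        unfolding f_def set_lebesgue_integral_def
        by (rule Bochner_Integration.integral_cong) (auto simp: mem(2)[unfolded mem_ball] indicator_def)
      also have "\<dots> = (LBINT x=x0 - ?s y..x0 + ?s y. g (L x y))"
        using le by (simp add: interval_integral_Ioo)
      also have "\<dots> = Q (L (x0 + ?s y) y) - Q (L (x0 - ?s y) y)"
      proof (rule interval_integral_FTC_finite)
        have mm: "{min (x0 - ?s y) (x0 + ?s y)..max (x0 - ?s y) (x0 + ?s y)} = {x0 - ?s y..x0 + ?s y}"
          using le by simp
        have cL: "continuous_on A (\<lambda>x. L x y)" for A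
          using continuous_on_compose2[OF Lc, of A "\<lambda>x. (x, y)"] by (simp add: continuous_intros)
        show "continuous_on {min (x0 - ?s y) (x0 + ?s y)..max (x0 - ?s y) (x0 + ?s y)} (\<lambda>x. g (L x y))"
          unfolding mm by (rule continuous_on_compose2[OF g cL]) (use mem(1) in blast)
        show "((\<lambda>x. Q (L x y)) has_vector_derivative g (L x y))
            (at x within {min (x0 - ?s y) (x0 + ?s y)..max (x0 - ?s y) (x0 + ?s y)})"
          if "min (x0 - ?s y) (x0 + ?s y) \<le> x" "x \<le> max (x0 - ?s y) (x0 + ?s y)" for x
        proof -
          have "x \<in> {x0 - ?s y..x0 + ?s y}" using that le by auto
          then show ?thesis using d mem(1) has_vector_derivative_at_within by blast
        qed
      qed
      finally show ?thesis using True by simp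
    next
      case False
      have "f (L x y) = 0" for x
      proof -
        have "t\<^sup>2 \<le> (y - y0)\<^sup>2" using False t by (simp add: abs_le_square_iff[symmetric]) linarith
        then have "t\<^sup>2 \<le> (x - x0)\<^sup>2 + (y - y0)\<^sup>2" by (simp add: add_increasing)
        then have "t \<le> dist z (L x y)" unfolding Ld by (rule real_le_rsqrt)
        then show ?thesis by (simp add: f_def)
      qed
      then show ?thesis using False by simp
    qed
  qed
  also have "\<dots> = integral {y0 - t..y0 + t} (\<lambda>y. Q (L (x0 + ?s y) y) - Q (L (x0 - ?s y) y))"
    and "(\<lambda>y. Q (L (x0 + ?s y) y)) integrable_on {y0 - t..y0 + t}"
    and "(\<lambda>y. Q (L (x0 - ?s y) y)) integrable_on {y0 - t..y0 + t}"
  proof -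
    \<comment> \<open>The sign \<open>\<sigma>\<close> selects one of the two ends of the
      chord.\<close>
    have c: "continuous_on {y0 - t..y0 + t} (\<lambda>y. Q (L (x0 + \<sigma> * ?s y) y))" if "\<sigma> * \<sigma> = 1" for \<sigma> :: real
    proof (rule continuous_on_compose2[OF Q])
      show "continuous_on {y0 - t..y0 + t} (\<lambda>y. L (x0 + \<sigma> * ?s y) y)"
        using continuous_on_compose2[OF Lc, of _ "\<lambda>y. (x0 + \<sigma> * ?s y, y)"] by (simp add: continuous_intros)
      show "(\<lambda>y. L (x0 + \<sigma> * ?s y) y) ` {y0 - t..y0 + t} \<subseteq> cball z t"
      proof safe
        fix y assume "y \<in> {y0 - t..y0 + t}"
        then have "(y - y0)\<^sup>2 \<le> t\<^sup>2" using t by (intro power2_le_iff_abs_le[THEN iffD2]) auto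
        moreover have "(x0 + \<sigma> * ?s y - x0)\<^sup>2 = (\<sigma> * \<sigma>) * (?s y)\<^sup>2" by (simp add: power2_eq_square mult_ac)
        ultimately show "L (x0 + \<sigma> * ?s y) y \<in> cball z t" using t that by (simp add: Ld)
      qed
    qed
    from c[of 1] c[of "-1"] have cc: "continuous_on {y0 - t..y0 + t} (\<lambda>y. Q (L (x0 + ?s y) y))"
      "continuous_on {y0 - t..y0 + t} (\<lambda>y. Q (L (x0 - ?s y) y))" by simp_all
    then show "(\<lambda>y. Q (L (x0 + ?s y) y)) integrable_on {y0 - t..y0 + t}"
      "(\<lambda>y. Q (L (x0 - ?s y) y)) integrable_on {y0 - t..y0 + t}" by (auto intro: integrable_continuous_real)
    let ?h = "\<lambda>y. Q (L (x0 + ?s y) y) - Q (L (x0 - ?s y) y)"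
    have "set_integrable lborel {y0 - t..y0 + t} ?h"
      unfolding set_integrable_def by (intro borel_integrable_compact continuous_intros cc) simp
    then have "set_integrable lborel ?I ?h" by (rule set_integrable_subset) auto
    from set_borel_integral_eq_integral(2)[OF this]
    show "(LINT y:?I|lborel. ?h y) = integral {y0 - t..y0 + t} ?h"
      by (simp add: integral_open_interval_real)
  qed
  ultimately show ?thesis by (simp add: integral_diff)
qed

text \<open>Substitution on an arc that is a graph over the coordinate \<open>g\<close>. The
  difference of two integrals is the oriented integral: one of the two intervals is empty or a
  point, depending on the direction in which the arc is run.\<close>

lemma arc_integral:
  fixes f h :: "real \<Rightarrow> complex"
  assumes ab: "a \<le> b" and f: "continuous_on {c - t..c + t} f"
    and g: "\<And>s. s \<in> {a..b} \<Longrightarrow> (g has_field_derivative g' s) (at s)"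
    and im: "\<And>s. s \<in> {a..b} \<Longrightarrow> g s \<in> {c - t..c + t}" and eq: "\<And>s. s \<in> {a..b} \<Longrightarrow> f (g s) = h s"
  shows "((\<lambda>s. g' s *\<^sub>R h s) has_integral (integral {g a..g b} f - integral {g b..g a} f)) {a..b}"
proof (rule has_integral_eq)
  show "((\<lambda>s. g' s *\<^sub>R f (g s)) has_integral (integral {g a..g b} f - integral {g b..g a} f)) {a..b}"
  proof (rule has_integral_substitution_general[of "{}"])
    show "continuous_on {a..b} g"
      using g by (meson DERIV_isCont continuous_at_imp_continuous_on)
    show "g ` {a..b} \<subseteq> {c - t..c + t}" using im by blast
  qed (use ab f g in \<open>auto intro: has_field_derivative_at_within\<close>)
qed (simp add: eq)

lemma circle_add_cis: "z + of_real t * cis \<theta> = Complex (Re z + t * cos \<theta>) (Im z + t * sin \<theta>)"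
  by (simp add: complex_eq_iff)

lemma sqrt_diff_square: "a\<^sup>2 + b\<^sup>2 = 1 \<Longrightarrow> 0 \<le> t \<Longrightarrow> sqrt (t\<^sup>2 - (t * b)\<^sup>2) = t * \<bar>a\<bar>"
proof -
  assume a: "a\<^sup>2 + b\<^sup>2 = 1" "0 \<le> t"
  then have "t\<^sup>2 = (a\<^sup>2 + b\<^sup>2) * t\<^sup>2" by simp
  then have "t\<^sup>2 - (t * b)\<^sup>2 = (t * \<bar>a\<bar>)\<^sup>2"
    by (simp add: power_mult_distrib algebra_simps)
  then show ?thesis using a by simp
qed

lemma slice_continuous:
  fixes f :: "complex \<Rightarrow> complex"
  assumes f: "continuous_on (cball z t) f" and t: "0 < t" and \<sigma>: "\<sigma> * \<sigma> = (1::real)"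
  shows "continuous_on {Im z - t..Im z + t} (\<lambda>y. f (Complex (Re z + \<sigma> * sqrt (t\<^sup>2 - (y - Im z)\<^sup>2)) y))"
    and "continuous_on {Re z - t..Re z + t} (\<lambda>x. f (Complex x (Im z + \<sigma> * sqrt (t\<^sup>2 - (x - Re z)\<^sup>2))))"
proof -
  have k: "(y - c)\<^sup>2 + (\<sigma> * sqrt (t\<^sup>2 - (y - c)\<^sup>2))\<^sup>2 = t\<^sup>2" if "y \<in> {c - t..c + t}" for y c
  proof -
    have "(y - c)\<^sup>2 \<le> t\<^sup>2" using t that by (intro power2_le_iff_abs_le[THEN iffD2]) auto
    moreover have "\<sigma>\<^sup>2 = 1" using \<sigma> by (simp add: power2_eq_square)
    ultimately show ?thesis by (simp add: power_mult_distrib)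
  qed
  show "continuous_on {Im z - t..Im z + t} (\<lambda>y. f (Complex (Re z + \<sigma> * sqrt (t\<^sup>2 - (y - Im z)\<^sup>2)) y))"
  proof (rule continuous_on_compose2[OF f])
    show "continuous_on {Im z - t..Im z + t} (\<lambda>y. Complex (Re z + \<sigma> * sqrt (t\<^sup>2 - (y - Im z)\<^sup>2)) y)"
      unfolding Complex_eq by (intro continuous_intros)
    show "(\<lambda>y. Complex (Re z + \<sigma> * sqrt (t\<^sup>2 - (y - Im z)\<^sup>2)) y) ` {Im z - t..Im z + t} \<subseteq> cball z t"
      using k[of _ "Im z"] t by (auto simp: dist_norm cmod_def power2_commute[of "Im z"] add.commute)
  qed
  show "continuous_on {Re z - t..Re z + t} (\<lambda>x. f (Complex x (Im z + \<sigma> * sqrt (t\<^sup>2 - (x - Re z)\<^sup>2))))"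
  proof (rule continuous_on_compose2[OF f])
    show "continuous_on {Re z - t..Re z + t} (\<lambda>x. Complex x (Im z + \<sigma> * sqrt (t\<^sup>2 - (x - Re z)\<^sup>2)))"
      unfolding Complex_eq by (intro continuous_intros)
    show "(\<lambda>x. Complex x (Im z + \<sigma> * sqrt (t\<^sup>2 - (x - Re z)\<^sup>2))) ` {Re z - t..Re z + t} \<subseteq> cball z t"
      using k[of _ "Re z"] t by (auto simp: dist_norm cmod_def power2_commute[of "Re z"] add.commute)
  qed
qed

lemma sin_cos_arc_signs:
  fixes s :: real
  shows "s \<in> {0..1/4} \<Longrightarrow> 0 \<le> cos (2 * pi * s)" "s \<in> {3/4..1} \<Longrightarrow> 0 \<le> cos (2 * pi * s)"
    "s \<in> {1/4..3/4} \<Longrightarrow> cos (2 * pi * s) \<le> 0"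
    "s \<in> {0..1/2} \<Longrightarrow> 0 \<le> sin (2 * pi * s)" "s \<in> {1/2..1} \<Longrightarrow> sin (2 * pi * s) \<le> 0"
proof -
  show "s \<in> {0..1/4} \<Longrightarrow> 0 \<le> cos (2 * pi * s)"
    by (rule cos_ge_zero) (auto simp: field_simps intro: order_trans[of _ 0])
  show "0 \<le> cos (2 * pi * s)" if "s \<in> {3/4..1}"
  proof -
    have "pi * (4 * s) \<ge> pi * 3" "pi * s \<le> pi * 1" using that by (auto intro!: mult_left_mono)
    then have "0 \<le> cos (2 * pi * s - 2 * pi)" using pi_gt_zero by (intro cos_ge_zero) (auto simp: field_simps)
    then show ?thesis by (simp add: cos_diff)
  qed
  show "cos (2 * pi * s) \<le> 0" if "s \<in> {1/4..3/4}"
  proof -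
    have "pi * (4 * s) \<ge> pi * 1" "pi * (4 * s) \<le> pi * 3" using that by (auto intro!: mult_left_mono)
    then have "0 \<le> cos (2 * pi * s - pi)" using pi_gt_zero by (intro cos_ge_zero) (auto simp: field_simps)
    then show ?thesis by (simp add: cos_diff)
  qed
  show "0 \<le> sin (2 * pi * s)" if "s \<in> {0..1/2}"
  proof -
    have "pi * (2 * s) \<le> pi * 1" using that by (intro mult_left_mono) auto
    then show ?thesis using that by (intro sin_ge_zero) (auto simp: mult_ac)
  qed
  show "sin (2 * pi * s) \<le> 0" if "s \<in> {1/2..1}"
  proof -
    have "pi * (2 * s) \<ge> pi * 1" "pi * s \<le> pi * 1" using that by (auto intro!: mult_left_mono)
    then have "0 \<le> sin (2 * pi * s - pi)" by (intro sin_ge_zero) (auto simp: mult_ac)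
    then show ?thesis by (simp add: sin_diff)
  qed
qed

text \<open>The circle integral of \<open>Q dy\<close>. The right half circle is a graph over the
  imaginary part but is cut by the base point \<open>s = 0\<close>, so it appears as the first and
  the last quarter, while the left half is run downwards in between.\<close>

lemma green_disc_dy:
  fixes Q :: "complex \<Rightarrow> complex"
  assumes t: "0 < t" and d: "\<And>w. w \<in> cball z t \<Longrightarrow> (Q has_derivative Q' w) (at w)"
    and g: "continuous_on (cball z t) (\<lambda>w. Q' w 1)"
  shows "((\<lambda>s. (2 * pi * t * cos (2 * pi * s)) *\<^sub>R Q (z + of_real t * cis (2 * pi * s))) has_integral
    (LINT w:ball z t|lborel. Q' w 1)) {0..1}"
proof -
  let ?s = "\<lambda>y. sqrt (t\<^sup>2 - (y - Im z)\<^sup>2)"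
  let ?f1 = "\<lambda>y. Q (Complex (Re z + ?s y) y)" and ?f2 = "\<lambda>y. Q (Complex (Re z - ?s y) y)"
  have Q: "continuous_on (cball z t) Q"
    by (intro continuous_at_imp_continuous_on ballI has_derivative_continuous[OF d])
  have c1: "continuous_on {Im z - t..Im z + t} ?f1" and c2: "continuous_on {Im z - t..Im z + t} ?f2"
    using slice_continuous(1)[OF Q t, of 1] slice_continuous(1)[OF Q t, of "-1"] by simp_all
  have slices: "(LINT w:ball z t|lborel. Q' w 1) = integral {Im z - t..Im z + t} ?f1 - integral {Im z - t..Im z + t} ?f2"
  proof (rule disc_integral_slices[OF lborel_eq_distr_Complex _ _ t Q g])
    show "continuous_on UNIV (\<lambda>(x, y). Complex x y)"
      unfolding split_beta Complex_eq by (intro continuous_intros)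
    show "dist z (Complex x y) = sqrt ((x - Re z)\<^sup>2 + (y - Im z)\<^sup>2)" for x y
      by (simp add: dist_norm cmod_def power2_commute)
    show "((\<lambda>x. Q (Complex x y)) has_vector_derivative Q' (Complex x y) 1) (at x)" if "Complex x y \<in> cball z t" for x y
    proof -
      have "((\<lambda>x. Complex x y) has_derivative (\<lambda>h. of_real h)) (at x)"
        unfolding Complex_eq by (auto intro!: derivative_eq_intros)
      from has_derivative_compose[OF this d[OF that]]
      have "((\<lambda>x. Q (Complex x y)) has_derivative (\<lambda>h. Q' (Complex x y) (of_real h))) (at x)" .
      moreover have "Q' (Complex x y) (of_real h) = h *\<^sub>R Q' (Complex x y) 1" for h
        using linear_cmul[OF has_derivative_linear[OF d[OF that]], of h 1] by (simp add: scaleR_conv_of_real)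
      ultimately show ?thesis by (simp add: has_vector_derivative_def)
    qed
  qed
  let ?g = "\<lambda>s. Im z + t * sin (2 * pi * s)" and ?g' = "\<lambda>s. 2 * pi * t * cos (2 * pi * s)"
  let ?h = "\<lambda>s. Q (z + of_real t * cis (2 * pi * s))"
  have dg: "(?g has_field_derivative ?g' s) (at s)" for s by (auto intro!: derivative_eq_intros)
  have im: "?g s \<in> {Im z - t..Im z + t}" for s
  proof -
    have "\<bar>t * sin (2 * pi * s)\<bar> \<le> t" using t by (simp add: abs_mult mult_left_le)
    then show ?thesis by (auto simp: abs_le_iff)
  qed
  have sq: "sqrt (t\<^sup>2 - (t * sin (2 * pi * s))\<^sup>2) = t * \<bar>cos (2 * pi * s)\<bar>" for s
    using sqrt_diff_square[of "cos (2 * pi * s)" "sin (2 * pi * s)" t] t by simp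
  have v: "sin (2 * pi * (1 / 4)) = 1" "sin (2 * pi * (3 / 4)) = -1"
    using sin_pi_half sin_3over2_pi by (simp_all add: mult.commute)
  have eA: "?f1 (?g s) = ?h s" if "s \<in> {0..1/4}" for s
    using sin_cos_arc_signs(1)[OF that] by (simp add: sq circle_add_cis)
  have A: "((\<lambda>s. ?g' s *\<^sub>R ?h s) has_integral integral {Im z..Im z + t} ?f1) {0..1/4}"
    using arc_integral[of 0 "1/4" "Im z" t ?f1 ?g ?g' ?h, OF _ c1 dg im eA] v t
    by (simp add: sq circle_add_cis)
  have eB: "?f1 (?g s) = ?h s" if "s \<in> {3/4..1}" for s
    using sin_cos_arc_signs(2)[OF that] by (simp add: sq circle_add_cis)
  have B: "((\<lambda>s. ?g' s *\<^sub>R ?h s) has_integral integral {Im z - t..Im z} ?f1) {3/4..1}"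
    using arc_integral[of "3/4" 1 "Im z" t ?f1 ?g ?g' ?h, OF _ c1 dg im eB] v t
    by (simp add: sq circle_add_cis)
  have eC: "?f2 (?g s) = ?h s" if "s \<in> {1/4..3/4}" for s
    using sin_cos_arc_signs(3)[OF that] by (simp add: sq circle_add_cis)
  have C: "((\<lambda>s. ?g' s *\<^sub>R ?h s) has_integral - integral {Im z - t..Im z + t} ?f2) {1/4..3/4}"
    using arc_integral[of "1/4" "3/4" "Im z" t ?f2 ?g ?g' ?h, OF _ c2 dg im eC] v t
    by (simp add: sq circle_add_cis)
  have "integral {Im z - t..Im z + t} ?f1 = integral {Im z - t..Im z} ?f1 + integral {Im z..Im z + t} ?f1"
    using Henstock_Kurzweil_Integration.integral_combine[of "Im z - t" "Im z" "Im z + t" ?f1]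
      integrable_continuous_real[OF c1] t by simp
  moreover have "((\<lambda>s. ?g' s *\<^sub>R ?h s) has_integral
      (integral {Im z..Im z + t} ?f1 + - integral {Im z - t..Im z + t} ?f2) + integral {Im z - t..Im z} ?f1) {0..1}"
    using has_integral_combine[OF _ _ has_integral_combine[OF _ _ A C] B] by simp
  ultimately show ?thesis unfolding slices by (simp add: algebra_simps)
qed

text \<open>The circle integral of \<open>P dx\<close>. Here the base point is an end of both half
  circles that are graphs over the real part, so two arcs suffice; the upper one is run from right
  to left, whence the sign.\<close>

lemma green_disc_dx:
  fixes P :: "complex \<Rightarrow> complex"
  assumes t: "0 < t" and d: "\<And>w. w \<in> cball z t \<Longrightarrow> (P has_derivative P' w) (at w)"
    and g: "continuous_on (cball z t) (\<lambda>w. P' w \<i>)"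
  shows "((\<lambda>s. (- 2 * pi * t * sin (2 * pi * s)) *\<^sub>R P (z + of_real t * cis (2 * pi * s))) has_integral
    - (LINT w:ball z t|lborel. P' w \<i>)) {0..1}"
proof -
  let ?s = "\<lambda>y. sqrt (t\<^sup>2 - (y - Re z)\<^sup>2)"
  let ?f1 = "\<lambda>y. P (Complex y (Im z + ?s y))" and ?f2 = "\<lambda>y. P (Complex y (Im z - ?s y))"
  have P: "continuous_on (cball z t) P"
    by (intro continuous_at_imp_continuous_on ballI has_derivative_continuous[OF d])
  have c1: "continuous_on {Re z - t..Re z + t} ?f1" and c2: "continuous_on {Re z - t..Re z + t} ?f2"
    using slice_continuous(2)[OF P t, of 1] slice_continuous(2)[OF P t, of "-1"] by simp_all
  have slices: "(LINT w:ball z t|lborel. P' w \<i>) = integral {Re z - t..Re z + t} ?f1 - integral {Re z - t..Re z + t} ?f2"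
  proof (rule disc_integral_slices[OF lborel_eq_distr_Complex_swap _ _ t P g])
    show "continuous_on UNIV (\<lambda>(x, y). Complex y x)"
      unfolding split_beta Complex_eq by (intro continuous_intros)
    show "dist z (Complex y x) = sqrt ((x - Im z)\<^sup>2 + (y - Re z)\<^sup>2)" for x y
      by (simp add: dist_norm cmod_def power2_commute add.commute)
    show "((\<lambda>x. P (Complex y x)) has_vector_derivative P' (Complex y x) \<i>) (at x)" if "Complex y x \<in> cball z t" for x y
    proof -
      have "((\<lambda>x. Complex y x) has_derivative (\<lambda>h. \<i> * of_real h)) (at x)"
        unfolding Complex_eq by (auto intro!: derivative_eq_intros)
      from has_derivative_compose[OF this d[OF that]]
      have "((\<lambda>x. P (Complex y x)) has_derivative (\<lambda>h. P' (Complex y x) (\<i> * of_real h))) (at x)" .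
      moreover have "P' (Complex y x) (\<i> * of_real h) = h *\<^sub>R P' (Complex y x) \<i>" for h
        using linear_cmul[OF has_derivative_linear[OF d[OF that]], of h \<i>] by (simp add: scaleR_conv_of_real mult.commute)
      ultimately show ?thesis by (simp add: has_vector_derivative_def)
    qed
  qed
  let ?g = "\<lambda>s. Re z + t * cos (2 * pi * s)" and ?g' = "\<lambda>s. - 2 * pi * t * sin (2 * pi * s)"
  let ?h = "\<lambda>s. P (z + of_real t * cis (2 * pi * s))"
  have dg: "(?g has_field_derivative ?g' s) (at s)" for s by (auto intro!: derivative_eq_intros)
  have im: "?g s \<in> {Re z - t..Re z + t}" for s
  proof -
    have "\<bar>t * cos (2 * pi * s)\<bar> \<le> t" using t by (simp add: abs_mult mult_left_le)
    then show ?thesis by (auto simp: abs_le_iff)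
  qed
  have sq: "sqrt (t\<^sup>2 - (t * cos (2 * pi * s))\<^sup>2) = t * \<bar>sin (2 * pi * s)\<bar>" for s
    using sqrt_diff_square[of "sin (2 * pi * s)" "cos (2 * pi * s)" t] t by simp
  have eA: "?f1 (?g s) = ?h s" if "s \<in> {0..1/2}" for s
    using sin_cos_arc_signs(4)[OF that] by (simp add: sq circle_add_cis)
  have A: "((\<lambda>s. ?g' s *\<^sub>R ?h s) has_integral - integral {Re z - t..Re z + t} ?f1) {0..1/2}"
    using arc_integral[of 0 "1/2" "Re z" t ?f1 ?g ?g' ?h, OF _ c1 dg im eA] t
    by (simp add: sq circle_add_cis)
  have eB: "?f2 (?g s) = ?h s" if "s \<in> {1/2..1}" for s
    using sin_cos_arc_signs(5)[OF that] by (simp add: sq circle_add_cis)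
  have B: "((\<lambda>s. ?g' s *\<^sub>R ?h s) has_integral integral {Re z - t..Re z + t} ?f2) {1/2..1}"
    using arc_integral[of "1/2" 1 "Re z" t ?f2 ?g ?g' ?h, OF _ c2 dg im eB] t
    by (simp add: sq circle_add_cis)
  show ?thesis
    using has_integral_combine[OF _ _ A B] unfolding slices by (simp add: algebra_simps)
qed

section \<open>Lifts of discs\<close>

lemma norm_smult_vec: "norm (c *s (v::complex^'n)) = cmod c * norm v"
  by (simp add: norm_vec_def norm_mult L2_set_right_distrib)

lemma bounded_linear_smult_right: "bounded_linear (\<lambda>v::complex^'n. c *s v)"
  by (rule bounded_linear_intro[where K="cmod c"])
    (simp_all add: norm_smult_vec vec_eq_iff algebra_simps)

lemma has_cderiv_iff:
  fixes f :: "complex \<Rightarrow> complex^'n"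
  shows "(f has_derivative (\<lambda>h. h *s v)) (at z within S) \<longleftrightarrow>
    (\<forall>j. ((\<lambda>w. f w $ j) has_field_derivative v $ j) (at z within S))"
proof
  assume f: "(f has_derivative (\<lambda>h. h *s v)) (at z within S)"
  show "\<forall>j. ((\<lambda>w. f w $ j) has_field_derivative v $ j) (at z within S)"
  proof
    fix j
    have "((\<lambda>w. f w $ j) has_derivative (\<lambda>h. (h *s v) $ j)) (at z within S)"
      by (rule bounded_linear.has_derivative[OF bounded_linear_vec_nth f])
    moreover have "(*) (v $ j) = (\<lambda>h. h * v $ j)" by (auto simp: mult.commute)
    ultimately show "((\<lambda>w. f w $ j) has_field_derivative v $ j) (at z within S)"
      by (simp add: has_field_derivative_def)
  qed
next
  assume f: "\<forall>j. ((\<lambda>w. f w $ j) has_field_derivative v $ j) (at z within S)"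
  show "(f has_derivative (\<lambda>h. h *s v)) (at z within S)"
    unfolding has_derivative_componentwise_within[of f]
  proof
    fix i :: "complex^'n" assume "i \<in> Basis"
    then obtain j b where i: "i = axis j b" by (auto simp: Basis_vec_def)
    have "(\<lambda>h. h * v $ j) = (*) (v $ j)" by (auto simp: mult.commute)
    then have "((\<lambda>w. f w $ j) has_derivative (\<lambda>h. h * v $ j)) (at z within S)"
      using f by (simp add: has_field_derivative_def)
    then have "((\<lambda>w. f w $ j \<bullet> b) has_derivative (\<lambda>h. (h * v $ j) \<bullet> b)) (at z within S)"
      by (rule has_derivative_inner_left)
    then show "((\<lambda>w. f w \<bullet> i) has_derivative (\<lambda>h. (h *s v) \<bullet> i)) (at z within S)"
      by (simp add: i inner_axis)
  qed
qed

lemma smult_left_eqD: "(\<lambda>h::complex. h *s v) = (\<lambda>h. h *s w) \<Longrightarrow> v = (w::complex^'n)"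
  by (drule fun_cong[of _ _ 1]) simp

text \<open>Two lifts differ by a continuous lattice-valued map, which is locally constant. Hence
  the definite descriptions in \<open>torus_deriv\<close> and \<open>velocity\<close> can be
  evaluated on any single lift.\<close>

lemma lift_deriv_unique:
  fixes f g :: "'a::real_normed_vector \<Rightarrow> complex^'n"
  assumes L: "lattice \<Lambda>" and "0 < d" "\<And>w. w \<in> ball z d \<Longrightarrow> proj \<Lambda> (f w) = proj \<Lambda> (g w)"
    and f: "(f has_derivative f') (at z)" and g: "(g has_derivative g') (at z)"
  shows "f' = g'"
proof -
  let ?h = "\<lambda>w. f w - g w"
  have h: "(?h has_derivative (\<lambda>u. f' u - g' u)) (at z)" by (intro derivative_intros f g)
  have "isCont ?h z" using has_derivative_continuous[OF h] .
  moreover have "?h w \<in> \<Lambda>" if "w \<in> ball z d" for w using assms(3)[OF that] by (simp add: proj_eq_iff[OF L])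
  ultimately obtain e where e: "0 < e" "\<And>w. w \<in> ball z e \<Longrightarrow> ?h w = ?h z"
    using lattice_valued_locally_const[OF L assms(2), of z ?h] by blast
  have "((\<lambda>w. ?h z) has_derivative (\<lambda>u. f' u - g' u)) (at z)"
  proof (rule has_derivative_transform_within_open[OF h open_ball])
    show "z \<in> ball z e" using e(1) by simp
    show "?h x = ?h z" if "x \<in> ball z e" for x by (rule e(2)[OF that])
  qed
  then have "(\<lambda>u. f' u - g' u) = (\<lambda>u. 0)" using has_derivative_const has_derivative_unique by blast
  then show ?thesis by (intro ext) (metis (no_types, lifting) right_minus_eq)
qed

lemma torus_deriv_eq:
  assumes L: "lattice \<Lambda>" and d: "0 < d" "\<And>w. w \<in> ball z d \<Longrightarrow> F w = proj \<Lambda> (f w)"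
    and f: "(f has_derivative (\<lambda>h. h *s v)) (at z)"
  shows "torus_deriv \<Lambda> F z = v"
  unfolding torus_deriv_def
proof (rule the_equality)
  show "\<exists>f e. 0 < e \<and> (\<forall>w\<in>ball z e. F w = proj \<Lambda> (f w)) \<and>
      (\<forall>j. ((\<lambda>w. f w $ j) has_field_derivative v $ j) (at z))"
    using d f unfolding has_cderiv_iff by blast
next
  fix v' assume "\<exists>f e. 0 < e \<and> (\<forall>w\<in>ball z e. F w = proj \<Lambda> (f w)) \<and>
      (\<forall>j. ((\<lambda>w. f w $ j) has_field_derivative v' $ j) (at z))"
  then obtain g e where g: "0 < e" "\<And>w. w \<in> ball z e \<Longrightarrow> F w = proj \<Lambda> (g w)"
    "(g has_derivative (\<lambda>h. h *s v')) (at z)" unfolding has_cderiv_iff by blast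
  have "(\<lambda>h. h *s v') = (\<lambda>h. h *s v)"
    by (rule lift_deriv_unique[OF L _ _ g(3) f, of "min d e"]) (use d g in auto)
  then show "v' = v" by (rule smult_left_eqD)
qed

lemma velocity_eq:
  fixes \<gamma> :: "real \<Rightarrow> (complex^'n) set"
  assumes L: "lattice \<Lambda>" and d: "0 < d" "\<And>s. s \<in> ball t d \<Longrightarrow> \<gamma> s = proj \<Lambda> (g s)"
    and g: "(g has_vector_derivative v) (at t)"
  shows "velocity \<Lambda> \<gamma> t = v"
  unfolding velocity_def
proof (rule the_equality)
  show "\<exists>g e. 0 < e \<and> (\<forall>s\<in>ball t e. \<gamma> s = proj \<Lambda> (g s)) \<and> (g has_vector_derivative v) (at t)"
    using d g by blast
next
  fix v' assume "\<exists>g e. 0 < e \<and> (\<forall>s\<in>ball t e. \<gamma> s = proj \<Lambda> (g s)) \<and> (g has_vector_derivative v') (at t)"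
  then obtain h e where h: "0 < e" "\<And>s. s \<in> ball t e \<Longrightarrow> \<gamma> s = proj \<Lambda> (h s)"
    "(h has_vector_derivative v') (at t)" by blast
  have "(\<lambda>r. r *\<^sub>R v') = (\<lambda>r. r *\<^sub>R v)"
    by (rule lift_deriv_unique[OF L _ _ h(3)[unfolded has_vector_derivative_def] g[unfolded has_vector_derivative_def], of "min d e"])
      (use d h in auto)
  then show "v' = v" by (drule_tac fun_cong[of _ _ 1]) simp
qed

text \<open>The lift lives on the open disc only, whereas its derivative extends continuously to the
  closed disc and gives the velocity on the boundary circle too; this avoids a global lift up to the
  boundary.\<close>

definition disc_lift ::
    "(complex^'n) set \<Rightarrow> (complex \<Rightarrow> (complex^'n) set) \<Rightarrow> complex \<Rightarrow> real \<Rightarrow>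
      (complex \<Rightarrow> complex^'n) \<Rightarrow> (complex \<Rightarrow> complex^'n) \<Rightarrow> bool" where
  "disc_lift \<Lambda> F z R f G \<longleftrightarrow> 0 < R \<and> continuous_on (cball z R) G \<and>
     (\<forall>w\<in>ball z R. F w = proj \<Lambda> (f w) \<and> (f has_derivative (\<lambda>h. h *s G w)) (at w)) \<and>
     (\<forall>j. (\<lambda>w. G w $ j) holomorphic_on ball z R) \<and>
     (\<forall>t s. 0 < t \<and> t \<le> R \<longrightarrow> velocity \<Lambda> (F \<circ> circlepath z t) s =
        (2 * of_real pi * \<i> * of_real t * cis (2 * pi * s)) *s G (z + of_real t * cis (2 * pi * s)))"

lemma disc_lift_torus_deriv:
  assumes "lattice \<Lambda>" "disc_lift \<Lambda> F z R f G" "w \<in> ball z R"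
  shows "torus_deriv \<Lambda> F w = G w"
proof -
  obtain d where d: "0 < d" "ball w d \<subseteq> ball z R"
    using assms(3) open_ball open_contains_ball by blast
  show ?thesis
    by (rule torus_deriv_eq[OF assms(1) d(1), where f=f]) (use assms(2,3) d(2) in \<open>auto simp: disc_lift_def subset_iff\<close>)
qed

lemma circlepath_cis: "circlepath z t s = z + of_real t * cis (2 * pi * s)"
  by (simp add: circlepath cis_conv_exp mult_ac)

lemma circle_has_vector_derivative:
  "((\<lambda>s. z + of_real t * cis (2 * pi * s)) has_vector_derivative
    2 * of_real pi * \<i> * of_real t * cis (2 * pi * s)) (at s)"
proof -
  have "((\<lambda>w. z + of_real t * exp (\<i> * (2 * of_real pi * w))) has_field_derivative
      2 * of_real pi * \<i> * of_real t * exp (\<i> * (2 * of_real pi * of_real s))) (at (of_real s))"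
    by (auto intro!: derivative_eq_intros simp: mult_ac)
  from has_vector_derivative_real_field[OF this] show ?thesis
    by (simp add: cis_conv_exp)
qed

lemma dist_circle: "0 \<le> t \<Longrightarrow> dist z (z + of_real t * cis \<theta>) = t"
  by (simp add: dist_norm norm_mult)

text \<open>Agreement with the lift is asked only on the circle itself: on the boundary circle of a
  disc nothing is known about \<open>F\<close> on the outer side.\<close>

lemma velocity_circle:
  assumes L: "lattice \<Lambda>" and V: "open V" "z + of_real t * cis (2 * pi * s) \<in> V"
    and F: "\<And>u. u \<in> V \<Longrightarrow> dist z u = t \<Longrightarrow> F u = proj \<Lambda> (f u)" and t: "0 < t"
    and f: "(f has_derivative (\<lambda>h. h *s v)) (at (z + of_real t * cis (2 * pi * s)))"
  shows "velocity \<Lambda> (F \<circ> circlepath z t) s = (2 * of_real pi * \<i> * of_real t * cis (2 * pi * s)) *s v"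
proof -
  let ?c = "\<lambda>s. z + of_real t * cis (2 * pi * s)"
  have "continuous_on UNIV ?c" unfolding cis_conv_exp by (intro continuous_intros)
  then have "open (?c -` V)" using V(1) by (simp add: continuous_on_open_vimage)
  then obtain d where d: "d > 0" "ball s d \<subseteq> ?c -` V"
    using V(2) by (metis openE vimageI2)
  show ?thesis
  proof (rule velocity_eq[OF L d(1), where g="f \<circ> ?c"])
    show "(F \<circ> circlepath z t) r = proj \<Lambda> ((f \<circ> ?c) r)" if "r \<in> ball s d" for r
      using d(2) that F[of "?c r"] dist_circle[of t z] t by (auto simp: circlepath_cis)
    have "((f \<circ> ?c) has_derivative (\<lambda>r. (r *\<^sub>R (2 * of_real pi * \<i> * of_real t * cis (2 * pi * s))) *s v)) (at s)"
      using has_derivative_compose[OF circle_has_vector_derivative[unfolded has_vector_derivative_def] f] by (simp add: o_def)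
    moreover have "(r *\<^sub>R c) *s v = r *\<^sub>R (c *s v)" for r c by (simp add: vec_eq_iff)
    ultimately show "((f \<circ> ?c) has_vector_derivative (2 * of_real pi * \<i> * of_real t * cis (2 * pi * s)) *s v) (at s)"
      by (simp add: has_vector_derivative_def)
  qed
qed

text \<open>Boundary points are limits of interior ones. In this way identities proved by complex
  analysis inside pass to the smooth extensions on the boundary.\<close>

lemma eq_on_ball_imp_eq_on_cball:
  fixes f g :: "complex \<Rightarrow> 'b::t2_space"
  assumes "0 < R" "open V" "u \<in> V" "u \<in> cball z R" "isCont f u" "isCont g u"
    and eq: "\<And>x. x \<in> V \<Longrightarrow> x \<in> ball z R \<Longrightarrow> f x = g x"
  shows "f u = g u"
proof -
  have nt: "at u within ball z R \<noteq> bot"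
    using assms(1,4) by (simp add: trivial_limit_within islimpt_ball)
  have f: "(f \<longlongrightarrow> f u) (at u within ball z R)" and g: "(g \<longlongrightarrow> g u) (at u within ball z R)"
    using assms(5,6) continuous_at_imp_continuous_at_within unfolding continuous_within by blast+
  have "\<forall>\<^sub>F x in at u within ball z R. x \<in> V \<and> x \<in> ball z R"
    using assms(2,3) by (auto simp: eventually_at_topological)
  then have "\<forall>\<^sub>F x in at u within ball z R. f x = g x"
    by eventually_elim (use eq in blast)
  then have "(g \<longlongrightarrow> f u) (at u within ball z R)" using f tendsto_cong by blast
  then show ?thesis using g tendsto_unique[OF nt] by blast
qed

definition local_lift where
  "local_lift \<Lambda> F z R w V f D1 \<longleftrightarrow> open V \<and> w \<in> V \<and> (\<forall>u\<in>V \<inter> cball z R. F u = proj \<Lambda> (f u)) \<and>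
    (\<forall>u\<in>V. isCont f u \<and> isCont D1 u) \<and> (\<forall>u\<in>V \<inter> cball z R. (f has_derivative (\<lambda>h. h *s D1 u)) (at u)) \<and>
    (\<forall>u\<in>V \<inter> ball z R. D1 u = torus_deriv \<Lambda> F u) \<and>
    (\<forall>j. (\<lambda>u. torus_deriv \<Lambda> F u $ j) holomorphic_on (V \<inter> ball z R))"

text \<open>Inside, the lift has a complex derivative. At the boundary the real derivative of the
  smooth extension is complex linear as a limit of complex linear maps.\<close>

lemma holomorphic_disc_local:
  fixes \<Lambda> :: "(complex^'n) set"
  assumes L: "lattice \<Lambda>" and D: "holomorphic_disc \<Lambda> F z R" and w: "w \<in> cball z R"
  shows "\<exists>V f D1. local_lift \<Lambda> F z R w V f D1"
proof -
  have R: "0 < R" using D unfolding holomorphic_disc_def by blast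
  obtain V f where V: "open V" "w \<in> V" and sm: "smooth_on V f"
    and hol: "\<And>j. (\<lambda>u. f u $ j) holomorphic_on (V \<inter> ball z R)"
    and F: "\<And>u. u \<in> V \<Longrightarrow> u \<in> cball z R \<Longrightarrow> F u = proj \<Lambda> (f u)"
    using D w unfolding holomorphic_disc_def by (metis IntI)
  define D1 where "D1 = dirder 1 f"
  have fd: "(f has_derivative frechet_derivative f (at u)) (at u)" if "u \<in> V" for u
    using sm that frechet_derivative_works unfolding smooth_on_def by (metis dir_derivs.simps(1))
  have dd: "dirder h f differentiable (at u)" if "u \<in> V" for u h
    using sm that unfolding smooth_on_def by (metis dir_derivs.simps)
  have cd: "isCont (dirder h f) u" if "u \<in> V" for u h
    using dd[OF that] differentiable_imp_continuous_within by blast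
  have opn: "open (V \<inter> ball z R)" using V by auto
  have inner: "frechet_derivative f (at u) = (\<lambda>h. h *s torus_deriv \<Lambda> F u) \<and>
      torus_deriv \<Lambda> F u = (\<chi> j. deriv (\<lambda>u. f u $ j) u)" if u: "u \<in> V \<inter> ball z R" for u
  proof -
    let ?v = "\<chi> j. deriv (\<lambda>u. f u $ j) u"
    have "(f has_derivative (\<lambda>h. h *s ?v)) (at u)"
      unfolding has_cderiv_iff using holomorphic_derivI[OF hol opn u] by simp
    moreover obtain d where "0 < d" "ball u d \<subseteq> V \<inter> ball z R" using opn u openE by blast
    ultimately have "torus_deriv \<Lambda> F u = ?v"
      by (intro torus_deriv_eq[OF L, where f=f]) (use F in \<open>auto simp: subset_iff\<close>)
    then show ?thesis
      using has_derivative_unique[OF fd \<open>(f has_derivative (\<lambda>h. h *s ?v)) (at u)\<close>] u by simp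
  qed
  have clin: "frechet_derivative f (at u) h = h *s D1 u" if u: "u \<in> V" "u \<in> cball z R" for u h
  proof (rule eq_on_ball_imp_eq_on_cball[OF R V(1) u, of "dirder h f" "\<lambda>u. h *s D1 u"])
    show "isCont (dirder h f) u" by (rule cd[OF u(1)])
    show "isCont (\<lambda>u. h *s D1 u) u"
      unfolding D1_def by (rule bounded_linear.isCont[OF bounded_linear_smult_right cd[OF u(1)]])
    show "frechet_derivative f (at x) h = h *s D1 x" if "x \<in> V" "x \<in> ball z R" for x
      unfolding D1_def using inner that by simp
  qed
  have "(\<lambda>u. torus_deriv \<Lambda> F u $ j) holomorphic_on (V \<inter> ball z R)" for j
    by (rule holomorphic_transform[OF holomorphic_deriv[OF hol[of j] opn]]) (use inner in simp)
  moreover have "D1 u = torus_deriv \<Lambda> F u" if "u \<in> V \<inter> ball z R" for u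
    using inner[OF that] unfolding D1_def by simp
  moreover have "(f has_derivative (\<lambda>h. h *s D1 u)) (at u)" if "u \<in> V \<inter> cball z R" for u
  proof -
    have "frechet_derivative f (at u) = (\<lambda>h. h *s D1 u)" using clin that by auto
    then show ?thesis using fd[of u] that by simp
  qed
  moreover have "isCont f u \<and> isCont D1 u" if "u \<in> V" for u
    using has_derivative_continuous[OF fd[OF that]] cd[OF that] unfolding D1_def by blast
  ultimately have "local_lift \<Lambda> F z R w V f D1" unfolding local_lift_def using V F by blast
  then show ?thesis by blast
qed

lemma constant_on_convex_open:
  fixes f :: "complex \<Rightarrow> 'b::real_normed_vector"
  assumes "convex S" "\<And>x. x \<in> S \<Longrightarrow> (f has_derivative (\<lambda>h. 0)) (at x within S)" "x \<in> S" "y \<in> S"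
  shows "f x = f y"
  using has_derivative_zero_unique[OF assms(1)] assms by blast

text \<open>In place of covering theory: the local derivatives glue to one holomorphic map
  \<open>G\<close>, whose primitive differs from each local lift by a local constant. Only the coset
  of that constant is independent of the local lift, and it is constant by connectedness; a shift of
  the primitive by a representative is a lift of the whole disc.\<close>

lemma holomorphic_disc_lift:
  fixes \<Lambda> :: "(complex^'n) set"
  assumes L: "lattice \<Lambda>" and D: "holomorphic_disc \<Lambda> F z R"
  shows "\<exists>f G. disc_lift \<Lambda> F z R f G \<and> ((\<forall>w\<in>ball z R. G w = 0) \<longrightarrow> F constant_on cball z R)"
proof -
  have R: "0 < R" using D unfolding holomorphic_disc_def by blast
  have "\<forall>w\<in>cball z R. \<exists>V f D1. local_lift \<Lambda> F z R w V f D1"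
    using holomorphic_disc_local[OF L D] by blast
  then obtain V \<phi> D1 where ll: "\<And>w. w \<in> cball z R \<Longrightarrow> local_lift \<Lambda> F z R w (V w) (\<phi> w) (D1 w)"
    by metis
  have V: "\<And>w. w \<in> cball z R \<Longrightarrow> open (V w)" "\<And>w. w \<in> cball z R \<Longrightarrow> w \<in> V w"
    and F: "\<And>w u. w \<in> cball z R \<Longrightarrow> u \<in> V w \<inter> cball z R \<Longrightarrow> F u = proj \<Lambda> (\<phi> w u)"
    and c: "\<And>w u. w \<in> cball z R \<Longrightarrow> u \<in> V w \<Longrightarrow> isCont (\<phi> w) u \<and> isCont (D1 w) u"
    and d: "\<And>w u. w \<in> cball z R \<Longrightarrow> u \<in> V w \<inter> cball z R \<Longrightarrow> (\<phi> w has_derivative (\<lambda>h. h *s D1 w u)) (at u)"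
    and D1: "\<And>w u. w \<in> cball z R \<Longrightarrow> u \<in> V w \<inter> ball z R \<Longrightarrow> D1 w u = torus_deriv \<Lambda> F u"
    and hol: "\<And>w j. w \<in> cball z R \<Longrightarrow> (\<lambda>u. torus_deriv \<Lambda> F u $ j) holomorphic_on (V w \<inter> ball z R)"
    using ll unfolding local_lift_def by blast+
  \<comment> \<open>Each point uses its own local lift; \<open>G_eq\<close> shows that every other
    local lift around it gives the same value, also on the boundary.\<close>
  define G where "G = (\<lambda>w. D1 w w)"
  have G_eq: "G u = D1 w u" if "w \<in> cball z R" "u \<in> V w" "u \<in> cball z R" for u w
    unfolding G_def
    by (rule eq_on_ball_imp_eq_on_cball[OF R, of "V w \<inter> V u" u z "D1 u" "D1 w"])
      (use that V c D1 in \<open>auto intro!: open_Int\<close>)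
  have G_ball: "G u = torus_deriv \<Lambda> F u" if "u \<in> ball z R" for u
    unfolding G_def by (rule D1) (use that V(2)[of u] in auto)
  have contG: "continuous_on (cball z R) G"
    unfolding continuous_on_eq_continuous_within
  proof
    fix w assume w: "w \<in> cball z R"
    have "\<forall>\<^sub>F u in at w within cball z R. u \<in> V w \<and> u \<in> cball z R"
      using V[OF w] by (auto simp: eventually_at_topological)
    then have "\<forall>\<^sub>F u in at w within cball z R. D1 w u = G u"
      by eventually_elim (use G_eq w in auto)
    moreover have "(D1 w \<longlongrightarrow> D1 w w) (at w within cball z R)"
      using c[OF w V(2)[OF w]] continuous_at_imp_continuous_at_within unfolding continuous_within by blast
    ultimately show "continuous (at w within cball z R) G"
      unfolding continuous_within G_def[THEN fun_cong, of w] using tendsto_cong by blast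
  qed
  have holG: "(\<lambda>u. G u $ j) holomorphic_on ball z R" for j
  proof -
    have "(\<lambda>u. torus_deriv \<Lambda> F u $ j) field_differentiable (at w within ball z R)" if w: "w \<in> ball z R" for w
    proof -
      have "w \<in> V w \<inter> ball z R" "open (V w \<inter> ball z R)" using V[of w] w by auto
      then show ?thesis
        using hol[of w j] w holomorphic_on_imp_differentiable_at field_differentiable_at_within
        by (meson mem_ball_imp_mem_cball)
    qed
    then have "(\<lambda>u. torus_deriv \<Lambda> F u $ j) holomorphic_on ball z R" unfolding holomorphic_on_def by blast
    then show ?thesis by (rule holomorphic_transform) (simp add: G_ball)
  qed
  have "\<exists>g. \<forall>x\<in>ball z R. (g has_field_derivative G x $ j) (at x)" for j
    using holomorphic_convex_primitive'[OF convex_ball open_ball holG[of j]] at_within_open[OF _ open_ball] by metis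
  then obtain g where g: "\<And>j x. x \<in> ball z R \<Longrightarrow> (g j has_field_derivative G x $ j) (at x)" by metis
  define f0 where "f0 = (\<lambda>w. \<chi> j. g j w)"
  have f0: "(f0 has_derivative (\<lambda>h. h *s G w)) (at w)" if "w \<in> ball z R" for w
    unfolding has_cderiv_iff f0_def using g[OF that] by simp
  define \<kappa> where "\<kappa> = (\<lambda>w. proj \<Lambda> (\<phi> w w - f0 w))"
  have const: "\<kappa> w = \<kappa> z" if w: "w \<in> ball z R" for w
  proof (rule connected_local_const[OF connected_ball[of z R]])
    show "\<forall>a\<in>ball z R. \<forall>\<^sub>F b in at a within ball z R. \<kappa> a = \<kappa> b"
    proof
      fix a assume a: "a \<in> ball z R"
      then have a': "a \<in> cball z R" by simp
      obtain e where e: "e > 0" "ball a e \<subseteq> V a \<inter> ball z R"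
        using V[OF a'] a openE[of "V a \<inter> ball z R" a] by auto
      have "\<kappa> a = \<kappa> b" if b: "b \<in> ball a e" for b
      proof -
        have "((\<lambda>u. \<phi> a u - f0 u) has_derivative (\<lambda>h. 0)) (at x within ball a e)" if x: "x \<in> ball a e" for x
        proof -
          have x': "x \<in> V a" "x \<in> ball z R" "x \<in> cball z R" using e x by (auto simp: subset_iff)
          have "((\<lambda>u. \<phi> a u - f0 u) has_derivative (\<lambda>h. h *s D1 a x - h *s G x)) (at x)"
            using x' by (intro derivative_intros d[OF a'] f0) auto
          then show ?thesis using G_eq[OF a' x'(1,3)] has_derivative_at_withinI by fastforce
        qed
        then have "\<phi> a a - f0 a = \<phi> a b - f0 b"
          using constant_on_convex_open[OF convex_ball, of a e "\<lambda>u. \<phi> a u - f0 u" a b] b e(1) by simp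
        moreover have "b \<in> V a \<inter> cball z R" "b \<in> cball z R" "b \<in> V b \<inter> cball z R"
          using e b V(2)[of b] by (auto simp: subset_iff)
        then have p: "proj \<Lambda> (\<phi> a b) = proj \<Lambda> (\<phi> b b)" using F[OF a', of b] F[of b b] by simp
        have "proj \<Lambda> (\<phi> a b - f0 b) = proj \<Lambda> (\<phi> b b - f0 b)" using proj_shift[OF L p, of "- f0 b"] by simp
        ultimately show ?thesis unfolding \<kappa>_def by simp
      qed
      then show "\<forall>\<^sub>F b in at a within ball z R. \<kappa> a = \<kappa> b"
        unfolding eventually_at_topological using e(1) by (intro exI[of _ "ball a e"]) auto
    qed
  qed (use w R in auto)
  define f where "f = (\<lambda>w. f0 w + (\<phi> z z - f0 z))"
  have fF: "F w = proj \<Lambda> (f w)" if w: "w \<in> ball z R" for w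
  proof -
    have "proj \<Lambda> (\<phi> w w - f0 w) = proj \<Lambda> (\<phi> z z - f0 z)" using const[OF w] unfolding \<kappa>_def .
    from proj_shift[OF L this, of "f0 w"] have "proj \<Lambda> (\<phi> w w) = proj \<Lambda> (f w)" by (simp add: f_def algebra_simps)
    then show ?thesis using F[of w w] w V(2)[of w] by simp
  qed
  have fd: "(f has_derivative (\<lambda>h. h *s G w)) (at w)" if "w \<in> ball z R" for w
    unfolding f_def using f0[OF that] by (auto intro!: derivative_eq_intros)
  have vel: "velocity \<Lambda> (F \<circ> circlepath z t) s =
        (2 * of_real pi * \<i> * of_real t * cis (2 * pi * s)) *s G (z + of_real t * cis (2 * pi * s))"
    if t: "0 < t" "t \<le> R" for t s
  proof -
    let ?w = "z + of_real t * cis (2 * pi * s)"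
    have w: "?w \<in> cball z R" using dist_circle[of t z] t by simp
    have wV: "?w \<in> V ?w \<inter> cball z R" using V(2)[OF w] w by blast
    show ?thesis
    proof (rule velocity_circle[OF L V(1)[OF w] V(2)[OF w] _ t(1), where f="\<phi> ?w"])
      show "F u = proj \<Lambda> (\<phi> ?w u)" if "u \<in> V ?w" "dist z u = t" for u
        using F[OF w, of u] that t by simp
      show "(\<phi> ?w has_derivative (\<lambda>h. h *s G ?w)) (at ?w)"
        using d[OF w wV] unfolding G_def .
    qed
  qed
  have "disc_lift \<Lambda> F z R f G"
    unfolding disc_lift_def using R contG fF fd holG vel by blast
  \<comment> \<open>A vanishing derivative makes the lift constant inside. A boundary point is
    reached through its own local lift, which is constant on the convex set
    \<open>ball u e \<inter> ball z R\<close> and continuous at \<open>u\<close>.\<close>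
  moreover have "F constant_on cball z R" if zero: "\<And>w. w \<in> ball z R \<Longrightarrow> G w = 0"
  proof -
    have fc: "f x = f z" if "x \<in> ball z R" for x
    proof (rule constant_on_convex_open[OF convex_ball])
      fix y assume y: "y \<in> ball z R"
      show "(f has_derivative (\<lambda>h. 0)) (at y within ball z R)"
        using has_derivative_at_withinI[OF fd[OF y]] zero[OF y] by simp
    qed (use that R in auto)
    have "F u = proj \<Lambda> (f z)" if u: "u \<in> cball z R" for u
    proof -
      obtain e where e: "e > 0" "ball u e \<subseteq> V u" using V[OF u] openE by blast
      have "u islimpt ball z R" using u R by (simp add: islimpt_ball)
      then obtain x0 where x0: "x0 \<in> ball z R" "x0 \<in> ball u e"
        using e(1) unfolding islimpt_def by (metis centre_in_ball open_ball)
      have eq: "\<phi> u x = \<phi> u x0" if x: "x \<in> ball u e \<inter> ball z R" for x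
      proof (rule constant_on_convex_open[OF convex_Int[OF convex_ball convex_ball] _ x])
        fix y assume y: "y \<in> ball u e \<inter> ball z R"
        then have y': "y \<in> V u" "y \<in> cball z R" "y \<in> ball z R" using e by (auto simp: subset_iff)
        have "(\<phi> u has_derivative (\<lambda>h. h *s D1 u y)) (at y)" using d[OF u, of y] y' by simp
        moreover have "D1 u y = 0" using G_eq[OF u y'(1,2)] zero[OF y'(3)] by simp
        ultimately have "(\<phi> u has_derivative (\<lambda>h. 0)) (at y)" by simp
        then show "(\<phi> u has_derivative (\<lambda>h. 0)) (at y within ball u e \<inter> ball z R)"
          by (rule has_derivative_at_withinI)
      qed (use x0 in auto)
      have "\<phi> u u = \<phi> u x0"
        by (rule eq_on_ball_imp_eq_on_cball[OF R open_ball[of u e] _ u, of "\<phi> u" "\<lambda>_. \<phi> u x0"])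
          (use e c[OF u V(2)[OF u]] eq in auto)
      moreover have "x0 \<in> V u \<inter> cball z R" using x0 e by (auto simp: subset_iff)
      then have "proj \<Lambda> (\<phi> u x0) = proj \<Lambda> (f z)" using F[OF u, of x0] fF[OF x0(1)] fc[OF x0(1)] by simp
      moreover have "F u = proj \<Lambda> (\<phi> u u)" using F[OF u, of u] u V(2)[OF u] by blast
      ultimately show ?thesis by simp
    qed
    then show ?thesis unfolding constant_on_def by blast
  qed
  ultimately show ?thesis by blast
qed

text \<open>The derivative of an entire map in direction \<open>u\<close> is \<open>u\<close> times
  its complex derivative, which is entire again.\<close>

lemma smooth_on_entire:
  fixes f :: "complex \<Rightarrow> complex^'n"
  assumes "\<And>j. (\<lambda>u. f u $ j) holomorphic_on UNIV"
  shows "smooth_on UNIV f"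
proof (rule smooth_coinduct[where P="\<lambda>f. \<forall>j. (\<lambda>u. f u $ j) holomorphic_on UNIV"])
  show "\<forall>j. (\<lambda>u. f u $ j) holomorphic_on UNIV" using assms by blast
  have d: "(f has_derivative (\<lambda>h. h *s (\<chi> j. deriv (\<lambda>u. f u $ j) x))) (at x)"
    if "\<forall>j. (\<lambda>u. f u $ j) holomorphic_on UNIV" for f :: "complex \<Rightarrow> complex^'n" and x
    unfolding has_cderiv_iff using holomorphic_derivI[OF that[rule_format] open_UNIV, of x] by simp
  show "f differentiable (at x)"
    if "\<forall>j. (\<lambda>u. f u $ j) holomorphic_on UNIV" for f :: "complex \<Rightarrow> complex^'n" and x
    using d[OF that] differentiableI by blast
  show "\<forall>j. (\<lambda>x. dirder u f x $ j) holomorphic_on UNIV"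
    if f: "\<forall>j. (\<lambda>u. f u $ j) holomorphic_on UNIV" for f :: "complex \<Rightarrow> complex^'n" and u
  proof
    fix j
    have "(\<lambda>x. u * deriv (\<lambda>u. f u $ j) x) holomorphic_on UNIV"
      by (intro holomorphic_intros holomorphic_deriv f[rule_format] open_UNIV)
    moreover have "dirder u f x $ j = u * deriv (\<lambda>u. f u $ j) x" for x
      using fun_cong[OF frechet_derivative_at[OF d[OF f, of x]], of u, symmetric] by simp
    ultimately show "(\<lambda>x. dirder u f x $ j) holomorphic_on UNIV" by simp
  qed
qed

lemma disc_lift_entire:
  assumes L: "lattice \<Lambda>" and f: "\<And>w. (f has_derivative (\<lambda>h. h *s G w)) (at w)"
    and G: "\<And>j. (\<lambda>w. G w $ j) holomorphic_on UNIV" and R: "0 < R"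
  shows "disc_lift \<Lambda> (\<lambda>w. proj \<Lambda> (f w)) z R f G"
proof -
  have "continuous_on UNIV G"
    using smooth_continuous[OF smooth_on_entire[OF G]] .
  then have "continuous_on (cball z R) G" by (rule continuous_on_subset) simp
  moreover have "(\<lambda>w. G w $ j) holomorphic_on ball z R" for j
    using G by (rule holomorphic_on_subset) simp
  moreover have "velocity \<Lambda> ((\<lambda>w. proj \<Lambda> (f w)) \<circ> circlepath z t) s =
        (2 * of_real pi * \<i> * of_real t * cis (2 * pi * s)) *s G (z + of_real t * cis (2 * pi * s))"
    if "0 < t" for t s
    by (rule velocity_circle[OF L open_UNIV, where f=f]) (use f that in auto)
  ultimately show ?thesis unfolding disc_lift_def using R f by blast
qed

lemma holomorphic_disc_entire:
  assumes f: "\<And>j. (\<lambda>w. f w $ j) holomorphic_on UNIV" and R: "0 < R"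
  shows "holomorphic_disc \<Lambda> (\<lambda>w. proj \<Lambda> (f w)) z R"
  unfolding holomorphic_disc_def
proof (intro conjI ballI R exI[of _ UNIV] exI[of _ f] allI)
  show "(\<lambda>u. f u $ j) holomorphic_on UNIV \<inter> ball z R" for j using f by (rule holomorphic_on_subset) simp
qed (use smooth_on_entire[OF f] in auto)

section \<open>The two pairings as integrals against a measure\<close>

text \<open>The flag \<open>nv\<close> selects the Nevanlinna pairing, its negation the Ahlfors pairing.\<close>

definition disc_pairing :: "bool \<Rightarrow> complex \<Rightarrow> real \<Rightarrow> (complex \<Rightarrow> complex) \<Rightarrow> complex" where
  "disc_pairing nv z R \<psi> = (if nv
     then LINT t:{0<..<R}|lborel. (LINT w:ball z t|lborel. \<psi> w) / of_real t
     else LINT w:ball z R|lborel. \<psi> w)"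

text \<open>The last clause, positivity on small balls inside the disc, is what makes the areas of
  nonconstant discs positive.\<close>

definition pairing_measure :: "bool \<Rightarrow> complex \<Rightarrow> real \<Rightarrow> complex measure \<Rightarrow> bool" where
  "pairing_measure nv z R \<mu> \<longleftrightarrow> finite_measure \<mu> \<and> sets \<mu> = sets borel \<and>
     (\<forall>\<psi> B. \<psi> \<in> borel_measurable borel \<longrightarrow> (\<forall>w. norm (\<psi> w) \<le> B) \<longrightarrow> disc_pairing nv z R \<psi> = (\<integral>w. \<psi> w \<partial>\<mu>)) \<and>
     (\<forall>w e. 0 < e \<longrightarrow> dist z w + e < R \<longrightarrow> 0 < measure \<mu> (ball w e))"

lemma pairing_measure_ahlfors: "pairing_measure False z R (density lborel (indicator (ball z R)))"
proof -
  let ?\<mu> = "density lborel (indicator (ball z R))"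
  have em: "emeasure ?\<mu> A = emeasure lborel (A \<inter> ball z R)" if "A \<in> sets borel" for A
  proof -
    have "emeasure ?\<mu> A = (\<integral>\<^sup>+x. indicator (ball z R) x * indicator A x \<partial>lborel)"
      by (rule emeasure_density) (use that in \<open>auto intro!: borel_measurable_indicator\<close>)
    also have "\<dots> = (\<integral>\<^sup>+x. indicator (A \<inter> ball z R) x \<partial>lborel)"
      by (rule nn_integral_cong) (auto simp: indicator_def)
    finally show ?thesis using that by simp
  qed
  have fin: "emeasure lborel (ball z R) < \<infinity>" by (rule emeasure_bounded_finite) simp
  have 1: "finite_measure ?\<mu>"
    by (rule finite_measureI) (use fin em[of UNIV] in auto)
  have 2: "(\<integral>w. \<psi> w \<partial>?\<mu>) = (LINT w:ball z R|lborel. \<psi> w)" if "\<psi> \<in> borel_measurable borel" for \<psi> :: "complex \<Rightarrow> complex"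
  proof -
    have "density lborel (indicator (ball z R)) = density lborel (\<lambda>x. ennreal (indicator (ball z R) x))"
      by (simp add: ennreal_indicator)
    moreover have "(\<integral>w. \<psi> w \<partial>density lborel (\<lambda>x. ennreal (indicator (ball z R) x))) = (\<integral>w. indicator (ball z R) w *\<^sub>R \<psi> w \<partial>lborel)"
      by (rule integral_density) (use that in \<open>auto intro!: borel_measurable_indicator\<close>)
    ultimately show ?thesis unfolding set_lebesgue_integral_def by simp
  qed
  have 3: "0 < measure ?\<mu> (ball w e)" if "0 < e" "dist z w + e < R" for w e
  proof -
    have "ball w e \<subseteq> ball z R"
    proof
      fix x assume "x \<in> ball w e"
      then show "x \<in> ball z R" using dist_triangle[of z x w] that by simp
    qed
    then have "emeasure ?\<mu> (ball w e) = emeasure lborel (ball w e)" using em[of "ball w e"] by (simp add: Int_absorb2)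
    then show ?thesis using that(1) by (simp add: measure_def[of ?\<mu>] measure_def[of lborel, symmetric])
  qed
  show ?thesis unfolding pairing_measure_def disc_pairing_def using 1 2 3 by simp
qed

text \<open>Exchanging the integrals turns the Nevanlinna pairing into integration with density
  \<open>log (R / dist z w)\<close>. The measure is obtained without the logarithm, by projecting
  \<open>dt/t\<close> times area from the cone \<open>dist z w < t < R\<close> to the variable
  \<open>w\<close>; its mass is finite since a disc of radius \<open>t\<close> has area of order
  \<open>t ^ 2\<close>.\<close>

lemma pairing_measure_nevanlinna:
  assumes R: "0 < R" shows "\<exists>\<mu>. pairing_measure True z R \<mu>"
proof -
  let ?P = "lborel \<Otimes>\<^sub>M lborel :: (real \<times> complex) measure"
  define S where "S = {p :: real \<times> complex. 0 < fst p \<and> fst p < R \<and> dist z (snd p) < fst p}"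
  define k :: "real \<times> complex \<Rightarrow> real" where "k = (\<lambda>p. indicator S p / fst p)"
  define \<mu> where "\<mu> = distr (density ?P (\<lambda>p. ennreal (k p))) borel snd"
  have "open S" unfolding S_def by (intro open_Collect_conj open_Collect_less continuous_intros)
  then have S: "S \<in> sets ?P" unfolding lborel_prod by simp
  have km [measurable]: "k \<in> borel_measurable ?P"
    unfolding k_def using S by (intro borel_measurable_divide borel_measurable_indicator) auto
  have k0: "0 \<le> k p" for p unfolding k_def S_def by (auto simp: indicator_def)
  have k_eq: "k (t, w) = indicator {0<..<R} t * (indicator (ball z t) w / t)" for t w
    unfolding k_def S_def by (auto simp: indicator_def)
  have sets: "sets \<mu> = sets borel" unfolding \<mu>_def by simp
  have em: "emeasure \<mu> A = (\<integral>\<^sup>+p. ennreal (k p) * indicator A (snd p) \<partial>?P)" if A: "A \<in> sets borel" for A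
  proof -
    have m: "snd \<in> measurable (density ?P (\<lambda>p. ennreal (k p))) borel" by simp
    have "snd -` A \<inter> space ?P \<in> sets ?P" using A by (intro measurable_sets[of snd]) auto
    then have "emeasure \<mu> A = (\<integral>\<^sup>+p. ennreal (k p) * indicator (snd -` A \<inter> space ?P) p \<partial>?P)"
      unfolding \<mu>_def using A by (subst emeasure_distr[OF m]) (auto simp: emeasure_density)
    then show ?thesis by (simp add: indicator_def space_pair_measure)
  qed
  have fin: "finite_measure \<mu>"
  proof (rule finite_measureI)
    have "emeasure \<mu> UNIV = (\<integral>\<^sup>+p. ennreal (k p) \<partial>?P)" by (simp add: em)
    also have "\<dots> = (\<integral>\<^sup>+t. \<integral>\<^sup>+w. ennreal (k (t, w)) \<partial>lborel \<partial>lborel)"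
      by (rule lborel.nn_integral_fst[symmetric]) simp
    also have "\<dots> \<le> (\<integral>\<^sup>+t. ennreal (unit_ball_vol 2 * R) * indicator {0<..<R} t \<partial>lborel)"
    proof (rule nn_integral_mono)
      fix t :: real
      show "(\<integral>\<^sup>+w. ennreal (k (t, w)) \<partial>lborel) \<le> ennreal (unit_ball_vol 2 * R) * indicator {0<..<R} t"
      proof (cases "t \<in> {0<..<R}")
        case True
        then have t: "0 < t" "t < R" by auto
        have "(\<integral>\<^sup>+w. ennreal (k (t, w)) \<partial>lborel) = (\<integral>\<^sup>+w. ennreal (1 / t) * indicator (ball z t) w \<partial>lborel)"
          by (rule nn_integral_cong) (use t in \<open>auto simp: k_eq indicator_def\<close>)
        also have "\<dots> = ennreal (1 / t) * ennreal (unit_ball_vol 2 * t ^ 2)"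
          using t by (simp add: nn_integral_cmult_indicator emeasure_ball)
        also have "\<dots> = ennreal (unit_ball_vol 2 * t)"
          using t by (simp add: ennreal_mult'[symmetric] power2_eq_square)
        also have "\<dots> \<le> ennreal (unit_ball_vol 2 * R)"
          using t by (intro ennreal_leI mult_left_mono) auto
        finally show ?thesis using True by simp
      qed (simp add: k_eq)
    qed
    also have "\<dots> = ennreal (unit_ball_vol 2 * R) * ennreal R"
      using R by (simp add: nn_integral_cmult_indicator)
    finally have "emeasure \<mu> UNIV < \<infinity>" by (simp add: ennreal_mult_less_top le_less_trans)
    then show "emeasure \<mu> (space \<mu>) \<noteq> \<infinity>" unfolding \<mu>_def by simp
  qed
  have int: "disc_pairing True z R \<psi> = (\<integral>w. \<psi> w \<partial>\<mu>)"
    if m: "\<psi> \<in> borel_measurable borel" and B: "\<And>w. norm (\<psi> w) \<le> B" for \<psi> :: "complex \<Rightarrow> complex" and B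
  proof -
    have snd: "snd \<in> measurable (density ?P (\<lambda>p. ennreal (k p))) borel" by simp
    have ms: "(\<lambda>p. \<psi> (snd p)) \<in> borel_measurable ?P" using m by measurable
    have "integrable \<mu> \<psi>"
      by (rule finite_measure.integrable_const_bound[OF fin, of _ B])
        (use B m in \<open>simp_all add: measurable_cong_sets[OF sets refl]\<close>)
    then have i: "integrable ?P (\<lambda>p. k p *\<^sub>R \<psi> (snd p))"
      unfolding \<mu>_def integrable_distr_eq[OF snd m]
      by (subst (asm) integrable_density) (use ms k0 in auto)
    have "(\<integral>w. \<psi> w \<partial>\<mu>) = (\<integral>p. k p *\<^sub>R \<psi> (snd p) \<partial>?P)"
      unfolding \<mu>_def integral_distr[OF snd m] by (rule integral_density) (use ms k0 in auto)
    also have "\<dots> = (\<integral>t. (\<integral>w. k (t, w) *\<^sub>R \<psi> w \<partial>lborel) \<partial>lborel)"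
      using lborel_pair.integral_fst'[OF i] by simp
    also have "\<dots> = disc_pairing True z R \<psi>"
      unfolding disc_pairing_def if_True set_lebesgue_integral_def
    proof (rule Bochner_Integration.integral_cong[OF refl])
      fix t
      have "(\<integral>w. k (t, w) *\<^sub>R \<psi> w \<partial>lborel) = (\<integral>w. (indicator {0<..<R} t / t) *\<^sub>R (indicator (ball z t) w *\<^sub>R \<psi> w) \<partial>lborel)"
        by (simp add: k_eq mult_ac)
      also have "\<dots> = (indicator {0<..<R} t / t) *\<^sub>R (\<integral>w. indicator (ball z t) w *\<^sub>R \<psi> w \<partial>lborel)"
        by (rule integral_scaleR_right)
      finally show "(\<integral>w. k (t, w) *\<^sub>R \<psi> w \<partial>lborel) =
          indicator {0<..<R} t *\<^sub>R ((\<integral>w. indicator (ball z t) w *\<^sub>R \<psi> w \<partial>lborel) / complex_of_real t)"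
        by (simp add: indicator_def scaleR_conv_of_real field_simps)
    qed
    finally show ?thesis by simp
  qed
  have pos: "0 < measure \<mu> (ball w e)" if e: "0 < e" "dist z w + e < R" for w e
  proof (rule ccontr)
    assume "\<not> 0 < measure \<mu> (ball w e)"
    then have "measure \<mu> (ball w e) = 0" using measure_nonneg[of \<mu> "ball w e"] by linarith
    then have "emeasure \<mu> (ball w e) = 0"
      using finite_measure.emeasure_eq_measure[OF fin, of "ball w e"] by simp
    then have "(\<integral>\<^sup>+p. ennreal (k p) * indicator (ball w e) (snd p) \<partial>?P) = 0" by (simp add: em)
    moreover have "(\<lambda>p. ennreal (k p) * indicator (ball w e) (snd p)) \<in> borel_measurable ?P"
      by (intro borel_measurable_times_ennreal measurable_compose[OF km measurable_ennreal]
          measurable_compose[OF measurable_snd borel_measurable_indicator]) simp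
    ultimately have "AE p in ?P. ennreal (k p) * indicator (ball w e) (snd p) = 0"
      using nn_integral_0_iff_AE by blast
    then obtain N where N: "{p \<in> space ?P. ennreal (k p) * indicator (ball w e) (snd p) \<noteq> 0} \<subseteq> N"
      "emeasure ?P N = 0" "N \<in> sets ?P" by (rule AE_E)
    let ?a = "dist z w + e"
    \<comment> \<open>For these radii the whole small ball lies in the disc of radius
      \<open>t\<close>, so the density is positive on a product of positive measure.\<close>
    have "{?a<..<R} \<times> ball w e \<subseteq> N"
    proof
      fix p assume "p \<in> {?a<..<R} \<times> ball w e"
      then have p: "?a < fst p" "fst p < R" "dist w (snd p) < e" by auto
      have "fst p > 0" using p zero_le_dist[of z w] e(1) by linarith
      moreover have "dist z (snd p) < fst p" using p dist_triangle[of z "snd p" w] by linarith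
      ultimately have "p \<in> S" "fst p > 0" using p unfolding S_def by auto
      then have "k p > 0" unfolding k_def by simp
      then show "p \<in> N" using N(1) p(3) by (auto simp: space_pair_measure)
    qed
    then have "emeasure ?P ({?a<..<R} \<times> ball w e) \<le> 0" using emeasure_mono[OF _ N(3)] N(2) by metis
    moreover have "emeasure ?P ({?a<..<R} \<times> ball w e) = ennreal (R - ?a) * ennreal (measure lborel (ball w e))"
    proof -
      have "emeasure lborel (ball w e) = ennreal (measure lborel (ball w e))"
        by (rule emeasure_eq_ennreal_measure) (use emeasure_bounded_finite[of "ball w e"] in auto)
      then show ?thesis using e by (simp add: lborel.emeasure_pair_measure_Times)
    qed
    moreover have "0 < measure lborel (ball w e)" using e by simp
    ultimately show False using e by (simp add: ennreal_eq_0_iff)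
  qed
  have "pairing_measure True z R \<mu>"
    unfolding pairing_measure_def
  proof (intro conjI allI impI fin sets)
    show "disc_pairing True z R \<psi> = (\<integral>w. \<psi> w \<partial>\<mu>)"
      if "\<psi> \<in> borel_measurable borel" "\<forall>w. norm (\<psi> w) \<le> B" for \<psi> B
      by (rule int[OF that(1)]) (use that(2) in blast)
    show "0 < measure \<mu> (ball w e)" if "0 < e" "dist z w + e < R" for w e by (rule pos[OF that])
  qed
  then show ?thesis ..
qed

lemma pairing_measure_exists: "0 < R \<Longrightarrow> \<exists>\<mu>. pairing_measure nv z R \<mu>"
  using pairing_measure_ahlfors[of z R] pairing_measure_nevanlinna[of R z] by (cases nv) auto

section \<open>Pulling forms back to discs\<close>

lemma bilinear_Basis_expand:
  fixes a :: "'a::euclidean_space \<Rightarrow> 'a \<Rightarrow> 'b::real_vector"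
  assumes "\<And>v. linear (\<lambda>u. a u v)" "\<And>u. linear (\<lambda>v. a u v)"
  shows "a u v = (\<Sum>e\<in>Basis. \<Sum>e'\<in>Basis. ((u \<bullet> e) * (v \<bullet> e')) *\<^sub>R a e e')"
proof -
  have "a u v = a (\<Sum>e\<in>Basis. (u \<bullet> e) *\<^sub>R e) v" by (simp add: euclidean_representation)
  also have "\<dots> = (\<Sum>e\<in>Basis. (u \<bullet> e) *\<^sub>R a e v)"
    by (simp add: linear_sum[OF assms(1)] linear_cmul[OF assms(1)])
  also have "\<dots> = (\<Sum>e\<in>Basis. (u \<bullet> e) *\<^sub>R a e (\<Sum>e'\<in>Basis. (v \<bullet> e') *\<^sub>R e'))" by (simp add: euclidean_representation)
  also have "\<dots> = (\<Sum>e\<in>Basis. \<Sum>e'\<in>Basis. ((u \<bullet> e) * (v \<bullet> e')) *\<^sub>R a e e')"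
    by (simp add: linear_sum[OF assms(2)] linear_cmul[OF assms(2)] scaleR_sum_right)
  finally show ?thesis .
qed

lemma linear_Basis_expand:
  fixes a :: "'a::euclidean_space \<Rightarrow> 'b::real_vector"
  assumes "linear a"
  shows "a u = (\<Sum>e\<in>Basis. (u \<bullet> e) *\<^sub>R a e)"
proof -
  have "a u = a (\<Sum>e\<in>Basis. (u \<bullet> e) *\<^sub>R e)" by (simp add: euclidean_representation)
  then show ?thesis by (simp add: linear_sum[OF assms] linear_cmul[OF assms])
qed

lemma form2_expand:
  "smooth_form \<Lambda> 2 \<phi> \<Longrightarrow> \<phi> (proj \<Lambda> x) [u, v] =
    (\<Sum>e\<in>Basis. \<Sum>e'\<in>Basis. ((u \<bullet> e) * (v \<bullet> e')) *\<^sub>R \<phi> (proj \<Lambda> x) [e, e'])"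
  by (rule bilinear_Basis_expand) (rule smooth_form2_bilinear; assumption)+

lemma smooth_form1_linear: "smooth_form \<Lambda> 1 \<eta> \<Longrightarrow> linear (\<lambda>v. \<eta> (proj \<Lambda> x) [v])"
  using smooth_form_alternating[of \<Lambda> 1 \<eta> x] unfolding alternating1_iff .

lemma smooth_form1_smooth: "smooth_form \<Lambda> 1 \<eta> \<Longrightarrow> smooth_on UNIV (\<lambda>x. \<eta> (proj \<Lambda> x) [v])"
  by (rule smooth_form_smooth[of \<Lambda> 1]) simp_all

lemma form_coeff_bounded:
  assumes L: "lattice \<Lambda>" and \<phi>: "smooth_form \<Lambda> k \<phi>" and vs: "length vs = k"
  shows "\<exists>K>0. \<forall>x. norm (\<phi> (proj \<Lambda> x) vs) \<le> K"
proof -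
  have per: "\<phi> (proj \<Lambda> (x + l)) vs = \<phi> (proj \<Lambda> x) vs" if "l \<in> \<Lambda>" for x l
    by (simp add: proj_add[OF L that])
  have c: "continuous_on UNIV (\<lambda>x. \<phi> (proj \<Lambda> x) vs)"
    by (rule smooth_continuous[OF smooth_form_smooth[OF \<phi> vs]])
  show ?thesis by (rule periodic_bounded[OF L c per]) blast+
qed

lemma form1_bounded:
  fixes \<eta> :: "'n::finite form"
  assumes L: "lattice \<Lambda>" and \<eta>: "smooth_form \<Lambda> 1 \<eta>"
  shows "\<exists>K>0. \<forall>x v. norm (\<eta> (proj \<Lambda> x) [v]) \<le> K * norm v"
proof -
  have "\<exists>K>0. \<forall>x. norm (\<eta> (proj \<Lambda> x) [e]) \<le> K" for e
    using form_coeff_bounded[OF L \<eta>, of "[e]"] by simp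
  then obtain K where K: "\<And>e. K e > 0" "\<And>e x. norm (\<eta> (proj \<Lambda> x) [e]) \<le> K e" by metis
  have "norm (\<eta> (proj \<Lambda> x) [v]) \<le> (1 + (\<Sum>e\<in>Basis. K e)) * norm v" for x v
  proof -
    have "norm (\<eta> (proj \<Lambda> x) [v]) \<le> (\<Sum>e\<in>Basis. norm ((v \<bullet> e) *\<^sub>R \<eta> (proj \<Lambda> x) [e]))"
      unfolding linear_Basis_expand[OF smooth_form1_linear[OF \<eta>], of x v] by (rule norm_sum)
    also have "\<dots> \<le> (\<Sum>e\<in>Basis. norm v * K e)"
      by (intro sum_mono) (auto intro!: mult_mono K(2) Basis_le_norm simp: abs_mult)
    also have "\<dots> = (\<Sum>e\<in>Basis. K e) * norm v" by (simp add: sum_distrib_left mult.commute)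
    also have "\<dots> \<le> (1 + (\<Sum>e\<in>Basis. K e)) * norm v" by (intro mult_right_mono) auto
    finally show ?thesis .
  qed
  moreover have "1 + (\<Sum>e\<in>Basis. K e) > 0" using K(1) by (simp add: add_pos_nonneg less_imp_le sum_nonneg)
  ultimately show ?thesis by blast
qed

text \<open>Smoothness of a form is known for fixed vectors only, so the product rule is applied to
  the expansion of the moving vector \<open>H w\<close> in the standard basis and reassembled by
  linearity.\<close>

lemma has_derivative_form1_comp:
  fixes \<eta> :: "'n::finite form" and f H :: "complex \<Rightarrow> complex^'n"
  assumes \<eta>: "smooth_form \<Lambda> 1 \<eta>" and f: "(f has_derivative f') (at w)" and H: "(H has_derivative H') (at w)"
  shows "((\<lambda>w. \<eta> (proj \<Lambda> (f w)) [H w]) has_derivative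
    (\<lambda>h. \<eta> (proj \<Lambda> (f w)) [H' h] + dirder (f' h) (\<lambda>x. \<eta> (proj \<Lambda> x) [H w]) (f w))) (at w)"
proof -
  let ?a = "\<lambda>e x. \<eta> (proj \<Lambda> x) [e]"
  note lin = smooth_form1_linear[OF \<eta>] and sm = smooth_form1_smooth[OF \<eta>]
  have ex: "?a v x = (\<Sum>e\<in>Basis. (v \<bullet> e) *\<^sub>R ?a e x)" for v x
    by (rule linear_Basis_expand[OF lin])
  have d: "((\<lambda>w. \<Sum>e\<in>Basis. (H w \<bullet> e) *\<^sub>R ?a e (f w)) has_derivative
      (\<lambda>h. \<Sum>e\<in>Basis. (H w \<bullet> e) *\<^sub>R dirder (f' h) (?a e) (f w) + (H' h \<bullet> e) *\<^sub>R ?a e (f w))) (at w)"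
    by (intro has_derivative_sum has_derivative_scaleR has_derivative_inner_left H
        has_derivative_compose[OF f smooth_has_derivative[OF sm]])
  have "(\<Sum>e\<in>Basis. (H w \<bullet> e) *\<^sub>R dirder u (?a e) x) = dirder u (\<lambda>x. ?a (H w) x) x" for u x
  proof -
    have "((\<lambda>x. \<Sum>e\<in>Basis. (H w \<bullet> e) *\<^sub>R ?a e x) has_derivative
       (\<lambda>u. \<Sum>e\<in>Basis. (H w \<bullet> e) *\<^sub>R dirder u (?a e) x)) (at x)"
      by (intro has_derivative_sum has_derivative_scaleR_right smooth_has_derivative sm)
    from fun_cong[OF frechet_derivative_at[OF this], of u]
    have "(\<Sum>e\<in>Basis. (H w \<bullet> e) *\<^sub>R dirder u (?a e) x) = dirder u (\<lambda>x. \<Sum>e\<in>Basis. (H w \<bullet> e) *\<^sub>R ?a e x) x" .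
    also have "(\<lambda>x. \<Sum>e\<in>Basis. (H w \<bullet> e) *\<^sub>R ?a e x) = (\<lambda>x. ?a (H w) x)"
      by (rule ext) (rule ex[symmetric])
    finally show ?thesis .
  qed
  then have "(\<lambda>h. \<Sum>e\<in>Basis. (H w \<bullet> e) *\<^sub>R dirder (f' h) (?a e) (f w) + (H' h \<bullet> e) *\<^sub>R ?a e (f w))
      = (\<lambda>h. ?a (H' h) (f w) + dirder (f' h) (\<lambda>x. ?a (H w) x) (f w))"
    by (intro ext) (simp add: sum.distrib ex[symmetric])
  with d show ?thesis unfolding ex[symmetric] by simp
qed

lemma continuous_on_form1:
  fixes \<eta> :: "'n::finite form"
  assumes \<eta>: "smooth_form \<Lambda> 1 \<eta>" and "continuous_on S f" "continuous_on S H"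
  shows "continuous_on S (\<lambda>w. \<eta> (proj \<Lambda> (f w)) [H w])"
  unfolding linear_Basis_expand[OF smooth_form1_linear[OF \<eta>], of "f w" "H w" for w]
  by (intro continuous_intros assms continuous_on_compose2[OF smooth_continuous[OF smooth_form1_smooth[OF \<eta>], of UNIV]]) auto

lemma continuous_on_form2:
  fixes \<phi> :: "'n::finite form"
  assumes \<phi>: "smooth_form \<Lambda> 2 \<phi>" and "continuous_on S f" "continuous_on S H" "continuous_on S K"
  shows "continuous_on S (\<lambda>w. \<phi> (proj \<Lambda> (f w)) [H w, K w])"
proof -
  have "smooth_on UNIV (\<lambda>x. \<phi> (proj \<Lambda> x) [e, e'])" for e e' by (rule smooth_form_smooth[OF \<phi>]) simp
  then show ?thesis
    unfolding form2_expand[OF \<phi>, of "f w" "H w" "K w" for w]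
    by (intro continuous_intros assms continuous_on_compose2[OF smooth_continuous[of "\<lambda>x. \<phi> (proj \<Lambda> x) [_, _]" UNIV]]) auto
qed

lemma continuous_on_dirder_form1:
  fixes \<eta> :: "'n::finite form"
  assumes \<eta>: "smooth_form \<Lambda> 1 \<eta>" and f: "continuous_on S f" and "continuous_on S H" "continuous_on S K"
  shows "continuous_on S (\<lambda>w. dirder (K w) (\<lambda>x. \<eta> (proj \<Lambda> x) [H w]) (f w))"
proof -
  let ?a = "\<lambda>e x. \<eta> (proj \<Lambda> x) [e]"
  note sm = smooth_form1_smooth[OF \<eta>]
  have ex: "dirder u (?a v) x = (\<Sum>e\<in>Basis. \<Sum>e'\<in>Basis. ((u \<bullet> e) * (v \<bullet> e')) *\<^sub>R dirder e (?a e') x)" for u v x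
  proof (rule bilinear_Basis_expand)
    show "linear (\<lambda>u. dirder u (?a v) x)" for v by (rule dirder_linear[OF sm])
    show "linear (\<lambda>v. dirder u (?a v) x)" for u
    proof (rule linearI)
      show "dirder u (?a (v + w)) x = dirder u (?a v) x + dirder u (?a w) x" for v w
        using fun_cong[OF dirder_add[OF sm[of v] sm[of w], of u], of x]
        by (simp add: linear_add[OF smooth_form1_linear[OF \<eta>]])
      show "dirder u (?a (r *\<^sub>R v)) x = r *\<^sub>R dirder u (?a v) x" for r v
        using fun_cong[OF dirder_bounded_linear[OF bounded_linear_scaleR_right[of r] sm[of v], where u=u], of x]
        by (simp add: linear_cmul[OF smooth_form1_linear[OF \<eta>]])
    qed
  qed
  have c: "continuous_on S (\<lambda>w. dirder e (?a e') (f w))" for e e'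
    by (rule continuous_on_compose2[OF smooth_continuous[OF smooth_dirder[OF sm], of UNIV] f]) auto
  show ?thesis
    unfolding ex[where u="K w" and v="H w" and x="f w" for w] by (intro continuous_intros assms c)
qed

text \<open>The coefficient of the pulled back form with respect to area. The cut-off removes the
  points where \<open>f\<close> and \<open>G\<close> are arbitrary, which makes it Borel and bounded
  on the whole plane.\<close>

definition disc_pullback :: "(complex^'n) set \<Rightarrow> (complex \<Rightarrow> complex^'n) \<Rightarrow> (complex \<Rightarrow> complex^'n) \<Rightarrow>
    complex \<Rightarrow> real \<Rightarrow> 'n form \<Rightarrow> complex \<Rightarrow> complex" where
  "disc_pullback \<Lambda> f G z R \<phi> w = indicator (ball z R) w *\<^sub>R \<phi> (proj \<Lambda> (f w)) [G w, \<i> *s G w]"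

lemma disc_lift_continuous:
  assumes "disc_lift \<Lambda> F z R f G" shows "continuous_on (ball z R) f" "continuous_on (cball z R) G"
    "continuous_on (ball z R) G" "0 < R"
proof -
  show "continuous_on (ball z R) f"
    using assms unfolding disc_lift_def
    by (intro continuous_at_imp_continuous_on) (blast intro: has_derivative_continuous)
  show G: "continuous_on (cball z R) G" and "0 < R" using assms unfolding disc_lift_def by auto
  show "continuous_on (ball z R) G" by (rule continuous_on_subset[OF G]) auto
qed

lemma disc_int_lift:
  assumes L: "lattice \<Lambda>" and D: "disc_lift \<Lambda> F z R f G" and t: "t \<le> R"
  shows "disc_int \<Lambda> F z t \<phi> = (LINT w:ball z t|lborel. disc_pullback \<Lambda> f G z R \<phi> w)"
  unfolding disc_int_def set_lebesgue_integral_def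
proof (rule Bochner_Integration.integral_cong[OF refl])
  fix w
  show "indicator (ball z t) w *\<^sub>R \<phi> (F w) [torus_deriv \<Lambda> F w, \<i> *s torus_deriv \<Lambda> F w] =
      indicator (ball z t) w *\<^sub>R disc_pullback \<Lambda> f G z R \<phi> w"
  proof (cases "w \<in> ball z t")
    case True
    then have w: "w \<in> ball z R" using t by auto
    then have "F w = proj \<Lambda> (f w)" using D unfolding disc_lift_def by blast
    then show ?thesis using w True disc_lift_torus_deriv[OF L D w] by (simp add: disc_pullback_def)
  qed simp
qed

definition pairing_int :: "bool \<Rightarrow> (complex^'n) set \<Rightarrow> (complex \<Rightarrow> (complex^'n) set) \<Rightarrow> complex \<Rightarrow> real \<Rightarrow> 'n form \<Rightarrow> complex" where
  "pairing_int nv = (if nv then nev_int else disc_int)"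

definition pairing_length :: "bool \<Rightarrow> (complex^'n) set \<Rightarrow> (complex \<Rightarrow> (complex^'n) set) \<Rightarrow> complex \<Rightarrow> real \<Rightarrow> real" where
  "pairing_length nv = (if nv then nev_length else bdry_length)"

lemma pairing_int_lift:
  assumes L: "lattice \<Lambda>" and D: "disc_lift \<Lambda> F z R f G"
  shows "pairing_int nv \<Lambda> F z R \<phi> = disc_pairing nv z R (disc_pullback \<Lambda> f G z R \<phi>)"
proof -
  have "nev_int \<Lambda> F z R \<phi> = disc_pairing True z R (disc_pullback \<Lambda> f G z R \<phi>)"
    unfolding disc_pairing_def if_True nev_int_def set_lebesgue_integral_def[of _ "{0<..<R}"]
  proof (rule Bochner_Integration.integral_cong[OF refl])
    fix t
    show "indicator {0<..<R} t *\<^sub>R (disc_int \<Lambda> F z t \<phi> / of_real t) =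
        indicator {0<..<R} t *\<^sub>R ((LINT w:ball z t|lborel. disc_pullback \<Lambda> f G z R \<phi> w) / of_real t)"
      by (cases "t \<in> {0<..<R}") (simp_all add: disc_int_lift[OF L D])
  qed
  then show ?thesis by (simp add: pairing_int_def disc_int_lift[OF L D] disc_pairing_def[of False])
qed

lemma disc_pullback_measurable_bounded:
  fixes \<phi> :: "'n::finite form"
  assumes L: "lattice \<Lambda>" and D: "disc_lift \<Lambda> F z R f G" and \<phi>: "smooth_form \<Lambda> 2 \<phi>"
  shows "disc_pullback \<Lambda> f G z R \<phi> \<in> borel_measurable borel"
    and "\<exists>B. \<forall>w. norm (disc_pullback \<Lambda> f G z R \<phi> w) \<le> B"
proof -
  note c = disc_lift_continuous[OF D]
  have iG: "continuous_on S (\<lambda>w. \<i> *s G w)" if "continuous_on S G" for S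
    using bounded_linear.continuous_on[OF bounded_linear_smult_right that] .
  show "disc_pullback \<Lambda> f G z R \<phi> \<in> borel_measurable borel"
    unfolding disc_pullback_def
    by (intro borel_measurable_continuous_on_indicator continuous_on_form2[OF \<phi>] iG c) simp
  have "\<exists>K. \<forall>x. norm (\<phi> (proj \<Lambda> x) [e, e']) \<le> K" for e e'
    using form_coeff_bounded[OF L \<phi>, of "[e, e']"] by auto
  then obtain K where K: "\<And>e e' x. norm (\<phi> (proj \<Lambda> x) [e, e']) \<le> K e e'" by metis
  obtain M where M: "\<And>w. w \<in> cball z R \<Longrightarrow> norm (G w) \<le> M"
    using compact_imp_bounded[OF compact_continuous_image[OF c(2) compact_cball]] unfolding bounded_iff by blast
  have "norm (disc_pullback \<Lambda> f G z R \<phi> w) \<le> (\<Sum>e\<in>Basis. \<Sum>e'\<in>Basis. M * M * K e e')" for w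
  proof (cases "w \<in> ball z R")
    case True
    then have m: "norm (G w) \<le> M" "norm (\<i> *s G w) \<le> M" using M[of w] by (auto simp: norm_smult_vec)
    have M0: "0 \<le> M" using m(1) norm_ge_zero order_trans by blast
    have "norm (disc_pullback \<Lambda> f G z R \<phi> w) \<le> (\<Sum>e\<in>Basis. \<Sum>e'\<in>Basis. norm (((G w \<bullet> e) * ((\<i> *s G w) \<bullet> e')) *\<^sub>R \<phi> (proj \<Lambda> (f w)) [e, e']))"
      using True unfolding disc_pullback_def form2_expand[OF \<phi>, of "f w" "G w" "\<i> *s G w"]
      by (auto intro!: order_trans[OF norm_sum] sum_mono)
    also have "\<dots> \<le> (\<Sum>e\<in>Basis. \<Sum>e'\<in>Basis. M * M * K e e')"
    proof (intro sum_mono)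
      fix e e' :: "complex^'n" assume "e \<in> Basis" "e' \<in> Basis"
      then have "\<bar>G w \<bullet> e\<bar> \<le> M" "\<bar>(\<i> *s G w) \<bullet> e'\<bar> \<le> M"
        using m Basis_le_norm order_trans by blast+
      then show "norm (((G w \<bullet> e) * ((\<i> *s G w) \<bullet> e')) *\<^sub>R \<phi> (proj \<Lambda> (f w)) [e, e']) \<le> M * M * K e e'"
        using M0 by (auto intro!: mult_mono K simp: abs_mult)
    qed
    finally show ?thesis .
  next
    case False
    have "0 \<le> M" using order_trans[OF norm_ge_zero M[of z]] c(4) by simp
    moreover have "0 \<le> K e e'" for e e' using K norm_ge_zero order_trans by blast
    ultimately show ?thesis using False by (auto simp: disc_pullback_def intro!: sum_nonneg)
  qed
  then show "\<exists>B. \<forall>w. norm (disc_pullback \<Lambda> f G z R \<phi> w) \<le> B" by blast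
qed

lemma pairing_int_measure:
  fixes \<phi> :: "'n::finite form"
  assumes L: "lattice \<Lambda>" and D: "disc_lift \<Lambda> F z R f G" and \<phi>: "smooth_form \<Lambda> 2 \<phi>"
    and \<mu>: "pairing_measure nv z R \<mu>"
  shows "pairing_int nv \<Lambda> F z R \<phi> = (\<integral>w. disc_pullback \<Lambda> f G z R \<phi> w \<partial>\<mu>)"
    and "integrable \<mu> (disc_pullback \<Lambda> f G z R \<phi>)"
proof -
  note mb = disc_pullback_measurable_bounded[OF L D \<phi>]
  then obtain B where B: "\<And>w. norm (disc_pullback \<Lambda> f G z R \<phi> w) \<le> B" by blast
  show "pairing_int nv \<Lambda> F z R \<phi> = (\<integral>w. disc_pullback \<Lambda> f G z R \<phi> w \<partial>\<mu>)"
    unfolding pairing_int_lift[OF L D] using \<mu> mb(1) B unfolding pairing_measure_def by blast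
  have fin: "finite_measure \<mu>" and sets: "sets \<mu> = sets borel" using \<mu> unfolding pairing_measure_def by auto
  show "integrable \<mu> (disc_pullback \<Lambda> f G z R \<phi>)"
    by (rule finite_measure.integrable_const_bound[OF fin, of _ B])
      (use B mb(1) in \<open>simp_all add: measurable_cong_sets[OF sets refl]\<close>)
qed

section \<open>Stokes' estimate\<close>

lemma circle_in_cball: "0 \<le> t \<Longrightarrow> t \<le> R \<Longrightarrow> z + of_real t * cis \<theta> \<in> cball z R"
  using dist_circle[of t z \<theta>] by simp

lemma continuous_on_circle_norm:
  fixes G :: "complex \<Rightarrow> complex^'n"
  assumes "continuous_on (cball z R) G"
  shows "continuous_on ({0..R} \<times> cbox 0 1) (\<lambda>(t, s). norm (G (z + of_real t * cis (2 * pi * s))))"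
  unfolding split_beta cis_conv_exp
  by (intro continuous_intros continuous_on_compose2[OF assms])
    (auto simp: cis_conv_exp[symmetric] dist_norm norm_mult)

lemma bdry_length_lift:
  assumes D: "disc_lift \<Lambda> F z R f G" and t: "0 < t" "t \<le> R"
  shows "bdry_length \<Lambda> F z t = 2 * pi * t * integral {0..1} (\<lambda>s. norm (G (z + of_real t * cis (2 * pi * s))))"
proof -
  have v: "norm (velocity \<Lambda> (F \<circ> circlepath z t) s) = 2 * pi * t * norm (G (z + of_real t * cis (2 * pi * s)))" for s
    using D t unfolding disc_lift_def by (simp add: norm_smult_vec norm_mult)
  have "continuous_on {0..1} (\<lambda>s. (\<lambda>(t, s). norm (G (z + of_real t * cis (2 * pi * s)))) (t, s))"
    by (rule continuous_on_compose2[OF continuous_on_circle_norm[OF disc_lift_continuous(2)[OF D]]])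
      (use t in \<open>auto intro!: continuous_intros\<close>)
  then have c: "continuous_on {0..1} (\<lambda>s. norm (G (z + of_real t * cis (2 * pi * s))))" by simp
  have "set_integrable lborel {0..1} (\<lambda>s. 2 * pi * t * norm (G (z + of_real t * cis (2 * pi * s))))"
    unfolding set_integrable_def by (intro borel_integrable_compact continuous_intros c) simp
  from set_borel_integral_eq_integral(2)[OF this] show ?thesis unfolding bdry_length_def v by simp
qed

text \<open>The boundary length at radius \<open>t\<close> is \<open>2 pi t\<close> times this mean.
  Divided by \<open>t\<close> it stays continuous down to radius 0, which settles the integrability
  of the Nevanlinna length.\<close>

definition circle_mean :: "(complex \<Rightarrow> complex^'n) \<Rightarrow> complex \<Rightarrow> real \<Rightarrow> real" where
  "circle_mean G z t = integral {0..1} (\<lambda>s. norm (G (z + of_real t * cis (2 * pi * s))))"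

lemma continuous_on_circle_mean:
  fixes G :: "complex \<Rightarrow> complex^'n"
  assumes "continuous_on (cball z R) G" shows "continuous_on {0..R} (circle_mean G z)"
  unfolding circle_mean_def
  using integral_continuous_on_param[OF continuous_on_circle_norm[OF assms]] by simp

lemma circle_mean_nonneg: "0 \<le> circle_mean G z t"
  unfolding circle_mean_def
  by (cases "(\<lambda>s. norm (G (z + of_real t * cis (2 * pi * s)))) integrable_on {0..1}")
    (auto intro: integral_nonneg simp: not_integrable_integral)

lemma circle_mean_le:
  fixes G :: "complex \<Rightarrow> complex^'n"
  assumes "continuous_on (cball z R) G" "\<And>w. w \<in> cball z R \<Longrightarrow> norm (G w) \<le> M" "0 \<le> t" "t \<le> R"
  shows "circle_mean G z t \<le> M"
proof -
  have "continuous_on {0..1} (\<lambda>s. (\<lambda>(t, s). norm (G (z + of_real t * cis (2 * pi * s)))) (t, s))"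
    by (rule continuous_on_compose2[OF continuous_on_circle_norm[OF assms(1)]])
      (use assms in \<open>auto intro!: continuous_intros\<close>)
  then have c: "continuous_on {0..1} (\<lambda>s. norm (G (z + of_real t * cis (2 * pi * s))))" by simp
  have "integral {0..1} (\<lambda>s. norm (G (z + of_real t * cis (2 * pi * s)))) \<le> integral {0..1} (\<lambda>s::real. M)"
    by (rule integral_le[OF integrable_continuous_real[OF c]])
      (auto intro!: assms(2) circle_in_cball[OF assms(3,4), unfolded mem_cball])
  then show ?thesis unfolding circle_mean_def by simp
qed

text \<open>Green's formula for the pulled back form \<open>P dx + Q dy\<close>. The radius stays
  below that of the disc because the second derivative of the lift enters, and
  \<open>disc_lift\<close> extends only the first one to the boundary.\<close>

lemma stokes_interior:
  fixes \<eta> :: "'n::finite form"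
  assumes L: "lattice \<Lambda>" and D: "disc_lift \<Lambda> F z R f G" and t: "0 < t" "t < R"
    and \<eta>: "smooth_form \<Lambda> 1 \<eta>" and K: "\<And>x v. norm (\<eta> (proj \<Lambda> x) [v]) \<le> K * norm v"
  shows "norm (disc_int \<Lambda> F z t (ext_deriv \<Lambda> \<eta>)) \<le> K * bdry_length \<Lambda> F z t"
proof -
  define G' where "G' = (\<lambda>w. \<chi> j. deriv (\<lambda>w. G w $ j) w)"
  have hol: "(\<lambda>w. G w $ j) holomorphic_on ball z R" for j using D unfolding disc_lift_def by blast
  have dG: "(G has_derivative (\<lambda>h. h *s G' w)) (at w)" if "w \<in> ball z R" for w
    unfolding has_cderiv_iff G'_def using holomorphic_derivI[OF hol open_ball that] by simp
  have df: "(f has_derivative (\<lambda>h. h *s G w)) (at w)" if "w \<in> ball z R" for w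
    using D that unfolding disc_lift_def by blast
  have sub: "cball z t \<subseteq> ball z R" using t by auto
  have cG': "continuous_on (cball z t) G'"
    unfolding G'_def
    by (intro continuous_on_vec_lambda continuous_on_subset[OF _ sub] holomorphic_on_imp_continuous_on holomorphic_deriv hol open_ball)
  have cG: "continuous_on (cball z t) G" and cf: "continuous_on (cball z t) f"
    using disc_lift_continuous[OF D] continuous_on_subset[OF _ sub] by blast+
  have ci: "continuous_on S (\<lambda>w. \<i> *s H w)" if "continuous_on S H" for S and H :: "complex \<Rightarrow> complex^'n"
    using bounded_linear.continuous_on[OF bounded_linear_smult_right that] .
  define P where "P = (\<lambda>w. \<eta> (proj \<Lambda> (f w)) [G w])"
  define Q where "Q = (\<lambda>w. \<eta> (proj \<Lambda> (f w)) [\<i> *s G w])"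
  \<comment> \<open>The terms containing the second derivative \<open>G'\<close> coincide in
    \<open>Q' w 1\<close> and \<open>P' w \<i>\<close>, as mixed partial derivatives do, and cancel;
    what is left is the exterior derivative on \<open>G w\<close> and
    \<open>\<i> *s G w\<close>.\<close>
  define P' where "P' = (\<lambda>w h. \<eta> (proj \<Lambda> (f w)) [h *s G' w] + dirder (h *s G w) (\<lambda>x. \<eta> (proj \<Lambda> x) [G w]) (f w))"
  define Q' where "Q' = (\<lambda>w h. \<eta> (proj \<Lambda> (f w)) [\<i> *s (h *s G' w)] + dirder (h *s G w) (\<lambda>x. \<eta> (proj \<Lambda> x) [\<i> *s G w]) (f w))"
  have dP: "(P has_derivative P' w) (at w)" if "w \<in> cball z t" for w
    unfolding P_def P'_def using that sub by (intro has_derivative_form1_comp[OF \<eta> df dG]) auto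
  have dQ: "(Q has_derivative Q' w) (at w)" if w: "w \<in> cball z t" for w
    unfolding Q_def Q'_def
    by (rule has_derivative_form1_comp[OF \<eta> df bounded_linear.has_derivative[OF bounded_linear_smult_right dG]])
      (use w sub in auto)
  have cP': "continuous_on (cball z t) (\<lambda>w. P' w \<i>)"
    unfolding P'_def by (intro continuous_on_add continuous_on_form1[OF \<eta>] continuous_on_dirder_form1[OF \<eta>] ci cf cG cG')
  have cQ': "continuous_on (cball z t) (\<lambda>w. Q' w 1)"
    unfolding Q'_def vector_smult_lid
    by (intro continuous_on_add continuous_on_form1[OF \<eta>] continuous_on_dirder_form1[OF \<eta>] ci cf cG cG')
  have si: "set_integrable lborel (ball z t) g" if "continuous_on (cball z t) g" for g :: "complex \<Rightarrow> complex"
  proof -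
    have "set_integrable lborel (cball z t) g"
      unfolding set_integrable_def by (rule borel_integrable_compact[OF compact_cball that])
    then show ?thesis by (rule set_integrable_subset) auto
  qed
  have "disc_int \<Lambda> F z t (ext_deriv \<Lambda> \<eta>) = (LINT w:ball z t|lborel. Q' w 1 - P' w \<i>)"
    unfolding disc_int_def set_lebesgue_integral_def
  proof (rule Bochner_Integration.integral_cong[OF refl])
    fix w
    show "indicator (ball z t) w *\<^sub>R ext_deriv \<Lambda> \<eta> (F w) [torus_deriv \<Lambda> F w, \<i> *s torus_deriv \<Lambda> F w] =
        indicator (ball z t) w *\<^sub>R (Q' w 1 - P' w \<i>)"
    proof (cases "w \<in> ball z t")
      case True
      then have w: "w \<in> ball z R" using t by auto
      then have "F w = proj \<Lambda> (f w)" using D unfolding disc_lift_def by blast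
      then show ?thesis
        by (simp add: disc_lift_torus_deriv[OF L D w] ext_deriv_1form[OF L \<eta>] P'_def Q'_def)
    qed simp
  qed
  also have "\<dots> = (LINT w:ball z t|lborel. Q' w 1) - (LINT w:ball z t|lborel. P' w \<i>)"
    by (rule set_integral_diff(2)[OF si[OF cQ'] si[OF cP']])
  finally have eq: "disc_int \<Lambda> F z t (ext_deriv \<Lambda> \<eta>) = \<dots>" .
  let ?c = "\<lambda>s. z + of_real t * cis (2 * pi * s)"
  have hi: "((\<lambda>s. (2 * pi * t * cos (2 * pi * s)) *\<^sub>R Q (?c s) + (- 2 * pi * t * sin (2 * pi * s)) *\<^sub>R P (?c s))
      has_integral disc_int \<Lambda> F z t (ext_deriv \<Lambda> \<eta>)) {0..1}"
    using has_integral_add[OF green_disc_dy[OF t(1) dQ cQ'] green_disc_dx[OF t(1) dP cP']]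
    unfolding eq by simp
  have pt: "norm ((2 * pi * t * cos (2 * pi * s)) *\<^sub>R Q (?c s) + (- 2 * pi * t * sin (2 * pi * s)) *\<^sub>R P (?c s))
      \<le> K * (2 * pi * t) * norm (G (?c s))" for s
  proof -
    let ?\<theta> = "2 * pi * s"
    note lin = smooth_form1_linear[OF \<eta>, of "f (?c s)"]
    \<comment> \<open>The velocity of the image curve divided by \<open>2 pi t\<close>; it has the
      norm of \<open>G\<close>, so the pointwise bound on \<open>\<eta>\<close> applies.\<close>
    have "(\<i> * cis ?\<theta>) *s G (?c s) = cos ?\<theta> *\<^sub>R (\<i> *s G (?c s)) + (- sin ?\<theta>) *\<^sub>R G (?c s)"
      by (simp add: vec_eq_iff complex_eq_iff algebra_simps)
    then have e: "\<eta> (proj \<Lambda> (f (?c s))) [(\<i> * cis ?\<theta>) *s G (?c s)] = cos ?\<theta> *\<^sub>R Q (?c s) + (- sin ?\<theta>) *\<^sub>R P (?c s)"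
      unfolding P_def Q_def by (simp only: linear_add[OF lin] linear_cmul[OF lin])
    have "(2 * pi * t * cos ?\<theta>) *\<^sub>R Q (?c s) + (- 2 * pi * t * sin ?\<theta>) *\<^sub>R P (?c s)
        = (2 * pi * t) *\<^sub>R \<eta> (proj \<Lambda> (f (?c s))) [(\<i> * cis ?\<theta>) *s G (?c s)]"
      unfolding e by (simp add: scaleR_diff_right)
    moreover have "norm (\<eta> (proj \<Lambda> (f (?c s))) [(\<i> * cis ?\<theta>) *s G (?c s)]) \<le> K * norm (G (?c s))"
      using K[of "f (?c s)" "(\<i> * cis ?\<theta>) *s G (?c s)"] by (simp add: norm_smult_vec norm_mult)
    ultimately show ?thesis
      using t mult_left_mono[of _ "K * norm (G (?c s))" "2 * pi * t"] by (simp add: mult_ac)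
  qed
  have "continuous_on {0..1} (\<lambda>s. (\<lambda>(t, s). norm (G (z + of_real t * cis (2 * pi * s)))) (t, s))"
    by (rule continuous_on_compose2[OF continuous_on_circle_norm[OF disc_lift_continuous(2)[OF D]]])
      (use t in \<open>auto intro!: continuous_intros\<close>)
  then have c: "continuous_on {0..1} (\<lambda>s. norm (G (?c s)))" by simp
  have "norm (integral {0..1} (\<lambda>s. (2 * pi * t * cos (2 * pi * s)) *\<^sub>R Q (?c s) + (- 2 * pi * t * sin (2 * pi * s)) *\<^sub>R P (?c s)))
      \<le> integral {0..1} (\<lambda>s. K * (2 * pi * t) * norm (G (?c s)))"
  proof (rule integral_norm_bound_integral)
    show "(\<lambda>s. K * (2 * pi * t) * norm (G (?c s))) integrable_on {0..1}"
      by (intro integrable_continuous_real continuous_intros c)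
  qed (use hi pt in \<open>blast intro: has_integral_integrable\<close>)+
  then show ?thesis
    unfolding integral_unique[OF hi] bdry_length_lift[OF D t(1) less_imp_le[OF t(2)]] by (simp add: mult_ac)
qed

text \<open>The estimate passes to the full radius along smaller ones: the area side by dominated
  convergence, the length side by continuity of the circle mean.\<close>

lemma stokes_closed:
  fixes \<eta> :: "'n::finite form"
  assumes L: "lattice \<Lambda>" and D: "disc_lift \<Lambda> F z R f G"
    and \<eta>: "smooth_form \<Lambda> 1 \<eta>" and K: "\<And>x v. norm (\<eta> (proj \<Lambda> x) [v]) \<le> K * norm v"
  shows "norm (disc_int \<Lambda> F z R (ext_deriv \<Lambda> \<eta>)) \<le> K * bdry_length \<Lambda> F z R"
proof -
  note R = disc_lift_continuous(4)[OF D]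
  \<comment> \<open>Radii strictly inside the disc that increase to \<open>R\<close>; adding 2
    rather than 1 keeps already the first one positive.\<close>
  define t where "t = (\<lambda>n::nat. R * (1 - 1 / (real n + 2)))"
  have t: "0 < t n" "t n < R" for n using R by (auto simp: t_def field_simps add_pos_nonneg)
  have tR: "t \<longlonglongrightarrow> R"
  proof -
    have "(\<lambda>n. 1 / (real n + 2)) \<longlonglongrightarrow> 0"
      using LIMSEQ_Suc[OF LIMSEQ_inverse_real_of_nat] by (simp add: inverse_eq_divide add.commute)
    then have "t \<longlonglongrightarrow> R * (1 - 0)" unfolding t_def by (intro tendsto_intros)
    then show ?thesis by simp
  qed
  let ?\<psi> = "disc_pullback \<Lambda> f G z R (ext_deriv \<Lambda> \<eta>)"
  note mb = disc_pullback_measurable_bounded[OF L D smooth_form_ext_deriv[OF L \<eta>]]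
  obtain B where B: "\<And>w. norm (?\<psi> w) \<le> B" using mb(2) by blast
  have fin: "emeasure lborel (ball z R) < \<infinity>" by (rule emeasure_bounded_finite) simp
  have "(\<lambda>n. LINT w:ball z (t n)|lborel. ?\<psi> w) \<longlonglongrightarrow> (LINT w:ball z R|lborel. ?\<psi> w)"
    unfolding set_lebesgue_integral_def
  proof (rule integral_dominated_convergence[where w="\<lambda>w. indicator (ball z R) w * B"])
    show "(\<lambda>w. indicator (ball z R) w *\<^sub>R ?\<psi> w) \<in> borel_measurable lborel"
      using mb(1) by (simp, intro borel_measurable_scaleR borel_measurable_indicator) auto
    show "(\<lambda>w. indicator (ball z (t n)) w *\<^sub>R ?\<psi> w) \<in> borel_measurable lborel" for n
      using mb(1) by (simp, intro borel_measurable_scaleR borel_measurable_indicator) auto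
    show "integrable lborel (\<lambda>w. indicator (ball z R) w * B)"
      using fin by (intro integrable_mult_left integrable_real_indicator) auto
    show "AE w in lborel. (\<lambda>n. indicator (ball z (t n)) w *\<^sub>R ?\<psi> w) \<longlonglongrightarrow> indicator (ball z R) w *\<^sub>R ?\<psi> w"
    proof (rule AE_I2)
      fix w
      show "(\<lambda>n. indicator (ball z (t n)) w *\<^sub>R ?\<psi> w) \<longlonglongrightarrow> indicator (ball z R) w *\<^sub>R ?\<psi> w"
      proof (cases "dist z w < R")
        case True
        have "\<forall>\<^sub>F n in sequentially. dist z w < t n" by (rule order_tendstoD(1)[OF tR True])
        then have "\<forall>\<^sub>F n in sequentially. indicator (ball z (t n)) w *\<^sub>R ?\<psi> w = indicator (ball z R) w *\<^sub>R ?\<psi> w"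
          by eventually_elim (use True in auto)
        then show ?thesis by (rule tendsto_eventually)
      next
        case False
        then have "w \<notin> ball z (t n)" for n using t(2)[of n] by auto
        then show ?thesis using False by simp
      qed
    qed
    show "AE w in lborel. norm (indicator (ball z (t n)) w *\<^sub>R ?\<psi> w) \<le> indicator (ball z R) w * B" for n
      using B t(2)[of n] order_trans[OF norm_ge_zero B] by (intro AE_I2) (auto simp: indicator_def)
  qed
  then have "(\<lambda>n. disc_int \<Lambda> F z (t n) (ext_deriv \<Lambda> \<eta>)) \<longlonglongrightarrow> disc_int \<Lambda> F z R (ext_deriv \<Lambda> \<eta>)"
    by (simp add: disc_int_lift[OF L D] less_imp_le[OF t(2)])
  from tendsto_norm[OF this]
  have 1: "(\<lambda>n. norm (disc_int \<Lambda> F z (t n) (ext_deriv \<Lambda> \<eta>))) \<longlonglongrightarrow> norm (disc_int \<Lambda> F z R (ext_deriv \<Lambda> \<eta>))" .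
  have "(\<lambda>n. circle_mean G z (t n)) \<longlonglongrightarrow> circle_mean G z R"
    by (rule continuous_on_tendsto_compose[OF continuous_on_circle_mean[OF disc_lift_continuous(2)[OF D]] tR])
      (use R t in \<open>auto intro!: always_eventually less_imp_le\<close>)
  then have "(\<lambda>n. 2 * pi * t n * circle_mean G z (t n)) \<longlonglongrightarrow> 2 * pi * R * circle_mean G z R"
    by (intro tendsto_intros tR)
  then have 2: "(\<lambda>n. K * bdry_length \<Lambda> F z (t n)) \<longlonglongrightarrow> K * bdry_length \<Lambda> F z R"
    using R by (intro tendsto_intros) (simp add: bdry_length_lift[OF D] t less_imp_le[OF t(2)] circle_mean_def)
  show ?thesis
    by (rule LIMSEQ_le[OF 1 2]) (use stokes_interior[OF L D t \<eta> K] in blast)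
qed

lemma nev_length_lift:
  assumes D: "disc_lift \<Lambda> F z R f G"
  shows "nev_length \<Lambda> F z R = (LINT t:{0<..<R}|lborel. 2 * pi * circle_mean G z t)"
    and "set_integrable lborel {0<..<R} (\<lambda>t. 2 * pi * circle_mean G z t)"
proof -
  show "nev_length \<Lambda> F z R = (LINT t:{0<..<R}|lborel. 2 * pi * circle_mean G z t)"
    unfolding nev_length_def set_lebesgue_integral_def
  proof (rule Bochner_Integration.integral_cong[OF refl])
    fix t
    show "indicator {0<..<R} t *\<^sub>R (bdry_length \<Lambda> F z t / t) = indicator {0<..<R} t *\<^sub>R (2 * pi * circle_mean G z t)"
      by (cases "t \<in> {0<..<R}") (simp_all add: bdry_length_lift[OF D] circle_mean_def)
  qed
  have "set_integrable lborel {0..R} (\<lambda>t. 2 * pi * circle_mean G z t)"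
    unfolding set_integrable_def
    by (intro borel_integrable_compact continuous_intros continuous_on_circle_mean disc_lift_continuous(2)[OF D]) simp
  then show "set_integrable lborel {0<..<R} (\<lambda>t. 2 * pi * circle_mean G z t)"
    by (rule set_integrable_subset) auto
qed

text \<open>The Nevanlinna estimate is the interior estimate integrated in \<open>dt/t\<close>; the
  Ahlfors estimate is the one at full radius.\<close>

lemma pairing_stokes:
  fixes \<eta> :: "'n::finite form"
  assumes L: "lattice \<Lambda>" and D: "disc_lift \<Lambda> F z R f G"
    and \<eta>: "smooth_form \<Lambda> 1 \<eta>" and K: "0 < K" "\<And>x v. norm (\<eta> (proj \<Lambda> x) [v]) \<le> K * norm v"
  shows "norm (pairing_int nv \<Lambda> F z R (ext_deriv \<Lambda> \<eta>)) \<le> K * pairing_length nv \<Lambda> F z R"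
proof -
  have "norm (nev_int \<Lambda> F z R (ext_deriv \<Lambda> \<eta>)) \<le> K * nev_length \<Lambda> F z R"
  proof -
    have "norm (nev_int \<Lambda> F z R (ext_deriv \<Lambda> \<eta>)) \<le>
        (\<integral>t. norm (indicator {0<..<R} t *\<^sub>R (disc_int \<Lambda> F z t (ext_deriv \<Lambda> \<eta>) / complex_of_real t)) \<partial>lborel)"
      unfolding nev_int_def set_lebesgue_integral_def by (rule integral_norm_bound)
    also have "\<dots> \<le> (\<integral>t. indicator {0<..<R} t *\<^sub>R (K * (2 * pi * circle_mean G z t)) \<partial>lborel)"
    proof (rule integral_mono')
      show "integrable lborel (\<lambda>t. indicator {0<..<R} t *\<^sub>R (K * (2 * pi * circle_mean G z t)))"
        using set_integrable_mult_right[OF nev_length_lift(2)[OF D], of K] unfolding set_integrable_def by blast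
      fix t
      show "0 \<le> indicator {0<..<R} t *\<^sub>R (K * (2 * pi * circle_mean G z t))"
        using K(1) circle_mean_nonneg[of G z t] by (simp add: indicator_def)
      show "norm (indicator {0<..<R} t *\<^sub>R (disc_int \<Lambda> F z t (ext_deriv \<Lambda> \<eta>) / complex_of_real t))
          \<le> indicator {0<..<R} t *\<^sub>R (K * (2 * pi * circle_mean G z t))"
      proof (cases "t \<in> {0<..<R}")
        case True
        then have t: "0 < t" "t < R" by auto
        have "norm (disc_int \<Lambda> F z t (ext_deriv \<Lambda> \<eta>)) \<le> K * (2 * pi * t * circle_mean G z t)"
          using stokes_interior[OF L D t \<eta> K(2)] t by (simp add: bdry_length_lift[OF D] circle_mean_def)
        then show ?thesis using t by (simp add: norm_divide field_simps)
      qed simp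
    qed
    also have "\<dots> = K * nev_length \<Lambda> F z R"
      unfolding nev_length_lift(1)[OF D] set_lebesgue_integral_def
      by (subst integral_mult_right_zero[symmetric]) (simp add: mult_ac)
    finally show ?thesis .
  qed
  then show ?thesis
    using stokes_closed[OF L D \<eta> K(2)] by (simp add: pairing_int_def pairing_length_def)
qed

text \<open>The same bound fits both lengths: in the Nevanlinna case the factor \<open>t\<close> of
  the circumference cancels against \<open>dt/t\<close>, and integration over \<open>t\<close> up to
  \<open>R\<close> restores a factor \<open>R\<close>.\<close>

lemma pairing_length_le:
  assumes D: "disc_lift \<Lambda> F z R f G" and M: "\<And>w. w \<in> cball z R \<Longrightarrow> norm (G w) \<le> M"
  shows "0 \<le> pairing_length nv \<Lambda> F z R" "pairing_length nv \<Lambda> F z R \<le> 2 * pi * R * M"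
proof -
  note c = disc_lift_continuous[OF D]
  have b: "bdry_length \<Lambda> F z R = 2 * pi * R * circle_mean G z R"
    using bdry_length_lift[OF D c(4)] by (simp add: circle_mean_def)
  have m: "0 \<le> circle_mean G z t" "t \<in> {0..R} \<Longrightarrow> circle_mean G z t \<le> M" for t
    using circle_mean_nonneg circle_mean_le[OF c(2) M, of t] by auto
  have "0 \<le> nev_length \<Lambda> F z R"
    unfolding nev_length_lift(1)[OF D] set_lebesgue_integral_def using m(1) by (intro integral_nonneg_AE) simp
  moreover have "nev_length \<Lambda> F z R \<le> (LINT t:{0<..<R}|lborel. 2 * pi * M)"
    unfolding nev_length_lift(1)[OF D]
  proof (rule set_integral_mono[OF nev_length_lift(2)[OF D]])
    show "set_integrable lborel {0<..<R} (\<lambda>t. 2 * pi * M)"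
    proof -
      have "set_integrable lborel {0..R} (\<lambda>t. 2 * pi * M)"
        unfolding set_integrable_def by (intro borel_integrable_compact continuous_intros) simp
      then show ?thesis by (rule set_integrable_subset) auto
    qed
    show "2 * pi * circle_mean G z t \<le> 2 * pi * M" if "t \<in> {0<..<R}" for t
      using m(2)[of t] that by simp
  qed
  moreover have "(LINT t:{0<..<R}|lborel. 2 * pi * M) = 2 * pi * R * M"
    using c(4) unfolding set_lebesgue_integral_def by simp
  ultimately have "0 \<le> nev_length \<Lambda> F z R" "nev_length \<Lambda> F z R \<le> 2 * pi * R * M" by linarith+
  moreover have "0 \<le> bdry_length \<Lambda> F z R" "bdry_length \<Lambda> F z R \<le> 2 * pi * R * M"
    unfolding b using m c(4) by auto
  ultimately show "0 \<le> pairing_length nv \<Lambda> F z R" "pairing_length nv \<Lambda> F z R \<le> 2 * pi * R * M"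
    by (simp_all add: pairing_length_def)
qed

section \<open>Matrices of discs and of the currents they generate\<close>

section \<open>Class matrices\<close>

definition outer :: "complex^'n \<Rightarrow> complex^'n^'n" where
  "outer v = (\<chi> j k. v $ j * cnj (v $ k))"

text \<open>By the spectral theorem these are the positive semidefinite Hermitian matrices of trace
  1. Written as a hull of a compact set, it is visibly compact and its members are finite
  combinations of rank one matrices.\<close>

definition class_hull :: "(complex^'n^'n) set" where
  "class_hull = convex hull (outer ` sphere 0 1)"

lemma continuous_on_outer: "continuous_on S G \<Longrightarrow> continuous_on S (\<lambda>w. outer (G w))"
  unfolding outer_def by (intro continuous_on_vec_lambda continuous_intros)

lemma closed_class_hull: "closed (class_hull :: (complex^'n^'n) set)"
  unfolding class_hull_def
  by (intro compact_imp_closed compact_convex_hull compact_continuous_image continuous_on_outer continuous_on_id) simp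

lemma outer_scaleR: "outer (r *\<^sub>R v) = (r * r) *\<^sub>R outer v"
  by (simp add: outer_def vec_eq_iff)

lemma omega_disc: "omega p [v, \<i> *s v] = of_real ((norm v)\<^sup>2)"
proof -
  have "omega p [v, \<i> *s v] = (\<Sum>j\<in>UNIV. of_real ((cmod (v $ j))\<^sup>2))"
    unfolding omega_def complex_norm_square by (simp add: sum_distrib_left algebra_simps)
  also have "\<dots> = of_real ((norm v)\<^sup>2)"
    by (simp add: norm_vec_def L2_set_def sum_nonneg)
  finally show ?thesis .
qed

lemma smooth_form_omega: "smooth_form \<Lambda> 2 (omega :: 'n::finite form)"
proof (rule smooth_form_cong)
  show "smooth_form \<Lambda> 2 (\<lambda>p vs. \<Sum>j\<in>UNIV. unit_form11 j j p vs)"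
    using form11_unit_form11 unfolding form11_def by (intro smooth_form_sum) blast
  show "forms_agree \<Lambda> 2 (\<lambda>p vs. \<Sum>j\<in>UNIV. unit_form11 j j p vs) omega"
    unfolding forms_agree_def by (simp add: omega_def unit_form11_def sum_distrib_left)
qed

definition pairing_area :: "bool \<Rightarrow> (complex^'n) set \<Rightarrow> (complex \<Rightarrow> (complex^'n) set) \<Rightarrow> complex \<Rightarrow> real \<Rightarrow> real" where
  "pairing_area nv \<Lambda> F z R = Re (pairing_int nv \<Lambda> F z R omega)"

definition class_matrix :: "bool \<Rightarrow> (complex^'n) set \<Rightarrow> (complex \<Rightarrow> (complex^'n) set) \<Rightarrow> complex \<Rightarrow> real \<Rightarrow> complex^'n^'n" where
  "class_matrix nv \<Lambda> F z R =
    (\<chi> j k. pairing_int nv \<Lambda> F z R (unit_form11 j k) / of_real (pairing_area nv \<Lambda> F z R))"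

lemma pairing_measure_integrable:
  fixes h :: "complex \<Rightarrow> 'b::{banach, second_countable_topology}"
  assumes \<mu>: "pairing_measure nv z R \<mu>" and h: "continuous_on (cball z R) h"
  shows "integrable \<mu> (\<lambda>w. indicator (ball z R) w *\<^sub>R h w)"
proof -
  have fin: "finite_measure \<mu>" and sets: "sets \<mu> = sets borel" using \<mu> unfolding pairing_measure_def by auto
  obtain B where B: "\<And>w. w \<in> cball z R \<Longrightarrow> norm (h w) \<le> B"
    using compact_imp_bounded[OF compact_continuous_image[OF h compact_cball]] unfolding bounded_iff by blast
  have m: "(\<lambda>w. indicator (ball z R) w *\<^sub>R h w) \<in> borel_measurable \<mu>"
    unfolding measurable_cong_sets[OF sets refl]
    by (rule borel_measurable_continuous_on_indicator) (auto intro: continuous_on_subset[OF h])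
  show ?thesis
    by (rule finite_measure.integrable_const_bound[OF fin, of _ "\<bar>B\<bar>"])
      (use m B in \<open>auto simp: indicator_def intro!: AE_I2 order_trans[OF B] \<close>)
qed

lemma disc_lift_pairings:
  fixes G :: "complex \<Rightarrow> complex^'n"
  assumes L: "lattice \<Lambda>" and D: "disc_lift \<Lambda> F z R f G" and \<mu>: "pairing_measure nv z R \<mu>"
  shows "pairing_area nv \<Lambda> F z R = (\<integral>w. indicator (ball z R) w *\<^sub>R (norm (G w))\<^sup>2 \<partial>\<mu>)"
    and "pairing_int nv \<Lambda> F z R (unit_form11 j k) = (\<integral>w. indicator (ball z R) w *\<^sub>R outer (G w) \<partial>\<mu>) $ j $ k"
proof -
  note c = disc_lift_continuous[OF D]
  have sm: "smooth_form \<Lambda> 2 (unit_form11 j k)" using form11_unit_form11 unfolding form11_def by blast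
  have "pairing_int nv \<Lambda> F z R omega = (\<integral>w. complex_of_real (indicator (ball z R) w *\<^sub>R (norm (G w))\<^sup>2) \<partial>\<mu>)"
    unfolding pairing_int_measure(1)[OF L D smooth_form_omega \<mu>] disc_pullback_def omega_disc
    by (simp add: scaleR_conv_of_real[where ?'a=complex])
  then have "pairing_int nv \<Lambda> F z R omega = of_real (\<integral>w. indicator (ball z R) w *\<^sub>R (norm (G w))\<^sup>2 \<partial>\<mu>)"
    by (simp only: integral_complex_of_real)
  then show "pairing_area nv \<Lambda> F z R = (\<integral>w. indicator (ball z R) w *\<^sub>R (norm (G w))\<^sup>2 \<partial>\<mu>)"
    unfolding pairing_area_def by simp
  have io: "integrable \<mu> (\<lambda>w. indicator (ball z R) w *\<^sub>R outer (G w))"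
    by (rule pairing_measure_integrable[OF \<mu> continuous_on_outer[OF c(2)]])
  have bl: "bounded_linear (\<lambda>M :: complex^'n^'n. M $ j $ k)"
    by (rule bounded_linear_compose[OF bounded_linear_vec_nth bounded_linear_vec_nth])
  show "pairing_int nv \<Lambda> F z R (unit_form11 j k) = (\<integral>w. indicator (ball z R) w *\<^sub>R outer (G w) \<partial>\<mu>) $ j $ k"
    unfolding pairing_int_measure(1)[OF L D sm \<mu>] disc_pullback_def unit_form11_disc
      integral_bounded_linear[OF bl io, symmetric] by (simp add: outer_def)
qed

text \<open>A continuous derivative that is nonzero somewhere stays away from 0 on a small ball,
  which the measure charges.\<close>

lemma pairing_area_pos:
  fixes G :: "complex \<Rightarrow> complex^'n"
  assumes L: "lattice \<Lambda>" and D: "disc_lift \<Lambda> F z R f G" and w0: "w0 \<in> ball z R" "G w0 \<noteq> 0"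
  shows "0 < pairing_area nv \<Lambda> F z R"
proof -
  note c = disc_lift_continuous[OF D]
  obtain \<mu> where \<mu>: "pairing_measure nv z R \<mu>" using pairing_measure_exists[OF c(4)] by blast
  have fin: "finite_measure \<mu>" and sets: "sets \<mu> = sets borel" and
    pos: "\<And>w e. 0 < e \<Longrightarrow> dist z w + e < R \<Longrightarrow> 0 < measure \<mu> (ball w e)"
    using \<mu> unfolding pairing_measure_def by auto
  define b where "b = norm (G w0) / 2"
  have b: "0 < b" "b < norm (G w0)" using w0 by (auto simp: b_def)
  have "isCont G w0" using c(3) w0(1) by (simp add: continuous_on_eq_continuous_at)
  then have "\<forall>\<^sub>F w in at w0. b < norm (G w)"
    unfolding isCont_def by (intro order_tendstoD(1)[OF tendsto_norm b(2)])
  then obtain d where d: "0 < d" "\<And>w. w \<noteq> w0 \<Longrightarrow> dist w w0 < d \<Longrightarrow> b < norm (G w)"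
    unfolding eventually_at by auto
  define e where "e = min d ((R - dist z w0) / 2)"
  have e: "0 < e" "dist z w0 + e < R" "e \<le> d" using d w0 by (auto simp: e_def min_def field_simps)
  have sub: "ball w0 e \<subseteq> ball z R"
  proof
    fix x assume "x \<in> ball w0 e"
    then show "x \<in> ball z R" using dist_triangle[of z x w0] e by simp
  qed
  have ge: "b \<le> norm (G w)" if "w \<in> ball w0 e" for w
    using d(2)[of w] b(2) e(3) that by (cases "w = w0") (auto simp: dist_commute)
  have "ball w0 e \<in> sets \<mu>" using sets by simp
  then have im: "integrable \<mu> (\<lambda>w. indicator (ball w0 e) w * b\<^sup>2)"
    and me: "(\<integral>w. indicator (ball w0 e) w * b\<^sup>2 \<partial>\<mu>) = measure \<mu> (ball w0 e) * b\<^sup>2"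
    using finite_measure.emeasure_finite[OF fin] by (auto simp: less_top)
  have "0 < measure \<mu> (ball w0 e) * b\<^sup>2" using pos[OF e(1,2)] b by simp
  also have "\<dots> \<le> (\<integral>w. indicator (ball z R) w *\<^sub>R (norm (G w))\<^sup>2 \<partial>\<mu>)"
    unfolding me[symmetric]
  proof (rule integral_mono[OF im])
    show "integrable \<mu> (\<lambda>w. indicator (ball z R) w *\<^sub>R (norm (G w))\<^sup>2)"
      by (rule pairing_measure_integrable[OF \<mu>]) (intro continuous_intros c)
    show "indicator (ball w0 e) w * b\<^sup>2 \<le> indicator (ball z R) w *\<^sub>R (norm (G w))\<^sup>2" for w
      using ge[of w] sub b(1) by (auto simp: indicator_def subset_iff)
  qed
  finally show ?thesis unfolding disc_lift_pairings(1)[OF L D \<mu>] .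
qed

text \<open>The matrix is an average of points of the hull, weighted by the area density. Otherwise
  a hyperplane would separate it strictly; its inequality, made homogeneous of degree two, holds for
  every vector \<open>G w\<close> and integrates to a contradiction.\<close>

lemma class_matrix_in_hull:
  fixes G :: "complex \<Rightarrow> complex^'n"
  assumes L: "lattice \<Lambda>" and D: "disc_lift \<Lambda> F z R f G" and pos: "0 < pairing_area nv \<Lambda> F z R"
  shows "class_matrix nv \<Lambda> F z R \<in> class_hull"
proof (rule ccontr)
  note c = disc_lift_continuous[OF D]
  obtain \<mu> where \<mu>: "pairing_measure nv z R \<mu>" using pairing_measure_exists[OF c(4)] by blast
  let ?A = "pairing_area nv \<Lambda> F z R"
  define X where "X = (\<integral>w. indicator (ball z R) w *\<^sub>R outer (G w) \<partial>\<mu>)"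
  have cm: "class_matrix nv \<Lambda> F z R = (1 / ?A) *\<^sub>R X"
    by (simp add: class_matrix_def disc_lift_pairings(2)[OF L D \<mu>] X_def vec_eq_iff
      scaleR_conv_of_real[where ?'a=complex] divide_inverse mult.commute)
  have io: "integrable \<mu> (\<lambda>w. indicator (ball z R) w *\<^sub>R outer (G w))"
    by (rule pairing_measure_integrable[OF \<mu> continuous_on_outer[OF c(2)]])
  assume "class_matrix nv \<Lambda> F z R \<notin> class_hull"
  then obtain a b where ab: "a \<bullet> class_matrix nv \<Lambda> F z R < b" "\<And>x. x \<in> class_hull \<Longrightarrow> b < a \<bullet> x"
    using separating_hyperplane_closed_point[of class_hull] closed_class_hull
    unfolding class_hull_def by (metis convex_convex_hull)
  have ge: "b * (norm v)\<^sup>2 \<le> a \<bullet> outer v" for v :: "complex^'n"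
  proof (cases "v = 0")
    case True
    then show ?thesis by (simp add: outer_def inner_vec_def)
  next
    case False
    define u where "u = (1 / norm v) *\<^sub>R v"
    have "u \<in> sphere 0 1" using False by (simp add: u_def)
    then have "outer u \<in> class_hull" unfolding class_hull_def by (intro hull_inc imageI)
    then have "b \<le> a \<bullet> outer u" using ab(2) by (simp add: less_imp_le)
    then have "(norm v * norm v) * b \<le> (norm v * norm v) * (a \<bullet> outer u)" by (intro mult_left_mono) auto
    moreover have "outer v = (norm v * norm v) *\<^sub>R outer u"
      unfolding u_def outer_scaleR using False by simp
    ultimately show ?thesis by (simp add: power2_eq_square mult_ac)
  qed
  have "b * ?A = (\<integral>w. b * (indicator (ball z R) w *\<^sub>R (norm (G w))\<^sup>2) \<partial>\<mu>)"
    unfolding disc_lift_pairings(1)[OF L D \<mu>] by simp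
  also have "\<dots> \<le> (\<integral>w. a \<bullet> (indicator (ball z R) w *\<^sub>R outer (G w)) \<partial>\<mu>)"
  proof (rule integral_mono)
    show "integrable \<mu> (\<lambda>w. b * (indicator (ball z R) w *\<^sub>R (norm (G w))\<^sup>2))"
      by (intro integrable_mult_right pairing_measure_integrable[OF \<mu>] continuous_intros c)
    show "integrable \<mu> (\<lambda>w. a \<bullet> (indicator (ball z R) w *\<^sub>R outer (G w)))"
      by (rule integrable_inner_right) (rule io)
    show "b * (indicator (ball z R) w *\<^sub>R (norm (G w))\<^sup>2) \<le> a \<bullet> (indicator (ball z R) w *\<^sub>R outer (G w))" for w
      using ge[of "G w"] by (simp add: indicator_def)
  qed
  also have "\<dots> = a \<bullet> X" unfolding X_def by (rule integral_inner_right) (use io in auto)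
  finally have "b * ?A \<le> a \<bullet> X" .
  then have "b \<le> a \<bullet> class_matrix nv \<Lambda> F z R" unfolding cm using pos by (simp add: field_simps)
  then show False using ab(1) by simp
qed

section \<open>Currents generated by sequences of discs\<close>

definition generates :: "bool \<Rightarrow> (complex^'n) set \<Rightarrow> (nat \<Rightarrow> complex \<Rightarrow> (complex^'n) set) \<Rightarrow> (nat \<Rightarrow> complex) \<Rightarrow>
    (nat \<Rightarrow> real) \<Rightarrow> ('n form \<Rightarrow> complex) \<Rightarrow> bool" where
  "generates nv \<Lambda> F z R T \<longleftrightarrow>
     (\<forall>j. holomorphic_disc \<Lambda> (F j) (z j) (R j) \<and> \<not> F j constant_on cball (z j) (R j)) \<and>
     (\<lambda>j. pairing_length nv \<Lambda> (F j) (z j) (R j) / pairing_area nv \<Lambda> (F j) (z j) (R j)) \<longlonglongrightarrow> 0 \<and>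
     current11 \<Lambda> T \<and>
     (\<exists>r. strict_mono r \<and> (\<forall>\<phi>. form11 \<Lambda> \<phi> \<longrightarrow>
        ((\<lambda>j. pairing_int nv \<Lambda> (F j) (z j) (R j) \<phi> / of_real (pairing_area nv \<Lambda> (F j) (z j) (R j))) \<circ> r)
          \<longlonglongrightarrow> T \<phi>))"

lemma generates_nevanlinna_eq: "generates_nevanlinna \<Lambda> F z R T = generates True \<Lambda> F z R T"
  by (simp add: generates_nevanlinna_def generates_def pairing_area_def pairing_int_def pairing_length_def nev_area_def)

lemma generates_ahlfors_eq: "generates_ahlfors \<Lambda> F z R T = generates False \<Lambda> F z R T"
  by (simp add: generates_ahlfors_def generates_def pairing_area_def pairing_int_def pairing_length_def disc_area_def)

lemma nonconstant_disc_lift: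
  fixes \<Lambda> :: "(complex^'n) set"
  assumes L: "lattice \<Lambda>" and "holomorphic_disc \<Lambda> F z R" "\<not> F constant_on cball z R"
  shows "\<exists>f G. disc_lift \<Lambda> F z R f G \<and> (\<forall>nv. 0 < pairing_area nv \<Lambda> F z R)"
proof -
  obtain f G where fG: "disc_lift \<Lambda> F z R f G" "(\<forall>w\<in>ball z R. G w = 0) \<longrightarrow> F constant_on cball z R"
    using holomorphic_disc_lift[OF L assms(2)] by blast
  then obtain w where "w \<in> ball z R" "G w \<noteq> 0" using assms(3) by blast
  then show ?thesis using pairing_area_pos[OF L fG(1)] fG(1) by blast
qed

lemma part11_disc:
  assumes "smooth_form \<Lambda> 2 \<phi>"
  shows "part11 \<phi> (proj \<Lambda> x) [u, \<i> *s u] = \<phi> (proj \<Lambda> x) [u, \<i> *s u]"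
proof -
  note b = smooth_form2_bilinear[OF assms]
  have "\<phi> (proj \<Lambda> x) [\<i> *s u, - u] = - \<phi> (proj \<Lambda> x) [\<i> *s u, u]" by (rule linear_neg[OF b(2)])
  also have "\<dots> = \<phi> (proj \<Lambda> x) [u, \<i> *s u]" using b(5)[of x u "\<i> *s u"] by simp
  finally show ?thesis unfolding part11_def by simp
qed

text \<open>The limit is given on (1,1)-forms only, so Stokes' estimate for the exterior derivative
  of \<open>\<eta>\<close> is transferred to its (1,1) part, which has the same pullback to
  holomorphic discs. The quotient is then at most a constant times length over area.\<close>

lemma generates_closed:
  fixes \<Lambda> :: "(complex^'n) set"
  assumes L: "lattice \<Lambda>" and gen: "generates nv \<Lambda> F z R T"
  shows "closed_current \<Lambda> T"
  unfolding closed_current_def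
proof (intro conjI allI impI)
  have T: "current11 \<Lambda> T" using gen unfolding generates_def by blast
  then show "current \<Lambda> 2 T" unfolding current11_def by blast
  fix \<eta> assume \<eta>: "smooth_form \<Lambda> 1 \<eta>"
  let ?\<phi> = "ext_deriv \<Lambda> \<eta>"
  note sm = smooth_form_ext_deriv[OF L \<eta>]
  let ?A = "\<lambda>j. pairing_area nv \<Lambda> (F j) (z j) (R j)" and ?l = "\<lambda>j. pairing_length nv \<Lambda> (F j) (z j) (R j)"
  obtain K where K: "0 < K" "\<And>x v. norm (\<eta> (proj \<Lambda> x) [v]) \<le> K * norm v"
    using form1_bounded[OF L \<eta>] by blast
  obtain r where r: "strict_mono r" and lim: "\<And>\<phi>. form11 \<Lambda> \<phi> \<Longrightarrow>
      ((\<lambda>j. pairing_int nv \<Lambda> (F j) (z j) (R j) \<phi> / of_real (?A j)) \<circ> r) \<longlonglongrightarrow> T \<phi>"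
    and ratio: "(\<lambda>j. ?l j / ?A j) \<longlonglongrightarrow> 0"
    using gen unfolding generates_def by blast
  have bound: "norm (pairing_int nv \<Lambda> (F j) (z j) (R j) (part11 ?\<phi>) / of_real (?A j)) \<le> K * (?l j / ?A j)" for j
  proof -
    obtain f G where D: "disc_lift \<Lambda> (F j) (z j) (R j) f G" and pos: "0 < ?A j"
      using nonconstant_disc_lift[OF L] gen unfolding generates_def by blast
    have "pairing_int nv \<Lambda> (F j) (z j) (R j) (part11 ?\<phi>) = pairing_int nv \<Lambda> (F j) (z j) (R j) ?\<phi>"
      unfolding pairing_int_lift[OF L D] disc_pullback_def part11_disc[OF sm] ..
    then show ?thesis
      using pairing_stokes[OF L D \<eta> K, of nv] pos by (simp add: norm_divide divide_right_mono)
  qed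
  have "(\<lambda>j. K * (?l j / ?A j)) \<longlonglongrightarrow> 0" using tendsto_mult_right_zero[OF ratio] .
  then have "(\<lambda>j. pairing_int nv \<Lambda> (F j) (z j) (R j) (part11 ?\<phi>) / of_real (?A j)) \<longlonglongrightarrow> 0"
    by (rule Lim_null_comparison[OF always_eventually[OF allI[OF bound]]])
  from LIMSEQ_subseq_LIMSEQ[OF this r] have "T (part11 ?\<phi>) = 0"
    using lim[OF form11_part11[OF sm]] LIMSEQ_unique by blast
  then show "T ?\<phi> = 0" using current11_part11[OF T sm] by simp
qed

lemma generates_class_matrix:
  fixes \<Lambda> :: "(complex^'n) set"
  assumes L: "lattice \<Lambda>" and gen: "generates nv \<Lambda> F z R T"
  shows "\<exists>r. strict_mono r \<and>
    ((\<lambda>j. class_matrix nv \<Lambda> (F j) (z j) (R j)) \<circ> r) \<longlonglongrightarrow> (\<chi> j k. T (unit_form11 j k))"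
    and "(\<chi> j k. T (unit_form11 j k)) \<in> class_hull"
proof -
  obtain r where r: "strict_mono r" and lim: "\<And>\<phi>. form11 \<Lambda> \<phi> \<Longrightarrow>
      ((\<lambda>j. pairing_int nv \<Lambda> (F j) (z j) (R j) \<phi> / of_real (pairing_area nv \<Lambda> (F j) (z j) (R j))) \<circ> r) \<longlonglongrightarrow> T \<phi>"
    using gen unfolding generates_def by blast
  have conv: "((\<lambda>j. class_matrix nv \<Lambda> (F j) (z j) (R j)) \<circ> r) \<longlonglongrightarrow> (\<chi> j k. T (unit_form11 j k))"
    unfolding class_matrix_def o_def
    by (intro tendsto_vec_lambda) (use lim[OF form11_unit_form11] in \<open>simp add: o_def\<close>)
  then show "\<exists>r. strict_mono r \<and>
    ((\<lambda>j. class_matrix nv \<Lambda> (F j) (z j) (R j)) \<circ> r) \<longlonglongrightarrow> (\<chi> j k. T (unit_form11 j k))" using r by blast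
  have "class_matrix nv \<Lambda> (F j) (z j) (R j) \<in> class_hull" for j
    using nonconstant_disc_lift[OF L] class_matrix_in_hull[OF L] gen unfolding generates_def by metis
  then show "(\<chi> j k. T (unit_form11 j k)) \<in> class_hull"
    by (intro closed_sequentially[OF closed_class_hull _ conv]) simp
qed

section \<open>Weak compactness of normalised discs\<close>

section \<open>Compactness\<close>

text \<open>Indicators of the pieces of a partition must be admissible arguments, hence Borel
  functions instead of continuous ones.\<close>

definition bounded_borel :: "('a::topological_space \<Rightarrow> complex) set" where
  "bounded_borel = {u. u \<in> borel_measurable borel \<and> bounded (range u)}"

lemma bounded_borelI: "u \<in> borel_measurable borel \<Longrightarrow> (\<And>x. norm (u x) \<le> b) \<Longrightarrow> u \<in> bounded_borel"
  unfolding bounded_borel_def bounded_iff by blast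

lemma bounded_borel_add_mult:
  assumes "u \<in> bounded_borel" "v \<in> bounded_borel"
  shows "(\<lambda>x. u x + c * v x) \<in> bounded_borel"
proof -
  obtain a b where a: "\<And>x. norm (u x) \<le> a" and b: "\<And>x. norm (v x) \<le> b"
    using assms unfolding bounded_borel_def bounded_iff by blast
  show ?thesis
  proof (rule bounded_borelI)
    show "(\<lambda>x. u x + c * v x) \<in> borel_measurable borel"
      using assms unfolding bounded_borel_def by auto
    show "norm (u x + c * v x) \<le> a + norm c * b" for x
      by (rule norm_triangle_le) (auto simp: norm_mult intro!: add_mono a mult_left_mono b)
  qed
qed

text \<open>A finite partition of the torus into small Borel pieces, written on the universal cover:
  by cocompactness the lattice translates of finitely many small balls cover everything, and a point
  belongs to the first family of translates that contains it.\<close>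

lemma periodic_partition:
  fixes \<Lambda> :: "(complex^'n) set"
  assumes L: "lattice \<Lambda>" and e: "0 < e"
  shows "\<exists>E xs. (\<forall>i. E i \<in> sets borel) \<and>
    (\<forall>x. \<exists>i<length xs. \<exists>l\<in>\<Lambda>. dist (x - l) (xs ! i) < e \<and> (\<forall>k. x \<in> E k \<longleftrightarrow> k = i))"
proof -
  obtain \<rho> where \<rho>: "\<And>x. \<exists>l\<in>\<Lambda>. norm (x - l) \<le> \<rho>" using lattice_cocompact[OF L] by blast
  obtain k where k: "finite k" "cball (0::complex^'n) \<rho> \<subseteq> (\<Union>x\<in>k. ball x e)"
  proof (rule compactE_image[of "cball (0::complex^'n) \<rho>" UNIV "\<lambda>x. ball x e"])
    show "cball 0 \<rho> \<subseteq> (\<Union>x\<in>(UNIV::(complex^'n) set). ball x e)"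
      using e centre_in_ball by blast
  qed (use that in auto)
  obtain xs where xs: "set xs = k" using finite_list[OF k(1)] by blast
  define U where "U = (\<lambda>i. if i < length xs then (\<Union>l\<in>\<Lambda>. ball (xs ! i + l) e) else {})"
  have oU: "open (U i)" for i unfolding U_def by auto
  define E where "E = (\<lambda>i. U i - (\<Union>i'<i. U i'))"
  have "E i \<in> sets borel" for i
    unfolding E_def using oU by (intro sets.Diff sets.finite_UN) auto
  moreover have "\<exists>i<length xs. \<exists>l\<in>\<Lambda>. dist (x - l) (xs ! i) < e \<and> (\<forall>k. x \<in> E k \<longleftrightarrow> k = i)" for x
  proof -
    obtain l where l: "l \<in> \<Lambda>" "norm (x - l) \<le> \<rho>" using \<rho> by blast
    then have "x - l \<in> cball 0 \<rho>" by simp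
    then have "x - l \<in> (\<Union>x\<in>k. ball x e)" using k(2) by blast
    then obtain i0 where "i0 < length xs" "dist (xs ! i0) (x - l) < e"
      unfolding xs[symmetric] by (auto simp: in_set_conv_nth)
    then have "x \<in> U i0" using l(1) unfolding U_def by (auto simp: dist_norm algebra_simps intro!: bexI[of _ l])
    then have LE: "x \<in> U (LEAST i. x \<in> U i)" "\<And>k. k < (LEAST i. x \<in> U i) \<Longrightarrow> x \<notin> U k"
      by (auto intro: LeastI dest: not_less_Least)
    let ?i = "LEAST i. x \<in> U i"
    have ii: "?i < length xs" using LE(1) unfolding U_def by (auto split: if_splits)
    then obtain l' where "l' \<in> \<Lambda>" "x \<in> ball (xs ! ?i + l') e" using LE(1) unfolding U_def by auto
    then have "\<exists>l\<in>\<Lambda>. dist (x - l) (xs ! ?i) < e" by (auto simp: dist_norm norm_minus_commute algebra_simps intro!: bexI[of _ l'])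
    moreover have "x \<in> E k \<longleftrightarrow> k = ?i" for k
    proof
      assume "x \<in> E k"
      then have "x \<in> U k" "\<not> ?i < k" using LE(1) unfolding E_def by auto
      moreover have "?i \<le> k" by (rule Least_le) fact
      ultimately show "k = ?i" by simp
    next
      assume "k = ?i"
      then show "x \<in> E k" using LE unfolding E_def by blast
    qed
    ultimately show ?thesis using ii by blast
  qed
  ultimately show ?thesis by blast
qed

text \<open>A selection argument: a diagonal subsequence converges on the countably many indicators
  of ever finer partitions. Step functions approximate a continuous periodic function uniformly, and
  the functionals are bounded by the sup norm uniformly in \<open>j\<close>.\<close>

lemma periodic_functionals_subsequence:
  fixes \<Lambda> :: "(complex^'n) set" and \<l> :: "nat \<Rightarrow> 'p \<Rightarrow> (complex^'n \<Rightarrow> complex) \<Rightarrow> complex"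
  assumes L: "lattice \<Lambda>" and P: "countable P"
    and lin: "\<And>j p u v c. p \<in> P \<Longrightarrow> u \<in> bounded_borel \<Longrightarrow> v \<in> bounded_borel \<Longrightarrow>
      \<l> j p (\<lambda>x. u x + c * v x) = \<l> j p u + c * \<l> j p v"
    and bd: "\<And>j p u b. p \<in> P \<Longrightarrow> u \<in> borel_measurable borel \<Longrightarrow> (\<And>x. norm (u x) \<le> b) \<Longrightarrow> norm (\<l> j p u) \<le> b"
  shows "\<exists>r. strict_mono r \<and> (\<forall>p\<in>P. \<forall>c. continuous_on UNIV c \<longrightarrow> (\<forall>l\<in>\<Lambda>. \<forall>x. c (x + l) = c x) \<longrightarrow>
    convergent (\<lambda>j. \<l> (r j) p c))"
proof -
  have "\<forall>m. \<exists>E xs. (\<forall>i. E i \<in> sets borel) \<and> (\<forall>x::complex^'n. \<exists>i<length xs. \<exists>l\<in>\<Lambda>.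
      dist (x - l) (xs ! i) < 1 / (real m + 1) \<and> (\<forall>k. x \<in> E k \<longleftrightarrow> k = i))"
    by (intro allI periodic_partition[OF L]) auto
  then obtain E where "\<forall>m. \<exists>xs. (\<forall>i. E m i \<in> sets borel) \<and> (\<forall>x::complex^'n. \<exists>i<length xs. \<exists>l\<in>\<Lambda>.
      dist (x - l) (xs ! i) < 1 / (real m + 1) \<and> (\<forall>k. x \<in> E m k \<longleftrightarrow> k = i))" unfolding choice_iff by blast
  then obtain xs where "\<forall>m. (\<forall>i. E m i \<in> sets borel) \<and> (\<forall>x::complex^'n. \<exists>i<length (xs m). \<exists>l\<in>\<Lambda>.
      dist (x - l) (xs m ! i) < 1 / (real m + 1) \<and> (\<forall>k. x \<in> E m k \<longleftrightarrow> k = i))" unfolding choice_iff by blast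
  then have Eb: "\<And>m i. E m i \<in> sets borel" and part: "\<And>m x. \<exists>i<length (xs m). \<exists>l\<in>\<Lambda>.
      dist (x - l) (xs m ! i) < 1 / (real m + 1) \<and> (\<forall>k. x \<in> E m k \<longleftrightarrow> k = i)" by blast+
  have ind_meas: "(indicator (E m i) :: complex^'n \<Rightarrow> complex) \<in> borel_measurable borel" for m i
    using Eb by (intro borel_measurable_indicator)
  have ind_le: "norm (indicator (E m i) x :: complex) \<le> 1" for m i x by (simp add: indicator_def)
  have ind_bb: "(indicator (E m i) :: complex^'n \<Rightarrow> complex) \<in> bounded_borel" for m i
    by (rule bounded_borelI[OF ind_meas ind_le])
  \<comment> \<open>Partition, piece and label of the functional form a countable index set, so one
    diagonal choice serves them all.\<close>
  define S where "S = (UNIV :: (nat \<times> nat) set) \<times> P"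
  have cS: "countable S" unfolding S_def using P by auto
  define h where "h = (\<lambda>j ((m, i), p). \<l> j p (indicator (E m i)))"
  have hb: "norm (h j x) \<le> 1" if "x \<in> S" for j x
    using that bd[OF _ ind_meas ind_le] unfolding h_def S_def by auto
  obtain r where r: "strict_mono (r::nat\<Rightarrow>nat)" "\<And>x. x \<in> S \<Longrightarrow> \<exists>l. (\<lambda>j. h (r j) x) \<longlonglongrightarrow> l"
    by (rule function_convergent_subsequence[of S h 1, OF cS hb]) blast+
  have conv: "convergent (\<lambda>j. \<l> (r j) p (indicator (E m i)))" if "p \<in> P" for p m i
    using r(2)[of "((m, i), p)"] that unfolding h_def S_def convergent_def by simp
  have "convergent (\<lambda>j. \<l> (r j) p c)" if p: "p \<in> P" and c: "continuous_on UNIV c" and per: "\<And>l x. l \<in> \<Lambda> \<Longrightarrow> c (x + l) = c x"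
    for p c
  proof -
    have cbb: "c \<in> bounded_borel"
    proof -
      have cm: "c \<in> borel_measurable borel" using c by (rule borel_measurable_continuous_onI)
      have "\<exists>b. \<forall>x. norm (c x) \<le> b" by (rule periodic_bounded[OF L c per]) blast+
      then show ?thesis using bounded_borelI[OF cm] by blast
    qed
    have uc: "uniformly_continuous_on UNIV c" by (rule periodic_uniformly_continuous[OF L c per])
    \<comment> \<open>Step functions with the value of \<open>c\<close> at the centre of each piece.
      The truncation at \<open>n\<close> is there for the induction; the full sum has
      \<open>n = length (xs m)\<close>.\<close>
    define cc where "cc = (\<lambda>m n x. \<Sum>i<n. c (xs m ! i) * (indicator (E m i) x :: complex))"
    have cc: "cc m n \<in> bounded_borel \<and> (\<forall>j. \<l> j p (cc m n) = (\<Sum>i<n. c (xs m ! i) * \<l> j p (indicator (E m i))))" for m n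
    proof (induction n)
      case 0
      have "norm (\<l> j p (\<lambda>x. 0)) \<le> 0" for j by (rule bd[OF p]) auto
      moreover have "(\<lambda>x. 0 :: complex) \<in> bounded_borel" by (rule bounded_borelI[of _ 0]) auto
      ultimately show ?case unfolding cc_def by simp
    next
      case (Suc n)
      have "cc m (Suc n) = (\<lambda>x. cc m n x + c (xs m ! n) * indicator (E m n) x)"
        by (rule ext) (simp only: cc_def sum.lessThan_Suc)
      then show ?case using Suc lin[OF p _ ind_bb] bounded_borel_add_mult[OF _ ind_bb] by simp
    qed
    have "Cauchy (\<lambda>j. \<l> (r j) p c)"
      unfolding Cauchy_def
    proof (intro allI impI)
      fix e :: real assume e: "e > 0"
      then obtain d where d: "d > 0" "\<And>x x'. dist x' x < d \<Longrightarrow> dist (c x') (c x) < e / 3"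
        using uniformly_continuous_onE[OF uc, of "e / 3"] by auto
      obtain m where m: "1 / (real m + 1) < d"
        using reals_Archimedean[OF d(1)] by (auto simp: inverse_eq_divide add.commute)
      let ?cm = "cc m (length (xs m))"
      have near: "norm (c x + (-1) * ?cm x) \<le> e / 3" for x
      proof -
        obtain i l where i: "i < length (xs m)" "l \<in> \<Lambda>" "dist (x - l) (xs m ! i) < 1 / (real m + 1)"
          "\<And>k. x \<in> E m k \<longleftrightarrow> k = i" using part[of m x] by blast
        have "?cm x = (\<Sum>k<length (xs m). if k = i then c (xs m ! i) else 0)"
          unfolding cc_def by (rule sum.cong) (auto simp: indicator_def i(4))
        also have "\<dots> = c (xs m ! i)" using i(1) by simp
        finally have "norm (c x + (-1) * ?cm x) = dist (c (x - l)) (c (xs m ! i))"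
          using per[OF i(2), of "x - l"] by (simp add: dist_norm)
        then show ?thesis using d(2)[of "x - l" "xs m ! i"] i(3) m by simp
      qed
      have close: "dist (\<l> j p c) (\<l> j p ?cm) \<le> e / 3" for j
      proof -
        have "norm (\<l> j p (\<lambda>x. c x + (-1) * ?cm x)) \<le> e / 3"
          using bounded_borel_add_mult[OF cbb, of ?cm "-1"] cc near unfolding bounded_borel_def
          by (intro bd[OF p]) auto
        then show ?thesis using lin[OF p cbb, of ?cm j "-1"] cc by (simp add: dist_norm)
      qed
      have "convergent (\<lambda>j. \<l> (r j) p ?cm)"
        using cc[of m "length (xs m)"] by (simp add: convergent_sum convergent_mult convergent_const conv[OF p])
      then have Cm: "Cauchy (\<lambda>j. \<l> (r j) p ?cm)" by (rule convergent_Cauchy)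
      obtain M where M: "\<And>j k. j \<ge> M \<Longrightarrow> k \<ge> M \<Longrightarrow> dist (\<l> (r j) p ?cm) (\<l> (r k) p ?cm) < e / 3"
        using metric_CauchyD[OF Cm, of "e / 3"] e by auto
      have "dist (\<l> (r j) p c) (\<l> (r k) p c) < e" if "j \<ge> M" "k \<ge> M" for j k
      proof -
        have "dist (\<l> (r k) p ?cm) (\<l> (r k) p c) \<le> e / 3"
          using close[of "r k"] by (subst dist_commute)
        then show ?thesis
          using M[OF that] close[of "r j"]
            dist_triangle[of "\<l> (r j) p c" "\<l> (r k) p c" "\<l> (r j) p ?cm"]
            dist_triangle[of "\<l> (r j) p ?cm" "\<l> (r k) p c" "\<l> (r k) p ?cm"]
          by linarith
      qed
      then show "\<exists>M. \<forall>m\<ge>M. \<forall>n\<ge>M. dist (\<l> (r m) p c) (\<l> (r n) p c) < e" by blast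
    qed
    then show ?thesis by (rule Cauchy_convergent)
  qed
  then show ?thesis using r(1) by blast
qed

text \<open>In the standard basis a pairing is a finite sum of functionals of the coefficients.
  After normalisation each is bounded by the sup norm, since a coordinate of \<open>G\<close> times
  one of \<open>\<i> *s G\<close> is at most the area density. Selection then yields one subsequence
  for all forms.\<close>

lemma generates_exists:
  fixes \<Lambda> :: "(complex^'n) set"
  assumes L: "lattice \<Lambda>" and disc: "\<And>j. holomorphic_disc \<Lambda> (F j) (z j) (R j)"
    and nc: "\<And>j. \<not> F j constant_on cball (z j) (R j)"
    and ratio: "(\<lambda>j. pairing_length nv \<Lambda> (F j) (z j) (R j) / pairing_area nv \<Lambda> (F j) (z j) (R j)) \<longlonglongrightarrow> 0"
  shows "\<exists>T. generates nv \<Lambda> F z R T"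
proof -
  let ?A = "\<lambda>j. pairing_area nv \<Lambda> (F j) (z j) (R j)"
  have "\<forall>j. \<exists>f G. disc_lift \<Lambda> (F j) (z j) (R j) f G \<and> 0 < ?A j"
    using nonconstant_disc_lift[OF L disc nc] by blast
  then obtain f G where fG: "\<And>j. disc_lift \<Lambda> (F j) (z j) (R j) (f j) (G j)" and pos: "\<And>j. 0 < ?A j"
    unfolding choice_iff by blast
  have "\<forall>j. \<exists>\<mu>. pairing_measure nv (z j) (R j) \<mu>"
    using pairing_measure_exists disc_lift_continuous(4)[OF fG] by blast
  then obtain \<mu> where \<mu>: "\<And>j. pairing_measure nv (z j) (R j) (\<mu> j)" unfolding choice_iff by blast
  note c = disc_lift_continuous[OF fG]
  have sets: "sets (\<mu> j) = sets borel" for j using \<mu>[of j] unfolding pairing_measure_def by blast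
  \<comment> \<open>Cut off to the disc, so that composition with it is Borel on the plane; the
    weight \<open>g\<close> vanishes outside, so the integrals are unchanged.\<close>
  define ff where "ff = (\<lambda>j w. indicator (ball (z j) (R j)) w *\<^sub>R f j w)"
  have ffm: "ff j \<in> borel_measurable borel" for j
    unfolding ff_def by (rule borel_measurable_continuous_on_indicator[OF _ c(1)]) simp
  define g where "g = (\<lambda>j (e, e') w. indicator (ball (z j) (R j)) w *\<^sub>R ((G j w \<bullet> e) * ((\<i> *s G j w) \<bullet> e')))"
  have gi: "integrable (\<mu> j) (g j p)" for j p
    unfolding g_def split_beta
    by (intro pairing_measure_integrable[OF \<mu>] continuous_intros c
        bounded_linear.continuous_on[OF bounded_linear_smult_right])
  define \<l> :: "nat \<Rightarrow> (complex^'n) \<times> (complex^'n) \<Rightarrow> (complex^'n \<Rightarrow> complex) \<Rightarrow> complex"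
    where "\<l> = (\<lambda>j p u. (\<integral>w. g j p w *\<^sub>R u (ff j w) \<partial>\<mu> j) / of_real (?A j))"
  let ?P = "(Basis :: (complex^'n) set) \<times> (Basis :: (complex^'n) set)"
  have um: "(\<lambda>w. u (ff j w)) \<in> borel_measurable (\<mu> j)" if "u \<in> borel_measurable borel" for u :: "complex^'n \<Rightarrow> complex" and j
    unfolding measurable_cong_sets[OF sets refl] by (rule measurable_compose[OF ffm that])
  have ui: "integrable (\<mu> j) (\<lambda>w. g j p w *\<^sub>R u (ff j w))" if u: "u \<in> bounded_borel" for u j p
  proof -
    obtain b where b: "\<And>x. norm (u x) \<le> b" using u unfolding bounded_borel_def bounded_iff by blast
    show ?thesis
    proof (rule Bochner_Integration.integrable_bound)
      show "integrable (\<mu> j) (\<lambda>w. b * g j p w)" using gi by simp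
      show "(\<lambda>w. g j p w *\<^sub>R u (ff j w)) \<in> borel_measurable (\<mu> j)"
        using u gi[of j p] um unfolding bounded_borel_def by (intro borel_measurable_scaleR) auto
      show "AE w in \<mu> j. norm (g j p w *\<^sub>R u (ff j w)) \<le> norm (b * g j p w)"
      proof (rule AE_I2)
        fix w
        have "norm (u (ff j w)) \<le> \<bar>b\<bar>" using b[of "ff j w"] by linarith
        from mult_left_mono[OF this, of "\<bar>g j p w\<bar>"]
        show "norm (g j p w *\<^sub>R u (ff j w)) \<le> norm (b * g j p w)"
          by (simp add: abs_mult mult.commute)
      qed
    qed
  qed
  have lin: "\<l> j p (\<lambda>x. u x + d * v x) = \<l> j p u + d * \<l> j p v"
    if "u \<in> bounded_borel" "v \<in> bounded_borel" for j p u v d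
  proof -
    have "(\<integral>w. g j p w *\<^sub>R (u (ff j w) + d * v (ff j w)) \<partial>\<mu> j) =
        (\<integral>w. g j p w *\<^sub>R u (ff j w) + d * (g j p w *\<^sub>R v (ff j w)) \<partial>\<mu> j)"
      by (rule Bochner_Integration.integral_cong[OF refl]) (simp add: scaleR_add_right)
    also have "\<dots> = (\<integral>w. g j p w *\<^sub>R u (ff j w) \<partial>\<mu> j) + (\<integral>w. d * (g j p w *\<^sub>R v (ff j w)) \<partial>\<mu> j)"
      by (rule Bochner_Integration.integral_add[OF ui[OF that(1)] integrable_mult_right[OF ui[OF that(2)]]])
    also have "(\<integral>w. d * (g j p w *\<^sub>R v (ff j w)) \<partial>\<mu> j) = d * (\<integral>w. g j p w *\<^sub>R v (ff j w) \<partial>\<mu> j)"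
      by (rule integral_mult_right_zero)
    finally show ?thesis unfolding \<l>_def by (simp add: add_divide_distrib)
  qed
  have bd: "norm (\<l> j p u) \<le> b"
    if p: "p \<in> ?P" and u: "u \<in> borel_measurable borel" and b: "\<And>x. norm (u x) \<le> b" for j p u b
  proof -
    have b0: "0 \<le> b" using b norm_ge_zero order_trans by blast
    have "norm (\<integral>w. g j p w *\<^sub>R u (ff j w) \<partial>\<mu> j) \<le> (\<integral>w. b * (indicator (ball (z j) (R j)) w *\<^sub>R (norm (G j w))\<^sup>2) \<partial>\<mu> j)"
    proof (rule order_trans[OF integral_norm_bound integral_mono'])
      show "integrable (\<mu> j) (\<lambda>w. b * (indicator (ball (z j) (R j)) w *\<^sub>R (norm (G j w))\<^sup>2))"
        by (intro integrable_mult_right pairing_measure_integrable[OF \<mu>] continuous_intros c)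
      fix w
      obtain e e' where p': "p = (e, e')" "e \<in> Basis" "e' \<in> Basis" using p by auto
      have "\<bar>G j w \<bullet> e\<bar> \<le> norm (G j w)" "\<bar>(\<i> *s G j w) \<bullet> e'\<bar> \<le> norm (G j w)"
        using Basis_le_norm[OF p'(2), of "G j w"] Basis_le_norm[OF p'(3), of "\<i> *s G j w"] by (simp_all add: norm_smult_vec)
      then have "\<bar>G j w \<bullet> e\<bar> * \<bar>(\<i> *s G j w) \<bullet> e'\<bar> \<le> norm (G j w) * norm (G j w)" by (intro mult_mono) auto
      then have "(\<bar>G j w \<bullet> e\<bar> * \<bar>(\<i> *s G j w) \<bullet> e'\<bar>) * norm (u (ff j w)) \<le> (norm (G j w) * norm (G j w)) * b"
        by (rule mult_mono[OF _ b]) auto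
      then show "norm (g j p w *\<^sub>R u (ff j w)) \<le> b * (indicator (ball (z j) (R j)) w *\<^sub>R (norm (G j w))\<^sup>2)"
        by (simp add: g_def p' abs_mult indicator_def power2_eq_square mult_ac)
      show "0 \<le> b * (indicator (ball (z j) (R j)) w *\<^sub>R (norm (G j w))\<^sup>2)" using b0 by (simp add: indicator_def)
    qed
    also have "\<dots> = b * ?A j" unfolding disc_lift_pairings(1)[OF L fG \<mu>] by simp
    finally show ?thesis using pos[of j] unfolding \<l>_def by (simp add: norm_divide divide_le_eq)
  qed
  have cP: "countable ?P" by (intro countable_finite finite_cartesian_product finite_Basis)
  have "\<exists>r. strict_mono r \<and> (\<forall>p\<in>?P. \<forall>c. continuous_on UNIV c \<longrightarrow> (\<forall>l\<in>\<Lambda>. \<forall>x. c (x + l) = c x) \<longrightarrow>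
      convergent (\<lambda>j. \<l> (r j) p c))"
  proof (rule periodic_functionals_subsequence[OF L cP])
    show "\<l> j p (\<lambda>x. u x + d * v x) = \<l> j p u + d * \<l> j p v"
      if "p \<in> ?P" "u \<in> bounded_borel" "v \<in> bounded_borel" for j p u v d
      by (rule lin[OF that(2,3)])
    show "norm (\<l> j p u) \<le> b"
      if "p \<in> ?P" "u \<in> borel_measurable borel" "\<And>x. norm (u x) \<le> b" for j p u b
      by (rule bd[OF that])
  qed
  then obtain r where r: "strict_mono r" and conv0: "\<forall>p\<in>?P. \<forall>c. continuous_on UNIV c \<longrightarrow>
      (\<forall>l\<in>\<Lambda>. \<forall>x. c (x + l) = c x) \<longrightarrow> convergent (\<lambda>j. \<l> (r j) p c)" by (elim exE conjE)
  have conv: "convergent (\<lambda>j. \<l> (r j) p c)"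
    if "p \<in> ?P" "continuous_on UNIV c" "\<And>l x. l \<in> \<Lambda> \<Longrightarrow> c (x + l) = c x" for p c
    using conv0 that by blast
  define N where "N = (\<lambda>j \<phi>. pairing_int nv \<Lambda> (F j) (z j) (R j) \<phi> / of_real (?A j))"
  define T where "T = (\<lambda>\<phi>. lim (\<lambda>j. N (r j) \<phi>))"
  have cb: "continuous_on UNIV (\<lambda>x. \<phi> (proj \<Lambda> x) [e, e'])" "(\<lambda>x. \<phi> (proj \<Lambda> x) [e, e']) \<in> bounded_borel"
    if \<phi>: "smooth_form \<Lambda> 2 \<phi>" for \<phi> :: "'n form" and e e'
  proof -
    show cont: "continuous_on UNIV (\<lambda>x. \<phi> (proj \<Lambda> x) [e, e'])"
      by (rule smooth_continuous[OF smooth_form_smooth[OF \<phi>]]) simp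
    obtain K where "\<And>x. norm (\<phi> (proj \<Lambda> x) [e, e']) \<le> K"
      using form_coeff_bounded[OF L \<phi>, of "[e, e']"] by auto
    then show "(\<lambda>x. \<phi> (proj \<Lambda> x) [e, e']) \<in> bounded_borel"
      by (intro bounded_borelI borel_measurable_continuous_onI cont)
  qed
  have N_eq: "N j \<phi> = (\<Sum>e\<in>Basis. \<Sum>e'\<in>Basis. \<l> j (e, e') (\<lambda>x. \<phi> (proj \<Lambda> x) [e, e']))"
    if \<phi>: "smooth_form \<Lambda> 2 \<phi>" for \<phi> j
  proof -
    have "disc_pullback \<Lambda> (f j) (G j) (z j) (R j) \<phi> w =
        (\<Sum>e\<in>Basis. \<Sum>e'\<in>Basis. g j (e, e') w *\<^sub>R \<phi> (proj \<Lambda> (ff j w)) [e, e'])" for w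
      unfolding disc_pullback_def form2_expand[OF \<phi>, of "f j w" "G j w" "\<i> *s G j w"]
      by (cases "w \<in> ball (z j) (R j)") (simp_all add: g_def ff_def)
    then have eq: "disc_pullback \<Lambda> (f j) (G j) (z j) (R j) \<phi> =
        (\<lambda>w. \<Sum>e\<in>Basis. \<Sum>e'\<in>Basis. g j (e, e') w *\<^sub>R \<phi> (proj \<Lambda> (ff j w)) [e, e'])" by (rule ext)
    show ?thesis
      unfolding N_def pairing_int_measure(1)[OF L fG \<phi> \<mu>] \<l>_def eq
      by (simp add: Bochner_Integration.integral_sum Bochner_Integration.integrable_sum ui[OF cb(2)[OF \<phi>]] sum_divide_distrib)
  qed
  have N_lim: "(\<lambda>j. N (r j) \<phi>) \<longlonglongrightarrow> T \<phi>" if \<phi>: "smooth_form \<Lambda> 2 \<phi>" for \<phi>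
  proof -
    have "convergent (\<lambda>j. \<l> (r j) (e, e') (\<lambda>x. \<phi> (proj \<Lambda> x) [e, e']))" if "e \<in> Basis" "e' \<in> Basis" for e e'
      using that by (intro conv cb[OF \<phi>]) (auto simp: proj_add[OF L])
    then have "convergent (\<lambda>j. N (r j) \<phi>)" unfolding N_eq[OF \<phi>] by (intro convergent_sum)
    then show ?thesis unfolding T_def by (simp add: convergent_LIMSEQ_iff)
  qed
  have N_add: "N j (\<lambda>p vs. \<phi> p vs + \<psi> p vs) = N j \<phi> + N j \<psi>"
    if "smooth_form \<Lambda> 2 \<phi>" "smooth_form \<Lambda> 2 \<psi>" for \<phi> \<psi> j
    using lin[OF cb(2)[OF that(1)] cb(2)[OF that(2)], where d=1]
    by (simp add: N_eq that smooth_form_add sum.distrib)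
  have zbb: "(\<lambda>x. 0) \<in> (bounded_borel :: (complex^'n \<Rightarrow> complex) set)" by (rule bounded_borelI[of _ 0]) auto
  have lin0: "\<l> j p (\<lambda>x. d * v x) = d * \<l> j p v" if "v \<in> bounded_borel" for j p v d
  proof -
    have "\<l> j p (\<lambda>x. 0) = 0" by (simp add: \<l>_def)
    then show ?thesis using lin[OF zbb that, of j p d] by simp
  qed
  have N_mult: "N j (\<lambda>p vs. d * \<phi> p vs) = d * N j \<phi>" if "smooth_form \<Lambda> 2 \<phi>" for \<phi> d j
    by (simp add: N_eq that smooth_form_cmult sum_distrib_left lin0[OF cb(2)[OF that]])
  have N_bound: "norm (N j \<phi>) \<le> (\<Sum>e\<in>(Basis::(complex^'n) set). \<Sum>e'\<in>(Basis::(complex^'n) set). b)"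
    if \<phi>: "smooth_form \<Lambda> 2 \<phi>" and b: "\<And>e e' x. e \<in> Basis \<Longrightarrow> e' \<in> Basis \<Longrightarrow> norm (\<phi> (proj \<Lambda> x) [e, e']) \<le> b" for \<phi> b j
    unfolding N_eq[OF \<phi>]
  proof (intro sum_norm_le bd)
    show "(\<lambda>x. \<phi> (proj \<Lambda> x) [e, e']) \<in> borel_measurable borel" for e e'
      using cb(2)[OF \<phi>] unfolding bounded_borel_def by blast
  qed (use b in auto)
  have T2: "current \<Lambda> 2 T"
    unfolding current_def
  proof (intro conjI allI impI)
    fix \<phi> \<psi> :: "'n form" assume a: "smooth_form \<Lambda> 2 \<phi> \<and> smooth_form \<Lambda> 2 \<psi>"
    then have "(\<lambda>j. N (r j) \<phi> + N (r j) \<psi>) \<longlonglongrightarrow> T (\<lambda>p vs. \<phi> p vs + \<psi> p vs)"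
      using N_lim[OF smooth_form_add, of \<phi> \<psi>] N_add by simp
    moreover have "(\<lambda>j. N (r j) \<phi> + N (r j) \<psi>) \<longlonglongrightarrow> T \<phi> + T \<psi>" using a by (intro tendsto_intros N_lim) auto
    ultimately show "T (\<lambda>p vs. \<phi> p vs + \<psi> p vs) = T \<phi> + T \<psi>" by (rule LIMSEQ_unique)
  next
    fix \<phi> :: "'n form" and d assume a: "smooth_form \<Lambda> 2 \<phi>"
    then have "(\<lambda>j. d * N (r j) \<phi>) \<longlonglongrightarrow> T (\<lambda>p vs. d * \<phi> p vs)"
      using N_lim[OF smooth_form_cmult, of \<phi> d] N_mult by simp
    moreover have "(\<lambda>j. d * N (r j) \<phi>) \<longlonglongrightarrow> d * T \<phi>" using a by (intro tendsto_intros N_lim) auto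
    ultimately show "T (\<lambda>p vs. d * \<phi> p vs) = d * T \<phi>" by (rule LIMSEQ_unique)
  next
    fix \<phi> :: "nat \<Rightarrow> 'n form" and \<psi>
    assume "(\<forall>m. smooth_form \<Lambda> 2 (\<phi> m)) \<and> smooth_form \<Lambda> 2 \<psi> \<and> forms_converge \<Lambda> 2 \<phi> \<psi>"
    then have \<phi>: "\<And>m. smooth_form \<Lambda> 2 (\<phi> m)" and \<psi>: "smooth_form \<Lambda> 2 \<psi>" and fc: "forms_converge \<Lambda> 2 \<phi> \<psi>" by auto
    \<comment> \<open>The number of pairs of basis vectors: coefficients within \<open>b\<close> of
      each other give values within \<open>b * B\<close>.\<close>
    define B where "B = (\<Sum>e\<in>(Basis::(complex^'n) set). \<Sum>e'\<in>(Basis::(complex^'n) set). 1 :: real)"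
    have B: "B > 0" unfolding B_def by (intro sum_pos) auto
    show "(\<lambda>m. T (\<phi> m)) \<longlonglongrightarrow> T \<psi>"
      unfolding tendsto_iff
    proof (intro allI impI)
      fix \<epsilon> :: real assume \<epsilon>: "\<epsilon> > 0"
      define b where "b = \<epsilon> / (2 * B)"
      have b: "b > 0" using \<epsilon> B by (simp add: b_def)
      have "\<forall>\<^sub>F m in sequentially. \<forall>x. dist (\<phi> m (proj \<Lambda> x) [e, e']) (\<psi> (proj \<Lambda> x) [e, e']) < b" for e e'
      proof -
        have "uniform_limit UNIV (\<lambda>m. dir_derivs [] (\<lambda>x. \<phi> m (proj \<Lambda> x) [e, e'])) (dir_derivs [] (\<lambda>x. \<psi> (proj \<Lambda> x) [e, e'])) sequentially"
          using fc[unfolded forms_converge_def, rule_format, of "[e, e']" "[]"] by simp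
        from uniform_limitD[OF this b] show ?thesis by simp
      qed
      then have "\<forall>\<^sub>F m in sequentially. \<forall>e\<in>Basis. \<forall>e'\<in>Basis. \<forall>x.
          dist (\<phi> m (proj \<Lambda> x) [e, e']) (\<psi> (proj \<Lambda> x) [e, e']) < b"
        by (intro eventually_ball_finite ballI) auto
      then show "\<forall>\<^sub>F m in sequentially. dist (T (\<phi> m)) (T \<psi>) < \<epsilon>"
      proof eventually_elim
        case (elim m)
        have sd: "smooth_form \<Lambda> 2 (\<lambda>p vs. \<phi> m p vs + (-1) * \<psi> p vs)"
          by (rule smooth_form_add[OF \<phi> smooth_form_cmult[OF \<psi>]])
        have Nd: "norm (N (r j) (\<phi> m) - N (r j) \<psi>) \<le> b * B" for j
        proof -
          have a1: "N (r j) (\<lambda>p vs. \<phi> m p vs + (-1) * \<psi> p vs) = N (r j) (\<phi> m) + (-1) * N (r j) \<psi>"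
            using N_add[OF \<phi> smooth_form_cmult[OF \<psi>, of "-1"], of "r j" m] N_mult[OF \<psi>, of "r j" "-1"] by simp
          have a2: "norm (N (r j) (\<lambda>p vs. \<phi> m p vs + (-1) * \<psi> p vs)) \<le> (\<Sum>e\<in>(Basis::(complex^'n) set). \<Sum>e'\<in>(Basis::(complex^'n) set). b)"
            by (rule N_bound[OF sd]) (use elim in \<open>simp add: dist_norm less_imp_le\<close>)
          have a3: "(\<Sum>e\<in>(Basis::(complex^'n) set). \<Sum>e'\<in>(Basis::(complex^'n) set). b) = b * B"
            unfolding B_def by (simp add: mult_ac)
          show ?thesis using a2 unfolding a1 a3 by simp
        qed
        have "norm (T (\<phi> m) - T \<psi>) \<le> b * B"
          by (rule LIMSEQ_le_const2[OF tendsto_norm[OF tendsto_diff[OF N_lim[OF \<phi>] N_lim[OF \<psi>]]]]) (use Nd in blast)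
        also have "b * B = \<epsilon> / 2" using B by (simp add: b_def)
        finally show ?case using \<epsilon> by (simp add: dist_norm)
      qed
    qed
  qed
  \<comment> \<open>Holomorphic discs test a form only on pairs \<open>v, \<i> *s v\<close>, where
    forms of type (2,0) and (0,2) are 0.\<close>
  have vanish: "T \<phi> = 0" if \<phi>: "smooth_form \<Lambda> 2 \<phi>" and zero: "\<And>x v. \<phi> (proj \<Lambda> x) [v, \<i> *s v] = 0" for \<phi>
  proof -
    have "N j \<phi> = 0" for j
      unfolding N_def pairing_int_measure(1)[OF L fG \<phi> \<mu>] disc_pullback_def zero by simp
    then show ?thesis using N_lim[OF \<phi>] by (simp add: LIMSEQ_const_iff)
  qed
  have "T \<phi> = 0" if "form20 \<Lambda> \<phi> \<or> form02 \<Lambda> \<phi>" for \<phi>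
  proof (rule vanish)
    show "smooth_form \<Lambda> 2 \<phi>" using that unfolding form20_def form02_def by blast
    show "\<phi> (proj \<Lambda> x) [v, \<i> *s v] = 0" for x v
      using that proj_in_torus[of \<Lambda> x] unfolding form20_def form02_def
      by (elim disjE conjE ballE[of _ _ "proj \<Lambda> x"] exE) (simp_all add: mult_ac)
  qed
  then have T11: "current11 \<Lambda> T" unfolding current11_def using T2 by blast
  have "((\<lambda>j. N j \<phi>) \<circ> r) \<longlonglongrightarrow> T \<phi>" if "form11 \<Lambda> \<phi>" for \<phi>
    using N_lim[of \<phi>] that unfolding form11_def by (simp add: o_def)
  then have "generates nv \<Lambda> F z R T"
    unfolding generates_def using disc nc ratio T11 r unfolding N_def by blast
  then show ?thesis by blast
qed

section \<open>Construction of the entire curve from blocks of monomials\<close>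

section \<open>Monomials on discs\<close>

lemma integral_cis:
  fixes k :: int
  shows "((\<lambda>s. cis (2 * pi * of_int k * s)) has_integral (if k = 0 then 1 else 0)) {0..1}"
proof (cases "k = 0")
  case True
  then show ?thesis using has_integral_const_real[of "1::complex" 0 1] by simp
next
  case False
  let ?c = "2 * of_real pi * \<i> * of_int k :: complex"
  have c: "?c \<noteq> 0" using False by simp
  have d: "((\<lambda>s. exp (?c * of_real s) / ?c) has_vector_derivative exp (?c * of_real s)) (at s within {0..1})" for s
  proof -
    have "((\<lambda>w. exp (?c * w) / ?c) has_field_derivative exp (?c * of_real s)) (at (of_real s))"
      using c by (auto intro!: derivative_eq_intros)
    from has_vector_derivative_real_field[OF this] show ?thesis .
  qed
  have "((\<lambda>s. exp (?c * of_real s)) has_integral exp (?c * of_real 1) / ?c - exp (?c * of_real 0) / ?c) {0..1}"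
    by (rule fundamental_theorem_of_calculus) (use d in auto)
  moreover have "exp (?c * of_real 1) = 1"
    using exp_integer_2pi[of "of_int k"] by (simp add: mult_ac)
  moreover have "exp (?c * of_real s) = cis (2 * pi * of_int k * s)" for s
    by (simp add: cis_conv_exp mult_ac)
  ultimately show ?thesis using False by simp
qed

text \<open>Green's formula reduces the area integral to the mean of a character over the circle,
  which vanishes unless its frequency \<open>a - b\<close> is 0.\<close>

lemma disc_monomial_integral:
  assumes t: "0 < t"
  shows "(LINT w:ball 0 t|lborel. w ^ a * cnj w ^ b) =
    (if a = b then of_real (pi * t ^ (2 * a + 2) / (real a + 1)) else 0)"
proof -
  \<comment> \<open>With \<open>Q = \<i> * P\<close> the integrand in Green's formula is
    \<open>2 * \<i>\<close> times the antiholomorphic derivative of \<open>P\<close>;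
    \<open>c\<close> normalises it to the monomial.\<close>
  define c where "c = 1 / (2 * \<i> * of_nat (Suc b))"
  define P where "P = (\<lambda>w. c * (w ^ a * cnj w ^ Suc b))"
  define P' where "P' = (\<lambda>w h. c * (w ^ a * (of_nat (Suc b) * cnj h * cnj w ^ b) + of_nat a * h * w ^ (a - 1) * cnj w ^ Suc b))"
  have dc: "(cnj has_derivative cnj) (at w)" for w
    by (rule bounded_linear.has_derivative[OF bounded_linear_cnj has_derivative_ident])
  have dcp: "((\<lambda>x. cnj x ^ Suc b) has_derivative (\<lambda>h. of_nat (Suc b) * cnj h * cnj w ^ b)) (at w)" for w
    using has_derivative_power[OF dc[of w], of "Suc b"] unfolding diff_Suc_1 .
  have dP: "(P has_derivative P' w) (at w)" for w
    unfolding P_def P'_def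
    by (intro has_derivative_mult_right has_derivative_mult has_derivative_power[OF has_derivative_ident] dcp)
  have dQ: "((\<lambda>w. \<i> * P w) has_derivative (\<lambda>h. \<i> * P' w h)) (at w)" for w
    by (intro has_derivative_mult_right dP)
  have cP: "continuous_on (cball 0 t) (\<lambda>w. P' w \<i>)" and cQ: "continuous_on (cball 0 t) (\<lambda>w. \<i> * P' w 1)"
    unfolding P'_def by (intro continuous_intros)+
  have si: "set_integrable lborel (ball 0 t) g" if "continuous_on (cball 0 t) g" for g :: "complex \<Rightarrow> complex"
  proof -
    have "set_integrable lborel (cball 0 t) g"
      unfolding set_integrable_def by (rule borel_integrable_compact[OF compact_cball that])
    then show ?thesis by (rule set_integrable_subset) auto
  qed
  have eq: "\<i> * P' w 1 - P' w \<i> = w ^ a * cnj w ^ b" for w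
  proof -
    have "\<i> * P' w 1 - P' w \<i> = (c * (2 * \<i> * of_nat (Suc b))) * (w ^ a * cnj w ^ b)"
      unfolding P'_def by (simp add: algebra_simps del: of_nat_Suc)
    also have "c * (2 * \<i> * of_nat (Suc b)) = 1" unfolding c_def by (simp del: of_nat_Suc)
    finally show ?thesis by simp
  qed
  have "(LINT w:ball 0 t|lborel. w ^ a * cnj w ^ b) = (LINT w:ball 0 t|lborel. \<i> * P' w 1) - (LINT w:ball 0 t|lborel. P' w \<i>)"
    unfolding eq[symmetric] by (rule set_integral_diff(2)[OF si[OF cQ] si[OF cP]])
  then have I: "((\<lambda>s. (2 * pi * t * cos (2 * pi * s)) *\<^sub>R (\<i> * P (0 + of_real t * cis (2 * pi * s)))
      + (- 2 * pi * t * sin (2 * pi * s)) *\<^sub>R P (0 + of_real t * cis (2 * pi * s)))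
      has_integral (LINT w:ball 0 t|lborel. w ^ a * cnj w ^ b)) {0..1}"
    using has_integral_add[OF green_disc_dy[OF t dQ cQ] green_disc_dx[OF t dP cP]] by simp
  let ?k = "int a - int b"
  have pt: "(2 * pi * t * cos (2 * pi * s)) *\<^sub>R (\<i> * P (0 + of_real t * cis (2 * pi * s)))
      + (- 2 * pi * t * sin (2 * pi * s)) *\<^sub>R P (0 + of_real t * cis (2 * pi * s)) =
      (2 * of_real pi * \<i> * c * of_real (t ^ (a + b + 2))) * cis (2 * pi * of_int ?k * s)" for s
  proof -
    let ?\<theta> = "2 * pi * s"
    have "cis ?\<theta> * (cis ?\<theta> ^ a * cnj (cis ?\<theta>) ^ Suc b) = cis ?\<theta> * cis (real a * ?\<theta>) * cis (real (Suc b) * (- ?\<theta>))"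
      unfolding cis_cnj Complex.DeMoivre mult.assoc ..
    also have "\<dots> = cis (2 * pi * of_int ?k * s)"
      by (simp add: cis_mult algebra_simps)
    finally have k: "cis ?\<theta> * (cis ?\<theta> ^ a * cnj (cis ?\<theta>) ^ Suc b) = cis (2 * pi * of_int ?k * s)" .
    have p: "P (0 + of_real t * cis ?\<theta>) = c * of_real (t ^ (a + b + 1)) * (cis ?\<theta> ^ a * cnj (cis ?\<theta>) ^ Suc b)"
      unfolding P_def by (simp add: power_mult_distrib power_add mult_ac)
    have lin: "(2 * pi * t * cos ?\<theta>) *\<^sub>R (\<i> * p) + (- 2 * pi * t * sin ?\<theta>) *\<^sub>R p
        = (2 * of_real pi * of_real t * \<i>) * (cis ?\<theta> * p)" for p
      by (simp add: complex_eq_iff algebra_simps)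
    show ?thesis unfolding lin p k[symmetric] by (simp add: mult_ac)
  qed
  have "((\<lambda>s. (2 * of_real pi * \<i> * c * of_real (t ^ (a + b + 2))) * cis (2 * pi * of_int ?k * s)) has_integral
      (2 * of_real pi * \<i> * c * of_real (t ^ (a + b + 2))) * (if ?k = 0 then 1 else 0)) {0..1}"
    by (rule has_integral_mult_right[OF integral_cis])
  from has_integral_unique[OF I[unfolded pt] this]
  have val: "(LINT w:ball 0 t|lborel. w ^ a * cnj w ^ b) =
      (2 * of_real pi * \<i> * c) * of_real (t ^ (a + b + 2)) * (if ?k = 0 then 1 else 0)" .
  have "2 * of_real pi * \<i> * (1 / (2 * \<i> * x)) = of_real pi / x" if "x \<noteq> 0" for x
    using that by (simp add: field_simps)
  from this[of "of_nat (Suc b)"] have v2: "2 * of_real pi * \<i> * c = of_real (pi / (real b + 1))"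
    unfolding c_def by (simp add: add.commute)
  show ?thesis unfolding val v2 by (cases "a = b") (simp_all add: mult_2 del: of_real_power)
qed

lemma pairing_measure_integral:
  assumes \<mu>: "pairing_measure nv z R \<mu>" and m: "\<psi> \<in> borel_measurable borel" and B: "\<And>w. norm (\<psi> w) \<le> B"
  shows "disc_pairing nv z R \<psi> = (\<integral>w. \<psi> w \<partial>\<mu>)"
proof -
  have "\<forall>\<psi> B. \<psi> \<in> borel_measurable borel \<longrightarrow> (\<forall>w. norm (\<psi> w) \<le> B) \<longrightarrow> disc_pairing nv z R \<psi> = (\<integral>w. \<psi> w \<partial>\<mu>)"
    using \<mu> unfolding pairing_measure_def by (elim conjE)
  from this[rule_format, OF m B] show ?thesis .
qed

text \<open>The squared norm of the monomial of degree \<open>a\<close>. The Nevanlinna value is the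
  Ahlfors one integrated in \<open>dt/t\<close>, which brings a further factor
  \<open>2 * (a + 1)\<close> into the denominator.\<close>

definition monomial_mass :: "bool \<Rightarrow> real \<Rightarrow> nat \<Rightarrow> real" where
  "monomial_mass nv R a = (if nv then pi * R ^ (2 * a + 2) / (2 * (real a + 1)\<^sup>2)
     else pi * R ^ (2 * a + 2) / (real a + 1))"

lemma pairing_measure_monomial:
  assumes \<mu>: "pairing_measure nv 0 R \<mu>" and R: "0 < R"
  shows "(\<integral>w. indicator (ball 0 R) w *\<^sub>R (w ^ a * cnj w ^ b) \<partial>\<mu>) =
    (if a = b then of_real (monomial_mass nv R a) else 0)"
proof -
  let ?\<psi> = "\<lambda>w::complex. indicator (ball 0 R) w *\<^sub>R (w ^ a * cnj w ^ b)"
  have m: "?\<psi> \<in> borel_measurable borel"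
    by (intro borel_measurable_continuous_on_indicator continuous_intros) simp
  have B: "norm (?\<psi> w) \<le> R ^ a * R ^ b" for w
    using R by (auto simp: indicator_def norm_mult norm_power intro!: mult_mono power_mono)
  have eq: "(\<integral>w. ?\<psi> w \<partial>\<mu>) = disc_pairing nv 0 R ?\<psi>"
    by (rule pairing_measure_integral[OF \<mu> m B, symmetric])
  have inner: "(LINT w:ball 0 t|lborel. ?\<psi> w) = (LINT w:ball 0 t|lborel. w ^ a * cnj w ^ b)" if "t \<le> R" for t
    unfolding set_lebesgue_integral_def
    by (rule Bochner_Integration.integral_cong[OF refl]) (use that in \<open>auto simp: indicator_def\<close>)
  show ?thesis
  proof (cases nv)
    case False
    then show ?thesis
      unfolding eq disc_pairing_def using inner[of R] disc_monomial_integral[OF R, of a b] by (simp add: monomial_mass_def)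
  next
    case True
    have "disc_pairing nv 0 R ?\<psi> = (LINT t:{0<..<R}|lborel. (if a = b then of_real (pi * t ^ (2 * a + 1) / (real a + 1)) else 0))"
      unfolding disc_pairing_def if_P[OF True] set_lebesgue_integral_def[of _ "{0<..<R}"]
    proof (rule Bochner_Integration.integral_cong[OF refl])
      fix t
      show "indicator {0<..<R} t *\<^sub>R ((LINT w:ball 0 t|lborel. ?\<psi> w) / complex_of_real t) =
          indicator {0<..<R} t *\<^sub>R (if a = b then complex_of_real (pi * t ^ (2 * a + 1) / (real a + 1)) else 0)"
      proof (cases "t \<in> {0<..<R}")
        case True
        then show ?thesis using inner[of t] disc_monomial_integral[of t a b] by (auto simp: field_simps)
      qed simp
    qed
    also have "\<dots> = (if a = b then of_real (monomial_mass nv R a) else 0)"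
    proof (cases "a = b")
      case ab: True
      let ?F = "\<lambda>t. complex_of_real (pi * t ^ (2 * a + 2) / (2 * (real a + 1)\<^sup>2))"
      have "(LINT t:{0<..<R}|lborel. complex_of_real (pi * t ^ (2 * a + 1) / (real a + 1)))
          = (LBINT t=0..R. complex_of_real (pi * t ^ (2 * a + 1) / (real a + 1)))"
        using R by (simp add: interval_integral_Ioo zero_ereal_def)
      also have "\<dots> = ?F R - ?F 0"
        unfolding zero_ereal_def
      proof (rule interval_integral_FTC_finite)
        show "continuous_on {min 0 R..max 0 R} (\<lambda>t. complex_of_real (pi * t ^ (2 * a + 1) / (real a + 1)))"
          by (intro continuous_intros) auto
        show "(?F has_vector_derivative complex_of_real (pi * t ^ (2 * a + 1) / (real a + 1))) (at t within {min 0 R..max 0 R})" for t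
        proof -
          have "((\<lambda>t. pi * t ^ (2 * a + 2) / (2 * (real a + 1)\<^sup>2)) has_real_derivative
              pi * (real (2 * a + 2) * t ^ (2 * a + 1)) / (2 * (real a + 1)\<^sup>2)) (at t within {min 0 R..max 0 R})"
            using DERIV_cdivide[OF DERIV_cmult[OF DERIV_pow[of "2 * a + 2" t "{min 0 R..max 0 R}"], of pi], of "2 * (real a + 1)\<^sup>2"]
            by simp
          moreover have "pi * (real (2 * a + 2) * t ^ (2 * a + 1)) / (2 * (real a + 1)\<^sup>2) = pi * t ^ (2 * a + 1) / (real a + 1)"
            by (simp add: power2_eq_square divide_simps)
          ultimately show ?thesis
            by (intro has_vector_derivative_of_real) (simp add: has_real_derivative_iff_has_vector_derivative)
        qed
      qed
      also have "\<dots> = of_real (monomial_mass nv R a)" using True by (simp add: monomial_mass_def)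
      finally show ?thesis using ab by simp
    qed (simp add: set_lebesgue_integral_def)
    finally show ?thesis unfolding eq .
  qed
qed

section \<open>Blocks of monomials\<close>

text \<open>The difference is the sum of two rank one products, of \<open>a - b\<close> with
  \<open>a\<close> and of \<open>b\<close> with \<open>a - b\<close>, and the norm of such a product
  is the product of the norms.\<close>

lemma norm_outer_diff:
  fixes a b :: "complex^'n"
  shows "norm (outer a - outer b) \<le> norm (a - b) * (norm a + norm b)"
proof -
  define o2 :: "complex^'n \<Rightarrow> complex^'n \<Rightarrow> complex^'n^'n" where "o2 = (\<lambda>a b::complex^'n. \<chi> j k. a $ j * cnj (b $ k))"
  have n: "norm (o2 a b) = norm a * norm b" for a b
  proof -
    have "norm (o2 a b $ j) = cmod (a $ j) * norm b" for j
      unfolding o2_def by (simp add: norm_vec_def norm_mult L2_set_right_distrib)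
    then show ?thesis by (simp add: norm_vec_def[of "o2 a b"] norm_vec_def[of a] L2_set_left_distrib)
  qed
  have "outer a - outer b = o2 (a - b) a + o2 b (a - b)"
    by (simp add: outer_def o2_def vec_eq_iff algebra_simps)
  then have "norm (outer a - outer b) \<le> norm (o2 (a - b) a) + norm (o2 b (a - b))"
    using norm_triangle_ineq[of "o2 (a - b) a" "o2 b (a - b)"] by simp
  then show ?thesis by (simp add: n algebra_simps)
qed

text \<open>The real part of the trace. It sends the rank one matrix of a vector to its squared
  norm, so that convergence of areas follows from convergence of matrices.\<close>

definition retrace :: "complex^'n^'n \<Rightarrow> real" where
  "retrace M = (\<Sum>j\<in>UNIV. Re (M $ j $ j))"

lemma bounded_linear_retrace: "bounded_linear (retrace :: complex^'n^'n \<Rightarrow> real)"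
  unfolding linear_conv_bounded_linear[symmetric]
  by (rule linearI) (simp_all add: retrace_def sum.distrib sum_distrib_left)

lemma retrace_outer: "retrace (outer v) = (norm v)\<^sup>2"
proof -
  have "Re (x * cnj x) = (cmod x)\<^sup>2" for x unfolding complex_norm_square[symmetric] by simp
  then show ?thesis by (simp add: retrace_def outer_def norm_vec_def L2_set_def sum_nonneg)
qed

text \<open>A convex weight is absorbed into the unit vector through its square root.\<close>

lemma class_hull_decompose:
  assumes "H \<in> (class_hull :: (complex^'n^'n) set)"
  shows "\<exists>N (u :: nat \<Rightarrow> complex^'n). H = (\<Sum>l\<in>{1..N}. outer (u l)) \<and> (\<forall>l\<in>{1..N}. norm (u l) \<le> 1) \<and> retrace H = 1"
proof -
  obtain N c x where c: "\<forall>i\<in>{1::nat..N}. 0 \<le> c i \<and> x i \<in> outer ` sphere 0 1" "sum c {1..N} = 1"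
    "(\<Sum>i = 1..N. c i *\<^sub>R x i) = H"
    using assms unfolding class_hull_def convex_hull_indexed by blast
  have "\<forall>i\<in>{1..N}. \<exists>v::complex^'n. norm v = 1 \<and> x i = outer v"
  proof
    fix i assume "i \<in> {1..N}"
    then have "x i \<in> outer ` sphere 0 1" using c(1) by blast
    then show "\<exists>v::complex^'n. norm v = 1 \<and> x i = outer v" by auto
  qed
  then obtain v where v: "\<And>i. i \<in> {1..N} \<Longrightarrow> norm (v i :: complex^'n) = 1 \<and> x i = outer (v i)" by metis
  define u where "u = (\<lambda>i. sqrt (c i) *\<^sub>R v i)"
  have ou: "outer (u i) = c i *\<^sub>R x i" if "i \<in> {1..N}" for i
    using v[OF that] c(1) that by (simp add: u_def outer_scaleR)
  have "c i \<le> 1" if "i \<in> {1..N}" for i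
    using member_le_sum[of i "{1..N}" c] that c by auto
  then have "norm (u i) \<le> 1" if "i \<in> {1..N}" for i
    using v[OF that] c(1) that by (simp add: u_def)
  moreover have "retrace H = (\<Sum>i\<in>{1..N}. c i * retrace (x i))"
    unfolding c(3)[symmetric] linear_sum[OF bounded_linear.linear[OF bounded_linear_retrace]]
    by (simp add: linear_cmul[OF bounded_linear.linear[OF bounded_linear_retrace]])
  moreover have "\<dots> = 1" using v c(2) by (simp add: retrace_outer)
  moreover have "H = (\<Sum>l\<in>{1..N}. outer (u l))" using c(3) ou by simp
  ultimately show ?thesis by (intro exI[of _ N] exI[of _ u]) auto
qed

text \<open>The coefficients make all monomials of a block equally large on the circle of radius \<open>R\<close>;
  the factor \<open>2 ^ m\<close> lets the block dominate there while it is still small at radius \<open>R / 4\<close>.\<close>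

definition block_coeff :: "real \<Rightarrow> nat \<Rightarrow> nat \<Rightarrow> real" where
  "block_coeff R m l = 2 ^ m * (real (m + l) + 1) / R ^ (m + l + 1)"

definition block :: "real \<Rightarrow> nat \<Rightarrow> (nat \<Rightarrow> complex^'n) \<Rightarrow> nat \<Rightarrow> complex \<Rightarrow> complex^'n" where
  "block R N u m w = (\<Sum>l\<in>{1..N}. (of_real (block_coeff R m l) * w ^ (m + l)) *s u l)"

lemma block_holomorphic: "(\<lambda>w. block R N u m w $ j) holomorphic_on S"
  unfolding block_def sum_component vector_smult_component by (intro holomorphic_intros)

lemma continuous_on_block: "continuous_on S (block R N u m)"
  using smooth_continuous[OF smooth_on_entire[OF block_holomorphic]] .

text \<open>At relative radius \<open>q\<close> the factor \<open>2 ^ m\<close> meets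
  \<open>q ^ m\<close>: \<open>q = 1 / 4\<close> gives decay in \<open>m\<close>, and
  \<open>q = 1\<close> growth of order \<open>m * 2 ^ m\<close>.\<close>

lemma block_bound:
  fixes u :: "nat \<Rightarrow> complex^'n"
  assumes R: "0 < R" and u: "\<And>l. l \<in> {1..N} \<Longrightarrow> norm (u l) \<le> 1" and w: "norm w \<le> q * R" and q: "0 \<le> q" "q \<le> 1"
  shows "norm (block R N u m w) \<le> real N * (real (m + N) + 1) / R * (2 * q) ^ m"
proof -
  have "norm (block R N u m w) \<le> (\<Sum>l\<in>{1..N}. (real (m + N) + 1) / R * (2 * q) ^ m)"
    unfolding block_def
  proof (rule sum_norm_le)
    fix l assume l: "l \<in> {1..N}"
    have c: "0 \<le> block_coeff R m l" using R by (simp add: block_coeff_def)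
    have "norm ((of_real (block_coeff R m l) * w ^ (m + l)) *s u l) \<le> block_coeff R m l * (q * R) ^ (m + l) * 1"
      unfolding norm_smult_vec using c u[OF l] w q R
      by (intro mult_mono) (auto simp: norm_mult norm_power intro!: mult_mono power_mono)
    also have "\<dots> = (real (m + l) + 1) / R * (2 * q) ^ m * q ^ l"
      using R by (simp add: block_coeff_def power_mult_distrib power_add field_simps)
    also have "\<dots> \<le> (real (m + N) + 1) / R * (2 * q) ^ m * 1"
      using l R q by (intro mult_mono divide_right_mono power_le_one) auto
    finally show "norm ((of_real (block_coeff R m l) * w ^ (m + l)) *s u l) \<le> (real (m + N) + 1) / R * (2 * q) ^ m" by simp
  qed
  then show ?thesis by simp
qed

text \<open>The common squared norm of the scaled monomials in a block, in the Ahlfors case up to a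
  factor that tends to 1 with \<open>m\<close>.\<close>

definition block_scale :: "bool \<Rightarrow> nat \<Rightarrow> real" where
  "block_scale nv m = (if nv then pi / 2 * 4 ^ m else pi * 4 ^ m * (real m + 1))"

lemma block_scale_ge: "pi / 2 * 4 ^ m \<le> block_scale nv m"
proof -
  have "pi * 4 ^ m * (1 / 2) \<le> pi * 4 ^ m * (real m + 1)" by (intro mult_left_mono) auto
  then show ?thesis by (simp add: block_scale_def)
qed

text \<open>The factor \<open>m + l + 1\<close> in the coefficients cancels the denominator of the
  Nevanlinna mass exactly; in the Ahlfors case one such factor survives, and its dependence on
  \<open>l\<close> disappears in the limit.\<close>

lemma block_coeff_mass:
  assumes "0 < R"
  shows "block_coeff R m l ^ 2 * monomial_mass nv R (m + l) =
    block_scale nv m * (if nv then 1 else (real (m + l) + 1) / (real m + 1))"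
proof -
  have p: "R ^ (2 * (m + l) + 2) = (R ^ (m + l + 1))\<^sup>2" 
    unfolding power_mult[symmetric] by (rule arg_cong[of _ _ "\<lambda>k. R ^ k"]) simp
  have 4: "(4::real) ^ m = (2 ^ m)\<^sup>2" by (simp add: power2_eq_square flip: power_mult_distrib)
  have nz: "real (m + l) + 1 \<noteq> 0" "real m + 1 \<noteq> 0" "R ^ (m + l + 1) \<noteq> 0" using assms by auto
  have 1: "(A * n / B)\<^sup>2 * (pi * B\<^sup>2 / (2 * n\<^sup>2)) = pi / 2 * A\<^sup>2"
    and 2: "(A * n / B)\<^sup>2 * (pi * B\<^sup>2 / n) = pi * A\<^sup>2 * d * (n / d)"
    if "n \<noteq> 0" "d \<noteq> 0" "B \<noteq> 0" for A B n d :: real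
    using that by (simp_all add: power_divide power_mult_distrib) (simp add: power2_eq_square)
  show ?thesis
    unfolding block_coeff_def monomial_mass_def block_scale_def p 4
    using 1[OF nz, of "2 ^ m"] 2[OF nz, of "2 ^ m"] by (cases nv) (simp_all only: if_True if_False simp_thms mult_1_right)
qed

text \<open>Orthogonality of the monomials removes the cross terms between different
  \<open>l\<close>, so each \<open>u l\<close> contributes its own rank one matrix.\<close>

lemma block_outer_integral:
  fixes u :: "nat \<Rightarrow> complex^'n"
  assumes \<mu>: "pairing_measure nv 0 R \<mu>" and R: "0 < R"
  shows "(\<integral>w. indicator (ball 0 R) w *\<^sub>R outer (block R N u m w) \<partial>\<mu>) =
    (\<Sum>l\<in>{1..N}. (block_scale nv m * (if nv then 1 else (real (m + l) + 1) / (real m + 1))) *\<^sub>R outer (u l))"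
    (is "?X = ?Y")
proof -
  have io: "integrable \<mu> (\<lambda>w. indicator (ball 0 R) w *\<^sub>R outer (block R N u m w))"
    by (rule pairing_measure_integrable[OF \<mu> continuous_on_outer[OF continuous_on_block]])
  have "?X $ j $ k = ?Y $ j $ k" for j k
  proof -
    have bl: "bounded_linear (\<lambda>M :: complex^'n^'n. M $ j $ k)"
      by (rule bounded_linear_compose[OF bounded_linear_vec_nth bounded_linear_vec_nth])
    let ?c = "\<lambda>l. complex_of_real (block_coeff R m l)"
    let ?e = "\<lambda>l l'. (?c l * ?c l') * (u l $ j * cnj (u l' $ k))"
    have im: "integrable \<mu> (\<lambda>w. indicator (ball 0 R) w *\<^sub>R (w ^ a * cnj w ^ b))" for a b
      by (rule pairing_measure_integrable[OF \<mu>]) (intro continuous_intros)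
    have "?X $ j $ k = (\<integral>w. (indicator (ball 0 R) w *\<^sub>R outer (block R N u m w)) $ j $ k \<partial>\<mu>)"
      by (rule integral_bounded_linear[OF bl io, symmetric])
    also have "\<dots> = (\<integral>w. (\<Sum>l\<in>{1..N}. \<Sum>l'\<in>{1..N}. ?e l l' * (indicator (ball 0 R) w *\<^sub>R (w ^ (m + l) * cnj w ^ (m + l')))) \<partial>\<mu>)"
    proof (rule Bochner_Integration.integral_cong[OF refl])
      fix w
      have "outer (block R N u m w) $ j $ k = (\<Sum>l\<in>{1..N}. \<Sum>l'\<in>{1..N}. ?e l l' * (w ^ (m + l) * cnj w ^ (m + l')))"
        by (simp add: outer_def block_def sum_product mult_ac)
      then show "(indicator (ball 0 R) w *\<^sub>R outer (block R N u m w)) $ j $ k =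
          (\<Sum>l\<in>{1..N}. \<Sum>l'\<in>{1..N}. ?e l l' * (indicator (ball 0 R) w *\<^sub>R (w ^ (m + l) * cnj w ^ (m + l'))))"
        by (simp add: scaleR_sum_right)
    qed
    also have "\<dots> = (\<Sum>l\<in>{1..N}. \<Sum>l'\<in>{1..N}. ?e l l' * (\<integral>w. indicator (ball 0 R) w *\<^sub>R (w ^ (m + l) * cnj w ^ (m + l')) \<partial>\<mu>))"
      by (subst Bochner_Integration.integral_sum, intro Bochner_Integration.integrable_sum integrable_mult_right im,
          subst Bochner_Integration.integral_sum, intro integrable_mult_right im, subst integral_mult_right_zero, rule refl)
    also have "\<dots> = (\<Sum>l\<in>{1..N}. \<Sum>l'\<in>{1..N}. if l' = l then ?e l l * of_real (monomial_mass nv R (m + l)) else 0)"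
      unfolding pairing_measure_monomial[OF \<mu> R] by (intro sum.cong refl) auto
    also have "\<dots> = (\<Sum>l\<in>{1..N}. ?e l l * of_real (monomial_mass nv R (m + l)))" by simp
    also have "\<dots> = (\<Sum>l\<in>{1..N}. of_real (block_coeff R m l ^ 2 * monomial_mass nv R (m + l)) * (u l $ j * cnj (u l $ k)))"
      by (simp add: power2_eq_square mult_ac)
    also have "\<dots> = ?Y $ j $ k"
      unfolding block_coeff_mass[OF R] by (simp add: outer_def scaleR_conv_of_real[where ?'a=complex] sum_component)
    finally show ?thesis .
  qed
  then show ?thesis by (simp add: vec_eq_iff)
qed

lemma n_over_2n: "(\<lambda>m. (real (m + N) + 1) * (1 / 2) ^ m) \<longlonglongrightarrow> 0"
proof -
  have "(\<lambda>m. real m * (1 / 2) ^ m) \<longlonglongrightarrow> 0" using powser_times_n_limit_0[of "1/2 :: real"] by simp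
  moreover have "(\<lambda>m. (real N + 1) * (1 / 2) ^ m) \<longlonglongrightarrow> (real N + 1) * 0"
    by (intro tendsto_mult tendsto_const LIMSEQ_power_zero) simp
  ultimately have "(\<lambda>m. real m * (1 / 2) ^ m + (real N + 1) * (1 / 2) ^ m) \<longlonglongrightarrow> 0 + (real N + 1) * 0"
    by (rule tendsto_add)
  then show ?thesis by (simp add: algebra_simps)
qed

text \<open>The length enters through a sup bound \<open>M\<close>, since
  \<open>2 * pi * R * M\<close> dominates both the Nevanlinna and the Ahlfors length; thus only
  \<open>G\<close> and the measure occur.\<close>

definition good_radius :: "complex measure \<Rightarrow> real \<Rightarrow> complex^'n^'n \<Rightarrow> real \<Rightarrow> (complex \<Rightarrow> complex^'n) \<Rightarrow> bool" where
  "good_radius \<mu> R H \<epsilon> G \<longleftrightarrow> (let A = (\<integral>w. indicator (ball 0 R) w *\<^sub>R (norm (G w))\<^sup>2 \<partial>\<mu>) in 0 < A \<and>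
     dist ((1 / A) *\<^sub>R (\<integral>w. indicator (ball 0 R) w *\<^sub>R outer (G w) \<partial>\<mu>)) H \<le> \<epsilon> \<and>
     (\<exists>M. (\<forall>w\<in>cball 0 R. norm (G w) \<le> M) \<and> 2 * pi * R * M / A \<le> \<epsilon>))"

text \<open>The area is at least of order \<open>4 ^ m\<close>, whereas the block has size of order
  at most \<open>m * 2 ^ m\<close>. Hence a perturbation bounded by \<open>\<Delta>\<close> changes
  the integrated matrix by a negligible amount, and the length, linear in the size, is negligible
  against the area.\<close>

lemma block_limit:
  fixes u :: "nat \<Rightarrow> complex^'n" and G :: "nat \<Rightarrow> complex \<Rightarrow> complex^'n"
  assumes \<mu>: "pairing_measure nv 0 R \<mu>" and R: "0 < R" and u: "\<And>l. l \<in> {1..N} \<Longrightarrow> norm (u l) \<le> 1"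
    and H: "H = (\<Sum>l\<in>{1..N}. outer (u l))" "retrace H = 1" and \<epsilon>: "0 < \<epsilon>" and \<Delta>: "0 \<le> \<Delta>"
    and G: "\<And>m. continuous_on (cball 0 R) (G m)"
    and close: "\<And>m w. w \<in> cball 0 R \<Longrightarrow> norm (G m w - block R N u m w) \<le> \<Delta>"
  shows "\<forall>\<^sub>F m in sequentially. good_radius \<mu> R H \<epsilon> (G m)"
proof -
  have fin: "finite_measure \<mu>" using \<mu> unfolding pairing_measure_def by blast
  define V where "V = measure \<mu> (space \<mu>)"
  \<comment> \<open>All limits are taken after division by \<open>block_scale\<close>, where the
    pure block tends to \<open>H\<close> itself.\<close>
  define \<kappa> where "\<kappa> = (\<lambda>m. 1 / block_scale nv m)"
  define M where "M = (\<lambda>m. real N * (real (m + N) + 1) / R * 2 ^ m)"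
  define A where "A = (\<lambda>m. \<integral>w. indicator (ball 0 R) w *\<^sub>R (norm (G m w))\<^sup>2 \<partial>\<mu>)"
  define Y where "Y = (\<lambda>m. \<integral>w. indicator (ball 0 R) w *\<^sub>R outer (G m w) \<partial>\<mu>)"
  define X where "X = (\<lambda>m. \<integral>w. indicator (ball 0 R) w *\<^sub>R outer (block R N u m w) \<partial>\<mu>)"
  have c0: "0 < pi / 2 * 4 ^ m" for m :: nat by simp
  have cpos: "0 < block_scale nv m" for m by (rule less_le_trans[OF c0 block_scale_ge])
  have \<kappa>0: "0 < \<kappa> m" for m using cpos by (simp add: \<kappa>_def)
  have \<kappa>le: "\<kappa> m \<le> 2 / pi * (1 / 4) ^ m" for m
  proof -
    have "1 / block_scale nv m \<le> 1 / (pi / 2 * 4 ^ m)"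
      by (rule divide_left_mono[OF block_scale_ge]) (use cpos in auto)
    then show ?thesis unfolding \<kappa>_def by (simp add: power_one_over)
  qed
  have M0: "0 \<le> M m" for m using R by (simp add: M_def)
  have bM: "norm (block R N u m w) \<le> M m" if "w \<in> cball 0 R" for m w
    using block_bound[OF R u, where q=1 and w=w] that unfolding M_def by simp
  have lim\<kappa>: "\<kappa> \<longlonglongrightarrow> 0"
  proof (rule tendsto_sandwich[of "\<lambda>_. 0" _ _ "\<lambda>m. 2 / pi * (1 / 4) ^ m"])
    show "(\<lambda>m. 2 / pi * (1 / 4 :: real) ^ m) \<longlonglongrightarrow> 0"
      by (rule tendsto_mult_right_zero) (rule LIMSEQ_power_zero, simp)
  qed (use \<kappa>0 \<kappa>le in \<open>auto simp: less_imp_le\<close>)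
  have limM: "(\<lambda>m. M m * \<kappa> m) \<longlonglongrightarrow> 0"
  proof (rule tendsto_sandwich[of "\<lambda>_. 0" _ _ "\<lambda>m. (2 / pi * real N / R) * ((real (m + N) + 1) * (1 / 2) ^ m)"])
    show "(\<lambda>m. (2 / pi * real N / R) * ((real (m + N) + 1) * (1 / 2) ^ m)) \<longlonglongrightarrow> 0"
      by (rule tendsto_mult_right_zero[OF n_over_2n])
    have "M m * \<kappa> m \<le> (2 / pi * real N / R) * ((real (m + N) + 1) * (1 / 2) ^ m)" for m
    proof -
      have "M m * \<kappa> m \<le> M m * (2 / pi * (1 / 4) ^ m)" by (intro mult_left_mono \<kappa>le M0)
      also have "\<dots> = (2 / pi * real N / R) * ((real (m + N) + 1) * (2 ^ m * (1 / 4) ^ m))"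
        by (simp add: M_def mult_ac)
      also have "(2::real) ^ m * (1 / 4) ^ m = (1 / 2) ^ m" by (simp flip: power_mult_distrib)
      finally show ?thesis .
    qed
    then show "\<forall>\<^sub>F m in sequentially. M m * \<kappa> m \<le> (2 / pi * real N / R) * ((real (m + N) + 1) * (1 / 2) ^ m)" by simp
    show "\<forall>\<^sub>F m in sequentially. 0 \<le> M m * \<kappa> m" using M0 \<kappa>0 by (simp add: less_imp_le)
  qed simp
  have iG: "integrable \<mu> (\<lambda>w. indicator (ball 0 R) w *\<^sub>R outer (G m w))" for m
    by (rule pairing_measure_integrable[OF \<mu> continuous_on_outer[OF G]])
  have ib: "integrable \<mu> (\<lambda>w. indicator (ball 0 R) w *\<^sub>R outer (block R N u m w))" for m
    by (rule pairing_measure_integrable[OF \<mu> continuous_on_outer[OF continuous_on_block]])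
  have limX: "(\<lambda>m. \<kappa> m *\<^sub>R X m) \<longlonglongrightarrow> H"
  proof -
    have eq: "\<kappa> m *\<^sub>R X m = (\<Sum>l\<in>{1..N}. (if nv then 1 else (real (m + l) + 1) / (real m + 1)) *\<^sub>R outer (u l))" for m
      unfolding X_def block_outer_integral[OF \<mu> R] using cpos[of m] by (simp add: scaleR_sum_right \<kappa>_def)
    have s: "(\<lambda>m. if nv then 1 else (real (m + l) + 1) / (real m + 1)) \<longlonglongrightarrow> 1" for l
    proof -
      have "(\<lambda>m. 1 + real l * inverse (real (Suc m))) \<longlonglongrightarrow> 1 + real l * 0"
        by (intro tendsto_intros LIMSEQ_inverse_real_of_nat)
      moreover have "1 + real l * inverse (real (Suc m)) = (real (m + l) + 1) / (real m + 1)" for m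
        by (simp add: field_simps)
      ultimately show ?thesis by (cases nv) simp_all
    qed
    have "(\<lambda>m. \<Sum>l\<in>{1..N}. (if nv then 1 else (real (m + l) + 1) / (real m + 1)) *\<^sub>R outer (u l)) \<longlonglongrightarrow> (\<Sum>l\<in>{1..N}. 1 *\<^sub>R outer (u l))"
      by (intro tendsto_sum tendsto_scaleR s tendsto_const)
    then show ?thesis unfolding eq H by simp
  qed
  \<comment> \<open>Linear in the size \<open>M m\<close> of the block: one factor in the difference
    of the outer products is at most \<open>\<Delta>\<close>, the other at most
    \<open>2 * M m + \<Delta>\<close>.\<close>
  have diff: "norm (Y m - X m) \<le> V * (\<Delta> * (2 * M m + \<Delta>))" for m
  proof -
    have "Y m - X m = (\<integral>w. indicator (ball 0 R) w *\<^sub>R (outer (G m w) - outer (block R N u m w)) \<partial>\<mu>)"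
      unfolding X_def Y_def by (simp add: scaleR_diff_right Bochner_Integration.integral_diff[OF iG ib])
    also have "norm \<dots> \<le> (\<integral>w. \<Delta> * (2 * M m + \<Delta>) \<partial>\<mu>)"
    proof (rule order_trans[OF integral_norm_bound integral_mono'])
      show "integrable \<mu> (\<lambda>w. \<Delta> * (2 * M m + \<Delta>))" using fin by (simp add: finite_measure.integrable_const)
      show "0 \<le> \<Delta> * (2 * M m + \<Delta>)" using \<Delta> M0[of m] by simp
      fix w
      show "norm (indicator (ball 0 R) w *\<^sub>R (outer (G m w) - outer (block R N u m w))) \<le> \<Delta> * (2 * M m + \<Delta>)"
      proof (cases "w \<in> ball 0 R")
        case True
        then have w: "w \<in> cball 0 R" by auto
        have "norm (G m w) \<le> norm (block R N u m w) + norm (G m w - block R N u m w)"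
          using norm_triangle_ineq[of "block R N u m w" "G m w - block R N u m w"] by simp
        then have "norm (G m w) \<le> M m + \<Delta>" using bM[OF w, of m] close[OF w, of m] by linarith
        then have "norm (G m w - block R N u m w) * (norm (G m w) + norm (block R N u m w)) \<le> \<Delta> * (2 * M m + \<Delta>)"
          using bM[OF w, of m] close[OF w, of m] \<Delta> by (intro mult_mono) auto
        then show ?thesis using True norm_outer_diff[of "G m w" "block R N u m w"] by simp
      next
        case False
        then show ?thesis using \<Delta> M0[of m] by simp
      qed
    qed
    also have "\<dots> = V * (\<Delta> * (2 * M m + \<Delta>))" using finite_measure.emeasure_finite[OF fin] by (simp add: V_def)
    finally show ?thesis .
  qed
  have limD: "(\<lambda>m. \<kappa> m *\<^sub>R (Y m - X m)) \<longlonglongrightarrow> 0"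
  proof (rule Lim_null_comparison)
    have "norm (\<kappa> m *\<^sub>R (Y m - X m)) \<le> V * \<Delta> * (2 * (M m * \<kappa> m) + \<Delta> * \<kappa> m)" for m
    proof -
      have "norm (\<kappa> m *\<^sub>R (Y m - X m)) = \<kappa> m * norm (Y m - X m)"
        by (subst norm_scaleR) (use \<kappa>0[of m] in simp)
      also have "\<dots> \<le> \<kappa> m * (V * (\<Delta> * (2 * M m + \<Delta>)))"
        by (rule mult_left_mono[OF diff]) (use \<kappa>0[of m] in simp)
      also have "\<dots> = V * \<Delta> * (2 * (M m * \<kappa> m) + \<Delta> * \<kappa> m)" by (simp add: algebra_simps)
      finally show ?thesis .
    qed
    then show "\<forall>\<^sub>F m in sequentially. norm (\<kappa> m *\<^sub>R (Y m - X m)) \<le> V * \<Delta> * (2 * (M m * \<kappa> m) + \<Delta> * \<kappa> m)" by simp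
    have "(\<lambda>m. V * \<Delta> * (2 * (M m * \<kappa> m) + \<Delta> * \<kappa> m)) \<longlonglongrightarrow> V * \<Delta> * (2 * 0 + \<Delta> * 0)"
      by (intro tendsto_intros limM lim\<kappa>)
    then show "(\<lambda>m. V * \<Delta> * (2 * (M m * \<kappa> m) + \<Delta> * \<kappa> m)) \<longlonglongrightarrow> 0" by simp
  qed
  have limY: "(\<lambda>m. \<kappa> m *\<^sub>R Y m) \<longlonglongrightarrow> H"
    using tendsto_add[OF limX limD] by (simp add: scaleR_diff_right)
  \<comment> \<open>The trace of \<open>H\<close> is 1, so after the same normalisation the areas
    tend to 1 and can be divided out.\<close>
  have trY: "A m = retrace (Y m)" for m
    unfolding A_def Y_def integral_bounded_linear[OF bounded_linear_retrace iG, symmetric]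
    by (simp add: linear_cmul[OF bounded_linear.linear[OF bounded_linear_retrace]] retrace_outer)
  have limA: "(\<lambda>m. A m * \<kappa> m) \<longlonglongrightarrow> 1"
    using bounded_linear.tendsto[OF bounded_linear_retrace limY] H(2)
    by (simp add: trY linear_cmul[OF bounded_linear.linear[OF bounded_linear_retrace]] mult.commute)
  have e1: "(\<lambda>m. (1 / (A m * \<kappa> m)) *\<^sub>R (\<kappa> m *\<^sub>R Y m)) = (\<lambda>m. (1 / A m) *\<^sub>R Y m)"
    using less_imp_neq[OF \<kappa>0] by (intro ext) (auto simp: scaleR_scaleR)
  have "(\<lambda>m. (1 / (A m * \<kappa> m)) *\<^sub>R (\<kappa> m *\<^sub>R Y m)) \<longlonglongrightarrow> (1 / 1) *\<^sub>R H"
    by (intro tendsto_intros limA limY) simp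
  then have lim1: "(\<lambda>m. (1 / A m) *\<^sub>R Y m) \<longlonglongrightarrow> H" unfolding e1 by simp
  have e2: "(\<lambda>m. 2 * pi * R * (M m * \<kappa> m + \<Delta> * \<kappa> m) / (A m * \<kappa> m)) = (\<lambda>m. 2 * pi * R * (M m + \<Delta>) / A m)"
  proof
    fix m
    have "2 * pi * R * (M m * \<kappa> m + \<Delta> * \<kappa> m) = (2 * pi * R * (M m + \<Delta>)) * \<kappa> m" by (simp add: algebra_simps)
    show "2 * pi * R * (M m * \<kappa> m + \<Delta> * \<kappa> m) / (A m * \<kappa> m) = 2 * pi * R * (M m + \<Delta>) / A m"
      unfolding \<open>2 * pi * R * (M m * \<kappa> m + \<Delta> * \<kappa> m) = _\<close> using \<kappa>0[of m] by simp
  qed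
  have "(\<lambda>m. 2 * pi * R * (M m * \<kappa> m + \<Delta> * \<kappa> m) / (A m * \<kappa> m)) \<longlonglongrightarrow> 2 * pi * R * (0 + \<Delta> * 0) / 1"
    by (intro tendsto_intros limM lim\<kappa> limA) simp
  then have lim2: "(\<lambda>m. 2 * pi * R * (M m + \<Delta>) / A m) \<longlonglongrightarrow> 0" unfolding e2 by simp
  have "\<forall>\<^sub>F m in sequentially. 0 < A m * \<kappa> m" by (rule order_tendstoD(1)[OF limA]) simp
  moreover have "\<forall>\<^sub>F m in sequentially. dist ((1 / A m) *\<^sub>R Y m) H < \<epsilon>" by (rule tendstoD[OF lim1 \<epsilon>])
  moreover have "\<forall>\<^sub>F m in sequentially. 2 * pi * R * (M m + \<Delta>) / A m < \<epsilon>" by (rule order_tendstoD(2)[OF lim2 \<epsilon>])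
  ultimately show ?thesis
  proof eventually_elim
    case (elim m)
    have "0 < A m" using elim(1) \<kappa>0[of m] by (simp add: zero_less_mult_iff)
    moreover have "norm (G m w) \<le> M m + \<Delta>" if w: "w \<in> cball 0 R" for w
      using norm_triangle_ineq[of "block R N u m w" "G m w - block R N u m w"] bM[OF w, of m] close[OF w, of m] by simp
    ultimately show ?case
      using elim(2,3) unfolding good_radius_def Let_def A_def Y_def by (intro conjI exI[of _ "M m + \<Delta>"] ballI) auto
  qed
qed

text \<open>Choosing for every \<open>m\<close> a counterexample \<open>G\<close>, if there is one, reduces the uniformity in \<open>G\<close>
  to sequences.\<close>

lemma block_eventually_good:
  fixes u :: "nat \<Rightarrow> complex^'n" and P :: "complex \<Rightarrow> complex^'n"
  assumes \<mu>: "pairing_measure nv 0 R \<mu>" and R: "0 < R" and u: "\<And>l. l \<in> {1..N} \<Longrightarrow> norm (u l) \<le> 1"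
    and H: "H = (\<Sum>l\<in>{1..N}. outer (u l))" "retrace H = 1" and \<epsilon>: "0 < \<epsilon>"
    and P: "continuous_on (cball 0 R) P"
  shows "\<forall>\<^sub>F m in sequentially. \<forall>G. continuous_on (cball 0 R) G \<longrightarrow>
    (\<forall>w\<in>cball 0 R. norm (G w - (P w + block R N u m w)) \<le> 1) \<longrightarrow> good_radius \<mu> R H \<epsilon> G"
proof -
  obtain B where B: "\<And>w. w \<in> cball 0 R \<Longrightarrow> norm (P w) \<le> B"
    using compact_imp_bounded[OF compact_continuous_image[OF P compact_cball]] unfolding bounded_iff by blast
  have B0: "0 \<le> B" using order_trans[OF norm_ge_zero B[of 0]] R by simp
  define ok where "ok = (\<lambda>m G. continuous_on (cball 0 R) G \<and> (\<forall>w\<in>cball 0 R. norm (G w - (P w + block R N u m w)) \<le> 1))"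
  define bad where "bad = (\<lambda>m G. ok m G \<and> \<not> good_radius \<mu> R H \<epsilon> G)"
  \<comment> \<open>Without a counterexample at \<open>m\<close> the unperturbed map is taken, so
    that the limit statement applies to the whole sequence.\<close>
  define G where "G = (\<lambda>m. if \<exists>G. bad m G then SOME G. bad m G else (\<lambda>w. P w + block R N u m w))"
  have Gbad: "bad m (G m)" if "\<exists>G. bad m G" for m
    using someI_ex[OF that] that by (simp add: G_def)
  have Gok: "ok m (G m)" for m
  proof (cases "\<exists>G. bad m G")
    case True
    then show ?thesis using Gbad unfolding bad_def by blast
  next
    case False
    then have "G m = (\<lambda>w. P w + block R N u m w)" unfolding G_def by (rule if_not_P)
    then show ?thesis unfolding ok_def by (simp add: continuous_on_add[OF P continuous_on_block])
  qed
  have "\<forall>\<^sub>F m in sequentially. good_radius \<mu> R H \<epsilon> (G m)"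
  proof (rule block_limit[OF \<mu> R u H \<epsilon>, of "B + 1"])
    show "continuous_on (cball 0 R) (G m)" for m using Gok unfolding ok_def by blast
    show "norm (G m w - block R N u m w) \<le> B + 1" if w: "w \<in> cball 0 R" for m w
    proof -
      have "norm (G m w - (P w + block R N u m w)) \<le> 1" using Gok w unfolding ok_def by blast
      moreover have "norm (G m w - block R N u m w) \<le> norm (P w) + norm (G m w - (P w + block R N u m w))"
        using norm_triangle_ineq[of "P w" "G m w - (P w + block R N u m w)"] by (simp add: algebra_simps)
      ultimately show ?thesis using B[OF w] by linarith
    qed
  qed (use B0 in auto)
  then show ?thesis
  proof eventually_elim
    case (elim m)
    then have "\<not> (\<exists>G. bad m G)" using Gbad unfolding bad_def by blast
    then show ?case unfolding bad_def ok_def by blast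
  qed
qed

text \<open>Every requirement holds for all large \<open>m\<close>, so one \<open>m\<close> meets
  them together: smallness on radius \<open>R / 4\<close>, and goodness for both pairings even after
  a perturbation by 1, the allowance for all later blocks.\<close>

lemma block_exists:
  fixes H :: "complex^'n^'n" and P :: "complex \<Rightarrow> complex^'n"
  assumes H: "H \<in> class_hull" and R: "0 < R" and \<epsilon>: "0 < \<epsilon>" and \<mu>: "\<And>nv. pairing_measure nv 0 R (\<mu> nv)"
    and P: "continuous_on (cball 0 R) P"
  shows "\<exists>\<gamma>. (\<forall>j. (\<lambda>w. \<gamma> w $ j) holomorphic_on UNIV) \<and> (\<forall>w\<in>cball 0 (R / 4). norm (\<gamma> w) \<le> \<epsilon>) \<and>
    (\<forall>nv G. continuous_on (cball 0 R) G \<longrightarrow> (\<forall>w\<in>cball 0 R. norm (G w - (P w + \<gamma> w)) \<le> 1) \<longrightarrow>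
      good_radius (\<mu> nv) R H \<epsilon> G)"
proof -
  obtain N and u :: "nat \<Rightarrow> complex^'n" where u: "H = (\<Sum>l\<in>{1..N}. outer (u l))"
    "\<And>l. l \<in> {1..N} \<Longrightarrow> norm (u l) \<le> 1" "retrace H = 1"
    using class_hull_decompose[OF H] by blast
  have "(\<lambda>m. real N / R * ((real (m + N) + 1) * (1 / 2) ^ m)) \<longlonglongrightarrow> 0"
    by (rule tendsto_mult_right_zero[OF n_over_2n])
  then have "\<forall>\<^sub>F m in sequentially. real N / R * ((real (m + N) + 1) * (1 / 2) ^ m) < \<epsilon>"
    by (rule order_tendstoD(2)[OF _ \<epsilon>])
  then have small: "\<forall>\<^sub>F m in sequentially. \<forall>w\<in>cball 0 (R / 4). norm (block R N u m w) \<le> \<epsilon>"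
  proof eventually_elim
    case (elim m)
    have "norm (block R N u m w) \<le> real N * (real (m + N) + 1) / R * (2 * (1 / 4)) ^ m" if "w \<in> cball 0 (R / 4)" for w
      by (rule block_bound[OF R u(2)]) (use that in auto)
    then show ?case using elim by (fastforce simp: mult_ac)
  qed
  have good: "\<forall>\<^sub>F m in sequentially. \<forall>G. continuous_on (cball 0 R) G \<longrightarrow>
      (\<forall>w\<in>cball 0 R. norm (G w - (P w + block R N u m w)) \<le> 1) \<longrightarrow> good_radius (\<mu> nv) R H \<epsilon> G" for nv
    by (rule block_eventually_good[OF \<mu> R u(2) u(1,3) \<epsilon> P])
  have "\<forall>\<^sub>F m in sequentially. (\<forall>w\<in>cball 0 (R / 4). norm (block R N u m w) \<le> \<epsilon>) \<and>
      (\<forall>nv G. continuous_on (cball 0 R) G \<longrightarrow> (\<forall>w\<in>cball 0 R. norm (G w - (P w + block R N u m w)) \<le> 1) \<longrightarrow>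
      good_radius (\<mu> nv) R H \<epsilon> G)"
    unfolding all_bool_eq by (intro eventually_conj small good)
  then obtain m where "(\<forall>w\<in>cball 0 (R / 4). norm (block R N u m w) \<le> \<epsilon>) \<and>
      (\<forall>nv G. continuous_on (cball 0 R) G \<longrightarrow> (\<forall>w\<in>cball 0 R. norm (G w - (P w + block R N u m w)) \<le> 1) \<longrightarrow>
      good_radius (\<mu> nv) R H \<epsilon> G)"
    using eventually_happens'[OF sequentially_bot] by blast
  then show ?thesis using block_holomorphic by blast
qed

section \<open>The universal entire curve\<close>

text \<open>The members of a countable dense set are repeated infinitely often by means of the
  pairing of naturals, so that approximations of any accuracy occur at arbitrarily late
  indices.\<close>

lemma dense_sequence_class_hull:
  "\<exists>Hs :: nat \<Rightarrow> complex^'n^'n. (\<forall>k. Hs k \<in> class_hull) \<and>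
     (\<forall>H\<in>class_hull. \<exists>\<kappa>. strict_mono \<kappa> \<and> (Hs \<circ> \<kappa>) \<longlonglongrightarrow> H)"
proof -
  let ?K = "class_hull :: (complex^'n^'n) set"
  obtain D where D: "countable D" "D \<subseteq> ?K" "?K \<subseteq> closure D" using separable by blast
  obtain v :: "complex^'n" where "norm v = 1" using vector_choose_size[of 1] by auto
  then have "outer v \<in> ?K" unfolding class_hull_def by (intro hull_inc imageI) simp
  then have ne: "D \<noteq> {}" using D(3) by auto
  define d where "d = from_nat_into D"
  have d: "d n \<in> D" "y \<in> D \<Longrightarrow> \<exists>n. d n = y" for n y
    using from_nat_into[OF ne] from_nat_into_surj[OF D(1)] unfolding d_def by auto
  define Hs where "Hs = (\<lambda>k. d (fst (prod_decode k)))"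
  have "\<exists>\<kappa>. strict_mono \<kappa> \<and> (Hs \<circ> \<kappa>) \<longlonglongrightarrow> H" if H: "H \<in> ?K" for H
  proof -
    have ex: "\<exists>k>b. dist (Hs k) H < 1 / (real i + 1)" for b i :: nat
    proof -
      have "0 < 1 / (real i + 1)" by simp
      then obtain y where "y \<in> D" "dist y H < 1 / (real i + 1)"
        using D(3) H closure_approachable[of H D] by blast
      then obtain n where "dist (d n) H < 1 / (real i + 1)" using d(2) by blast
      \<comment> \<open>The second component of the code is a free counter that pushes the index
        beyond \<open>b\<close>.\<close>
      moreover have "b < prod_encode (n, Suc b)" using le_prod_encode_2[of "Suc b" n] by simp
      ultimately show ?thesis unfolding Hs_def by (intro exI[of _ "prod_encode (n, Suc b)"]) simp
    qed
    obtain \<kappa> where \<kappa>: "\<And>i. dist (Hs (\<kappa> i)) H < 1 / (real i + 1)" "\<And>i. \<kappa> i < \<kappa> (Suc i)"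
      using dependent_nat_choice[of "\<lambda>i k. dist (Hs k) H < 1 / (real i + 1)" "\<lambda>i k k'. k < k'"] ex by blast
    have "(\<lambda>i. dist (Hs (\<kappa> i)) H) \<longlonglongrightarrow> 0"
    proof (rule tendsto_sandwich[of "\<lambda>_. 0" _ _ "\<lambda>i. 1 / (real i + 1)"])
      show "(\<lambda>i. 1 / (real i + 1)) \<longlonglongrightarrow> 0"
        using LIMSEQ_inverse_real_of_nat by (simp add: inverse_eq_divide add.commute)
    qed (use \<kappa>(1) in \<open>auto simp: less_imp_le\<close>)
    then have "(\<lambda>i. Hs (\<kappa> i)) \<longlonglongrightarrow> H" by (rule iffD2[OF tendsto_dist_iff])
    moreover have "strict_mono \<kappa>" using \<kappa>(2) by (simp add: strict_mono_Suc_iff)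
    ultimately show ?thesis by (auto simp: o_def)
  qed
  moreover have "Hs k \<in> ?K" for k unfolding Hs_def using d(1) D(2) by blast
  ultimately show ?thesis by blast
qed

lemma geometric_tail:
  fixes \<gamma> :: "nat \<Rightarrow> 'a::banach"
  assumes "\<And>j. n \<le> j \<Longrightarrow> norm (\<gamma> j) \<le> 1 / 2 ^ j"
  shows "summable \<gamma>" "norm ((\<Sum>j. \<gamma> j) - (\<Sum>j<n. \<gamma> j)) \<le> 2 / 2 ^ n"
proof -
  have g: "summable (\<lambda>j::nat. 1 / 2 ^ j :: real)"
    using summable_geometric[of "1/2 :: real"] by (simp add: power_one_over)
  show s: "summable \<gamma>" by (rule summable_comparison_test'[OF g assms])
  have sh: "(\<lambda>i. 1 / 2 ^ (i + n) :: real) sums (2 / 2 ^ n)"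
    using sums_mult[OF geometric_sums[of "1/2 :: real"], of "1 / 2 ^ n"] by (simp add: power_one_over power_add mult.commute divide_simps)
  have "(\<Sum>j. \<gamma> j) - (\<Sum>j<n. \<gamma> j) = (\<Sum>i. \<gamma> (i + n))"
    using suminf_split_initial_segment[OF s, of n] by simp
  also have "norm \<dots> \<le> (\<Sum>i. 1 / 2 ^ (i + n))"
    by (rule norm_suminf_le[OF _ sums_summable[OF sh]]) (use assms in simp)
  also have "\<dots> = 2 / 2 ^ n" using sh by (rule sums_unique[symmetric])
  finally show "norm ((\<Sum>j. \<gamma> j) - (\<Sum>j<n. \<gamma> j)) \<le> 2 / 2 ^ n" .
qed

text \<open>Blocks are chosen recursively, each against the sum \<open>P\<close> of the previous
  ones. Block \<open>k\<close> is bounded by \<open>1 / 2 ^ k\<close> on radius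
  \<open>4 ^ k / 4\<close>, which gives locally uniform convergence to an entire map.\<close>

lemma universal_derivative:
  fixes Hs :: "nat \<Rightarrow> complex^'n^'n"
  assumes Hs: "\<And>k. Hs k \<in> class_hull" and \<mu>: "\<And>k nv. pairing_measure nv 0 (4 ^ k) (\<mu> k nv)"
  shows "\<exists>G :: complex \<Rightarrow> complex^'n. (\<forall>j. (\<lambda>w. G w $ j) holomorphic_on UNIV) \<and>
    (\<forall>k nv. good_radius (\<mu> k nv) (4 ^ k) (Hs k) (1 / 2 ^ k) G)"
proof -
  \<comment> \<open>The specification of block \<open>k\<close> on top of the sum \<open>P\<close>;
    it speaks of all \<open>G\<close> near the new sum because the final map is not yet
    known.\<close>
  define Q where "Q = (\<lambda>k (P :: complex \<Rightarrow> complex^'n) \<gamma>. (\<forall>j. (\<lambda>w. \<gamma> w $ j) holomorphic_on UNIV) \<and>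
    (\<forall>w\<in>cball 0 (4 ^ k / 4). norm (\<gamma> w) \<le> 1 / 2 ^ k) \<and>
    (\<forall>nv G. continuous_on (cball 0 (4 ^ k)) G \<longrightarrow> (\<forall>w\<in>cball 0 (4 ^ k). norm (G w - (P w + \<gamma> w)) \<le> 1) \<longrightarrow>
      good_radius (\<mu> k nv) (4 ^ k) (Hs k) (1 / 2 ^ k) G))"
  have "\<exists>\<gamma>. Q k P \<gamma>" if "continuous_on UNIV P" for k P
    unfolding Q_def by (rule block_exists[OF Hs _ _ \<mu> continuous_on_subset[OF that]]) auto
  then have "\<forall>k P. \<exists>\<gamma>. continuous_on UNIV P \<longrightarrow> Q k P \<gamma>" by blast
  then obtain \<Gamma> where \<Gamma>: "\<And>k P. continuous_on UNIV P \<Longrightarrow> Q k P (\<Gamma> k P)" unfolding choice_iff by blast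
  define P where "P = rec_nat (\<lambda>w. 0) (\<lambda>k P w. P w + \<Gamma> k P w)"
  have P0: "P 0 = (\<lambda>w. 0)" and PS: "P (Suc k) = (\<lambda>w. P k w + \<Gamma> k (P k) w)" for k
    by (simp_all add: P_def)
  define \<gamma> where "\<gamma> = (\<lambda>k. \<Gamma> k (P k))"
  have holQ: "continuous_on UNIV \<gamma>'" if "Q k P' \<gamma>'" for k P' \<gamma>'
    using smooth_continuous[OF smooth_on_entire] that unfolding Q_def by blast
  have cP: "continuous_on UNIV (P k)" for k
    by (induction k) (simp_all add: P0 PS continuous_on_add holQ[OF \<Gamma>])
  have Q\<gamma>: "Q k (P k) (\<gamma> k)" for k unfolding \<gamma>_def by (rule \<Gamma>[OF cP])
  have Psum: "P n w = (\<Sum>k<n. \<gamma> k w)" for n w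
    by (induction n) (simp_all add: P0 PS \<gamma>_def)
  \<comment> \<open>Block \<open>j\<close> is small on radius \<open>4 ^ j / 4\<close>, which
    reaches \<open>4 ^ k\<close> from \<open>j = Suc k\<close> on.\<close>
  have small: "norm (\<gamma> j w) \<le> 1 / 2 ^ j" if w: "w \<in> cball 0 (4 ^ k)" and j: "Suc k \<le> j" for j k w
  proof -
    have "(4::real) ^ Suc k \<le> 4 ^ j" using j by (intro power_increasing) auto
    then have "w \<in> cball 0 (4 ^ j / 4)" using w by simp
    then show ?thesis using Q\<gamma>[of j] unfolding Q_def by blast
  qed
  define G where "G = (\<lambda>w. \<Sum>j. \<gamma> j w)"
  have tail: "norm (G w - P n w) \<le> 2 / 2 ^ n" if w: "w \<in> cball 0 (4 ^ k)" and n: "Suc k \<le> n" for w k n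
    unfolding G_def Psum by (rule geometric_tail(2)) (use small[OF w] n in auto)
  have unif: "uniform_limit (cball 0 (4 ^ k)) P G sequentially" for k
  proof (rule uniform_limitI)
    fix e :: real assume e: "e > 0"
    have "(\<lambda>n. 2 / 2 ^ n :: real) \<longlonglongrightarrow> 2 * 0"
      using tendsto_mult[OF tendsto_const LIMSEQ_power_zero[of "1/2 :: real"], of 2] by (simp add: power_one_over)
    then have "\<forall>\<^sub>F n in sequentially. 2 / 2 ^ n < e" using e order_tendstoD(2) by fastforce
    moreover have "\<forall>\<^sub>F n in sequentially. Suc k \<le> n" by (rule eventually_ge_at_top)
    ultimately show "\<forall>\<^sub>F n in sequentially. \<forall>x\<in>cball 0 (4 ^ k). dist (P n x) (G x) < e"
    proof eventually_elim
      case (elim n)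
      show ?case
      proof
        fix x :: complex assume "x \<in> cball 0 (4 ^ k)"
        from tail[OF this elim(2)] elim(1) show "dist (P n x) (G x) < e"
          by (simp add: dist_norm norm_minus_commute)
      qed
    qed
  qed
  have "(\<lambda>w. G w $ j) holomorphic_on UNIV" for j
  proof (rule holomorphic_uniform_sequence[OF open_UNIV])
    show "(\<lambda>w. P n w $ j) holomorphic_on UNIV" for n
      unfolding Psum sum_component
      by (intro holomorphic_on_sum) (use Q\<gamma> in \<open>simp add: Q_def\<close>)
    fix x :: complex
    obtain k where k: "norm x + 1 < 4 ^ k" using real_arch_pow[of 4 "norm x + 1"] by auto
    have sub: "cball x 1 \<subseteq> cball 0 (4 ^ k)"
    proof
      fix y assume "y \<in> cball x 1"
      then show "y \<in> cball 0 (4 ^ k)" using k dist_triangle[of 0 y x] by (simp add: dist_norm)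
    qed
    have "uniform_limit (cball x 1) (\<lambda>n w. P n w $ j) (\<lambda>w. G w $ j) sequentially"
      using bounded_linear.uniform_limit[OF bounded_linear_vec_nth uniform_limit_on_subset[OF unif sub], of j] .
    then show "\<exists>d>0. cball x d \<subseteq> UNIV \<and> uniform_limit (cball x d) (\<lambda>n w. P n w $ j) (\<lambda>w. G w $ j) sequentially"
      by (intro exI[of _ 1]) simp
  qed
  moreover have "good_radius (\<mu> k nv) (4 ^ k) (Hs k) (1 / 2 ^ k) G" for k nv
  proof -
    have "continuous_on UNIV G" by (rule smooth_continuous[OF smooth_on_entire]) fact
    then have "continuous_on (cball 0 (4 ^ k)) G" by (rule continuous_on_subset) simp
    moreover have "norm (G w - (P k w + \<gamma> k w)) \<le> 1" if w: "w \<in> cball 0 (4 ^ k)" for w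
    proof -
      \<comment> \<open>The geometric tail starts at \<open>Suc k\<close>, just after the block of
        index \<open>k\<close>, and stays within the allowance 1 for which that block was
        built.\<close>
      have "norm (G w - (P k w + \<gamma> k w)) \<le> 2 / 2 ^ Suc k"
        using tail[OF w order_refl] by (simp only: PS \<gamma>_def)
      also have "\<dots> \<le> 1" by simp
      finally show ?thesis .
    qed
    ultimately show ?thesis using Q\<gamma>[of k] unfolding Q_def by blast
  qed
  ultimately show ?thesis by blast
qed

text \<open>The radii for \<open>T\<close> are those \<open>4 ^ k\<close> at which the prescribed
  matrices \<open>Hs k\<close> approach the matrix of \<open>T\<close>. The curve can be fixed
  before \<open>nv\<close> and \<open>T\<close>, as every \<open>4 ^ k\<close> is a good radius for
  both pairings.\<close>

lemma universal_curve:
  fixes \<Lambda> :: "(complex^'n) set"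
  assumes L: "lattice \<Lambda>"
  shows "\<exists>F. entire_curve \<Lambda> F \<and> (\<forall>nv F' z R' T. generates nv \<Lambda> F' z R' T \<longrightarrow>
    (\<exists>R. strict_mono R \<and> filterlim R at_top sequentially \<and>
      (\<exists>S. generates nv \<Lambda> (\<lambda>j. F) (\<lambda>j. 0) R S \<and> current_class \<Lambda> S = current_class \<Lambda> T)))"
proof -
  obtain Hs :: "nat \<Rightarrow> complex^'n^'n" where Hs: "\<And>k. Hs k \<in> class_hull"
    and dense: "\<And>H. H \<in> class_hull \<Longrightarrow> \<exists>\<kappa>. strict_mono \<kappa> \<and> (Hs \<circ> \<kappa>) \<longlonglongrightarrow> H"
    using dense_sequence_class_hull by blast
  have "\<forall>k nv. \<exists>\<mu>. pairing_measure nv 0 (4 ^ k) \<mu>" by (intro allI pairing_measure_exists) simp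
  then obtain \<mu> where \<mu>: "\<And>k nv. pairing_measure nv 0 (4 ^ k) (\<mu> k nv)" unfolding choice_iff by blast
  obtain G :: "complex \<Rightarrow> complex^'n" where G: "\<And>j. (\<lambda>w. G w $ j) holomorphic_on UNIV"
    and good: "\<And>k nv. good_radius (\<mu> k nv) (4 ^ k) (Hs k) (1 / 2 ^ k) G"
    using universal_derivative[of Hs \<mu>, OF Hs \<mu>] by blast
  have "\<exists>g. \<forall>x. (g has_field_derivative G x $ j) (at x)" for j
    using holomorphic_convex_primitive'[OF convex_UNIV open_UNIV G[of j]] by (metis UNIV_I)
  then obtain g where g: "\<And>j x. (g j has_field_derivative G x $ j) (at x)" by metis
  define f where "f = (\<lambda>w. \<chi> j. g j w)"
  have fd: "(f has_derivative (\<lambda>h. h *s G w)) (at w)" for w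
    unfolding has_cderiv_iff f_def using g by simp
  have fh: "(\<lambda>w. f w $ j) holomorphic_on UNIV" for j
    unfolding f_def by (rule holomorphic_onI) (simp add: field_differentiable_def, use g in blast)
  define F where "F = (\<lambda>w. proj \<Lambda> (f w))"
  have R: "0 < (4::real) ^ k" for k :: nat by simp
  have D: "disc_lift \<Lambda> F 0 (4 ^ k) f G" for k
    unfolding F_def by (rule disc_lift_entire[OF L fd G R])
  have hd: "holomorphic_disc \<Lambda> F 0 (4 ^ k)" for k
    unfolding F_def by (rule holomorphic_disc_entire[OF fh R])
  have entire: "entire_curve \<Lambda> F"
    unfolding entire_curve_def F_def using fh by (auto intro!: exI[of _ UNIV] exI[of _ f])
  let ?A = "\<lambda>nv k. pairing_area nv \<Lambda> F 0 (4 ^ k)" and ?C = "\<lambda>nv k. class_matrix nv \<Lambda> F 0 (4 ^ k)"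
  have cm: "?C nv k = (1 / ?A nv k) *\<^sub>R (\<integral>w. indicator (ball 0 (4 ^ k)) w *\<^sub>R outer (G w) \<partial>\<mu> k nv)" for nv k
    by (simp add: class_matrix_def disc_lift_pairings(2)[OF L D \<mu>] vec_eq_iff
      scaleR_conv_of_real[where ?'a=complex] divide_inverse mult.commute)
  have Apos: "0 < ?A nv k" and near: "dist (?C nv k) (Hs k) \<le> 1 / 2 ^ k"
    and len: "pairing_length nv \<Lambda> F 0 (4 ^ k) / ?A nv k \<le> 1 / 2 ^ k" for nv k
  proof -
    obtain M where M: "0 < ?A nv k" "dist (?C nv k) (Hs k) \<le> 1 / 2 ^ k"
      "\<And>w. w \<in> cball 0 (4 ^ k) \<Longrightarrow> norm (G w) \<le> M" "2 * pi * 4 ^ k * M / ?A nv k \<le> 1 / 2 ^ k"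
      using good[where k=k and nv=nv] unfolding good_radius_def Let_def cm disc_lift_pairings(1)[OF L D \<mu>] by blast
    show "0 < ?A nv k" "dist (?C nv k) (Hs k) \<le> 1 / 2 ^ k" by (rule M)+
    have "pairing_length nv \<Lambda> F 0 (4 ^ k) / ?A nv k \<le> 2 * pi * 4 ^ k * M / ?A nv k"
      using pairing_length_le(2)[OF D M(3)] M(1) by (intro divide_right_mono) auto
    then show "pairing_length nv \<Lambda> F 0 (4 ^ k) / ?A nv k \<le> 1 / 2 ^ k" using M(4) by linarith
  qed
  have nonneg: "0 \<le> pairing_length nv \<Lambda> F 0 (4 ^ k)" for nv k
  proof -
    obtain M where "\<And>w. w \<in> cball 0 (4 ^ k) \<Longrightarrow> norm (G w) \<le> M"
      using good[where k=k and nv=nv] unfolding good_radius_def Let_def by blast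
    then show ?thesis by (rule pairing_length_le(1)[OF D])
  qed
  \<comment> \<open>A constant disc would have derivative 0 and thus area 0.\<close>
  have nc: "\<not> F constant_on cball 0 (4 ^ k)" for k
  proof
    assume "F constant_on cball 0 (4 ^ k)"
    then obtain p where p: "\<And>w. w \<in> cball 0 (4 ^ k) \<Longrightarrow> F w = p" unfolding constant_on_def by blast
    have "G w = 0" if w: "w \<in> ball 0 (4 ^ k)" for w
    proof -
      obtain d where d: "0 < d" "ball w d \<subseteq> ball 0 (4 ^ k)" using w open_ball openE by blast
      have "torus_deriv \<Lambda> F w = 0"
      proof (rule torus_deriv_eq[OF L d(1), where f="\<lambda>_. f 0"])
        show "F u = proj \<Lambda> (f 0)" if "u \<in> ball w d" for u
          using p[of u] p[of 0] d(2) that by (auto simp: F_def)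
        show "((\<lambda>_. f 0) has_derivative (\<lambda>h. h *s 0)) (at w)" by simp
      qed
      then show ?thesis using disc_lift_torus_deriv[OF L D w] by simp
    qed
    then have "?A False k = (\<integral>w. 0 \<partial>\<mu> k False)"
      unfolding disc_lift_pairings(1)[OF L D \<mu>] by (intro Bochner_Integration.integral_cong) (auto simp: indicator_def)
    then show False using Apos[of False k] by simp
  qed
  have half: "(\<lambda>k. 1 / 2 ^ k :: real) \<longlonglongrightarrow> 0"
    using LIMSEQ_power_zero[of "1/2 :: real"] by (simp add: power_one_over)
  have main: "\<exists>R. strict_mono R \<and> filterlim R at_top sequentially \<and>
      (\<exists>S. generates nv \<Lambda> (\<lambda>j. F) (\<lambda>j. 0) R S \<and> current_class \<Lambda> S = current_class \<Lambda> T)"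
    if gen: "generates nv \<Lambda> F' z R' T" for nv F' z R' T
  proof -
    define H where "H = (\<chi> j k. T (unit_form11 j k))"
    have "H \<in> class_hull" unfolding H_def by (rule generates_class_matrix(2)[OF L gen])
    then obtain \<kappa> where \<kappa>: "strict_mono \<kappa>" "(Hs \<circ> \<kappa>) \<longlonglongrightarrow> H" using dense by blast
    define R where "R = (\<lambda>i. 4 ^ \<kappa> i :: real)"
    have mono: "strict_mono R"
      unfolding R_def using \<kappa>(1) by (auto simp: strict_mono_def)
    have top: "filterlim R at_top sequentially"
    proof -
      have "filterlim (\<lambda>n. 4 ^ n :: real) at_top sequentially"
        by (rule filterlim_at_infinity_imp_filterlim_at_top[OF filterlim_realpow_sequentially_gt1]) simp_all
      from filterlim_compose[OF this filterlim_subseq[OF \<kappa>(1)]] show ?thesis unfolding R_def .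
    qed
    have half\<kappa>: "(\<lambda>i. 1 / 2 ^ \<kappa> i :: real) \<longlonglongrightarrow> 0"
      using LIMSEQ_subseq_LIMSEQ[OF half \<kappa>(1)] by (simp add: o_def)
    have ratio: "(\<lambda>i. pairing_length nv \<Lambda> F 0 (R i) / pairing_area nv \<Lambda> F 0 (R i)) \<longlonglongrightarrow> 0"
      unfolding R_def
    proof (rule tendsto_sandwich[of "\<lambda>_. 0" _ _ "\<lambda>i. 1 / 2 ^ \<kappa> i"])
      show "\<forall>\<^sub>F i in sequentially. 0 \<le> pairing_length nv \<Lambda> F 0 (4 ^ \<kappa> i) / pairing_area nv \<Lambda> F 0 (4 ^ \<kappa> i)"
        using nonneg Apos by (simp add: less_imp_le)
    qed (use len half\<kappa> in auto)
    have lim: "(\<lambda>i. class_matrix nv \<Lambda> F 0 (R i)) \<longlonglongrightarrow> H"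
    proof -
      have "(\<lambda>i. dist (?C nv (\<kappa> i)) (Hs (\<kappa> i))) \<longlonglongrightarrow> 0"
        by (rule tendsto_sandwich[of "\<lambda>_. 0" _ _ "\<lambda>i. 1 / 2 ^ \<kappa> i"]) (use near half\<kappa> in auto)
      then have "(\<lambda>i. ?C nv (\<kappa> i) - Hs (\<kappa> i)) \<longlonglongrightarrow> 0" by (simp add: dist_norm tendsto_norm_zero_iff)
      from tendsto_add[OF this \<kappa>(2)[unfolded o_def]] show ?thesis by (simp add: R_def)
    qed
    \<comment> \<open>Compactness supplies some current generated along a subsequence; its matrix is
      forced to be \<open>H\<close>, which fixes the class although not the current.\<close>
    have "\<exists>S. generates nv \<Lambda> (\<lambda>j. F) (\<lambda>j. 0) R S"
      by (rule generates_exists[OF L]) (use hd nc ratio in \<open>auto simp: R_def\<close>)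
    then obtain S where S: "generates nv \<Lambda> (\<lambda>j. F) (\<lambda>j. 0) R S" by blast
    obtain r where r: "strict_mono r" "((\<lambda>j. class_matrix nv \<Lambda> F 0 (R j)) \<circ> r) \<longlonglongrightarrow> (\<chi> j k. S (unit_form11 j k))"
      using generates_class_matrix(1)[OF L S] by blast
    have "(\<chi> j k. S (unit_form11 j k)) = H"
      by (rule LIMSEQ_unique[OF r(2) LIMSEQ_subseq_LIMSEQ[OF lim r(1)]])
    then have eq: "S (unit_form11 j k) = T (unit_form11 j k)" for j k
      unfolding H_def by (simp add: vec_eq_iff)
    have "current11 \<Lambda> S" "current11 \<Lambda> T" using S gen unfolding generates_def by blast+
    then have "current_class \<Lambda> S = current_class \<Lambda> T"
      by (intro current_class_eqI11[OF L] generates_closed[OF L S] generates_closed[OF L gen] eq)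
    then show ?thesis using mono top S by blast
  qed
  show ?thesis using entire main by blast
qed

theorem theorem1:
  fixes \<Lambda> :: "(complex^'n) set"
  assumes "lattice \<Lambda>"
  shows "\<exists>F. entire_curve \<Lambda> F \<and>
    (\<forall>T. nevanlinna_current \<Lambda> T \<longrightarrow>
      (\<exists>R. strict_mono R \<and> filterlim R at_top sequentially \<and>
        (\<exists>S. generates_nevanlinna \<Lambda> (\<lambda>j. F) (\<lambda>j. 0) R S \<and>
          current_class \<Lambda> S = current_class \<Lambda> T))) \<and>
    (\<forall>T. ahlfors_current \<Lambda> T \<longrightarrow>
      (\<exists>R. strict_mono R \<and> filterlim R at_top sequentially \<and>
        (\<exists>S. generates_ahlfors \<Lambda> (\<lambda>j. F) (\<lambda>j. 0) R S \<and>
          current_class \<Lambda> S = current_class \<Lambda> T)))"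
  using universal_curve[OF assms]
  unfolding nevanlinna_current_def ahlfors_current_def generates_nevanlinna_eq generates_ahlfors_eq by blast

end
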